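(* Let $N\ge1$ be an integer. (i) For $\varphi=(\varphi_1,\varphi_2)\in H^N_c$, \[\gamma_n= 2 \sqrt{\hat \varphi_1(-n) \hat\varphi_2(n)}+\frac{\ell^2_n}{|n|^{N+\frac{1}{2}}}\quad \text{as } |n|\to \infty \] with the appropriate choice of the square root (for each $n$). The asymptotics hold uniformly on bounded sets of $H^N_c$. (ii) For $\varphi=(\varphi_1,\varphi_2)\in H^N_r$, \[0\leq \gamma_n= 2|\hat\varphi_1(-n)| +\frac{\ell^4_n}{n^{N+1}}\quad \text{as } |n|\to \infty, \] uniformly on bounded sets of $H^N_r$.
   Context: For an integer $N\ge0$, $H^N$ is the Sobolev space of 1-periodic complex-valued functions on $\mathbb{R}$ with its standard norm, $H^0=L^2$, $H^N_c:=H^N\times H^N$, and $H^N_r:=\{(u,\bar u)\mid u\in H^N\}\subset H^N_c$. For $u\in L^2$, $\hat u(n):=\int_0^1u(x)e^{-2\pi i n x}\,dx$, $n\in\mathbb{Z}$. For $\varphi=(\varphi_1,\varphi_2)\in L^2_c:=H^0_c$ the Zakharov--Shabat operator is \[L(\varphi)= i \begin{pmatrix}1&0\\0&-1\end{pmatrix}\partial_x + \begin{pmatrix}0& \varphi_1 \\ \varphi_2 &0\end{pmatrix}.\] Its periodic spectrum is the spectrum of $L(\varphi)$ on $[0,2]$ with periodic boundary conditions. It is discrete and the eigenvalues, counted with algebraic multiplicities, are listed in lexicographic order $\cdots \preceq\lambda^-_{n}\preceq \lambda^+_n\preceq \lambda^-_{n+1}\preceq\lambda_{n+1}^+ \preceq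 \cdots$ in such a way that $(\lambda_n^\pm-n\pi)_{n\in\mathbb{Z}}\in\ell^2$. Here $a\preceq b$ means $\operatorname{Re}a<\operatorname{Re}b$, or $\operatorname{Re}a=\operatorname{Re}b$ and $\operatorname{Im}a\le\operatorname{Im}b$. Set $\gamma_n:=\lambda_n^+-\lambda_n^-$. Notation: $x_n=y_n+\frac{\ell^p_n}{n^{s}}$ as $|n|\to\infty$ means that $x_n=y_n+\frac{e_n}{|n|^{s}}$ for $|n|$ large with $\sum|e_n|^p<\infty$. "Uniformly on bounded sets" means that for every bounded set of potentials there are $n_0\ge1$ and $C>0$ such that $\sum_{|n|\ge n_0}|e_n|^p\le C$ for all potentials in that set. *)

theory Defs
  imports "HOL-Analysis.Analysis" "HOL-Library.Function_Algebras"
begin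

text \<open>Elements of \<open>L\<^sup>2\<close> and \<open>H\<^sup>N\<close> are represented by functions; everything below that
  depends on them is invariant under changes on null sets.\<close>

definition L2_on :: "real set \<Rightarrow> (real \<Rightarrow> 'a::euclidean_space) set" where
  "L2_on S = {f. f \<in> borel_measurable (lebesgue_on S) \<and>
                 integrable (lebesgue_on S) (\<lambda>x. (norm (f x))\<^sup>2)}"

definition L2_periodic :: "(real \<Rightarrow> complex) set" where
  "L2_periodic = {u. (\<forall>x. u (x + 1) = u x) \<and> u \<in> L2_on {0..1}}"

definition fourier :: "(real \<Rightarrow> complex) \<Rightarrow> int \<Rightarrow> complex" where
  "fourier u n = (\<integral>x. u x * exp (- 2 * complex_of_real pi * \<i> * of_int n * complex_of_real x)
                     \<partial>lebesgue_on {0..1})"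

text \<open>The periodic Sobolev norm in Fourier form; it is equivalent to
  \<open>(\<Sum>\<^bsub>k\<le>N\<^esub> \<parallel>\<partial>\<^sup>k u\<parallel>\<^sup>2)\<^bsup>1/2\<^esup>\<close> (norms in \<open>L\<^sup>2[0,1]\<close>), so bounded sets are the same.\<close>

definition sobolev :: "nat \<Rightarrow> (real \<Rightarrow> complex) set" where
  "sobolev N = {u \<in> L2_periodic.
     (\<lambda>n::int. (1 + (real_of_int n)\<^sup>2) ^ N * (cmod (fourier u n))\<^sup>2) summable_on UNIV}"

definition sobolev_norm :: "nat \<Rightarrow> (real \<Rightarrow> complex) \<Rightarrow> real" where
  "sobolev_norm N u =
     sqrt (\<Sum>\<^sub>\<infinity>n::int. (1 + (real_of_int n)\<^sup>2) ^ N * (cmod (fourier u n))\<^sup>2)"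

type_synonym potential = "(real \<Rightarrow> complex) \<times> (real \<Rightarrow> complex)"

definition Hc :: "nat \<Rightarrow> potential set" where
  "Hc N = sobolev N \<times> sobolev N"

definition Hr :: "nat \<Rightarrow> potential set" where
  "Hr N = {(u, \<lambda>x. cnj (u x)) | u. u \<in> sobolev N}"

definition Hc_norm :: "nat \<Rightarrow> potential \<Rightarrow> real" where
  "Hc_norm N \<phi> = sqrt ((sobolev_norm N (fst \<phi>))\<^sup>2 + (sobolev_norm N (snd \<phi>))\<^sup>2)"

definition Hc_bounded :: "nat \<Rightarrow> potential set \<Rightarrow> bool" where
  "Hc_bounded N B \<longleftrightarrow> (\<exists>M. \<forall>\<phi>\<in>B. Hc_norm N \<phi> \<le> M)"

text \<open>A function on \<open>[0,2]\<close> is represented by its extension by zero, so that dimensions of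
  spaces of such functions can be taken inside the type \<open>vecfun\<close>. The predicate below says that
  \<open>F\<close> lies in the domain of the periodic operator, i.e. \<open>F\<close> is (the absolutely continuous
  representative of) an element of \<open>H\<^sup>1([0,2], \<complex>\<^sup>2)\<close> with \<open>F(0) = F(2)\<close>, and that \<open>f\<close> is its
  derivative.\<close>

type_synonym vecfun = "real \<Rightarrow> complex \<times> complex"

definition H1_periodic_deriv :: "vecfun \<Rightarrow> vecfun \<Rightarrow> bool" where
  "H1_periodic_deriv F f \<longleftrightarrow>
     (\<forall>x. x \<notin> {0..2} \<longrightarrow> F x = 0) \<and> F 0 = F 2 \<and> f \<in> L2_on {0..2} \<and>
     (\<forall>x\<in>{0..2}. F x = F 0 + (\<integral>t. f t \<partial>lebesgue_on {0..x}))"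

text \<open>\<open>L(\<phi>)F\<close>, where \<open>f\<close> stands for \<open>\<partial>\<^sub>xF\<close>.\<close>

definition ZS_op :: "potential \<Rightarrow> vecfun \<Rightarrow> vecfun \<Rightarrow> vecfun" where
  "ZS_op \<phi> F f x = (\<i> * fst (f x) + fst \<phi> x * snd (F x),
                    - \<i> * snd (f x) + snd \<phi> x * fst (F x))"

definition vecfun_scale :: "complex \<Rightarrow> vecfun \<Rightarrow> vecfun" where
  "vecfun_scale c F = (\<lambda>x. (c * fst (F x), c * snd (F x)))"

lemma vector_space_vecfun_scale: "vector_space vecfun_scale"
  by unfold_locales (auto simp: vecfun_scale_def fun_eq_iff algebra_simps)

text \<open>\<open>ZS_kernel \<phi> \<mu> k\<close> is the kernel of \<open>(L(\<phi>) - \<mu>)\<^sup>k\<close>, including the domain conditions on the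
  iterates.\<close>

primrec ZS_kernel :: "potential \<Rightarrow> complex \<Rightarrow> nat \<Rightarrow> vecfun set" where
  "ZS_kernel \<phi> \<mu> 0 = {\<lambda>x. 0}"
| "ZS_kernel \<phi> \<mu> (Suc k) =
     {F. \<exists>f. H1_periodic_deriv F f \<and>
        (\<exists>G \<in> ZS_kernel \<phi> \<mu> k.
           AE x in lebesgue_on {0..2}. ZS_op \<phi> F f x - vecfun_scale \<mu> F x = G x)}"

text \<open>The algebraic multiplicity is the complex dimension of the root space; it is \<open>0\<close> exactly
  when \<open>\<mu>\<close> is not an eigenvalue, since the root spaces are finite-dimensional.\<close>

definition ZS_alg_mult :: "potential \<Rightarrow> complex \<Rightarrow> nat" where
  "ZS_alg_mult \<phi> \<mu> = vector_space.dim vecfun_scale (\<Union>k. ZS_kernel \<phi> \<mu> k)"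

definition lex_le :: "complex \<Rightarrow> complex \<Rightarrow> bool" where
  "lex_le a b \<longleftrightarrow> Re a < Re b \<or> (Re a = Re b \<and> Im a \<le> Im b)"

text \<open>\<open>lm n\<close> and \<open>lp n\<close> are \<open>\<lambda>\<^sub>n\<^sup>-\<close> and \<open>\<lambda>\<^sub>n\<^sup>+\<close>. The conditions determine both sequences
  uniquely. The sets in the multiplicity clause are finite because of the last two clauses.\<close>

definition periodic_eigenvalue_listing ::
    "potential \<Rightarrow> (int \<Rightarrow> complex) \<Rightarrow> (int \<Rightarrow> complex) \<Rightarrow> bool" where
  "periodic_eigenvalue_listing \<phi> lm lp \<longleftrightarrow>
     (\<forall>\<mu>. card {n. lm n = \<mu>} + card {n. lp n = \<mu>} = ZS_alg_mult \<phi> \<mu>) \<and>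
     (\<forall>n. lex_le (lm n) (lp n) \<and> lex_le (lp n) (lm (n + 1))) \<and>
     (\<lambda>n. (cmod (lm n - of_int n * of_real pi))\<^sup>2) summable_on UNIV \<and>
     (\<lambda>n. (cmod (lp n - of_int n * of_real pi))\<^sup>2) summable_on UNIV"

text \<open>\<open>x\<^sub>n = y\<^sub>n + \<ell>\<^sup>p\<^sub>n / n\<^sup>s\<close> as \<open>|n| \<rightarrow> \<infinity>\<close>, for one pair of sequences and uniformly for
  families indexed by a set \<open>B\<close>.\<close>

definition lp_remainder ::
    "nat \<Rightarrow> real \<Rightarrow> int \<Rightarrow> (int \<Rightarrow> complex) \<Rightarrow> (int \<Rightarrow> complex) \<Rightarrow> (int \<Rightarrow> complex) \<Rightarrow> bool" where
  "lp_remainder p s n\<^sub>0 x y e \<longleftrightarrow>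
     (\<forall>n. n\<^sub>0 \<le> \<bar>n\<bar> \<longrightarrow> x n = y n + e n / complex_of_real (real_of_int \<bar>n\<bar> powr s)) \<and>
     (\<lambda>n. cmod (e n) ^ p) summable_on {n. n\<^sub>0 \<le> \<bar>n\<bar>}"

definition lp_asymp :: "nat \<Rightarrow> real \<Rightarrow> (int \<Rightarrow> complex) \<Rightarrow> (int \<Rightarrow> complex) \<Rightarrow> bool" where
  "lp_asymp p s x y \<longleftrightarrow> (\<exists>n\<^sub>0\<ge>1. \<exists>e. lp_remainder p s n\<^sub>0 x y e)"

definition lp_asymp_uniform ::
    "nat \<Rightarrow> real \<Rightarrow> 'a set \<Rightarrow> ('a \<Rightarrow> int \<Rightarrow> complex) \<Rightarrow> ('a \<Rightarrow> int \<Rightarrow> complex) \<Rightarrow> bool" where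
  "lp_asymp_uniform p s B x y \<longleftrightarrow>
     (\<exists>n\<^sub>0\<ge>1. \<exists>C>0. \<forall>\<phi>\<in>B. \<exists>e. lp_remainder p s n\<^sub>0 (x \<phi>) (y \<phi>) e \<and>
        (\<Sum>\<^sub>\<infinity>n\<in>{n. n\<^sub>0 \<le> \<bar>n\<bar>}. cmod (e n) ^ p) \<le> C)"

end

theory Submission imports Defs begin

text \<open>The operator acts on Fourier modes. If \<open>F = (F\<^sub>1, F\<^sub>2)\<close> has the coefficients \<open>a k\<close> of
\<open>exp (- \<i> \<pi> k x)\<close> in \<open>F\<^sub>1\<close> and \<open>b k\<close> of \<open>exp (\<i> \<pi> k x)\<close> in \<open>F\<^sub>2\<close>, then \<open>L(\<phi>)\<close> multiplies \<open>a k\<close> and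
\<open>b k\<close> by \<open>\<pi> k\<close> and couples \<open>a k\<close> to \<open>b l\<close> through a number that depends on \<open>k + l\<close> only: a Fourier
coefficient of \<open>\<phi>\<^sub>1\<close> or \<open>\<phi>\<^sub>2\<close> at frequency \<open>\<mp> (k + l) / 2\<close>. So the operator is a diagonal one plus a pair of
Hankel matrices, and near \<open>\<pi> n\<close> only the two modes with index \<open>n\<close> are resonant.

For large \<open>\<bar>n\<bar>\<close> the plane of these two modes is deformed into an invariant plane of the full operator, the
graph of a solution \<open>(Y, U)\<close> of a Riccati equation that is solved by contraction in weighted sup norms
(\<open>riccati_exists\<close>, \<open>F_invariant\<close>). All root vectors with eigenvalue in the strip
\<open>\<bar>Re \<mu> - \<pi> n\<bar> \<le> \<pi> / 2\<close> lie in this plane (\<open>in_plane\<close>), so the algebraic multiplicities there are those of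
\<open>\<pi> n\<close> plus a two by two matrix with diagonal entries \<open>p\<^sub>s\<close> and off-diagonal entries \<open>q\<^sub>s\<close>
(\<open>alg_mult_strip\<close>). Every strip with large index contains exactly two eigenvalues, the numbering by size
therefore puts \<open>\<lambda>\<^sub>n\<^sup>-\<close> and \<open>\<lambda>\<^sub>n\<^sup>+\<close> into the strip of index \<open>n\<close>, and the gap is given exactly by the
discriminant, \<open>\<gamma>\<^sub>n\<^sup>2 = (p\<^sub>T - p\<^sub>F)\<^sup>2 + 4 q\<^sub>T q\<^sub>F\<close> (\<open>gap_squared\<close>).

Two estimates give the asymptotics. First, \<open>q\<^sub>s\<close> differs from the matrix entry that couples the two resonant
modes, a Fourier coefficient of \<open>\<phi>\<close> at \<open>\<mp> n\<close>, by a cubic sum with two resolvent factors (\<open>off_entry_error\<close>); since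
\<open>2 \<bar>n\<bar> \<le> \<bar>n - k\<bar> + \<bar>n + k\<bar>\<close>, each resolvent factor trades a power of \<open>n\<close> for a decaying coefficient,
and Young's inequality bounds the sum by an \<open>\<ell>\<^sup>2\<close> sequence over \<open>\<bar>n\<bar>\<^sup>N\<^sup>+\<^sup>1\<close> (\<open>triple_l2\<close>). Second, the
operator is symmetric for the bilinear form that pairs the two components, and evaluating the form on the two
columns of the invariant plane bounds \<open>p\<^sub>T - p\<^sub>F\<close> by \<open>(\<bar>q\<^sub>T\<bar> + \<bar>q\<^sub>F\<bar>) / \<bar>n\<bar>\<close> (\<open>diag_entry_diff\<close>). Hence
\<open>\<gamma>\<^sub>n\<^sup>2 / 4\<close> is the product of the two Fourier coefficients up to an \<open>\<ell>\<^sup>1\<close> sequence over \<open>\<bar>n\<bar>\<^sup>2\<^sup>N\<^sup>+\<^sup>1\<close>. For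
complex potentials a square root loses half of the exponent (\<open>nearer_root_close\<close>). For potentials of real
type the spectrum is real (\<open>real_multiplicity\<close>), the two Fourier coefficients are conjugate, and
\<open>\<bar>g\<^sup>2 - w\<^sup>2\<bar> \<le> 2 w \<tau> + 2 \<tau>\<^sup>2\<close> with nonnegative \<open>g\<close>, \<open>w\<close> gives \<open>\<bar>g - w\<bar> \<le> 4 \<tau>\<close> without this loss
(\<open>nonneg_root_close\<close>); the remainder is then even square summable.

All constants depend on \<open>N\<close> and on a bound for the norm of the potential only, which is the uniformity.\<close>

section \<open>Families with bounded sums\<close>

text \<open>With bounds for all finite partial sums instead of a bound for an infinite sum, nonnegative families can be
compared, added and reindexed without separate proofs of summability.\<close>

definition sum_le :: "('a \<Rightarrow> real) \<Rightarrow> real \<Rightarrow> bool" where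
  "sum_le f C \<longleftrightarrow> (\<forall>x. 0 \<le> f x) \<and> (\<forall>F. finite F \<longrightarrow> sum f F \<le> C)"

lemma sum_le_nonneg: "sum_le f C \<Longrightarrow> 0 \<le> f x"
  by (simp add: sum_le_def)

lemma sum_le_bound_nonneg: "sum_le f C \<Longrightarrow> 0 \<le> C"
  unfolding sum_le_def by (drule conjunct2, drule spec[of _ "{}"]) simp

lemma sum_le_point: "sum_le f C \<Longrightarrow> f x \<le> C"
  unfolding sum_le_def by (drule conjunct2, drule spec[of _ "{x}"]) simp

lemma sum_le_summable:
  assumes "sum_le f C" shows "f summable_on A"
proof (rule nonneg_bdd_above_summable_on)
  show "bdd_above (sum f ` {F. F \<subseteq> A \<and> finite F})"
    using assms by (intro bdd_aboveI[of _ C]) (auto simp: sum_le_def)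
qed (use assms in \<open>auto simp: sum_le_def\<close>)

lemma sum_le_infsum:
  assumes "sum_le f C" shows "infsum f A \<le> C"
  by (rule infsum_le_finite_sums[OF sum_le_summable[OF assms]]) (use assms in \<open>auto simp: sum_le_def\<close>)

lemma sum_leI:
  assumes "\<And>x. 0 \<le> f x" "f summable_on UNIV" "infsum f UNIV \<le> C"
  shows "sum_le f C"
proof -
  have "sum f F \<le> C" if "finite F" for F
    using finite_sum_le_infsum[OF assms(2) that] assms(1,3) by simp
  then show ?thesis using assms(1) by (simp add: sum_le_def)
qed

lemma sum_le_mono:
  assumes "sum_le g C" "\<And>x. 0 \<le> f x" "\<And>x. f x \<le> g x" "C \<le> D"
  shows "sum_le f D"
proof -
  have "sum f F \<le> D" if "finite F" for F
  proof -
    have "sum f F \<le> sum g F" using assms(3) by (rule sum_mono)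
    also have "\<dots> \<le> C" using assms(1) that by (simp add: sum_le_def)
    finally show ?thesis using assms(4) by simp
  qed
  then show ?thesis using assms(2) by (simp add: sum_le_def)
qed

lemma sum_le_add:
  assumes "sum_le f C" "sum_le g D" shows "sum_le (\<lambda>x. f x + g x) (C + D)"
  using assms unfolding sum_le_def by (auto simp: sum.distrib intro: add_mono)

lemma sum_le_cmult:
  assumes "sum_le f C" "0 \<le> k" shows "sum_le (\<lambda>x. k * f x) (k * C)"
  using assms unfolding sum_le_def by (auto simp: sum_distrib_left[symmetric] intro: mult_left_mono)

lemma sum_le_inj:
  assumes "sum_le f C" "inj h" shows "sum_le (\<lambda>x. f (h x)) C"
  unfolding sum_le_def
proof safe
  fix F :: "'b set" assume "finite F"
  have "(\<Sum>x\<in>F. f (h x)) = sum f (h ` F)"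
    by (subst sum.reindex) (simp_all add: inj_on_subset[OF assms(2)])
  also have "\<dots> \<le> C" using assms(1) \<open>finite F\<close> by (auto simp: sum_le_def)
  finally show "(\<Sum>x\<in>F. f (h x)) \<le> C" .
qed (use assms in \<open>auto simp: sum_le_def\<close>)

lemma sum_le_shift:
  fixes f :: "int \<Rightarrow> real" assumes "sum_le f C"
  shows "sum_le (\<lambda>l. f (k + l)) C" "sum_le (\<lambda>l. f (l + k)) C" "sum_le (\<lambda>l. f (k - l)) C" "sum_le (\<lambda>l. f (l - k)) C"
  by (rule sum_le_inj[OF assms], simp add: inj_def)+

text \<open>The elementary inequality \<open>a b \<le> a\<^sup>2 + b\<^sup>2\<close> replaces the Cauchy-Schwarz inequality:
constants may depend on the bounds in an arbitrary way.\<close>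

lemma sum_le_amgm:
  assumes "sum_le (\<lambda>x. (f x)\<^sup>2) C" "sum_le (\<lambda>x. (g x)\<^sup>2) D" "\<And>x. 0 \<le> f x" "\<And>x. 0 \<le> g x"
  shows "sum_le (\<lambda>x. f x * g x) (C + D)"
proof (rule sum_le_mono[OF sum_le_add[OF assms(1,2)]])
  fix x show "f x * g x \<le> (f x)\<^sup>2 + (g x)\<^sup>2"
    using sum_squares_bound[of "f x" "g x"]
      mult_nonneg_nonneg[OF assms(3,4), of x x] by linarith
qed (use assms in auto)

lemma sum_le_prod:
  assumes "sum_le f C" "sum_le g D"
  shows "sum_le (\<lambda>(x, y). f x * g y) (C * D)"
  unfolding sum_le_def
proof safe
  fix F :: "('a \<times> 'b) set" assume F: "finite F"
  have "(\<Sum>(x,y)\<in>F. f x * g y) \<le> (\<Sum>(x,y)\<in>fst ` F \<times> snd ` F. f x * g y)"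
    using F assms by (intro sum_mono2 subset_fst_snd) (auto simp: sum_le_def)
  also have "\<dots> = sum f (fst ` F) * sum g (snd ` F)"
    by (simp add: sum_product sum.cartesian_product)
  also have "\<dots> \<le> C * D"
    using F assms sum_le_bound_nonneg[OF assms(1)]
    by (intro mult_mono) (auto simp: sum_le_def intro: sum_nonneg)
  finally show "(\<Sum>(x,y)\<in>F. f x * g y) \<le> C * D" .
qed (use assms in \<open>auto simp: sum_le_def\<close>)

lemma sum_le_norm:
  fixes F :: "'a \<Rightarrow> 'b::banach"
  assumes "sum_le f C" "\<And>x. norm (F x) \<le> f x"
  shows "(\<lambda>x. norm (F x)) summable_on A" "F summable_on A" "norm (infsum F A) \<le> C"
    "norm (infsum F A) \<le> infsum f A"
proof -
  show 1: "(\<lambda>x. norm (F x)) summable_on A"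
    by (rule summable_on_comparison_test[OF sum_le_summable[OF assms(1)]]) (use assms(2) in auto)
  then show 2: "F summable_on A" by (rule abs_summable_summable)
  have "norm (infsum F A) \<le> infsum f A"
    by (rule norm_infsum_le[OF has_sum_infsum[OF 2] has_sum_infsum[OF sum_le_summable[OF assms(1)]]])
       (use assms in auto)
  then show "norm (infsum F A) \<le> C" "norm (infsum F A) \<le> infsum f A"
    using sum_le_infsum[OF assms(1), of A] by auto
qed

lemma infsum_diff:
  fixes f g :: "'a \<Rightarrow> 'b::real_normed_vector"
  assumes "f summable_on A" "g summable_on A"
  shows "infsum (\<lambda>x. f x - g x) A = infsum f A - infsum g A"
  using infsum_add[OF assms(1), of "\<lambda>x. - g x"] assms(2)
  by (simp add: infsum_uminus summable_on_uminus)

text \<open>Tonelli: bounds for the rows whose own sum is bounded give a bound for the double sum.\<close>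

lemma sum_le_iterate:
  assumes "\<And>x. sum_le (f x) (g x)" "sum_le g C"
  shows "sum_le (\<lambda>(x, y). f x y) C"
  unfolding sum_le_def
proof safe
  fix F :: "('a \<times> 'b) set" assume F: "finite F"
  have "(\<Sum>(x,y)\<in>F. f x y) \<le> (\<Sum>(x,y)\<in>fst ` F \<times> snd ` F. f x y)"
    using F assms by (intro sum_mono2 subset_fst_snd) (auto simp: sum_le_def)
  also have "\<dots> = (\<Sum>x\<in>fst ` F. sum (f x) (snd ` F))"
    by (simp add: sum.cartesian_product)
  also have "\<dots> \<le> (\<Sum>x\<in>fst ` F. g x)"
    using F assms by (intro sum_mono) (auto simp: sum_le_def)
  also have "\<dots> \<le> C" using F assms by (auto simp: sum_le_def)
  finally show "(\<Sum>(x,y)\<in>F. f x y) \<le> C" .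
qed (use assms in \<open>auto simp: sum_le_def\<close>)

text \<open>Young's inequality \<open>\<ell>\<^sup>1 * \<ell>\<^sup>2 \<subseteq> \<ell>\<^sup>2\<close>. The translations of the usual convolution are replaced by an
arbitrary family of injections \<open>n \<mapsto> \<tau> n i\<close>, so that index sets of pairs are covered as well. Finite
sums satisfy it by Cauchy-Schwarz with weight \<open>w\<close>, and the infinite inner sums are limits of finite ones.\<close>

lemma sum_le_Young:
  assumes w: "sum_le w A" and g: "sum_le (\<lambda>x. (g x)\<^sup>2) G" and g0: "\<And>x. 0 \<le> g x"
    and inj: "\<And>i. inj (\<lambda>n. \<tau> n i)"
  shows "sum_le (\<lambda>n. (\<Sum>\<^sub>\<infinity>i. w i * g (\<tau> n i))\<^sup>2) (A\<^sup>2 * G)"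
  unfolding sum_le_def
proof safe
  fix S :: "'c set" assume S: "finite S"
  have G0: "0 \<le> G" and A0: "0 \<le> A" using sum_le_bound_nonneg g w by blast+
  have gb: "g x \<le> G + 1" for x
  proof -
    have "(g x)\<^sup>2 \<le> G" by (rule sum_le_point[OF g])
    moreover have "2 * g x \<le> (g x)\<^sup>2 + 1"
      using sum_squares_bound[of "g x" 1] by simp
    ultimately show ?thesis using g0[of x] by linarith
  qed
  have fin: "(\<Sum>n\<in>S. (\<Sum>i\<in>T. w i * g (\<tau> n i))\<^sup>2) \<le> A\<^sup>2 * G" if T: "finite T" for T
  proof -
    have wT: "sum w T \<le> A" "0 \<le> sum w T" using w T by (auto simp: sum_le_def intro: sum_nonneg)
    have "(\<Sum>i\<in>T. w i * g (\<tau> n i))\<^sup>2 \<le> A * (\<Sum>i\<in>T. w i * (g (\<tau> n i))\<^sup>2)" for n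
    proof -
      have "(\<Sum>i\<in>T. w i * g (\<tau> n i)) = (\<Sum>i\<in>T. sqrt (w i) * (sqrt (w i) * g (\<tau> n i)))"
        using sum_le_nonneg[OF w] by (simp add: mult.assoc[symmetric])
      also have "\<dots>\<^sup>2 \<le> (\<Sum>i\<in>T. (sqrt (w i))\<^sup>2) * (\<Sum>i\<in>T. (sqrt (w i) * g (\<tau> n i))\<^sup>2)"
        by (rule Cauchy_Schwarz_ineq_sum)
      also have "\<dots> = sum w T * (\<Sum>i\<in>T. w i * (g (\<tau> n i))\<^sup>2)"
        using sum_le_nonneg[OF w] by (simp add: power_mult_distrib)
      also have "\<dots> \<le> A * (\<Sum>i\<in>T. w i * (g (\<tau> n i))\<^sup>2)"
        using wT sum_le_nonneg[OF w] by (intro mult_right_mono sum_nonneg) auto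
      finally show ?thesis .
    qed
    then have "(\<Sum>n\<in>S. (\<Sum>i\<in>T. w i * g (\<tau> n i))\<^sup>2) \<le> (\<Sum>n\<in>S. A * (\<Sum>i\<in>T. w i * (g (\<tau> n i))\<^sup>2))"
      by (rule sum_mono)
    also have "\<dots> = A * (\<Sum>i\<in>T. w i * (\<Sum>n\<in>S. (g (\<tau> n i))\<^sup>2))"
      by (simp add: sum_distrib_left sum.swap[of _ S])
    also have "\<dots> \<le> A * (\<Sum>i\<in>T. w i * G)"
      using A0 sum_le_nonneg[OF w] sum_le_inj[OF g inj] S
      by (intro mult_left_mono sum_mono mult_left_mono) (auto simp: sum_le_def)
    also have "\<dots> = A * (sum w T * G)" by (simp add: sum_distrib_right)
    also have "\<dots> \<le> A * (A * G)" using wT A0 G0 by (intro mult_left_mono mult_right_mono) auto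
    finally show ?thesis by (simp add: power2_eq_square mult.assoc)
  qed
  have sm: "(\<lambda>i. w i * g (\<tau> n i)) summable_on UNIV" for n
    by (rule sum_le_summable, rule sum_le_mono[OF sum_le_cmult[OF w, of "G + 1"]])
       (use gb g0 sum_le_nonneg[OF w] G0 in \<open>auto simp: mult.commute[of "w _"] intro: mult_right_mono\<close>)
  have "((\<lambda>T. \<Sum>n\<in>S. (\<Sum>i\<in>T. w i * g (\<tau> n i))\<^sup>2) \<longlongrightarrow> (\<Sum>n\<in>S. (\<Sum>\<^sub>\<infinity>i. w i * g (\<tau> n i))\<^sup>2)) (finite_subsets_at_top UNIV)"
    by (intro tendsto_sum tendsto_power infsum_tendsto sm)
  then show "(\<Sum>n\<in>S. (\<Sum>\<^sub>\<infinity>i. w i * g (\<tau> n i))\<^sup>2) \<le> A\<^sup>2 * G"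
    by (rule tendsto_upperbound) (auto intro!: eventually_finite_subsets_at_top_weakI fin)
qed simp

lemma sum_le_sq_add:
  assumes "sum_le (\<lambda>x. (f x)\<^sup>2) C" "sum_le (\<lambda>x. (g x)\<^sup>2) D"
  shows "sum_le (\<lambda>x. (f x + g x)\<^sup>2) (2 * C + 2 * D)"
proof (rule sum_le_mono[OF sum_le_add[OF sum_le_cmult[OF assms(1), of 2] sum_le_cmult[OF assms(2), of 2]]])
  fix x show "(f x + g x)\<^sup>2 \<le> 2 * (f x)\<^sup>2 + 2 * (g x)\<^sup>2"
    using sum_squares_bound[of "f x" "g x"] by (simp add: power2_sum)
qed auto

lemma sum_le_sq_mono:
  assumes "sum_le (\<lambda>x. (g x)\<^sup>2) C" "\<And>x. 0 \<le> f x" "\<And>x. f x \<le> g x"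
  shows "sum_le (\<lambda>x. (f x)\<^sup>2) C"
  by (rule sum_le_mono[OF assms(1)]) (auto intro: power_mono assms)

lemma sum_le_sq_cmult:
  assumes "sum_le (\<lambda>x. (f x)\<^sup>2) C" shows "sum_le (\<lambda>x. (k * f x)\<^sup>2) (k\<^sup>2 * C)"
  using sum_le_cmult[OF assms, of "k\<^sup>2"] by (simp add: power_mult_distrib)

section \<open>Weights\<close>

text \<open>\<open>recip\<close> is the size of the resolvent factor. The value \<open>recip 0 = 0\<close> is used on purpose: it removes the
resonant index from all sums.\<close>

definition recip :: "int \<Rightarrow> real" where "recip m = 1 / \<bar>real_of_int m\<bar>"
definition recip1 :: "int \<Rightarrow> real" where "recip1 m = 1 / (1 + \<bar>real_of_int m\<bar>)"
definition weight :: "nat \<Rightarrow> int \<Rightarrow> real" where "weight N m = (1 + \<bar>real_of_int m\<bar>) ^ N"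

lemma recip_nonneg [simp]: "0 \<le> recip m" and recip1_pos [simp]: "0 < recip1 m" and weight_pos [simp]: "0 < weight N m"
  and recip_0 [simp]: "recip 0 = 0" and recip1_le1: "recip1 m \<le> 1"
  and weight_minus: "weight N (- m) = weight N m"
  by (simp_all add: recip_def recip1_def weight_def)

lemma recip1_nonneg [simp]: "0 \<le> recip1 m" and weight_nonneg [simp]: "0 \<le> weight N m" and weight_nonzero [simp]: "weight N m \<noteq> 0"
  using recip1_pos[of m] weight_pos[of N m] by linarith+

lemma recip_le1: "recip m \<le> 1"
proof (cases "m = 0")
  case False
  then have "1 \<le> \<bar>real_of_int m\<bar>" by linarith
  then show ?thesis by (simp add: recip_def)
qed simp

definition recip_const :: real where
  "recip_const = (\<Sum>\<^sub>\<infinity>m. (recip m)\<^sup>2) + (\<Sum>\<^sub>\<infinity>m. (recip1 m)\<^sup>2)"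

lemma recip_sq_summable: "(\<lambda>m. (recip m)\<^sup>2) summable_on UNIV"
proof -
  have s: "(\<lambda>n::nat. (1 / (real n)\<^sup>2)) summable_on UNIV"
    by (rule summable_nonneg_imp_summable_on) (use inverse_power_summable[of 2, where 'a=real] in \<open>auto simp: field_simps\<close>)
  have "(\<lambda>m. (recip m)\<^sup>2) summable_on (range int)"
    by (subst summable_on_reindex) (use s in \<open>auto simp: o_def recip_def power_divide\<close>)
  moreover have "(\<lambda>m. (recip m)\<^sup>2) summable_on (range (\<lambda>n. - int n))"
    by (subst summable_on_reindex) (use s in \<open>auto simp: o_def recip_def power_divide inj_def\<close>)
  ultimately have "(\<lambda>m. (recip m)\<^sup>2) summable_on (range int \<union> range (\<lambda>n. - int n))"
    by (rule summable_on_union)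
  moreover have "range int \<union> range (\<lambda>n. - int n) = UNIV"
  proof -
    have "m \<in> range int \<union> range (\<lambda>n. - int n)" for m
      by (cases m rule: int_cases2) simp_all
    then show ?thesis by blast
  qed
  ultimately show ?thesis by simp
qed

lemma recip1_sq_le: "sum_le (\<lambda>m. (recip1 m)\<^sup>2) recip_const" and recip_sq_le: "sum_le (\<lambda>m. (recip m)\<^sup>2) recip_const"
proof -
  have le: "(recip1 m)\<^sup>2 \<le> (recip m)\<^sup>2 + (if m = 0 then 1 else 0)" for m
  proof (cases "m = 0")
    case False
    then have "\<bar>real_of_int m\<bar> > 0" by simp
    then have "recip1 m \<le> recip m" unfolding recip1_def recip_def by (intro divide_left_mono) auto
    then have "(recip1 m)\<^sup>2 \<le> (recip m)\<^sup>2" by (rule power_mono) simp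
    then show ?thesis using False by simp
  qed (simp add: recip1_def)
  have "(\<lambda>m::int. if m = 0 then 1 else 0 :: real) summable_on UNIV"
    by (rule finite_nonzero_values_imp_summable_on) auto
  from summable_on_comparison_test[OF summable_on_add[OF recip_sq_summable this], of "\<lambda>m. (recip1 m)\<^sup>2"]
  have s: "(\<lambda>m. (recip1 m)\<^sup>2) summable_on UNIV" using le by simp
  have "0 \<le> (\<Sum>\<^sub>\<infinity>m. (recip1 m)\<^sup>2)" "0 \<le> (\<Sum>\<^sub>\<infinity>m. (recip m)\<^sup>2)" by (auto intro: infsum_nonneg)
  then show "sum_le (\<lambda>m. (recip1 m)\<^sup>2) recip_const" "sum_le (\<lambda>m. (recip m)\<^sup>2) recip_const"
    using sum_leI[OF _ s] sum_leI[OF _ recip_sq_summable] by (simp_all add: recip_const_def)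
qed

lemma weight_submult: "weight N (a + b) \<le> weight N a * weight N b"
proof -
  have "1 + \<bar>real_of_int (a + b)\<bar> \<le> (1 + \<bar>real_of_int a\<bar>) * (1 + \<bar>real_of_int b\<bar>)"
    using mult_nonneg_nonneg[of "\<bar>real_of_int a\<bar>" "\<bar>real_of_int b\<bar>"] abs_triangle_ineq[of "real_of_int a" "real_of_int b"]
    unfolding of_int_add distrib_left distrib_right by linarith
  then show ?thesis unfolding weight_def power_mult_distrib[symmetric] by (intro power_mono) auto
qed

text \<open>One of two numbers is at least half as large as their sum.\<close>

lemma weight_add: "weight N (a + b) \<le> 2 ^ N * max (weight N a) (weight N b)"
proof -
  let ?m = "max (1 + \<bar>real_of_int a\<bar>) (1 + \<bar>real_of_int b\<bar>)"
  have "1 + \<bar>real_of_int (a + b)\<bar> \<le> 2 * ?m" by (auto simp: max_def)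
  then have "weight N (a + b) \<le> 2 ^ N * ?m ^ N"
    unfolding weight_def power_mult_distrib[symmetric] by (intro power_mono) auto
  also have "?m ^ N = max (weight N a) (weight N b)"
  proof (cases "\<bar>real_of_int a\<bar> \<le> \<bar>real_of_int b\<bar>")
    case True
    then show ?thesis using power_mono[of "1 + \<bar>real_of_int a\<bar>" "1 + \<bar>real_of_int b\<bar>" N]
      by (simp add: weight_def max_def)
  next
    case False
    then show ?thesis using power_mono[of "1 + \<bar>real_of_int b\<bar>" "1 + \<bar>real_of_int a\<bar>" N]
      by (simp add: weight_def max_def)
  qed
  finally show ?thesis .
qed

lemma weight_add_le: "weight N (a + b) \<le> 2 ^ N * (weight N a + weight N b)"
  by (rule order_trans[OF weight_add]) (auto simp: max_def)

lemma recip1_ge_weight: "N \<ge> 1 \<Longrightarrow> 1 / weight N m \<le> recip1 m"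
  unfolding recip1_def weight_def by (rule divide_left_mono) (simp_all add: self_le_power)

text \<open>From \<open>2 n = (n - l) + (n + l)\<close>: the product of two reciprocals is at most their sum divided by \<open>\<bar>n\<bar>\<close>.\<close>

lemma partial_fraction_le: "\<bar>real_of_int n\<bar> * (recip (n - l) * recip1 (n + l)) \<le> recip (n - l) + recip1 (n + l)"
  and partial_fraction_le1: "\<bar>real_of_int n\<bar> * (recip (n - l) * recip1 (n + l)) \<le> 1"
proof -
  show "\<bar>real_of_int n\<bar> * (recip (n - l) * recip1 (n + l)) \<le> recip (n - l) + recip1 (n + l)"
  proof (cases "n = l")
    case False
    let ?x = "\<bar>real_of_int (n - l)\<bar>" and ?y = "1 + \<bar>real_of_int (n + l)\<bar>"
    have xy: "?x > 0" "?y > 0" using False by simp_all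
    have "\<bar>real_of_int n\<bar> \<le> ?x + ?y" by simp
    then have "\<bar>real_of_int n\<bar> / (?x * ?y) \<le> (?x + ?y) / (?x * ?y)"
      using xy by (intro divide_right_mono) auto
    also have "\<dots> = 1 / ?x + 1 / ?y"
    proof -
      have *: "(x + y) / (x * y) = 1 / x + 1 / y" if "x > 0" "y > 0" for x y :: real
        using that by (simp add: field_simps)
      show ?thesis by (rule *[OF xy])
    qed
    finally show ?thesis by (simp add: recip_def recip1_def divide_divide_eq_left)
  qed simp
  show "\<bar>real_of_int n\<bar> * (recip (n - l) * recip1 (n + l)) \<le> 1"
  proof (cases "n = l")
    case False
    let ?x = "\<bar>real_of_int (n - l)\<bar>" and ?y = "1 + \<bar>real_of_int (n + l)\<bar>"
    have "1 \<le> \<bar>n - l\<bar>" using False by auto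
    then have x: "1 \<le> ?x" by linarith
    have y: "1 \<le> ?y" by simp
    have "\<bar>real_of_int n\<bar> \<le> ?x \<or> \<bar>real_of_int n\<bar> \<le> ?y" unfolding of_int_add of_int_diff by linarith
    moreover have "a \<le> u * v" if "a \<le> u \<or> a \<le> v" "1 \<le> u" "1 \<le> v" for a u v :: real
      proof -
      have "u * 1 \<le> u * v" "1 * v \<le> u * v" using that by (intro mult_left_mono mult_right_mono; simp)+
      then show ?thesis using that(1) by (simp only: mult_1_right mult_1_left) linarith
    qed
    ultimately have "\<bar>real_of_int n\<bar> \<le> ?x * ?y" using x y by blast
    moreover have "0 < ?x * ?y" using x y by (intro mult_pos_pos) linarith+
    ultimately show ?thesis by (simp add: recip_def recip1_def divide_le_eq)
  qed simp
qed

text \<open>The gain of a power of \<open>n\<close>: \<open>2 \<bar>n\<bar> \<le> \<bar>n - k\<bar> + \<bar>n + k\<bar>\<close>, so after multiplication with \<open>\<bar>n\<bar>\<close> either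
the resolvent factor disappears or the factor \<open>\<bar>n + k\<bar>\<close> has to be absorbed by a coefficient at \<open>n + k\<close>.\<close>

lemma two_n_recip_le: "2 * \<bar>real_of_int n\<bar> * recip (n - k) \<le> 1 + \<bar>real_of_int (n + k)\<bar> * recip (n - k)"
proof (cases "n = k")
  case False
  have *: "a * (1 / x) \<le> 1 + b * (1 / x)" if "x > 0" "a \<le> x + b" for a b x :: real
    using that by (simp add: field_simps)
  show ?thesis unfolding recip_def by (rule *) (use False in simp_all)
qed simp

section \<open>Hankel sums\<close>

text \<open>The sequence model of the operator. \<open>P s\<close> are the symbols of the two Hankel matrices, \<open>c\<close> is a common
majorant, and \<open>M\<close> bounds its weighted square sum. Every constant below is a function of \<open>N\<close> and \<open>M\<close>.\<close>

locale hankel =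
  fixes N :: nat and M :: real and P :: "bool \<Rightarrow> int \<Rightarrow> complex" and c :: "int \<Rightarrow> real"
  assumes N1: "N \<ge> 1" and Pc: "cmod (P s m) \<le> c m"
    and dM: "sum_le (\<lambda>m. (weight N m * c m)\<^sup>2) M"
begin

definition K :: real where "K = M + recip_const + 1"

definition d :: "int \<Rightarrow> real" where "d m = weight N m * c m"

definition v :: "int \<Rightarrow> real" where "v m = 1 / weight N m"

lemma v_pos [simp]: "0 < v m" and v_nonneg [simp]: "0 \<le> v m" and v_le_recip1: "v m \<le> recip1 m"
  and v_minus: "v (- m) = v m"
  using recip1_ge_weight[OF N1] by (simp_all add: v_def less_imp_le weight_minus)

lemma v_le1: "v m \<le> 1"
  using v_le_recip1[of m] recip1_le1[of m] by linarith

lemma c_nonneg [simp]: "0 \<le> c m"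
  using order_trans[OF norm_ge_zero Pc] .

lemma d_nonneg [simp]: "0 \<le> d m"
  by (simp add: d_def)

lemma c_eq: "c m = d m * v m"
  using weight_pos[of N m] by (simp add: d_def v_def)

lemma weight_v [simp]: "weight N m * v m = 1" "v m * weight N m = 1"
  using weight_pos[of N m] by (simp_all add: v_def)

lemma d_sq: "sum_le (\<lambda>m. (d m)\<^sup>2) M"
  using dM by (simp add: d_def)

lemma M_nonneg: "0 \<le> M" and recip_const_nonneg: "0 \<le> recip_const"
  using sum_le_bound_nonneg[OF dM] sum_le_bound_nonneg[OF recip_sq_le] by auto

lemma K1: "1 \<le> K"
  using M_nonneg recip_const_nonneg by (simp add: K_def)

lemma K0 [simp]: "0 \<le> K" "0 < K"
  using K1 by auto

lemma d_le_K: "d m \<le> K"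
proof -
  have "2 * d m \<le> (d m)\<^sup>2 + 1" using sum_squares_bound[of "d m" 1] by simp
  moreover have "(d m)\<^sup>2 \<le> M" by (rule sum_le_point[OF d_sq])
  ultimately show ?thesis using d_nonneg[of m] recip_const_nonneg M_nonneg by (simp add: K_def)
qed

lemma abs_c_le_d: "\<bar>real_of_int m\<bar> * c m \<le> d m"
proof -
  have "\<bar>real_of_int m\<bar> \<le> 1 + \<bar>real_of_int m\<bar>" by simp
  also have "\<dots> \<le> weight N m" unfolding weight_def using N1 by (intro self_le_power) auto
  finally show ?thesis unfolding d_def by (rule mult_right_mono) simp
qed

lemma sum_d_le:
  assumes "sum_le (\<lambda>l. (g l)\<^sup>2) recip_const" "\<And>l. 0 \<le> g l"
  shows "sum_le (\<lambda>l. d (k + l) * g l) K"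
  by (rule sum_le_mono[OF sum_le_amgm[OF sum_le_shift(1)[OF d_sq] assms(1)]])
     (use assms in \<open>auto simp: K_def\<close>)

lemma sum_dh: "sum_le (\<lambda>l. d (k + l) * recip (n - l)) K"
  by (rule sum_d_le) (auto intro: sum_le_shift(3)[OF recip_sq_le])

lemma sum_dr: "sum_le (\<lambda>l. d (k + l) * recip1 (n + l)) K"
  by (rule sum_d_le) (auto intro: sum_le_shift(1)[OF recip1_sq_le])

lemma sum_dr': "sum_le (\<lambda>l. d (k + l) * recip1 (n - l)) K"
  by (rule sum_d_le) (auto intro: sum_le_shift(3)[OF recip1_sq_le])

lemma sum_c: "sum_le c K"
proof (rule sum_le_mono[OF sum_dr[of 0 0]])
  fix x show "c x \<le> d (0 + x) * recip1 (0 + x)"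
    using mult_left_mono[OF v_le_recip1, of "d x" x] by (simp add: c_eq)
qed auto

lemma sum_c_shift: "sum_le (\<lambda>l. c (k + l)) K"
  by (rule sum_le_shift(1)[OF sum_c])

text \<open>One of the two resolvent factors is spent on the power of \<open>n\<close>, by
\<open>2 \<bar>n\<bar> \<le> \<bar>n - k\<bar> + \<bar>n - l\<bar> + \<bar>k + l\<bar>\<close>.\<close>

lemma two_resolvents_le: "\<bar>real_of_int n\<bar> * (recip (n - k) * (c (k + l) * recip (n - l))) \<le> c (k + l) + d (k + l) * recip (n - l)"
proof (cases "k = n \<or> l = n")
  case False
  let ?a = "recip (n - k)" and ?b = "recip (n - l)" and ?m = "\<bar>real_of_int (k + l)\<bar>"
  have a: "\<bar>real_of_int (n - k)\<bar> * ?a = 1" "\<bar>real_of_int (n - l)\<bar> * ?b = 1"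
    using False by (auto simp: recip_def)
  have "2 * \<bar>real_of_int n\<bar> \<le> \<bar>real_of_int (n - k)\<bar> + \<bar>real_of_int (n - l)\<bar> + ?m"
    unfolding of_int_add of_int_diff by linarith
  then have "2 * \<bar>real_of_int n\<bar> * (?a * (c (k + l) * ?b))
      \<le> (\<bar>real_of_int (n - k)\<bar> + \<bar>real_of_int (n - l)\<bar> + ?m) * (?a * (c (k + l) * ?b))"
    by (rule mult_right_mono) simp
  also have "\<dots> = (\<bar>real_of_int (n - k)\<bar> * ?a) * (c (k + l) * ?b) + (\<bar>real_of_int (n - l)\<bar> * ?b) * (c (k + l) * ?a)
      + ?a * ((?m * c (k + l)) * ?b)"
    by (simp add: algebra_simps)
  also have "\<dots> = c (k + l) * ?b + c (k + l) * ?a + ?a * ((?m * c (k + l)) * ?b)"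
    by (simp only: a mult_1)
  also have "\<dots> \<le> c (k + l) * 1 + c (k + l) * 1 + 1 * (d (k + l) * ?b)"
    by (intro add_mono mult_mono mult_left_mono recip_le1 abs_c_le_d order_refl) auto
  also have "\<dots> \<le> 2 * (c (k + l) + d (k + l) * ?b)"
    by simp
  finally show ?thesis by simp
qed (auto)

definition C1 :: real where "C1 = 2 ^ N * (4 * K)"
definition C2 :: real where "C2 = 2 ^ N * (2 * K)"

lemma C_nonneg [simp]: "0 \<le> C1" "0 \<le> C2"
  by (auto simp: C1_def C2_def)

text \<open>A resolvent, the Hankel matrix and another resolvent, applied to a sequence centred at \<open>- n\<close>, give a
sequence centred at \<open>n\<close> that is smaller by \<open>1 / \<bar>n\<bar>\<close>. The weight of the result is
submultiplicative, \<open>n - k = (n + l) - (k + l)\<close>, so one of the two factors on the left carries it.\<close>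

lemma resolvent_gain:
  assumes "n \<noteq> 0"
  shows "sum_le (\<lambda>l. recip (n - k) * (c (k + l) * (recip (n - l) * v (n + l)))) (C1 / \<bar>real_of_int n\<bar> * v (n - k))"
proof -
  have n: "\<bar>real_of_int n\<bar> > 0" using assms by simp
  let ?g = "\<lambda>l. 2 ^ N * ((d (k + l) * recip (n - l) + d (k + l) * recip1 (n + l)) + (c (k + l) + d (k + l) * recip (n - l)))"
  have S: "sum_le ?g (2 ^ N * ((K + K) + (K + K)))"
    by (intro sum_le_cmult sum_le_add sum_dh sum_dr sum_c_shift) auto
  have le: "\<bar>real_of_int n\<bar> * weight N (n - k) * (recip (n - k) * (c (k + l) * (recip (n - l) * v (n + l)))) \<le> ?g l" for l
  proof -
    let ?t = "recip (n - k) * (c (k + l) * recip (n - l))"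
    have "weight N (n - k) = weight N ((n + l) + - (k + l))" by simp
    also have "\<dots> \<le> 2 ^ N * (weight N (n + l) + weight N (k + l))"
      using weight_add_le[of N "n + l" "- (k + l)"] by (simp only: weight_minus)
    finally have "\<bar>real_of_int n\<bar> * weight N (n - k) * (?t * v (n + l))
       \<le> \<bar>real_of_int n\<bar> * (2 ^ N * (weight N (n + l) + weight N (k + l))) * (?t * v (n + l))"
      by (intro mult_right_mono mult_left_mono) auto
    also have "\<dots> = 2 ^ N * (\<bar>real_of_int n\<bar> * (recip (n - k) * ((weight N (k + l) * c (k + l)) * (recip (n - l) * v (n + l))))
        + (weight N (n + l) * v (n + l)) * (\<bar>real_of_int n\<bar> * ?t))"
      by (simp only: distrib_left distrib_right mult_ac add.commute)
    also have "\<dots> = 2 ^ N * (d (k + l) * (recip (n - k) * (\<bar>real_of_int n\<bar> * (recip (n - l) * v (n + l))))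
        + \<bar>real_of_int n\<bar> * ?t)"
      by (simp add: d_def mult_ac)
    also have "\<dots> \<le> 2 ^ N * (d (k + l) * (1 * (recip (n - l) + recip1 (n + l))) + (c (k + l) + d (k + l) * recip (n - l)))"
    proof -
      have "\<bar>real_of_int n\<bar> * (recip (n - l) * v (n + l)) \<le> \<bar>real_of_int n\<bar> * (recip (n - l) * recip1 (n + l))"
        by (intro mult_left_mono v_le_recip1) auto
      also have "\<dots> \<le> recip (n - l) + recip1 (n + l)" by (rule partial_fraction_le)
      finally have "recip (n - k) * (\<bar>real_of_int n\<bar> * (recip (n - l) * v (n + l))) \<le> 1 * (recip (n - l) + recip1 (n + l))"
        by (intro mult_mono recip_le1) auto
      then show ?thesis
        by (intro mult_left_mono add_mono two_resolvents_le) auto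
    qed
    also have "\<dots> = ?g l" by (simp add: algebra_simps)
    finally show ?thesis by (simp add: mult_ac)
  qed
  have "sum_le (\<lambda>l. (1 / \<bar>real_of_int n\<bar> * v (n - k)) * ?g l) ((1 / \<bar>real_of_int n\<bar> * v (n - k)) * (2 ^ N * ((K + K) + (K + K))))"
    by (rule sum_le_cmult[OF S]) auto
  then show ?thesis
  proof (rule sum_le_mono)
    fix l
    let ?x = "recip (n - k) * (c (k + l) * (recip (n - l) * v (n + l)))"
    have "?x = (1 / \<bar>real_of_int n\<bar> * v (n - k)) * (\<bar>real_of_int n\<bar> * weight N (n - k) * ?x)"
      using n weight_pos[of N "n - k"] by (simp add: v_def)
    also have "\<dots> \<le> (1 / \<bar>real_of_int n\<bar> * v (n - k)) * ?g l"
      by (rule mult_left_mono[OF le]) auto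
    finally show "?x \<le> (1 / \<bar>real_of_int n\<bar> * v (n - k)) * ?g l" .
  qed (auto simp: C1_def mult_ac)
qed

text \<open>Without resolvents there is no gain, but the Hankel matrix maps sequences centred at \<open>n\<close> to
sequences centred at \<open>- n\<close>.\<close>

lemma symbol_conv_le: "sum_le (\<lambda>k. c (l + k) * v (n - k)) (C2 * v (n + l))"
proof -
  let ?g = "\<lambda>k. 2 ^ N * (d (l + k) * recip1 (n - k) + c (l + k))"
  have S: "sum_le ?g (2 ^ N * (K + K))"
    by (intro sum_le_cmult sum_le_add sum_dr' sum_c_shift) auto
  have le: "weight N (n + l) * (c (l + k) * v (n - k)) \<le> ?g k" for k
  proof -
    have "weight N (n + l) = weight N ((n - k) + (l + k))" by simp
    also have "\<dots> \<le> 2 ^ N * (weight N (n - k) + weight N (l + k))" by (rule weight_add_le)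
    finally have "weight N (n + l) * (c (l + k) * v (n - k)) \<le> 2 ^ N * (weight N (n - k) + weight N (l + k)) * (c (l + k) * v (n - k))"
      by (intro mult_right_mono) auto
    also have "\<dots> = 2 ^ N * (d (l + k) * v (n - k) + (weight N (n - k) * v (n - k)) * c (l + k))"
      unfolding d_def by (simp only: distrib_left distrib_right mult_ac add.commute)
    also have "\<dots> \<le> ?g k"
      by (simp add: mult_left_mono[OF v_le_recip1])
    finally show ?thesis .
  qed
  have "sum_le (\<lambda>k. v (n + l) * ?g k) (v (n + l) * (2 ^ N * (K + K)))"
    by (rule sum_le_cmult[OF S]) auto
  then show ?thesis
  proof (rule sum_le_mono)
    fix k
    have "c (l + k) * v (n - k) = v (n + l) * (weight N (n + l) * (c (l + k) * v (n - k)))"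
      by (simp add: mult.assoc[symmetric])
    also have "\<dots> \<le> v (n + l) * ?g k" by (rule mult_left_mono[OF le]) auto
    finally show "c (l + k) * v (n - k) \<le> v (n + l) * ?g k" .
  qed (auto simp: C2_def mult_ac)
qed

lemma recip_v_le: "n \<noteq> 0 \<Longrightarrow> recip (n - l) * v (n + l) \<le> 1 / \<bar>real_of_int n\<bar>"
proof -
  assume "n \<noteq> 0"
  then have n: "\<bar>real_of_int n\<bar> > 0" by simp
  have "\<bar>real_of_int n\<bar> * (recip (n - l) * v (n + l)) \<le> \<bar>real_of_int n\<bar> * (recip (n - l) * recip1 (n + l))"
    by (intro mult_left_mono v_le_recip1) auto
  also have "\<dots> \<le> 1" by (rule partial_fraction_le1)
  finally show ?thesis using n by (simp add: field_simps)
qed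

lemma pairing_gain:
  assumes "n \<noteq> 0"
  shows "sum_le (\<lambda>l. c (n + l) * (recip (n - l) * v (n + l))) (K / \<bar>real_of_int n\<bar>)"
proof -
  have "sum_le (\<lambda>l. 1 / \<bar>real_of_int n\<bar> * c (n + l)) (1 / \<bar>real_of_int n\<bar> * K)"
    by (intro sum_le_cmult sum_c_shift) auto
  then show ?thesis
  proof (rule sum_le_mono)
    fix l show "c (n + l) * (recip (n - l) * v (n + l)) \<le> 1 / \<bar>real_of_int n\<bar> * c (n + l)"
      using mult_left_mono[OF recip_v_le[OF assms], of "c (n + l)" l] by (simp add: mult.commute)
  qed auto
qed

lemma v_submult: "v a * v b \<le> v (a + b)"
proof -
  have "1 / (weight N a * weight N b) \<le> 1 / weight N (a + b)"
    by (rule divide_left_mono[OF weight_submult]) auto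
  then show ?thesis by (simp add: v_def)
qed

lemma v_shift_le: "v (2 * n) * v (n - l) \<le> v (n + l)"
  using v_submult[of "2 * n" "- (n - l)"] by (simp only: v_minus) simp

text \<open>For the product of an off-diagonal entry, which has size \<open>v (2 * n)\<close>, with \<open>Y\<close>: the sum of \<open>2 n\<close> and
\<open>- (n + k)\<close> is \<open>n - k\<close>, and the factor \<open>1 / \<bar>n\<bar>\<close> comes from the other weight and a resolvent factor.\<close>

lemma corner_gain:
  assumes "n \<noteq> 0"
  shows "recip (n - k) * (v (2 * n) * (recip (n - k) * v (n + k))) \<le> 2 ^ N / \<bar>real_of_int n\<bar> * v (n - k)"
proof -
  have n: "\<bar>real_of_int n\<bar> > 0" using assms by simp
  have "weight N (n - k) = weight N (2 * n + - (n + k))" by simp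
  also have "\<dots> \<le> 2 ^ N * max (weight N (2 * n)) (weight N (n + k))"
    using weight_add[of N "2 * n" "- (n + k)"] by (simp only: weight_minus)
  finally have W: "weight N (n - k) \<le> 2 ^ N * max (weight N (2 * n)) (weight N (n + k))" .
  have m: "max (weight N (2 * n)) (weight N (n + k)) * (v (2 * n) * v (n + k)) \<le> max (v (2 * n)) (v (n + k))"
  proof (cases "weight N (2 * n) \<le> weight N (n + k)")
    case True
    then have "max (weight N (2 * n)) (weight N (n + k)) * (v (2 * n) * v (n + k)) = (weight N (n + k) * v (n + k)) * v (2 * n)"
      by (simp only: max_def if_True mult_ac)
    also have "\<dots> \<le> max (v (2 * n)) (v (n + k))" by (simp only: weight_v mult_1 max.cobounded1 max.cobounded2)
    finally show ?thesis .
  next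
    case False
    then have "max (weight N (2 * n)) (weight N (n + k)) * (v (2 * n) * v (n + k)) = (weight N (2 * n) * v (2 * n)) * v (n + k)"
      by (simp only: max_def if_False mult_ac)
    also have "\<dots> \<le> max (v (2 * n)) (v (n + k))" by (simp only: weight_v mult_1 max.cobounded1 max.cobounded2)
    finally show ?thesis .
  qed
  have hm: "recip (n - k) * max (v (2 * n)) (v (n + k)) \<le> 1 / \<bar>real_of_int n\<bar>"
  proof (cases "v (2 * n) \<le> v (n + k)")
    case True
    then show ?thesis using recip_v_le[OF assms] by (simp add: max_def)
  next
    case False
    have "recip (n - k) * v (2 * n) \<le> 1 * recip1 (2 * n)" by (intro mult_mono recip_le1 v_le_recip1) auto
    also have "\<dots> \<le> 1 / \<bar>real_of_int n\<bar>" using n by (simp add: recip1_def divide_left_mono)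
    finally show ?thesis using False by (simp add: max_def)
  qed
  have "weight N (n - k) * (recip (n - k) * (v (2 * n) * (recip (n - k) * v (n + k))))
     \<le> 2 ^ N * max (weight N (2 * n)) (weight N (n + k)) * (recip (n - k) * (v (2 * n) * (recip (n - k) * v (n + k))))"
    by (rule mult_right_mono[OF W]) auto
  also have "\<dots> = 2 ^ N * (recip (n - k) * (recip (n - k) * (max (weight N (2 * n)) (weight N (n + k)) * (v (2 * n) * v (n + k)))))"
    by (simp only: mult_ac)
  also have "\<dots> \<le> 2 ^ N * (1 * (recip (n - k) * max (v (2 * n)) (v (n + k))))"
    by (intro mult_left_mono mult_mono recip_le1 m) (auto simp: le_max_iff_disj)
  also have "\<dots> \<le> 2 ^ N * (1 / \<bar>real_of_int n\<bar>)" using mult_left_mono[OF hm, of "2 ^ N"] by simp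
  finally have "v (n - k) * (weight N (n - k) * (recip (n - k) * (v (2 * n) * (recip (n - k) * v (n + k)))))
     \<le> v (n - k) * (2 ^ N * (1 / \<bar>real_of_int n\<bar>))"
    by (rule mult_left_mono) auto
  then show ?thesis by (simp add: mult.assoc[symmetric]) (simp add: mult.commute)
qed

end

section \<open>A fixed point principle\<close>

text \<open>The contraction principle on a ball of a weighted sup norm, stated pointwise. The Lipschitz constant is
\<open>1 / 2\<close> and the image of the centre lies in the ball of half the radius, so the ball is mapped to itself.\<close>

lemma weighted_fixpoint:
  fixes \<Phi> :: "('i \<Rightarrow> complex) \<Rightarrow> 'i \<Rightarrow> complex" and w :: "'i \<Rightarrow> real"
  assumes w: "\<And>i. 0 \<le> w i" and R: "0 \<le> R"
    and start: "\<And>i. cmod (\<Phi> (\<lambda>_. 0) i) \<le> R / 2 * w i"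
    and lip: "\<And>X X' t i. (\<And>i. cmod (X i) \<le> R * w i) \<Longrightarrow> (\<And>i. cmod (X' i) \<le> R * w i) \<Longrightarrow> 0 \<le> t \<Longrightarrow>
        (\<And>i. cmod (X i - X' i) \<le> t * w i) \<Longrightarrow> cmod (\<Phi> X i - \<Phi> X' i) \<le> t / 2 * w i"
  shows "\<exists>X. (\<forall>i. cmod (X i) \<le> R * w i) \<and> \<Phi> X = X"
proof -
  define S where "S k = (\<Phi> ^^ k) (\<lambda>_. 0)" for k
  have S0: "S 0 = (\<lambda>_. 0)" and S_Suc: "S (Suc k) = \<Phi> (S k)" for k by (simp_all add: S_def)
  have z: "cmod (0 :: complex) \<le> R * w i" for i using w R by simp
  have ball: "cmod (S k i) \<le> R * w i" for k i
  proof (induction k arbitrary: i)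
    case 0 show ?case using z by (simp add: S0)
  next
    case (Suc k)
    have "cmod (\<Phi> (S k) i - \<Phi> (\<lambda>_. 0) i) \<le> R / 2 * w i"
      by (rule lip[OF Suc.IH z R]) (simp add: Suc.IH)
    then have "cmod (\<Phi> (S k) i) \<le> R / 2 * w i + R / 2 * w i"
      using start[of i] norm_triangle_sub[of "\<Phi> (S k) i" "\<Phi> (\<lambda>_. 0) i"] by linarith
    then show ?case by (simp add: S_Suc)
  qed
  have step: "cmod (S (Suc k) i - S k i) \<le> R / 2 ^ Suc k * w i" for k i
  proof (induction k arbitrary: i)
    case 0 show ?case using start by (simp add: S_Suc S0)
  next
    case (Suc k)
    have "cmod (\<Phi> (S (Suc k)) i - \<Phi> (S k) i) \<le> R / 2 ^ Suc k / 2 * w i"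
      by (rule lip[OF ball ball _ Suc.IH]) (use R in auto)
    then show ?case by (simp add: S_Suc field_simps)
  qed
  define X where "X i = (\<Sum>j. S (Suc j) i - S j i)" for i
  have geo: "(\<lambda>j. R / 2 ^ Suc (j + k) * w i) sums (R / 2 ^ k * w i)" for k i
    using sums_mult[OF power_half_series, of "R / 2 ^ k * w i"]
    by (simp add: power_add power_divide field_simps)
  have close: "cmod (X i - S k i) \<le> R / 2 ^ k * w i" for k i
  proof -
    have sn: "summable (\<lambda>j. norm (S (Suc j) i - S j i))"
      by (rule summable_comparison_test'[OF sums_summable[OF geo[of 0 i]], of 0]) (use step in simp)
    then have sm: "summable (\<lambda>j. S (Suc j) i - S j i)" by (rule summable_norm_cancel)
    have tel: "(\<Sum>j<k. S (Suc j) i - S j i) = S k i"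
      using sum_lessThan_telescope[of "\<lambda>j. S j i" k] by (simp add: S0)
    have "X i - S k i = (\<Sum>j. S (Suc (j + k)) i - S (j + k) i)"
      unfolding X_def using suminf_split_initial_segment[OF sm, of k] tel by simp
    also have "cmod \<dots> \<le> (\<Sum>j. norm (S (Suc (j + k)) i - S (j + k) i))"
      using sn by (intro summable_norm) (simp add: summable_iff_shift[of "\<lambda>j. norm (S (Suc j) i - S j i)" k])
    also have "\<dots> \<le> (\<Sum>j. R / 2 ^ Suc (j + k) * w i)"
      using sn step by (intro suminf_le sums_summable[OF geo]) (auto simp: summable_iff_shift[of "\<lambda>j. norm (S (Suc j) i - S j i)" k])
    also have "\<dots> = R / 2 ^ k * w i" by (rule sums_unique[OF geo, symmetric])
    finally show ?thesis .
  qed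
  have small: "(\<lambda>k. R / 2 ^ k * w i) \<longlonglongrightarrow> 0" for i
    using tendsto_mult[OF LIMSEQ_power_zero[of "1/2 :: real"] tendsto_const[of "R * w i"]] by (simp add: power_divide)
  have XR: "cmod (X i) \<le> R * w i" for i
  proof -
    have "cmod (X i) \<le> R * w i + R / 2 ^ k * w i" for k
      using ball[of k i] close[of i k] norm_triangle_sub[of "X i" "S k i"] by linarith
    moreover have "(\<lambda>k. R * w i + R / 2 ^ k * w i) \<longlonglongrightarrow> R * w i + 0"
      by (intro tendsto_add tendsto_const small)
    ultimately have "cmod (X i) \<le> R * w i + 0"
      by (intro tendsto_lowerbound[of _ _ sequentially]) auto
    then show ?thesis by simp
  qed
  have "\<Phi> X i = X i" for i
  proof -
    have "cmod (\<Phi> X i - X i) \<le> R / 2 ^ k * w i + R / 2 ^ k * w i" for k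
    proof -
      have a: "cmod (\<Phi> X i - \<Phi> (S k) i) \<le> R / 2 ^ k / 2 * w i"
        by (rule lip[OF XR ball _ close]) (use R in auto)
      have b: "cmod (X i - S (Suc k) i) \<le> R / 2 ^ Suc k * w i" by (rule close)
      have "cmod (\<Phi> X i - X i) \<le> cmod (\<Phi> X i - \<Phi> (S k) i) + cmod (X i - S (Suc k) i)"
        using norm_triangle_ineq4[of "\<Phi> X i - \<Phi> (S k) i" "X i - S (Suc k) i"] by (simp add: S_Suc)
      also have "\<dots> \<le> R / 2 ^ k / 2 * w i + R / 2 ^ Suc k * w i" by (rule add_mono[OF a b])
      also have "\<dots> = R / 2 ^ k * w i" by (simp add: field_simps)
      also have "\<dots> \<le> R / 2 ^ k * w i + R / 2 ^ k * w i"
      proof -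
        have "0 \<le> R / 2 ^ k * w i" using R w by (intro mult_nonneg_nonneg divide_nonneg_nonneg) auto
        then show ?thesis by (simp only: le_add_same_cancel1)
      qed
      finally show ?thesis .
    qed
    moreover have "(\<lambda>k. R / 2 ^ k * w i + R / 2 ^ k * w i) \<longlonglongrightarrow> 0 + 0"
      by (intro tendsto_add small)
    ultimately have "cmod (\<Phi> X i - X i) \<le> 0 + 0"
      by (intro tendsto_lowerbound[of _ _ sequentially]) auto
    then show ?thesis by simp
  qed
  with XR show ?thesis by (intro exI[of _ X]) auto
qed

section \<open>The invariant plane\<close>

context hankel
begin

text \<open>The entries of the two by two matrix by which the operator acts on the invariant plane (after subtraction
of \<open>\<pi> n\<close>), as functions of the parametrisation \<open>Y\<close>, \<open>U\<close> of the plane.\<close>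

definition diag_entry :: "int \<Rightarrow> (bool \<Rightarrow> int \<Rightarrow> complex) \<Rightarrow> bool \<Rightarrow> complex" where
  "diag_entry n Y s = (\<Sum>\<^sub>\<infinity>l. P (\<not> s) (n + l) * Y s l)"

definition off_entry :: "int \<Rightarrow> (bool \<Rightarrow> int \<Rightarrow> complex) \<Rightarrow> bool \<Rightarrow> complex" where
  "off_entry n U s = P s (2 * n) + (\<Sum>\<^sub>\<infinity>k. P s (n + k) * U s k)"

text \<open>Column \<open>s\<close> of the plane has \<open>Y s\<close> in component \<open>s\<close> and the unit sequence at \<open>n\<close> plus \<open>U s\<close> in the
other component. Invariance, solved for the diagonal part, is the fixed point equation \<open>Y = FY n Y U\<close>,
\<open>U = FU n Y U\<close>. Division by zero makes both maps vanish at the index \<open>n\<close>, which is the normalisation.\<close>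

definition FY where
  "FY n Y U s l = 1 / complex_of_real (pi * real_of_int (n - l)) *
     (P s (l + n) + (\<Sum>\<^sub>\<infinity>k. P s (l + k) * U s k) - diag_entry n Y s * Y s l - off_entry n U s * U (\<not> s) l)"

definition FU where
  "FU n Y U s k = 1 / complex_of_real (pi * real_of_int (n - k)) *
     ((\<Sum>\<^sub>\<infinity>l. P (\<not> s) (k + l) * Y s l) - diag_entry n Y s * U s k - off_entry n U s * Y (\<not> s) k)"

text \<open>\<open>\<kappa>\<close> is chosen so that the quadratic map \<open>FU\<close> has Lipschitz constant \<open>1 / 2\<close> in the weights below,
\<open>R\<close> is twice the size of the inhomogeneous term, and from \<open>n_contract\<close> on \<open>FY\<close> has Lipschitz constant
\<open>1 / 2\<close> and \<open>U\<close> is bounded by \<open>v\<close>.\<close>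

definition \<kappa> :: real where "\<kappa> = 2 * (C1 + 2 * K + 2 ^ N * (2 * C2 + K))"
definition R :: real where "R = 2 * K"
definition n_contract :: real where "n_contract = \<kappa> * R + 2 * \<kappa> * (3 * C2 + K) + 4 * K * R + 1"

text \<open>The unknown \<open>Y\<close> is of first order in the potential and centred at \<open>- n\<close>, the unknown \<open>U\<close> is of second order
and centred at \<open>n\<close>, with a gain \<open>1 / \<bar>n\<bar>\<close>.\<close>

definition wY :: "int \<Rightarrow> int \<Rightarrow> real" where "wY n l = recip (n - l) * v (n + l)"
definition wU :: "int \<Rightarrow> int \<Rightarrow> real" where "wU n k = \<kappa> / \<bar>real_of_int n\<bar> * v (n - k)"

lemma \<kappa>_nonneg [simp]: "0 \<le> \<kappa>" and R_nonneg [simp]: "0 \<le> R"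
  using K1 by (auto simp: \<kappa>_def R_def intro!: add_nonneg_nonneg mult_nonneg_nonneg)

lemma wY_nonneg [simp]: "0 \<le> wY n l" and wU_nonneg [simp]: "0 \<le> wU n l"
  by (auto simp: wY_def wU_def)

lemma wY_le_v: "wY n l \<le> v (n + l)"
  using mult_right_mono[OF recip_le1[of "n - l"], of "v (n + l)"] by (simp add: wY_def)

lemma resolvent_le_recip: "cmod (1 / complex_of_real (pi * real_of_int m)) \<le> recip m"
proof (cases "m = 0")
  case False
  then have "\<bar>real_of_int m\<bar> > 0" by simp
  moreover have "1 * \<bar>real_of_int m\<bar> \<le> pi * \<bar>real_of_int m\<bar>"
    using pi_ge_two by (intro mult_right_mono) auto
  ultimately have "1 / (pi * \<bar>real_of_int m\<bar>) \<le> 1 / \<bar>real_of_int m\<bar>"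
    by (intro divide_left_mono) auto
  then show ?thesis by (simp add: recip_def norm_divide norm_mult)
qed simp

lemma conv_le:
  assumes "sum_le (\<lambda>l. c (k + l) * w l) B" "\<And>l. cmod (X l) \<le> t * w l" "0 \<le> t"
  shows "cmod (\<Sum>\<^sub>\<infinity>l. P s (k + l) * X l) \<le> t * B" "(\<lambda>l. P s (k + l) * X l) summable_on UNIV"
proof -
  have S: "sum_le (\<lambda>l. t * (c (k + l) * w l)) (t * B)"
    by (rule sum_le_cmult[OF assms(1,3)])
  have "norm (P s (k + l) * X l) \<le> t * (c (k + l) * w l)" for l
    using mult_mono[OF Pc[of s "k + l"] assms(2)[of l]] by (simp add: norm_mult mult_ac)
  from sum_le_norm[OF S this] show "cmod (\<Sum>\<^sub>\<infinity>l. P s (k + l) * X l) \<le> t * B"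
    "(\<lambda>l. P s (k + l) * X l) summable_on UNIV" by auto
qed

lemma conv_bounded:
  assumes "\<And>l. cmod (X l) \<le> t" "0 \<le> t"
  shows "cmod (\<Sum>\<^sub>\<infinity>l. P s (k + l) * X l) \<le> t * K" "(\<lambda>l. P s (k + l) * X l) summable_on UNIV"
  using conv_le[of k "\<lambda>_. 1" K X t] sum_c_shift[of k] assms by auto

lemma wY_le1: "wY n l \<le> 1"
  using wY_le_v[of n l] v_le1[of "n + l"] by linarith

lemma sum_wY:
  assumes "n \<noteq> 0"
  shows "sum_le (\<lambda>l. c (n + l) * wY n l) (K / \<bar>real_of_int n\<bar>)"
    "sum_le (\<lambda>l. c (k + l) * wY n l) K"
  using pairing_gain[OF assms] sum_le_mono[OF sum_c_shift, of "\<lambda>l. c (k + l) * wY n l" k K]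
  by (auto simp: wY_def[symmetric] mult_left_le wY_le1)

lemma sum_wU:
  shows "sum_le (\<lambda>k. c (l + k) * wU n k) (\<kappa> / \<bar>real_of_int n\<bar> * C2 * v (n + l))"
proof -
  have "sum_le (\<lambda>k. \<kappa> / \<bar>real_of_int n\<bar> * (c (l + k) * v (n - k))) (\<kappa> / \<bar>real_of_int n\<bar> * (C2 * v (n + l)))"
    by (intro sum_le_cmult symbol_conv_le) auto
  then show ?thesis by (simp add: wU_def mult_ac)
qed

lemma sum_wU_n: "sum_le (\<lambda>k. c (n + k) * wU n k) (\<kappa> / \<bar>real_of_int n\<bar> * C2 * v (2 * n))"
  using sum_wU[of n n] by simp

lemma diag_entry_lipschitz:
  assumes "n \<noteq> 0" "\<And>l. cmod (Y s l) \<le> A * wY n l" "\<And>l. cmod (Y' s l) \<le> B * wY n l"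
    "\<And>l. cmod (Y s l - Y' s l) \<le> t * wY n l" "0 \<le> t" "0 \<le> A" "0 \<le> B"
  shows "cmod (diag_entry n Y s - diag_entry n Y' s) \<le> t * (K / \<bar>real_of_int n\<bar>)"
proof -
  have "diag_entry n Y s - diag_entry n Y' s = (\<Sum>\<^sub>\<infinity>l. P (\<not> s) (n + l) * (Y s l - Y' s l))"
    unfolding diag_entry_def right_diff_distrib
    by (rule infsum_diff[symmetric])
       (rule conv_le(2)[OF sum_wY(1)[OF assms(1)] assms(2,6)] conv_le(2)[OF sum_wY(1)[OF assms(1)] assms(3,7)])+
  then show ?thesis
    using conv_le[OF sum_wY(1)[OF assms(1)], where X = "\<lambda>l. Y s l - Y' s l" and t = t] assms by auto
qed

lemma diag_entry_le:
  assumes "n \<noteq> 0" "\<And>l. cmod (Y s l) \<le> A * wY n l" "0 \<le> A"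
  shows "cmod (diag_entry n Y s) \<le> A * (K / \<bar>real_of_int n\<bar>)"
  unfolding diag_entry_def using conv_le[OF sum_wY(1)[OF assms(1)], where X = "Y s" and t = A] assms by auto

lemma off_entry_lipschitz:
  assumes "n \<noteq> 0" "\<And>l. cmod (U s l) \<le> A * wU n l" "\<And>l. cmod (U' s l) \<le> B * wU n l"
    "\<And>l. cmod (U s l - U' s l) \<le> t * wU n l" "0 \<le> t" "0 \<le> A" "0 \<le> B"
  shows "cmod (off_entry n U s - off_entry n U' s) \<le> t * (\<kappa> / \<bar>real_of_int n\<bar> * C2 * v (2 * n))"
proof -
  have "off_entry n U s - off_entry n U' s = (\<Sum>\<^sub>\<infinity>l. P s (n + l) * (U s l - U' s l))"
    unfolding off_entry_def right_diff_distrib add_diff_cancel_left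
    by (rule infsum_diff[symmetric])
       (rule conv_le(2)[OF sum_wU_n assms(2,6)] conv_le(2)[OF sum_wU_n assms(3,7)])+
  then show ?thesis
    using conv_le[OF sum_wU_n, where X = "\<lambda>l. U s l - U' s l" and t = t] assms by auto
qed

lemma off_entry_minus_P:
  assumes "n \<noteq> 0" "\<And>l. cmod (U s l) \<le> A * wU n l" "0 \<le> A"
  shows "cmod (off_entry n U s - P s (2 * n)) \<le> A * (\<kappa> / \<bar>real_of_int n\<bar> * C2 * v (2 * n))"
  unfolding off_entry_def using conv_le[OF sum_wU_n, where X = "U s" and t = A] assms by auto

lemma P_le: "cmod (P s m) \<le> K * v m"
  using order_trans[OF Pc[of s m]] mult_right_mono[OF d_le_K v_nonneg, of m m] by (simp add: c_eq)

lemma n_contract_D: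
  assumes "n_contract \<le> \<bar>real_of_int n\<bar>"
  shows "n \<noteq> 0" "R * (\<kappa> / \<bar>real_of_int n\<bar>) \<le> 1"
    "(\<kappa> * (3 * C2 + K) + 2 * K * R) / \<bar>real_of_int n\<bar> \<le> 1 / 2" "1 \<le> \<bar>real_of_int n\<bar>"
proof -
  have p: "0 \<le> \<kappa> * R" "0 \<le> \<kappa> * (3 * C2 + K)" "0 \<le> K * R" by auto
  note assms = assms[unfolded n_contract_def mult.assoc]
  then have n: "1 \<le> \<bar>real_of_int n\<bar>" using assms p by linarith
  then show "n \<noteq> 0" "1 \<le> \<bar>real_of_int n\<bar>" by auto
  have "\<kappa> * R \<le> \<bar>real_of_int n\<bar>" using assms p by linarith
  then show "R * (\<kappa> / \<bar>real_of_int n\<bar>) \<le> 1" using n by (simp add: divide_le_eq mult.commute)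
  have "2 * (\<kappa> * (3 * C2 + K) + 2 * (K * R)) \<le> \<bar>real_of_int n\<bar>" using assms p(1) unfolding distrib_left[of 2] by linarith
  then show "(\<kappa> * (3 * C2 + K) + 2 * K * R) / \<bar>real_of_int n\<bar> \<le> 1 / 2"
  proof -
    have "a / x \<le> 1 / 2" if "2 * a \<le> x" "1 \<le> x" for a x :: real using that by (simp add: divide_le_eq)
    from this[OF _ n] show ?thesis
      using \<open>2 * (\<kappa> * (3 * C2 + K) + 2 * (K * R)) \<le> \<bar>real_of_int n\<bar>\<close> by (simp only: mult.assoc)
  qed
qed

lemma off_entry_le:
  assumes "n_contract \<le> \<bar>real_of_int n\<bar>" "\<And>l. cmod (U s l) \<le> R * wU n l"
  shows "cmod (off_entry n U s) \<le> (K + C2) * v (2 * n)"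
proof -
  note n = n_contract_D[OF assms(1)]
  have "cmod (off_entry n U s) \<le> cmod (P s (2 * n)) + cmod (off_entry n U s - P s (2 * n))"
    by (rule norm_triangle_sub)
  also have "\<dots> \<le> K * v (2 * n) + R * (\<kappa> / \<bar>real_of_int n\<bar> * C2 * v (2 * n))"
    by (intro add_mono P_le off_entry_minus_P n(1) assms) auto
  also have "\<dots> = K * v (2 * n) + (R * (\<kappa> / \<bar>real_of_int n\<bar>)) * (C2 * v (2 * n))" by simp
  also have "\<dots> \<le> K * v (2 * n) + 1 * (C2 * v (2 * n))"
    by (intro add_left_mono mult_right_mono n) auto
  finally show ?thesis by (simp add: algebra_simps)
qed

lemma prod_diff_le:
  fixes a a' b b' :: complex
  assumes "cmod (a - a') \<le> A1" "cmod b \<le> B1" "cmod a' \<le> A2" "cmod (b - b') \<le> B2"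
  shows "cmod (a * b - a' * b') \<le> A1 * B1 + A2 * B2"
proof -
  have "a * b - a' * b' = (a - a') * b + a' * (b - b')" by (simp add: algebra_simps)
  also have "cmod \<dots> \<le> cmod (a - a') * cmod b + cmod a' * cmod (b - b')"
    by (rule order_trans[OF norm_triangle_ineq]) (simp add: norm_mult)
  also have "\<dots> \<le> A1 * B1 + A2 * B2"
    by (intro add_mono mult_mono assms) (use order_trans[OF norm_ge_zero assms(1)] order_trans[OF norm_ge_zero assms(3)] in auto)
  finally show ?thesis .
qed

text \<open>Every term of \<open>FY\<close> that depends on the unknowns contains a factor \<open>1 / \<bar>n\<bar>\<close>, from \<open>wU\<close> or from the
diagonal entry.\<close>

lemma FY_lipschitz:
  assumes n: "n_contract \<le> \<bar>real_of_int n\<bar>"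
    and Y: "\<And>s l. cmod (Y s l) \<le> R * wY n l" and Y': "\<And>s l. cmod (Y' s l) \<le> R * wY n l"
    and U: "\<And>s l. cmod (U s l) \<le> R * wU n l" and U': "\<And>s l. cmod (U' s l) \<le> R * wU n l"
    and dY: "\<And>s l. cmod (Y s l - Y' s l) \<le> t * wY n l" and dU: "\<And>s l. cmod (U s l - U' s l) \<le> t * wU n l"
    and t: "0 \<le> t"
  shows "cmod (FY n Y U s l - FY n Y' U' s l) \<le> t / 2 * wY n l"
proof -
  note nb = n_contract_D[OF n]
  let ?n = "\<bar>real_of_int n\<bar>" and ?V = "v (n + l)"
  define \<theta> where "\<theta> = \<kappa> / ?n"
  have \<theta>0: "0 \<le> \<theta>" and R\<theta>: "R * \<theta> \<le> 1" using nb by (auto simp: \<theta>_def)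
  let ?S = "\<Sum>\<^sub>\<infinity>k. P s (l + k) * U s k" and ?S' = "\<Sum>\<^sub>\<infinity>k. P s (l + k) * U' s k"
  have "?S - ?S' = (\<Sum>\<^sub>\<infinity>k. P s (l + k) * (U s k - U' s k))"
    unfolding right_diff_distrib
    by (rule infsum_diff[symmetric])
       (rule conv_le(2)[OF sum_wU U R_nonneg] conv_le(2)[OF sum_wU U' R_nonneg])+
  then have 1: "cmod (?S - ?S') \<le> t * (\<theta> * C2 * ?V)"
    using conv_le(1)[OF sum_wU[of l n] dU[of s] t, of s] by (simp add: \<theta>_def)
  have vv: "v (2 * n) * v (n - l) \<le> ?V" by (rule v_shift_le)
  have U_v: "cmod (U s' l) \<le> 1 * v (n - l)" for s'
  proof -
    have "cmod (U s' l) \<le> (R * \<theta>) * v (n - l)" using U[of s' l] by (simp add: wU_def \<theta>_def)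
    also have "\<dots> \<le> 1 * v (n - l)" by (intro mult_right_mono R\<theta>) auto
    finally show ?thesis .
  qed
  have 2: "cmod (diag_entry n Y s * Y s l - diag_entry n Y' s * Y' s l)
       \<le> t * (K / ?n) * (R * ?V) + R * (K / ?n) * (t * ?V)"
    by (rule prod_diff_le)
       (use diag_entry_lipschitz[where Y = Y and Y' = Y' and s = s, OF nb(1) Y Y' dY t R_nonneg R_nonneg] diag_entry_le[where Y = Y' and s = s, OF nb(1) Y' R_nonneg] Y[of s l] dY[of s l] wY_le_v[of n l] t
          mult_left_mono[OF wY_le_v[of n l] R_nonneg] mult_left_mono[OF wY_le_v[of n l] t] in auto)
  have 3: "cmod (off_entry n U s * U (\<not> s) l - off_entry n U' s * U' (\<not> s) l)
       \<le> t * (\<theta> * C2 * v (2 * n)) * (1 * v (n - l)) + (K + C2) * v (2 * n) * (t * (\<theta> * v (n - l)))"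
    by (rule prod_diff_le)
       (use off_entry_lipschitz[where U = U and U' = U' and s = s, OF nb(1) U U' dU t R_nonneg R_nonneg] U_v off_entry_le[where U = U' and s = s, OF n U'] dU[of "\<not> s" l] in \<open>auto simp: \<theta>_def wU_def\<close>)
  also have "\<dots> = (t * \<theta> * C2 + (K + C2) * t * \<theta>) * (v (2 * n) * v (n - l))" by (simp add: algebra_simps)
  also have "\<dots> \<le> (t * \<theta> * C2 + (K + C2) * t * \<theta>) * ?V"
    using t \<theta>0 by (intro mult_left_mono vv) auto
  finally have 3: "cmod (off_entry n U s * U (\<not> s) l - off_entry n U' s * U' (\<not> s) l) \<le> (t * \<theta> * C2 + (K + C2) * t * \<theta>) * ?V" .
  let ?D = "(?S - ?S') - (diag_entry n Y s * Y s l - diag_entry n Y' s * Y' s l) - (off_entry n U s * U (\<not> s) l - off_entry n U' s * U' (\<not> s) l)"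
  have "cmod ?D \<le> cmod (?S - ?S') + cmod (diag_entry n Y s * Y s l - diag_entry n Y' s * Y' s l)
      + cmod (off_entry n U s * U (\<not> s) l - off_entry n U' s * U' (\<not> s) l)"
    by (intro order_trans[OF norm_triangle_ineq4] add_mono order_refl)
  also have "\<dots> \<le> t * (\<theta> * C2 * ?V) + (t * (K / ?n) * (R * ?V) + R * (K / ?n) * (t * ?V))
      + (t * \<theta> * C2 + (K + C2) * t * \<theta>) * ?V"
    by (intro add_mono 1 2 3)
  also have "\<dots> = t * ((\<kappa> * (3 * C2 + K) + 2 * K * R) / ?n) * ?V"
    by (simp add: \<theta>_def add_divide_distrib algebra_simps)
  also have "\<dots> \<le> t * (1 / 2) * ?V"
    using t by (intro mult_right_mono mult_left_mono nb(3)) auto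
  finally have D: "cmod ?D \<le> t * (1 / 2) * ?V" .
  have "FY n Y U s l - FY n Y' U' s l = 1 / complex_of_real (pi * real_of_int (n - l)) * ?D"
    unfolding FY_def by (simp only: right_diff_distrib distrib_left) simp
  then have "cmod (FY n Y U s l - FY n Y' U' s l) = cmod (1 / complex_of_real (pi * real_of_int (n - l))) * cmod ?D"
    by (simp only: norm_mult)
  also have "\<dots> \<le> recip (n - l) * (t * (1 / 2) * ?V)"
    by (intro mult_mono resolvent_le_recip D) auto
  finally show ?thesis by (simp add: wY_def mult_ac)
qed

text \<open>Here the factor \<open>1 / \<bar>n\<bar>\<close> is part of the weight and has to be reproduced by each term: by
\<open>resolvent_gain\<close>, by the diagonal entry, and by \<open>corner_gain\<close>.\<close>

lemma FU_lipschitz: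
  assumes n: "n_contract \<le> \<bar>real_of_int n\<bar>"
    and Y: "\<And>s l. cmod (Y s l) \<le> R * wY n l" and Y': "\<And>s l. cmod (Y' s l) \<le> R * wY n l"
    and U: "\<And>s l. cmod (U s l) \<le> R * wU n l" and U': "\<And>s l. cmod (U' s l) \<le> R * wU n l"
    and dY: "\<And>s l. cmod (Y s l - Y' s l) \<le> t * wY n l" and dU: "\<And>s l. cmod (U s l - U' s l) \<le> t * wU n l"
    and t: "0 \<le> t"
  shows "cmod (FU n Y U s k - FU n Y' U' s k) \<le> t / 2 * wU n k"
proof -
  note nb = n_contract_D[OF n]
  let ?n = "\<bar>real_of_int n\<bar>" and ?V = "v (n - k)" and ?h = "recip (n - k)"
  define \<theta> where "\<theta> = \<kappa> / ?n"
  have \<theta>0: "0 \<le> \<theta>" and R\<theta>: "R * \<theta> \<le> 1" using nb by (auto simp: \<theta>_def)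
  let ?S = "\<Sum>\<^sub>\<infinity>l. P (\<not> s) (k + l) * Y s l" and ?S' = "\<Sum>\<^sub>\<infinity>l. P (\<not> s) (k + l) * Y' s l"
  have SS: "?S - ?S' = (\<Sum>\<^sub>\<infinity>l. P (\<not> s) (k + l) * (Y s l - Y' s l))"
    unfolding right_diff_distrib
    by (rule infsum_diff[symmetric])
       (rule conv_le(2)[OF sum_wY(2)[OF nb(1)] Y R_nonneg] conv_le(2)[OF sum_wY(2)[OF nb(1)] Y' R_nonneg])+
  have "sum_le (\<lambda>l. t * (?h * (c (k + l) * wY n l))) (t * (C1 / ?n * ?V))"
    using resolvent_gain[OF nb(1), of k] by (intro sum_le_cmult t) (simp add: wY_def)
  moreover have "norm (?h * (P (\<not> s) (k + l) * (Y s l - Y' s l))) \<le> t * (?h * (c (k + l) * wY n l))" for l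
    using mult_left_mono[OF mult_mono[OF Pc[of "\<not> s" "k + l"] dY[of s l]], of ?h] by (simp add: norm_mult mult_ac)
  ultimately have "norm (\<Sum>\<^sub>\<infinity>l. ?h * (P (\<not> s) (k + l) * (Y s l - Y' s l))) \<le> t * (C1 / ?n * ?V)"
    by (rule sum_le_norm(3))
  then have 1: "?h * cmod (?S - ?S') \<le> t * (C1 / ?n * ?V)"
    unfolding SS by (simp add: infsum_cmult_right' norm_mult)
  have 2: "cmod (diag_entry n Y s * U s k - diag_entry n Y' s * U' s k)
       \<le> t * (K / ?n) * (R * (\<theta> * ?V)) + R * (K / ?n) * (t * (\<theta> * ?V))"
    by (rule prod_diff_le)
       (use diag_entry_lipschitz[where Y = Y and Y' = Y' and s = s, OF nb(1) Y Y' dY t R_nonneg R_nonneg] diag_entry_le[where Y = Y' and s = s, OF nb(1) Y' R_nonneg] U[of s k] dU[of s k] in \<open>auto simp: \<theta>_def wU_def\<close>)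
  also have "\<dots> = 2 * (t * (K / ?n) * ?V) * (R * \<theta>)" by (simp add: algebra_simps)
  also have "\<dots> \<le> 2 * (t * (K / ?n) * ?V) * 1" using t by (intro mult_left_mono R\<theta>) auto
  finally have "?h * cmod (diag_entry n Y s * U s k - diag_entry n Y' s * U' s k) \<le> 1 * (2 * (t * (K / ?n) * ?V) * 1)"
    using t by (intro mult_mono recip_le1) auto
  then have 2: "?h * cmod (diag_entry n Y s * U s k - diag_entry n Y' s * U' s k) \<le> 2 * (t * (K / ?n) * ?V)" by simp
  have "cmod (off_entry n U s * Y (\<not> s) k - off_entry n U' s * Y' (\<not> s) k)
       \<le> t * (\<theta> * C2 * v (2 * n)) * (R * wY n k) + (K + C2) * v (2 * n) * (t * wY n k)"
    by (rule prod_diff_le)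
       (use off_entry_lipschitz[where U = U and U' = U' and s = s, OF nb(1) U U' dU t R_nonneg R_nonneg] off_entry_le[where U = U' and s = s, OF n U'] Y[of "\<not> s" k] dY[of "\<not> s" k] in \<open>auto simp: \<theta>_def\<close>)
  also have "\<dots> = (C2 * (R * \<theta>) + (K + C2)) * (t * (v (2 * n) * wY n k))" by (simp add: algebra_simps)
  also have "\<dots> \<le> (C2 * 1 + (K + C2)) * (t * (v (2 * n) * wY n k))"
    using t by (intro mult_right_mono add_right_mono mult_left_mono R\<theta>) auto
  finally have "?h * cmod (off_entry n U s * Y (\<not> s) k - off_entry n U' s * Y' (\<not> s) k)
       \<le> ?h * ((C2 * 1 + (K + C2)) * (t * (v (2 * n) * wY n k)))"
    by (rule mult_left_mono) auto
  also have "\<dots> = (2 * C2 + K) * t * (?h * (v (2 * n) * wY n k))" by (simp add: algebra_simps)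
  also have "\<dots> \<le> (2 * C2 + K) * t * (2 ^ N / ?n * ?V)"
    using t corner_gain[OF nb(1), of k] by (intro mult_left_mono) (auto simp: wY_def)
  finally have 3: "?h * cmod (off_entry n U s * Y (\<not> s) k - off_entry n U' s * Y' (\<not> s) k) \<le> (2 * C2 + K) * t * (2 ^ N / ?n * ?V)" .
  let ?D = "(?S - ?S') - (diag_entry n Y s * U s k - diag_entry n Y' s * U' s k) - (off_entry n U s * Y (\<not> s) k - off_entry n U' s * Y' (\<not> s) k)"
  have "cmod ?D \<le> cmod (?S - ?S') + cmod (diag_entry n Y s * U s k - diag_entry n Y' s * U' s k)
      + cmod (off_entry n U s * Y (\<not> s) k - off_entry n U' s * Y' (\<not> s) k)"
    by (intro order_trans[OF norm_triangle_ineq4] add_mono order_refl)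
  then have "?h * cmod ?D \<le> ?h * (cmod (?S - ?S') + cmod (diag_entry n Y s * U s k - diag_entry n Y' s * U' s k)
      + cmod (off_entry n U s * Y (\<not> s) k - off_entry n U' s * Y' (\<not> s) k))"
    by (rule mult_left_mono) auto
  also have "\<dots> \<le> t * (C1 / ?n * ?V) + 2 * (t * (K / ?n) * ?V) + (2 * C2 + K) * t * (2 ^ N / ?n * ?V)"
    unfolding distrib_left by (intro add_mono 1 2 3)
  also have "\<dots> = t / 2 * wU n k"
    by (simp add: wU_def \<kappa>_def add_divide_distrib algebra_simps)
  finally have D: "?h * cmod ?D \<le> t / 2 * wU n k" .
  have "FU n Y U s k - FU n Y' U' s k = 1 / complex_of_real (pi * real_of_int (n - k)) * ?D"
    unfolding FU_def by (simp only: right_diff_distrib distrib_left) simp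
  then have "cmod (FU n Y U s k - FU n Y' U' s k) = cmod (1 / complex_of_real (pi * real_of_int (n - k))) * cmod ?D"
    by (simp only: norm_mult)
  also have "\<dots> \<le> ?h * cmod ?D"
    by (intro mult_right_mono resolvent_le_recip) auto
  finally show ?thesis using D by linarith
qed

definition riccati :: "int \<Rightarrow> (bool \<Rightarrow> int \<Rightarrow> complex) \<Rightarrow> (bool \<Rightarrow> int \<Rightarrow> complex) \<Rightarrow> bool" where
  "riccati n Y U \<longleftrightarrow> (\<forall>s l. cmod (Y s l) \<le> R * wY n l) \<and> (\<forall>s l. cmod (U s l) \<le> R * wU n l) \<and>
     (\<forall>s l. Y s l = FY n Y U s l) \<and> (\<forall>s k. U s k = FU n Y U s k)"

lemma riccati_exists:
  assumes n: "n_contract \<le> \<bar>real_of_int n\<bar>"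
  shows "\<exists>Y U. riccati n Y U"
proof -
  note nb = n_contract_D[OF n]
  \<comment> \<open>the fixed point principle is applied to both unknown families at once; the first index separates them\<close>
  define Yof where "Yof X s l = X (True, s, l)" for X :: "bool \<times> bool \<times> int \<Rightarrow> complex" and s l
  define Uof where "Uof X s l = X (False, s, l)" for X :: "bool \<times> bool \<times> int \<Rightarrow> complex" and s l
  define \<Phi> where "\<Phi> X = (\<lambda>(i, s, l). if i then FY n (Yof X) (Uof X) s l else FU n (Yof X) (Uof X) s l)"
    for X :: "bool \<times> bool \<times> int \<Rightarrow> complex"
  define w where "w = (\<lambda>(i, s :: bool, l). if i then wY n l else wU n l)"
  have "\<exists>X. (\<forall>i. cmod (X i) \<le> R * w i) \<and> \<Phi> X = X"
  proof (rule weighted_fixpoint)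
    show "0 \<le> w i" for i by (auto simp: w_def split: prod.splits)
    show "0 \<le> R" by simp
    show "cmod (\<Phi> (\<lambda>_. 0) i) \<le> R / 2 * w i" for i
    proof -
      obtain j s l where i: "i = (j, s, l)" by (cases i)
      show ?thesis
      proof (cases j)
        case True
        have "cmod (\<Phi> (\<lambda>_. 0) i) = cmod (1 / complex_of_real (pi * real_of_int (n - l))) * cmod (P s (l + n))"
          using True by (simp add: i \<Phi>_def FY_def Yof_def Uof_def norm_mult norm_divide)
        also have "\<dots> \<le> recip (n - l) * (K * v (l + n))"
          by (intro mult_mono resolvent_le_recip P_le) auto
        also have "\<dots> = R / 2 * w i" using True by (simp add: i w_def R_def wY_def add.commute)
        finally show ?thesis .
      qed (simp add: i \<Phi>_def FU_def Yof_def Uof_def w_def)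
    qed
  next
    fix X X' :: "bool \<times> bool \<times> int \<Rightarrow> complex" and t :: real and i :: "bool \<times> bool \<times> int"
    assume X: "\<And>i. cmod (X i) \<le> R * w i" and X': "\<And>i. cmod (X' i) \<le> R * w i" and t: "0 \<le> t"
      and dX: "\<And>i. cmod (X i - X' i) \<le> t * w i"
    obtain j s l where i: "i = (j, s, l)" using prod_cases3 by blast
    have "cmod (Yof X s l) \<le> R * wY n l" "cmod (Yof X' s l) \<le> R * wY n l"
      "cmod (Uof X s l) \<le> R * wU n l" "cmod (Uof X' s l) \<le> R * wU n l"
      "cmod (Yof X s l - Yof X' s l) \<le> t * wY n l" "cmod (Uof X s l - Uof X' s l) \<le> t * wU n l" for s l
      using X[of "(True, s, l)"] X'[of "(True, s, l)"] dX[of "(True, s, l)"]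
        X[of "(False, s, l)"] X'[of "(False, s, l)"] dX[of "(False, s, l)"]
      by (simp_all add: Yof_def Uof_def w_def)
    note b = this
    show "cmod (\<Phi> X i - \<Phi> X' i) \<le> t / 2 * w i"
      using FY_lipschitz[where Y = "Yof X" and Y' = "Yof X'" and U = "Uof X" and U' = "Uof X'" and s = s and l = l, OF n b t]
        FU_lipschitz[where Y = "Yof X" and Y' = "Yof X'" and U = "Uof X" and U' = "Uof X'" and s = s and k = l, OF n b t] by (simp add: i \<Phi>_def w_def)
  qed
  then obtain X where X: "\<And>i. cmod (X i) \<le> R * w i" and fp: "\<Phi> X = X" by blast
  have "riccati n (Yof X) (Uof X)"
    unfolding riccati_def
    using X[of "(True, _, _)"] X[of "(False, _, _)"] fun_cong[OF fp, of "(True, _, _)"] fun_cong[OF fp, of "(False, _, _)"]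
    by (auto simp: Yof_def Uof_def w_def \<Phi>_def)
  then show ?thesis by blast
qed

end

lemma delta_sum:
  fixes f :: "int \<Rightarrow> complex"
  shows "(\<lambda>l. f l * (if l = n then 1 else 0)) summable_on UNIV" "(\<Sum>\<^sub>\<infinity>l. f l * (if l = n then 1 else 0)) = f n"
proof -
  have "((\<lambda>l. f l * (if l = n then 1 else 0)) has_sum (f n)) UNIV"
    using has_sum_finite_neutralI[of "{n}" UNIV "\<lambda>l. f l * (if l = n then 1 else 0)"] by simp
  then show "(\<lambda>l. f l * (if l = n then 1 else 0)) summable_on UNIV" "(\<Sum>\<^sub>\<infinity>l. f l * (if l = n then 1 else 0)) = f n"
    by (auto simp: infsumI has_sum_imp_summable)
qed

context hankel
begin

text \<open>The Zakharov-Shabat operator after Fourier transformation, when \<open>P\<close> consists of the Fourier coefficients of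
the potential.\<close>

definition seq_op :: "(bool \<Rightarrow> int \<Rightarrow> complex) \<Rightarrow> bool \<Rightarrow> int \<Rightarrow> complex" where
  "seq_op x t k = complex_of_real (pi * real_of_int k) * x t k + (\<Sum>\<^sub>\<infinity>l. P t (k + l) * x (\<not> t) l)"

definition plane_col :: "int \<Rightarrow> (bool \<Rightarrow> int \<Rightarrow> complex) \<Rightarrow> (bool \<Rightarrow> int \<Rightarrow> complex) \<Rightarrow> bool \<Rightarrow> bool \<Rightarrow> int \<Rightarrow> complex" where
  "plane_col n Y U s t k = (if t = s then Y s k else (if k = n then 1 else 0) + U s k)"

text \<open>The sum of all lower bounds for \<open>\<bar>n\<bar>\<close> that are needed from here on.\<close>

definition n_plane :: real where
  "n_plane = n_contract + 2 * (4 * R\<^sup>2 * K + R\<^sup>2 * \<kappa>\<^sup>2 * K) + 2 * (K * R * (1 + \<kappa>)) + 4 * (K * (1 + K)) + 4 * (R * K) + 4 * (K + C2)"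

lemma n_plane_D:
  assumes "n_plane \<le> \<bar>real_of_int n\<bar>"
  shows "n_contract \<le> \<bar>real_of_int n\<bar>" "2 * (4 * R\<^sup>2 * K + R\<^sup>2 * \<kappa>\<^sup>2 * K) \<le> \<bar>real_of_int n\<bar>"
    "2 * (K * R * (1 + \<kappa>)) + 4 * (K * (1 + K)) \<le> \<bar>real_of_int n\<bar>"
    "4 * (R * K) \<le> \<bar>real_of_int n\<bar>" "4 * (K + C2) \<le> \<bar>real_of_int n\<bar>"
proof -
  have "0 \<le> n_contract" "0 \<le> 2 * (4 * R\<^sup>2 * K + R\<^sup>2 * \<kappa>\<^sup>2 * K)" "0 \<le> 2 * (K * R * (1 + \<kappa>))"
    "0 \<le> 4 * (K * (1 + K))" "0 \<le> 4 * (R * K)" "0 \<le> 4 * (K + C2)"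
    unfolding n_contract_def by (intro add_nonneg_nonneg mult_nonneg_nonneg; simp)+
  with assms show "n_contract \<le> \<bar>real_of_int n\<bar>" "2 * (4 * R\<^sup>2 * K + R\<^sup>2 * \<kappa>\<^sup>2 * K) \<le> \<bar>real_of_int n\<bar>"
    "2 * (K * R * (1 + \<kappa>)) + 4 * (K * (1 + K)) \<le> \<bar>real_of_int n\<bar>"
    "4 * (R * K) \<le> \<bar>real_of_int n\<bar>" "4 * (K + C2) \<le> \<bar>real_of_int n\<bar>"
    unfolding n_plane_def by linarith+
qed

context
  fixes n Y U
  assumes ric: "riccati n Y U" and large: "n_plane \<le> \<bar>real_of_int n\<bar>"
begin

abbreviation "pn \<equiv> diag_entry n Y"
abbreviation "qn \<equiv> off_entry n U"
abbreviation "Fn \<equiv> plane_col n Y U"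

lemma nb: "n_contract \<le> \<bar>real_of_int n\<bar>"
  using n_plane_D[OF large] by auto

lemma n1: "1 \<le> \<bar>real_of_int n\<bar>" and n0: "n \<noteq> 0" and n_pos: "0 < \<bar>real_of_int n\<bar>"
  using n_contract_D[OF nb] by auto

lemma Y_bound: "cmod (Y s l) \<le> R * wY n l" and U_bound: "cmod (U s l) \<le> R * wU n l"
  using ric by (auto simp: riccati_def)

lemma U_bound_v: "cmod (U s l) \<le> v (n - l)"
proof -
  have "cmod (U s l) \<le> (R * (\<kappa> / \<bar>real_of_int n\<bar>)) * v (n - l)"
    using U_bound[of s l] by (simp add: wU_def)
  also have "\<dots> \<le> 1 * v (n - l)" by (intro mult_right_mono n_contract_D(2)[OF nb]) auto
  finally show ?thesis by simp
qed

lemma Y_le_R: "cmod (Y s l) \<le> R"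
  using order_trans[OF Y_bound mult_left_le[OF wY_le1 R_nonneg]] .

lemma U_le1: "cmod (U s l) \<le> 1"
  using order_trans[OF U_bound_v v_le1] .

lemma Y_n [simp]: "Y s n = 0" and U_n [simp]: "U s n = 0"
proof -
  have "Y s n = FY n Y U s n" "U s n = FU n Y U s n" using ric by (auto simp: riccati_def)
  then show "Y s n = 0" "U s n = 0" by (simp_all add: FY_def FU_def)
qed

lemma Y_eq: "l \<noteq> n \<Longrightarrow> complex_of_real (pi * real_of_int (n - l)) * Y s l =
     P s (l + n) + (\<Sum>\<^sub>\<infinity>k. P s (l + k) * U s k) - pn s * Y s l - qn s * U (\<not> s) l"
  and U_eq: "l \<noteq> n \<Longrightarrow> complex_of_real (pi * real_of_int (n - l)) * U s l =
     (\<Sum>\<^sub>\<infinity>k. P (\<not> s) (l + k) * Y s k) - pn s * U s l - qn s * Y (\<not> s) l"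
proof -
  have *: "Y s l = FY n Y U s l" "U s l = FU n Y U s l" using ric by (auto simp: riccati_def)
  { assume "l \<noteq> n"
    then have "complex_of_real (pi * real_of_int (n - l)) \<noteq> 0" by simp
    then have "complex_of_real (pi * real_of_int (n - l)) * (1 / complex_of_real (pi * real_of_int (n - l)) * z) = z" for z
      by simp
    note c = this
    show "complex_of_real (pi * real_of_int (n - l)) * Y s l =
     P s (l + n) + (\<Sum>\<^sub>\<infinity>k. P s (l + k) * U s k) - pn s * Y s l - qn s * U (\<not> s) l"
      by (subst *(1), unfold FY_def, rule c)
    show "complex_of_real (pi * real_of_int (n - l)) * U s l =
     (\<Sum>\<^sub>\<infinity>k. P (\<not> s) (l + k) * Y s k) - pn s * U s l - qn s * Y (\<not> s) l"
      by (subst *(2), unfold FU_def, rule c) }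
qed

lemma F_sum:
  "(\<Sum>\<^sub>\<infinity>l. P t (k + l) * Fn s (\<not> t) l) =
     (if t = s then P s (k + n) + (\<Sum>\<^sub>\<infinity>l. P s (k + l) * U s l) else (\<Sum>\<^sub>\<infinity>l. P (\<not> s) (k + l) * Y s l))"
proof (cases "t = s")
  case True
  have "(\<Sum>\<^sub>\<infinity>l. P s (k + l) * Fn s (\<not> t) l) = (\<Sum>\<^sub>\<infinity>l. P s (k + l) * (if l = n then 1 else 0) + P s (k + l) * U s l)"
    using True by (intro infsum_cong) (auto simp: plane_col_def distrib_left)
  also have "\<dots> = (\<Sum>\<^sub>\<infinity>l. P s (k + l) * (if l = n then 1 else 0)) + (\<Sum>\<^sub>\<infinity>l. P s (k + l) * U s l)"
    by (rule infsum_add[OF delta_sum(1) conv_bounded(2)[OF U_le1]]) auto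
  finally show ?thesis using True by (simp add: delta_sum(2))
next
  case False
  then have "t = (\<not> s)" by auto
  then show ?thesis by (auto simp: plane_col_def)
qed

lemma F_invariant:
  "seq_op (Fn s) t k = complex_of_real (pi * real_of_int n) * Fn s t k + pn s * Fn s t k + qn s * Fn (\<not> s) t k"
proof (cases "t = s")
  case True
  show ?thesis
  proof (cases "k = n")
    case kn: True
    have "n + n = 2 * n" by simp
    then show ?thesis
      using True kn unfolding seq_op_def F_sum by (simp add: plane_col_def off_entry_def)
  next
    case False
    have "complex_of_real (pi * real_of_int k) = complex_of_real (pi * real_of_int n) - complex_of_real (pi * real_of_int (n - k))"
      by (simp add: algebra_simps)
    then show ?thesis
      using True False Y_eq[OF False, of s] unfolding seq_op_def F_sum by (simp add: plane_col_def algebra_simps)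
  qed
next
  case False
  then have t: "t = (\<not> s)" by auto
  show ?thesis
  proof (cases "k = n")
    case kn: True
    then show ?thesis
      using t unfolding seq_op_def F_sum by (simp add: plane_col_def diag_entry_def)
  next
    case False
    have "complex_of_real (pi * real_of_int k) = complex_of_real (pi * real_of_int n) - complex_of_real (pi * real_of_int (n - k))"
      by (simp add: algebra_simps)
    then show ?thesis
      using t False U_eq[OF False, of s] unfolding seq_op_def F_sum by (simp add: plane_col_def algebra_simps)
  qed
qed

lemma F_n: "Fn s t n = (if t = s then 0 else 1)"
  by (simp add: plane_col_def)

lemma F_bound: "cmod (Fn s t k) \<le> 2 + R"
proof -
  have "cmod ((if k = n then 1 else 0) + U s k) \<le> 2"
    using norm_triangle_ineq[of "if k = n then 1 else 0" "U s k"] U_le1[of s k] by (auto split: if_splits)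
  then show ?thesis using Y_le_R[of s k] R_nonneg by (auto simp: plane_col_def intro: order_trans)
qed

lemma p_le: "cmod (pn s) \<le> R * K / \<bar>real_of_int n\<bar>"
  using diag_entry_le[where Y = Y and s = s, OF n0 Y_bound R_nonneg] by simp

lemma q_le: "cmod (qn s) \<le> (K + C2) * v (2 * n)"
  by (rule off_entry_le[OF nb U_bound])

lemma p_le_quarter: "cmod (pn s) \<le> 1 / 4" and q_le_quarter: "cmod (qn s) \<le> 1 / 4"
proof -
  have "R * K / \<bar>real_of_int n\<bar> \<le> 1 / 4"
    using n_plane_D(4)[OF large] n_pos by (simp add: divide_le_eq)
  then show "cmod (pn s) \<le> 1 / 4" using p_le[of s] by linarith
  have "v (2 * n) \<le> 1 / \<bar>real_of_int n\<bar>"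
  proof (rule order_trans[OF v_le_recip1])
    show "recip1 (2 * n) \<le> 1 / \<bar>real_of_int n\<bar>"
      unfolding recip1_def using n_pos by (intro frac_le) simp_all
  qed
  then have "cmod (qn s) \<le> (K + C2) * (1 / \<bar>real_of_int n\<bar>)"
    using q_le[of s] mult_left_mono[of "v (2 * n)" "1 / \<bar>real_of_int n\<bar>" "K + C2"] by simp
  also have "\<dots> \<le> 1 / 4"
    using n_plane_D(5)[OF large] n_pos by (simp add: divide_le_eq)
  finally show "cmod (qn s) \<le> 1 / 4" .
qed

subsection \<open>Vectors whose image lies in the plane\<close>

lemma seq_op_diff:
  assumes "\<And>t k. cmod (x t k) \<le> A" "\<And>t k. cmod (y t k) \<le> B"
  shows "seq_op (\<lambda>t k. x t k - y t k) t k = seq_op x t k - seq_op y t k"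
proof -
  have AB: "0 \<le> A" "0 \<le> B" using order_trans[OF norm_ge_zero assms(1)] order_trans[OF norm_ge_zero assms(2)] by auto
  have "(\<Sum>\<^sub>\<infinity>l. P t (k + l) * (x (\<not> t) l - y (\<not> t) l)) = (\<Sum>\<^sub>\<infinity>l. P t (k + l) * x (\<not> t) l) - (\<Sum>\<^sub>\<infinity>l. P t (k + l) * y (\<not> t) l)"
    unfolding right_diff_distrib
    by (rule infsum_diff) (rule conv_bounded(2)[OF assms(1) AB(1)] conv_bounded(2)[OF assms(2) AB(2)])+
  then show ?thesis by (simp add: seq_op_def algebra_simps)
qed

lemma seq_op_comb:
  "seq_op (\<lambda>t k. a * Fn True t k + b * Fn False t k) t k = a * seq_op (Fn True) t k + b * seq_op (Fn False) t k"
proof -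
  have s: "(\<lambda>l. P t (k + l) * Fn s (\<not> t) l) summable_on UNIV" for s
    by (rule conv_bounded(2)[OF F_bound]) (use R_nonneg in auto)
  have "(\<Sum>\<^sub>\<infinity>l. P t (k + l) * (a * Fn True (\<not> t) l + b * Fn False (\<not> t) l)) =
    (\<Sum>\<^sub>\<infinity>l. a * (P t (k + l) * Fn True (\<not> t) l) + b * (P t (k + l) * Fn False (\<not> t) l))"
    by (simp add: algebra_simps)
  also have "\<dots> = a * (\<Sum>\<^sub>\<infinity>l. P t (k + l) * Fn True (\<not> t) l) + b * (\<Sum>\<^sub>\<infinity>l. P t (k + l) * Fn False (\<not> t) l)"
    by (subst infsum_add) (simp_all add: infsum_cmult_right' summable_on_cmult_right s)
  finally show ?thesis by (simp add: seq_op_def algebra_simps)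
qed

lemma comb_bound: "cmod (a * Fn True t k + b * Fn False t k) \<le> (cmod a + cmod b) * (2 + R)"
proof -
  have "cmod (a * Fn True t k + b * Fn False t k) \<le> cmod a * cmod (Fn True t k) + cmod b * cmod (Fn False t k)"
    by (rule order_trans[OF norm_triangle_ineq]) (simp add: norm_mult)
  also have "\<dots> \<le> cmod a * (2 + R) + cmod b * (2 + R)"
    by (intro add_mono mult_left_mono F_bound) auto
  finally show ?thesis by (simp add: algebra_simps)
qed

text \<open>If \<open>(L - \<mu>) x\<close> lies in the plane, \<open>\<mu>\<close> is in the strip of \<open>n\<close> and the modes of \<open>x\<close> with index \<open>n\<close>
vanish, then a sup bound for \<open>x\<close> can be halved: off the index \<open>n\<close> the diagonal part is invertible with
inverse \<open>recip (n - k)\<close> up to a constant, and inserting the resulting bound once more into the equation gives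
two resolvents and hence a factor \<open>1 / \<bar>n\<bar>\<close>.\<close>

lemma halving:
  fixes x :: "bool \<Rightarrow> int \<Rightarrow> complex"
  assumes \<mu>: "\<bar>Re \<mu> - pi * real_of_int n\<bar> \<le> pi / 2"
    and S: "\<And>t k. cmod (x t k) \<le> S"
    and eq: "\<And>t k. seq_op x t k - \<mu> * x t k = w True * Fn True t k + w False * Fn False t k"
    and xn: "\<And>t. x t n = 0"
  shows "cmod (x t k) \<le> S / 2"
proof -
  let ?n = "\<bar>real_of_int n\<bar>"
  have S0: "0 \<le> S" using order_trans[OF norm_ge_zero S] .
  have w: "cmod (w s) \<le> S * K" for s
  proof -
    have "w s = (\<Sum>\<^sub>\<infinity>l. P (\<not> s) (n + l) * x s l)"
      using eq[of "\<not> s" n] by (cases s) (simp_all add: seq_op_def xn F_n)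
    then show ?thesis using conv_bounded(1)[where X = "x s" and s = "\<not> s" and k = n, OF S S0] by simp
  qed
  define \<epsilon> where "\<epsilon> = K * R * (1 + \<kappa>) / ?n"
  have \<epsilon>0: "0 \<le> \<epsilon>" by (auto simp: \<epsilon>_def)
  have nn: "2 * (K * R * (1 + \<kappa>)) + 4 * (K * (1 + K)) \<le> ?n" by (rule n_plane_D(3)[OF large])
  have "0 \<le> K * R * (1 + \<kappa>)" "0 \<le> K * (1 + K)" by auto
  then have "K * R * (1 + \<kappa>) \<le> ?n" using nn by linarith
  then have \<epsilon>1: "\<epsilon> \<le> 1" using n_pos by (simp add: \<epsilon>_def divide_le_eq)
  have wF: "cmod (w t * Y t k + w (\<not> t) * U (\<not> t) k) \<le> S * \<epsilon>" if "k \<noteq> n" for t k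
  proof -
    have "cmod (Y t k) \<le> R * (1 / ?n)"
      using order_trans[OF Y_bound mult_left_mono[OF recip_v_le[OF n0, of k, folded wY_def] R_nonneg]] .
    moreover have "cmod (U (\<not> t) k) \<le> R * (\<kappa> / ?n)"
    proof -
      have "wU n k \<le> \<kappa> / ?n * 1" unfolding wU_def by (intro mult_left_mono v_le1) auto
      then show ?thesis using order_trans[OF U_bound mult_left_mono[of "wU n k" "\<kappa> / ?n" R]] by simp
    qed
    ultimately have "cmod (w t) * cmod (Y t k) + cmod (w (\<not> t)) * cmod (U (\<not> t) k) \<le> S * K * (R * (1 / ?n)) + S * K * (R * (\<kappa> / ?n))"
      using S0 by (intro add_mono mult_mono w) auto
    also have "\<dots> = S * \<epsilon>" by (simp add: \<epsilon>_def add_divide_distrib algebra_simps)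
    finally show ?thesis using norm_triangle_ineq[of "w t * Y t k" "w (\<not> t) * U (\<not> t) k"] by (simp add: norm_mult)
  qed
  have step: "cmod (x t k) \<le> recip (n - k) * (S * \<epsilon> + cmod (\<Sum>\<^sub>\<infinity>l. P t (k + l) * x (\<not> t) l))" for t k
  proof (cases "k = n")
    case False
    let ?C = "\<Sum>\<^sub>\<infinity>l. P t (k + l) * x (\<not> t) l" and ?z = "complex_of_real (pi * real_of_int k) - \<mu>"
    have e: "?z * x t k = (w t * Y t k + w (\<not> t) * U (\<not> t) k) - ?C"
      using eq[of t k] False by (cases t) (simp_all add: seq_op_def plane_col_def algebra_simps)
    have kn: "1 \<le> \<bar>real_of_int (n - k)\<bar>" using False by linarith
    have "\<bar>real_of_int (n - k)\<bar> \<le> \<bar>pi * real_of_int k - Re \<mu>\<bar>"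
    proof -
      have "pi * \<bar>real_of_int (n - k)\<bar> = \<bar>pi * real_of_int n - pi * real_of_int k\<bar>"
        by (simp add: abs_mult right_diff_distrib[symmetric])
      then have "pi * \<bar>real_of_int (n - k)\<bar> - pi / 2 \<le> \<bar>pi * real_of_int k - Re \<mu>\<bar>" using \<mu> by linarith
      moreover have "pi * 1 \<le> pi * \<bar>real_of_int (n - k)\<bar>" using kn by (intro mult_left_mono) auto
      moreover have "2 * \<bar>real_of_int (n - k)\<bar> \<le> pi * \<bar>real_of_int (n - k)\<bar>" using pi_ge_two by (intro mult_right_mono) auto
      moreover have "T \<le> Z" if "pi * T - pi / 2 \<le> Z" "pi * 1 \<le> pi * T" "2 * T \<le> pi * T" for T Z
        using that by linarith
      ultimately show ?thesis by blast
    qed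
    also have "\<dots> \<le> cmod ?z" using abs_Re_le_cmod[of ?z] by simp
    finally have z: "\<bar>real_of_int (n - k)\<bar> \<le> cmod ?z" .
    have "\<bar>real_of_int (n - k)\<bar> * cmod (x t k) \<le> cmod ?z * cmod (x t k)"
      by (rule mult_right_mono[OF z]) simp
    also have "\<dots> = cmod ((w t * Y t k + w (\<not> t) * U (\<not> t) k) - ?C)"
      unfolding norm_mult[symmetric] e ..
    also have "\<dots> \<le> S * \<epsilon> + cmod ?C"
      using norm_triangle_ineq4[of "w t * Y t k + w (\<not> t) * U (\<not> t) k" ?C] wF[OF False, of t] by linarith
    finally have "recip (n - k) * (\<bar>real_of_int (n - k)\<bar> * cmod (x t k)) \<le> recip (n - k) * (S * \<epsilon> + cmod ?C)"
      by (rule mult_left_mono) simp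
    moreover have "recip (n - k) * \<bar>real_of_int (n - k)\<bar> = 1" using False by (simp add: recip_def)
    ultimately show ?thesis by (simp add: mult.assoc[symmetric])
  qed (simp add: xn)
  have crude: "cmod (x t l) \<le> ((1 + K) * S) * recip (n - l)" for t l
  proof -
    have "S * \<epsilon> + cmod (\<Sum>\<^sub>\<infinity>k. P t (l + k) * x (\<not> t) k) \<le> S * 1 + S * K"
      by (intro add_mono mult_left_mono \<epsilon>1 S0 conv_bounded(1)[where X = "x (\<not> t)", OF S S0])
    then have "recip (n - l) * (S * \<epsilon> + cmod (\<Sum>\<^sub>\<infinity>k. P t (l + k) * x (\<not> t) k)) \<le> recip (n - l) * (S * 1 + S * K)"
      by (rule mult_left_mono) simp
    then show ?thesis using step[of t l] by (simp add: algebra_simps)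
  qed
  have KS: "0 \<le> (1 + K) * S" using S0 by auto
  have "recip (n - k) * cmod (\<Sum>\<^sub>\<infinity>l. P t (k + l) * x (\<not> t) l) \<le> ((1 + K) * S) * ((K + K) / ?n)"
  proof -
    have "sum_le (\<lambda>l. 1 / ?n * (c (k + l) + d (k + l) * recip (n - l))) (1 / ?n * (K + K))"
      by (intro sum_le_cmult sum_le_add sum_c_shift sum_dh) auto
    then have "sum_le (\<lambda>l. recip (n - k) * (c (k + l) * recip (n - l))) ((K + K) / ?n)"
    proof (rule sum_le_mono)
      fix l show "recip (n - k) * (c (k + l) * recip (n - l)) \<le> 1 / ?n * (c (k + l) + d (k + l) * recip (n - l))"
        using two_resolvents_le[of n k l] n_pos by (simp add: field_simps)
    qed auto
    then have "sum_le (\<lambda>l. ((1 + K) * S) * (recip (n - k) * (c (k + l) * recip (n - l)))) (((1 + K) * S) * ((K + K) / ?n))"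
      by (rule sum_le_cmult[OF _ KS])
    moreover have "norm (recip (n - k) * (P t (k + l) * x (\<not> t) l)) \<le> ((1 + K) * S) * (recip (n - k) * (c (k + l) * recip (n - l)))" for l
      using mult_left_mono[OF mult_mono[OF Pc[of t "k + l"] crude[of "\<not> t" l]], of "recip (n - k)"] by (simp add: norm_mult mult_ac)
    ultimately have "norm (\<Sum>\<^sub>\<infinity>l. recip (n - k) * (P t (k + l) * x (\<not> t) l)) \<le> ((1 + K) * S) * ((K + K) / ?n)"
      by (rule sum_le_norm(3))
    then show ?thesis by (simp add: infsum_cmult_right' norm_mult)
  qed
  moreover have "recip (n - k) * (S * \<epsilon>) \<le> 1 * (S * \<epsilon>)"
    using S0 \<epsilon>0 by (intro mult_right_mono recip_le1) auto
  ultimately have "cmod (x t k) \<le> S * \<epsilon> + ((1 + K) * S) * ((K + K) / ?n)"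
    using step[of t k] by (simp add: distrib_left)
  also have "\<dots> = S * ((K * R * (1 + \<kappa>) + 2 * (K * (1 + K))) / ?n)"
    by (simp add: \<epsilon>_def add_divide_distrib algebra_simps)
  also have "\<dots> \<le> S * (1 / 2)"
    using nn n_pos by (intro mult_left_mono S0) (simp add: divide_le_eq)
  finally show ?thesis by simp
qed

text \<open>Subtracting the element of the plane with the same modes at \<open>n\<close> reduces the claim to
\<open>halving\<close>, which can be repeated indefinitely. Since the right-hand side may be any element of the plane, the
statement applies to root vectors of all orders.\<close>

lemma in_plane:
  fixes x :: "bool \<Rightarrow> int \<Rightarrow> complex"
  assumes \<mu>: "\<bar>Re \<mu> - pi * real_of_int n\<bar> \<le> pi / 2"
    and S: "\<And>t k. cmod (x t k) \<le> S"
    and eq: "\<And>t k. seq_op x t k - \<mu> * x t k = w True * Fn True t k + w False * Fn False t k"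
  shows "x t k = x False n * Fn True t k + x True n * Fn False t k"
proof -
  define y where "y t k = x False n * Fn True t k + x True n * Fn False t k" for t k
  \<comment> \<open>the right-hand side that remains for the difference \<open>x - y\<close>\<close>
  define u where "u s = w s - x (\<not> s) n * (complex_of_real (pi * real_of_int n) - \<mu> + pn s) - x s n * qn (\<not> s)" for s
  let ?T = "S + (cmod (x False n) + cmod (x True n)) * (2 + R)"
  have T: "cmod (x t k - y t k) \<le> ?T" for t k
    using norm_triangle_ineq4[of "x t k" "y t k"] S[of t k] comb_bound[of "x False n" t k "x True n"] by (simp add: y_def)
  have T0: "0 \<le> ?T" using order_trans[OF norm_ge_zero T] .
  have e: "seq_op (\<lambda>t k. x t k - y t k) t k - \<mu> * (x t k - y t k) = u True * Fn True t k + u False * Fn False t k" for t k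
  proof -
    have "seq_op y t k = x False n * seq_op (Fn True) t k + x True n * seq_op (Fn False) t k"
      unfolding y_def by (rule seq_op_comb)
    moreover have "seq_op (\<lambda>t k. x t k - y t k) t k = seq_op x t k - seq_op y t k"
      by (rule seq_op_diff[OF S]) (auto simp: y_def intro: comb_bound)
    ultimately show ?thesis
      using eq[of t k] unfolding F_invariant by (simp add: u_def y_def algebra_simps)
  qed
  have y0: "x t n - y t n = 0" for t
    by (cases t) (simp_all add: y_def F_n)
  have "cmod (x t k - y t k) \<le> ?T / 2 ^ j" for t k j
  proof (induction j arbitrary: t k)
    case 0 show ?case using T by simp
  next
    case (Suc j)
    from halving[OF \<mu> Suc.IH e y0, of t k] show ?case by simp
  qed
  moreover have "(\<lambda>j. ?T / 2 ^ j) \<longlonglongrightarrow> 0"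
    using tendsto_mult[OF tendsto_const[of ?T] LIMSEQ_power_zero[of "1/2 :: real"]] by (simp add: power_divide)
  ultimately have "cmod (x t k - y t k) \<le> 0"
    by (intro tendsto_lowerbound[of "\<lambda>j. ?T / 2 ^ j" 0 sequentially]) auto
  then show ?thesis by (simp add: y_def)
qed

end

end

section \<open>The size of the reduced matrix\<close>

text \<open>The double sums over \<open>(k, l)\<close> become convolutions after a change of variables \<open>\<sigma> n\<close> that depends on \<open>n\<close>.\<close>

lemma sum_le_Young_bij:
  assumes w: "sum_le w A" and g: "sum_le (\<lambda>x. (g x)\<^sup>2) G" and g0: "\<And>x. 0 \<le> g x"
    and inj: "\<And>i. inj (\<lambda>n. \<tau> n i)" and bij: "\<And>n. bij (\<sigma> n)"
  shows "(\<lambda>x. w (\<sigma> n x) * g (\<tau> n (\<sigma> n x))) summable_on UNIV"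
    and "sum_le (\<lambda>n. (\<Sum>\<^sub>\<infinity>x. w (\<sigma> n x) * g (\<tau> n (\<sigma> n x)))\<^sup>2) (A\<^sup>2 * G)"
proof -
  have G0: "0 \<le> G" using sum_le_bound_nonneg[OF g] .
  have gb: "g x \<le> G + 1" for x
  proof -
    have "(g x)\<^sup>2 \<le> G" by (rule sum_le_point[OF g])
    moreover have "2 * g x \<le> (g x)\<^sup>2 + 1" using sum_squares_bound[of "g x" 1] by simp
    ultimately show ?thesis using g0[of x] by linarith
  qed
  have "sum_le (\<lambda>i. w i * g (\<tau> n i)) ((G + 1) * A)"
    by (rule sum_le_mono[OF sum_le_cmult[OF w, of "G + 1"]])
       (use gb g0 sum_le_nonneg[OF w] G0 in \<open>auto simp: mult.commute[of "w _"] intro: mult_right_mono\<close>)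
  then have "(\<lambda>i. w i * g (\<tau> n i)) summable_on UNIV" by (rule sum_le_summable)
  then show "(\<lambda>x. w (\<sigma> n x) * g (\<tau> n (\<sigma> n x))) summable_on UNIV"
    using summable_on_reindex_bij_betw[OF bij[of n], of "\<lambda>i. w i * g (\<tau> n i)"] by simp
  have "(\<Sum>\<^sub>\<infinity>x. w (\<sigma> n x) * g (\<tau> n (\<sigma> n x))) = (\<Sum>\<^sub>\<infinity>i. w i * g (\<tau> n i))" for n
    using infsum_reindex_bij_betw[OF bij[of n], of "\<lambda>i. w i * g (\<tau> n i)"] by simp
  then show "sum_le (\<lambda>n. (\<Sum>\<^sub>\<infinity>x. w (\<sigma> n x) * g (\<tau> n (\<sigma> n x)))\<^sup>2) (A\<^sup>2 * G)"
    using sum_le_Young[OF w g g0 inj] by simp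
qed

context hankel
begin

text \<open>The leading error term of the off-diagonal entries. Iterating the equations for \<open>Y\<close> and \<open>U\<close> once expands
the off-diagonal entry into \<open>P s (2 * n)\<close> and a cubic sum in \<open>P\<close>, of which this is the majorant.\<close>

definition triple :: "int \<Rightarrow> real" where
  "triple n = (\<Sum>\<^sub>\<infinity>(k, l). c (n + k) * (recip (n - k) * (c (k + l) * (recip (n - l) * c (l + n)))))"

lemma triple_sum:
  shows "sum_le (\<lambda>l. c (k + l) * (recip (n - l) * c (l + n))) (K * K)" (is ?A)
    and "sum_le (\<lambda>k. c (n + k) * (recip (n - k) * (\<Sum>\<^sub>\<infinity>l. c (k + l) * (recip (n - l) * c (l + n))))) (triple n)" (is ?B)
    and "(\<lambda>(k, l). c (n + k) * (recip (n - k) * (c (k + l) * (recip (n - l) * c (l + n))))) summable_on UNIV" (is ?C)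
proof -
  have cK: "c m \<le> K" for m using sum_le_point[OF sum_c] .
  show ?A
  proof (rule sum_le_mono[OF sum_le_cmult[OF sum_c_shift, of K n]])
    fix l
    have "c (k + l) * (recip (n - l) * c (l + n)) \<le> K * (1 * c (l + n))"
      by (intro mult_mono mult_right_mono cK recip_le1) auto
    then show "c (k + l) * (recip (n - l) * c (l + n)) \<le> K * c (n + l)" by (simp add: add.commute)
  qed auto
  have S: "sum_le (\<lambda>(k, l). c (n + k) * (recip (n - k) * (c (k + l) * (recip (n - l) * c (l + n))))) (K * (K * K))"
  proof (rule sum_le_mono[OF sum_le_prod[OF sum_c_shift[of n] sum_le_cmult[OF sum_c_shift[of n], of K]]])
    fix x :: "int \<times> int"
    obtain k l where x: "x = (k, l)" by (cases x)
    have "c (n + k) * (recip (n - k) * (c (k + l) * (recip (n - l) * c (l + n)))) \<le> c (n + k) * (1 * (K * (1 * c (l + n))))"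
      by (intro mult_mono mult_left_mono mult_right_mono cK recip_le1) auto
    then show "(case x of (k, l) \<Rightarrow> c (n + k) * (recip (n - k) * (c (k + l) * (recip (n - l) * c (l + n)))))
       \<le> (case x of (x, y) \<Rightarrow> c (n + x) * (K * c (n + y)))" by (simp add: x add.commute)
  qed auto
  show ?C by (rule sum_le_summable[OF S])
  then have S': "(\<lambda>(k, l). c (n + k) * (recip (n - k) * (c (k + l) * (recip (n - l) * c (l + n))))) summable_on UNIV \<times> UNIV"
    by simp
  have it: "(\<Sum>\<^sub>\<infinity>l. c (n + k) * (recip (n - k) * (c (k + l) * (recip (n - l) * c (l + n)))))
     = c (n + k) * (recip (n - k) * (\<Sum>\<^sub>\<infinity>l. c (k + l) * (recip (n - l) * c (l + n))))" for k
    by (simp add: infsum_cmult_right')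
  show ?B
  proof (rule sum_leI)
    show "0 \<le> c (n + k) * (recip (n - k) * (\<Sum>\<^sub>\<infinity>l. c (k + l) * (recip (n - l) * c (l + n))))" for k
      by (intro mult_nonneg_nonneg infsum_nonneg) auto
    show "(\<lambda>k. c (n + k) * (recip (n - k) * (\<Sum>\<^sub>\<infinity>l. c (k + l) * (recip (n - l) * c (l + n))))) summable_on UNIV"
      using summable_on_Sigma_banach[OF S'] by (simp add: it)
    show "(\<Sum>\<^sub>\<infinity>k. c (n + k) * (recip (n - k) * (\<Sum>\<^sub>\<infinity>l. c (k + l) * (recip (n - l) * c (l + n))))) \<le> triple n"
      using infsum_Sigma'_banach[OF S'] by (simp add: it triple_def)
  qed
qed

definition D1 :: real where "D1 = R * \<kappa> * C2 + R * K * R + (K + C2) * R * \<kappa>"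
definition D2 :: real where "D2 = D1 * C1 + R * K * R * \<kappa>"
definition Ce :: real where "Ce = D2 * C2 + (K + C2) * R * (4 * K\<^sup>2)"

lemma D_nonneg [simp]: "0 \<le> D1" "0 \<le> D2" "0 \<le> Ce"
  unfolding D1_def D2_def Ce_def by (intro add_nonneg_nonneg mult_nonneg_nonneg; simp)+

context
  fixes n Y U
  assumes ric: "riccati n Y U" and large: "n_plane \<le> \<bar>real_of_int n\<bar>"
begin

lemmas size_facts = nb[OF ric large] n0[OF ric large] n_pos[OF ric large] n1[OF ric large]
  Y_bound[OF ric large] U_bound[OF ric large] U_bound_v[OF ric large] p_le[OF ric large] q_le[OF ric large]

text \<open>First order expansion of \<open>Y\<close>: the equation is used once, with the bounds of the ball on the right.\<close>

lemma Y_main: "cmod (Y s l) \<le> recip (n - l) * (c (l + n) + D1 / \<bar>real_of_int n\<bar> * v (n + l))"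
proof -
  let ?n = "\<bar>real_of_int n\<bar>" and ?S = "\<Sum>\<^sub>\<infinity>k. P s (l + k) * U s k"
  have vn: "wY n l \<le> v (n + l)" by (rule wY_le_v)
  have 1: "cmod ?S \<le> R * (\<kappa> / ?n * C2 * v (n + l))"
    by (rule conv_le(1)[OF sum_wU[of l n] size_facts(6)]) simp
  have "cmod (diag_entry n Y s * Y s l) \<le> (R * K / ?n) * (R * v (n + l))"
    unfolding norm_mult by (intro mult_mono size_facts(8) order_trans[OF size_facts(5) mult_left_mono[OF vn R_nonneg]]) auto
  moreover have "cmod (off_entry n U s * U (\<not> s) l) \<le> ((K + C2) * v (2 * n)) * (R * (\<kappa> / ?n * v (n - l)))"
    unfolding norm_mult using size_facts(6)[of "\<not> s" l] by (intro mult_mono size_facts(9)) (auto simp: wU_def)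
  moreover have "((K + C2) * v (2 * n)) * (R * (\<kappa> / ?n * v (n - l))) \<le> ((K + C2) * R * \<kappa> / ?n) * v (n + l)"
  proof -
    have "((K + C2) * v (2 * n)) * (R * (\<kappa> / ?n * v (n - l))) = ((K + C2) * R * \<kappa> / ?n) * (v (2 * n) * v (n - l))" by simp
    also have "\<dots> \<le> ((K + C2) * R * \<kappa> / ?n) * v (n + l)" by (intro mult_left_mono v_shift_le) auto
    finally show ?thesis .
  qed
  ultimately have b: "cmod ?S + cmod (diag_entry n Y s * Y s l) + cmod (off_entry n U s * U (\<not> s) l)
     \<le> R * (\<kappa> / ?n * C2 * v (n + l)) + (R * K / ?n) * (R * v (n + l)) + ((K + C2) * R * \<kappa> / ?n) * v (n + l)"
    using 1 by linarith
  also have "\<dots> = D1 / ?n * v (n + l)" by (simp add: D1_def add_divide_distrib algebra_simps)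
  finally have b: "cmod ?S + cmod (diag_entry n Y s * Y s l) + cmod (off_entry n U s * U (\<not> s) l) \<le> D1 / ?n * v (n + l)" .
  have "cmod (P s (l + n) + ?S - diag_entry n Y s * Y s l - off_entry n U s * U (\<not> s) l)
     \<le> cmod (P s (l + n)) + cmod ?S + cmod (diag_entry n Y s * Y s l) + cmod (off_entry n U s * U (\<not> s) l)"
    by (intro order_trans[OF norm_triangle_ineq4] add_mono order_refl norm_triangle_ineq)
  also have "\<dots> \<le> c (l + n) + D1 / ?n * v (n + l)" using b Pc[of s "l + n"] by linarith
  finally have "cmod (1 / complex_of_real (pi * real_of_int (n - l))) * cmod (P s (l + n) + ?S - diag_entry n Y s * Y s l - off_entry n U s * U (\<not> s) l)
     \<le> recip (n - l) * (c (l + n) + D1 / ?n * v (n + l))"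
    by (intro mult_mono resolvent_le_recip) auto
  moreover have "cmod (Y s l) = cmod (FY n Y U s l)" using ric unfolding riccati_def by metis
  moreover have "cmod (FY n Y U s l) = cmod (1 / complex_of_real (pi * real_of_int (n - l))) * cmod (P s (l + n) + ?S - diag_entry n Y s * Y s l - off_entry n U s * U (\<not> s) l)"
    by (simp only: FY_def norm_mult)
  ultimately show ?thesis by linarith
qed

text \<open>Second order expansion of \<open>U\<close>, obtained by inserting \<open>Y_main\<close> into the equation for \<open>U\<close>.\<close>

lemma U_main:
  "cmod (U s k) \<le> recip (n - k) * (\<Sum>\<^sub>\<infinity>l. c (k + l) * (recip (n - l) * c (l + n)))
     + D2 / \<bar>real_of_int n\<bar>\<^sup>2 * v (n - k) + (K + C2) * R * v (2 * n) * (recip (n - k) * wY n k)"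
proof -
  let ?n = "\<bar>real_of_int n\<bar>" and ?S = "\<Sum>\<^sub>\<infinity>l. P (\<not> s) (k + l) * Y s l"
  let ?G = "\<Sum>\<^sub>\<infinity>l. c (k + l) * (recip (n - l) * c (l + n))"
  have s1: "sum_le (\<lambda>l. recip (n - k) * (c (k + l) * (recip (n - l) * c (l + n)))) (recip (n - k) * ?G)"
    by (rule sum_le_cmult, rule sum_leI)
       (auto intro: sum_le_summable[OF triple_sum(1)])
  have s2: "sum_le (\<lambda>l. D1 / ?n * (recip (n - k) * (c (k + l) * (recip (n - l) * v (n + l))))) (D1 / ?n * (C1 / ?n * v (n - k)))"
    by (rule sum_le_cmult[OF resolvent_gain[OF size_facts(2)]]) auto
  have "norm (recip (n - k) * (P (\<not> s) (k + l) * Y s l)) \<le>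
     recip (n - k) * (c (k + l) * (recip (n - l) * c (l + n))) + D1 / ?n * (recip (n - k) * (c (k + l) * (recip (n - l) * v (n + l))))" for l
    using mult_left_mono[OF mult_mono[OF Pc[of "\<not> s" "k + l"] Y_main[of s l]], of "recip (n - k)"]
    by (simp add: norm_mult algebra_simps)
  from sum_le_norm(3)[OF sum_le_add[OF s1 s2] this]
  have 1: "recip (n - k) * cmod ?S \<le> recip (n - k) * ?G + D1 / ?n * (C1 / ?n * v (n - k))"
    by (simp add: infsum_cmult_right' norm_mult)
  have "cmod (diag_entry n Y s * U s k) \<le> (R * K / ?n) * (R * (\<kappa> / ?n * v (n - k)))"
    unfolding norm_mult using size_facts(6)[of s k] by (intro mult_mono size_facts(8)) (auto simp: wU_def)
  then have 2: "recip (n - k) * cmod (diag_entry n Y s * U s k) \<le> 1 * ((R * K / ?n) * (R * (\<kappa> / ?n * v (n - k))))"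
    by (intro mult_mono recip_le1) auto
  have "cmod (off_entry n U s * Y (\<not> s) k) \<le> ((K + C2) * v (2 * n)) * (R * wY n k)"
    unfolding norm_mult using size_facts(5)[of "\<not> s" k] by (intro mult_mono size_facts(9)) auto
  then have 3: "recip (n - k) * cmod (off_entry n U s * Y (\<not> s) k) \<le> recip (n - k) * (((K + C2) * v (2 * n)) * (R * wY n k))"
    by (intro mult_left_mono) auto
  have "cmod (U s k) = cmod (FU n Y U s k)" using ric unfolding riccati_def by metis
  also have "\<dots> = cmod (1 / complex_of_real (pi * real_of_int (n - k))) * cmod (?S - diag_entry n Y s * U s k - off_entry n U s * Y (\<not> s) k)"
    by (simp only: FU_def norm_mult)
  also have "\<dots> \<le> recip (n - k) * (cmod ?S + cmod (diag_entry n Y s * U s k) + cmod (off_entry n U s * Y (\<not> s) k))"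
    by (intro mult_mono resolvent_le_recip order_trans[OF norm_triangle_ineq4] add_mono order_refl) auto
  also have "\<dots> \<le> recip (n - k) * ?G + D1 / ?n * (C1 / ?n * v (n - k)) + 1 * ((R * K / ?n) * (R * (\<kappa> / ?n * v (n - k))))
      + recip (n - k) * (((K + C2) * v (2 * n)) * (R * wY n k))"
    using add_mono[OF add_mono[OF 1 2] 3] by (simp only: distrib_left)
  also have "\<dots> = recip (n - k) * ?G + D2 / ?n\<^sup>2 * v (n - k) + (K + C2) * R * v (2 * n) * (recip (n - k) * wY n k)"
    by (simp add: D2_def power2_eq_square add_divide_distrib algebra_simps)
  finally show ?thesis .
qed

lemma resolvent_sq_gain: "sum_le (\<lambda>k. c (n + k) * (recip (n - k) * wY n k)) (4 * K\<^sup>2 / \<bar>real_of_int n\<bar>\<^sup>2)"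
proof -
  let ?n = "\<bar>real_of_int n\<bar>"
  have "sum_le (\<lambda>k. K * (2 / ?n\<^sup>2) * ((recip (n - k))\<^sup>2 + (recip1 (n + k))\<^sup>2)) (K * (2 / ?n\<^sup>2) * (recip_const + recip_const))"
    by (intro sum_le_cmult sum_le_add sum_le_shift(3)[OF recip_sq_le] sum_le_shift(1)[OF recip1_sq_le]) auto
  then show ?thesis
  proof (rule sum_le_mono)
    fix k
    have "c (n + k) * (recip (n - k) * wY n k) = d (n + k) * (recip (n - k) * v (n + k))\<^sup>2"
      by (simp add: wY_def c_eq power2_eq_square mult_ac)
    also have "\<dots> \<le> K * ((recip (n - k) + recip1 (n + k)) / ?n)\<^sup>2"
    proof (intro mult_mono d_le_K power_mono)
      have "?n * (recip (n - k) * v (n + k)) \<le> ?n * (recip (n - k) * recip1 (n + k))"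
        by (intro mult_left_mono v_le_recip1) auto
      then have "?n * (recip (n - k) * v (n + k)) \<le> recip (n - k) + recip1 (n + k)" using partial_fraction_le[of n k] by linarith
      then show "recip (n - k) * v (n + k) \<le> (recip (n - k) + recip1 (n + k)) / ?n"
        using size_facts(3) by (simp add: le_divide_eq mult.commute)
    qed auto
    also have "\<dots> \<le> K * (2 * ((recip (n - k))\<^sup>2 + (recip1 (n + k))\<^sup>2) / ?n\<^sup>2)"
      using sum_squares_bound[of "recip (n - k)" "recip1 (n + k)"]
      by (intro mult_left_mono) (auto simp: power_divide power2_sum intro!: divide_right_mono)
    finally show "c (n + k) * (recip (n - k) * wY n k) \<le> K * (2 / ?n\<^sup>2) * ((recip (n - k))\<^sup>2 + (recip1 (n + k))\<^sup>2)" by (simp add: algebra_simps add_divide_distrib)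
  next
    have "K * (2 / ?n\<^sup>2) * (recip_const + recip_const) \<le> K * (2 / ?n\<^sup>2) * (K + K)"
      using M_nonneg recip_const_nonneg by (intro mult_left_mono) (simp_all add: K_def)
    then show "K * (2 / ?n\<^sup>2) * (recip_const + recip_const) \<le> 4 * K\<^sup>2 / ?n\<^sup>2" by (simp add: power2_eq_square)
  qed (auto simp: wY_def)
qed

text \<open>The remainders of \<open>U_main\<close> are of order \<open>1 / \<bar>n\<bar>\<^sup>2\<close> relative to \<open>v (2 * n)\<close>; square summability over \<open>n\<close> of
\<open>1 / \<bar>n\<bar>\<close> absorbs them later.\<close>

lemma off_entry_error: "cmod (off_entry n U s - P s (2 * n)) \<le> triple n + Ce / \<bar>real_of_int n\<bar>\<^sup>2 * v (2 * n)"
proof -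
  let ?n = "\<bar>real_of_int n\<bar>"
  let ?G = "\<lambda>k. \<Sum>\<^sub>\<infinity>l. c (k + l) * (recip (n - l) * c (l + n))"
  have S: "sum_le (\<lambda>k. c (n + k) * (recip (n - k) * ?G k) + D2 / ?n\<^sup>2 * (c (n + k) * v (n - k))
      + (K + C2) * R * v (2 * n) * (c (n + k) * (recip (n - k) * wY n k)))
     (triple n + D2 / ?n\<^sup>2 * (C2 * v (n + n)) + (K + C2) * R * v (2 * n) * (4 * K\<^sup>2 / ?n\<^sup>2))"
    by (intro sum_le_add sum_le_cmult triple_sum(2) symbol_conv_le resolvent_sq_gain) auto
  have "norm (P s (n + k) * U s k) \<le> c (n + k) * (recip (n - k) * ?G k) + D2 / ?n\<^sup>2 * (c (n + k) * v (n - k))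
      + (K + C2) * R * v (2 * n) * (c (n + k) * (recip (n - k) * wY n k))" for k
    using mult_mono[OF Pc[of s "n + k"] U_main[of s k]] by (simp add: norm_mult algebra_simps)
  from sum_le_norm(3)[OF S this]
  have "cmod (\<Sum>\<^sub>\<infinity>k. P s (n + k) * U s k) \<le> triple n + D2 / ?n\<^sup>2 * (C2 * v (n + n)) + (K + C2) * R * v (2 * n) * (4 * K\<^sup>2 / ?n\<^sup>2)" .
  also have "\<dots> = triple n + Ce / ?n\<^sup>2 * v (2 * n)"
    by (simp add: Ce_def add_divide_distrib algebra_simps)
  finally show ?thesis by (simp add: off_entry_def)
qed

end

lemma weight_sum3: "weight N (a + b + e) \<le> 4 ^ N * (weight N a + weight N b + weight N e)"
proof -
  have "weight N (a + b + e) \<le> 2 ^ N * (weight N (a + b) + 1 * weight N e)" using weight_add_le[of N "a + b" e] by simp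
  also have "\<dots> \<le> 2 ^ N * (2 ^ N * (weight N a + weight N b) + 2 ^ N * weight N e)"
    by (intro mult_left_mono add_mono mult_right_mono weight_add_le) auto
  also have "\<dots> = (2 ^ N * 2 ^ N) * (weight N a + weight N b + weight N e)" by (simp add: algebra_simps)
  also have "(2 ^ N * 2 ^ N :: real) = 4 ^ N" by (simp add: power_mult_distrib[symmetric])
  finally show ?thesis .
qed

text \<open>The three arguments of the coefficients add up to \<open>2 n\<close> with signs, so one of them carries the weight
\<open>weight N (2 * n)\<close> and turns \<open>c\<close> into \<open>d\<close>. One resolvent factor, at a coefficient that does not carry the
weight, is used for the factor \<open>\<bar>n\<bar>\<close> by \<open>two_n_recip_le\<close>. If this needs a second \<open>d\<close>, the product of two
\<open>d\<close>s with two resolvent factors is split by \<open>a b \<le> a\<^sup>2 + b\<^sup>2\<close>. In each of the seven resulting terms two factors are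
summable and the third is square summable.\<close>

lemma triple_pointwise:
  fixes n k l :: int
  defines "u \<equiv> n + k" and "w \<equiv> k + l" and "z \<equiv> l + n"
  shows "\<bar>real_of_int n\<bar> * weight N (2 * n) * (c u * (recip (n - k) * (c w * (recip (n - l) * c z))))
    \<le> 4 ^ N * ((c w * c z * d u + c u * c w * d z + c u * c z * d w)
       + (2 * (c w * (d u)\<^sup>2 * recip (n - k)) + 2 * (c w * (d z)\<^sup>2 * recip (n - l))
       + (c z * (d u)\<^sup>2 * recip (n - k) + c z * (d w)\<^sup>2 * recip (n - l))))"
proof -
  let ?n = "\<bar>real_of_int n\<bar>" and ?a = "recip (n - k)" and ?b = "recip (n - l)"
  have a1: "?a \<le> 1" "?b \<le> 1" by (auto intro: recip_le1)
  have na: "?n * ?a * x \<le> x + y * ?a" if "0 \<le> x" "\<bar>real_of_int u\<bar> * x \<le> y" for x y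
  proof -
    have "2 * (?n * ?a) * x \<le> (1 + \<bar>real_of_int u\<bar> * ?a) * x"
      using two_n_recip_le[of n k] that by (intro mult_right_mono) (auto simp: u_def)
    also have "\<dots> = x + (\<bar>real_of_int u\<bar> * x) * ?a" by (simp add: algebra_simps)
    also have "\<dots> \<le> x + y * ?a" using that by (intro add_left_mono mult_right_mono) auto
    finally have "2 * (?n * ?a * x) \<le> x + y * ?a" by (simp add: mult.assoc)
    moreover have "0 \<le> ?n * ?a * x" using that by auto
    ultimately show ?thesis by linarith
  qed
  have nb: "?n * ?b * x \<le> x + y * ?b" if "0 \<le> x" "\<bar>real_of_int z\<bar> * x \<le> y" for x y
  proof -
    have "2 * (?n * ?b) * x \<le> (1 + \<bar>real_of_int z\<bar> * ?b) * x"
      using two_n_recip_le[of n l] that by (intro mult_right_mono) (auto simp: z_def add.commute)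
    also have "\<dots> = x + (\<bar>real_of_int z\<bar> * x) * ?b" by (simp add: algebra_simps)
    also have "\<dots> \<le> x + y * ?b" using that by (intro add_left_mono mult_right_mono) auto
    finally have "2 * (?n * ?b * x) \<le> x + y * ?b" by (simp add: mult.assoc)
    moreover have "0 \<le> ?n * ?b * x" using that by auto
    ultimately show ?thesis by linarith
  qed
  have dd: "d x * d y * (?a * ?b) \<le> (d x)\<^sup>2 * ?a + (d y)\<^sup>2 * ?b" for x y
  proof -
    have "d x * d y * (?a * ?b) \<le> ((d x)\<^sup>2 + (d y)\<^sup>2) * (?a * ?b)"
    proof (rule mult_right_mono)
      have "2 * (d x * d y) \<le> (d x)\<^sup>2 + (d y)\<^sup>2" "0 \<le> d x * d y"
        using sum_squares_bound[of "d x" "d y"] by (simp_all add: mult.assoc)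
      then show "d x * d y \<le> (d x)\<^sup>2 + (d y)\<^sup>2" by linarith
    qed auto
    also have "\<dots> = (d x)\<^sup>2 * (?a * ?b) + (d y)\<^sup>2 * (?b * ?a)" by (simp add: algebra_simps)
    also have "\<dots> \<le> (d x)\<^sup>2 * (?a * 1) + (d y)\<^sup>2 * (?b * 1)"
      by (intro add_mono mult_left_mono a1) auto
    finally show ?thesis by simp
  qed
  have T1: "?n * ?b * (d u * c w * c z * ?a) \<le> c w * c z * d u + c w * ((d u)\<^sup>2 * ?a + (d z)\<^sup>2 * ?b)"
  proof -
    have "?n * ?b * (d u * c w * c z * ?a) \<le> d u * c w * c z * ?a + (d u * c w * d z * ?a) * ?b"
      using mult_left_mono[OF abs_c_le_d[of z], of "d u * c w * ?a"] by (intro nb) (auto simp: mult_ac)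
    also have "\<dots> = d u * c w * c z * ?a + c w * (d u * d z * (?a * ?b))" by (simp add: mult_ac)
    also have "\<dots> \<le> d u * c w * c z * 1 + c w * ((d u)\<^sup>2 * ?a + (d z)\<^sup>2 * ?b)"
      by (intro add_mono mult_left_mono a1 dd) auto
    finally show ?thesis by (simp add: mult_ac)
  qed
  have T3: "?n * ?a * (c u * c w * d z * ?b) \<le> c u * c w * d z + c w * ((d u)\<^sup>2 * ?a + (d z)\<^sup>2 * ?b)"
  proof -
    have "?n * ?a * (c u * c w * d z * ?b) \<le> c u * c w * d z * ?b + (d u * c w * d z * ?b) * ?a"
      using mult_left_mono[OF abs_c_le_d[of u], of "c w * d z * ?b"] by (intro na) (auto simp: mult_ac)
    also have "\<dots> = c u * c w * d z * ?b + c w * (d u * d z * (?a * ?b))" by (simp add: mult_ac)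
    also have "\<dots> \<le> c u * c w * d z * 1 + c w * ((d u)\<^sup>2 * ?a + (d z)\<^sup>2 * ?b)"
      by (intro add_mono mult_left_mono a1 dd) auto
    finally show ?thesis by simp
  qed
  have T2: "?n * ?a * (c u * d w * c z * ?b) \<le> c u * c z * d w + c z * ((d u)\<^sup>2 * ?a + (d w)\<^sup>2 * ?b)"
  proof -
    have "?n * ?a * (c u * d w * c z * ?b) \<le> c u * d w * c z * ?b + (d u * d w * c z * ?b) * ?a"
      using mult_left_mono[OF abs_c_le_d[of u], of "d w * c z * ?b"] by (intro na) (auto simp: mult_ac)
    also have "\<dots> = c u * d w * c z * ?b + c z * (d u * d w * (?a * ?b))" by (simp add: mult_ac)
    also have "\<dots> \<le> c u * d w * c z * 1 + c z * ((d u)\<^sup>2 * ?a + (d w)\<^sup>2 * ?b)"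
      by (intro add_mono mult_left_mono a1 dd) auto
    finally show ?thesis by (simp add: mult_ac)
  qed
  have "weight N (2 * n) = weight N (u + - w + z)" by (simp add: u_def w_def z_def)
  also have "\<dots> \<le> 4 ^ N * (weight N u + weight N w + weight N z)" using weight_sum3[of u "- w" z] by (simp only: weight_minus)
  finally have Wn: "weight N (2 * n) \<le> 4 ^ N * (weight N u + weight N w + weight N z)" .
  have "?n * weight N (2 * n) * (c u * (?a * (c w * (?b * c z)))) = (?n * (c u * (?a * (c w * (?b * c z))))) * weight N (2 * n)"
    by (simp only: mult_ac)
  also have "\<dots> \<le> (?n * (c u * (?a * (c w * (?b * c z))))) * (4 ^ N * (weight N u + weight N w + weight N z))"
    by (intro mult_left_mono Wn) auto
  also have "\<dots> = 4 ^ N * (?n * ?b * (d u * c w * c z * ?a) + ?n * ?a * (c u * d w * c z * ?b) + ?n * ?a * (c u * c w * d z * ?b))"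
    by (simp add: d_def algebra_simps)
  also have "\<dots> \<le> 4 ^ N * ((c w * c z * d u + c w * ((d u)\<^sup>2 * ?a + (d z)\<^sup>2 * ?b))
      + (c u * c z * d w + c z * ((d u)\<^sup>2 * ?a + (d w)\<^sup>2 * ?b))
      + (c u * c w * d z + c w * ((d u)\<^sup>2 * ?a + (d z)\<^sup>2 * ?b)))"
    by (intro mult_left_mono add_mono T1 T2 T3) auto
  finally show ?thesis by (simp add: algebra_simps)
qed

lemma d_sqK: "sum_le (\<lambda>m. (d m)\<^sup>2) K" and recip_sqK: "sum_le (\<lambda>m. (recip m)\<^sup>2) K"
  by (rule sum_le_mono[OF d_sq] sum_le_mono[OF recip_sq_le]; use M_nonneg recip_const_nonneg in \<open>simp add: K_def\<close>)+

text \<open>Every term has a summable weight in two new variables, in which \<open>n\<close> does not occur, and a square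
summable factor whose argument is an injective function of \<open>n\<close> for fixed new variables.\<close>

lemma Young_triple:
  fixes f :: "int \<Rightarrow> int \<Rightarrow> int \<Rightarrow> real"
  assumes w: "sum_le w (K * K)" and g: "sum_le (\<lambda>x. (g x)\<^sup>2) K" and g0: "\<And>x. 0 \<le> g x"
    and inj: "\<And>i. inj (\<lambda>n. \<tau> n i)" and bij: "\<And>n. bij (\<sigma> n)"
    and eq: "\<And>n k l. f n k l = w (\<sigma> n (k, l)) * g (\<tau> n (\<sigma> n (k, l)))"
  shows "(\<lambda>(k, l). f n k l) summable_on UNIV" "sum_le (\<lambda>n. (\<Sum>\<^sub>\<infinity>(k, l). f n k l)\<^sup>2) (K ^ 5)"
proof -
  have e: "(\<lambda>(k, l). f n k l) = (\<lambda>x. w (\<sigma> n x) * g (\<tau> n (\<sigma> n x)))" for n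
    by (auto simp: eq)
  have K5: "(K * K)\<^sup>2 * K = K ^ 5" by (simp add: power2_eq_square eval_nat_numeral mult_ac)
  show "(\<lambda>(k, l). f n k l) summable_on UNIV"
    unfolding e by (rule sum_le_Young_bij(1)[OF w g g0 inj bij])
  show "sum_le (\<lambda>n. (\<Sum>\<^sub>\<infinity>(k, l). f n k l)\<^sup>2) (K ^ 5)"
    unfolding e using sum_le_Young_bij(2)[OF w g g0 inj bij] by (simp add: K5)
qed

lemma bij_qr: "bij (\<lambda>(k, l). (k + l, l + n :: int))"
  by (rule bij_betw_byWitness[where f' = "\<lambda>(q, r). (q - r + n, r - n)"]) auto

lemma bij_pq: "bij (\<lambda>(k, l). (n + k :: int, k + l))"
  by (rule bij_betw_byWitness[where f' = "\<lambda>(p, q). (p - n, q - p + n)"]) auto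

lemma bij_pr: "bij (\<lambda>(k, l). (n + k :: int, l + n :: int))"
  by (rule bij_betw_byWitness[where f' = "\<lambda>(p, r). (p - n, r - n)"]) auto

lemmas prod_cc = sum_le_prod[OF sum_c sum_c]
lemmas prod_dc = sum_le_prod[OF d_sqK sum_c]
lemmas prod_cd = sum_le_prod[OF sum_c d_sqK]

lemma triple_part1: "(\<lambda>(k, l). c (k + l) * c (l + n) * d (n + k)) summable_on UNIV"
    "sum_le (\<lambda>n. (\<Sum>\<^sub>\<infinity>(k, l). c (k + l) * c (l + n) * d (n + k))\<^sup>2) (K ^ 5)"
  by (rule Young_triple[where \<sigma> = "\<lambda>n (k, l). (k + l, l + n)" and \<tau> = "\<lambda>n (a, b). 2 * n + a - b" and g = d, OF prod_cc d_sqK];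
      auto simp: bij_qr inj_def)+

lemma triple_part2: "(\<lambda>(k, l). c (n + k) * c (k + l) * d (l + n)) summable_on UNIV"
    "sum_le (\<lambda>n. (\<Sum>\<^sub>\<infinity>(k, l). c (n + k) * c (k + l) * d (l + n))\<^sup>2) (K ^ 5)"
  by (rule Young_triple[where \<sigma> = "\<lambda>n (k, l). (n + k, k + l)" and \<tau> = "\<lambda>n (a, b). 2 * n - a + b" and g = d, OF prod_cc d_sqK];
      auto simp: bij_pq inj_def add.commute)+

lemma triple_part3: "(\<lambda>(k, l). c (n + k) * c (l + n) * d (k + l)) summable_on UNIV"
    "sum_le (\<lambda>n. (\<Sum>\<^sub>\<infinity>(k, l). c (n + k) * c (l + n) * d (k + l))\<^sup>2) (K ^ 5)"
  by (rule Young_triple[where \<sigma> = "\<lambda>n (k, l). (n + k, l + n)" and \<tau> = "\<lambda>n (a, b). a + b - 2 * n" and g = d, OF prod_cc d_sqK];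
      auto simp: bij_pr inj_def)+

lemma triple_part4: "(\<lambda>(k, l). c (k + l) * (d (n + k))\<^sup>2 * recip (n - k)) summable_on UNIV"
    "sum_le (\<lambda>n. (\<Sum>\<^sub>\<infinity>(k, l). c (k + l) * (d (n + k))\<^sup>2 * recip (n - k))\<^sup>2) (K ^ 5)"
  by (rule Young_triple[where \<sigma> = "\<lambda>n (k, l). (n + k, k + l)" and \<tau> = "\<lambda>n (a, b). 2 * n - a" and g = recip, OF prod_dc recip_sqK];
      auto simp: bij_pq inj_def)+

lemma triple_part5: "(\<lambda>(k, l). c (k + l) * (d (l + n))\<^sup>2 * recip (n - l)) summable_on UNIV"
    "sum_le (\<lambda>n. (\<Sum>\<^sub>\<infinity>(k, l). c (k + l) * (d (l + n))\<^sup>2 * recip (n - l))\<^sup>2) (K ^ 5)"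
  by (rule Young_triple[where \<sigma> = "\<lambda>n (k, l). (k + l, l + n)" and \<tau> = "\<lambda>n (a, b). 2 * n - b" and g = recip, OF prod_cd recip_sqK];
      auto simp: bij_qr inj_def)+

lemma triple_part6: "(\<lambda>(k, l). c (l + n) * (d (n + k))\<^sup>2 * recip (n - k)) summable_on UNIV"
    "sum_le (\<lambda>n. (\<Sum>\<^sub>\<infinity>(k, l). c (l + n) * (d (n + k))\<^sup>2 * recip (n - k))\<^sup>2) (K ^ 5)"
  by (rule Young_triple[where \<sigma> = "\<lambda>n (k, l). (n + k, l + n)" and \<tau> = "\<lambda>n (a, b). 2 * n - a" and g = recip, OF prod_dc recip_sqK];
      auto simp: bij_pr inj_def)+

lemma triple_part7: "(\<lambda>(k, l). c (l + n) * (d (k + l))\<^sup>2 * recip (n - l)) summable_on UNIV"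
    "sum_le (\<lambda>n. (\<Sum>\<^sub>\<infinity>(k, l). c (l + n) * (d (k + l))\<^sup>2 * recip (n - l))\<^sup>2) (K ^ 5)"
  by (rule Young_triple[where \<sigma> = "\<lambda>n (k, l). (k + l, l + n)" and \<tau> = "\<lambda>n (a, b). 2 * n - b" and g = recip, OF prod_dc recip_sqK];
      auto simp: bij_qr inj_def)+

definition Cm :: real where "Cm = 16 ^ N * (100 * K ^ 5)"

lemma triple_l2: "sum_le (\<lambda>n. (\<bar>real_of_int n\<bar> * weight N (2 * n) * triple n)\<^sup>2) Cm"
proof -
  let ?g = "\<lambda>n. 4 ^ N * (((\<Sum>\<^sub>\<infinity>(k, l). c (k + l) * c (l + n) * d (n + k))
      + (\<Sum>\<^sub>\<infinity>(k, l). c (n + k) * c (k + l) * d (l + n)) + (\<Sum>\<^sub>\<infinity>(k, l). c (n + k) * c (l + n) * d (k + l)))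
      + ((2 * (\<Sum>\<^sub>\<infinity>(k, l). c (k + l) * (d (n + k))\<^sup>2 * recip (n - k)) + 2 * (\<Sum>\<^sub>\<infinity>(k, l). c (k + l) * (d (l + n))\<^sup>2 * recip (n - l)))
      + ((\<Sum>\<^sub>\<infinity>(k, l). c (l + n) * (d (n + k))\<^sup>2 * recip (n - k)) + (\<Sum>\<^sub>\<infinity>(k, l). c (l + n) * (d (k + l))\<^sup>2 * recip (n - l)))))"
  have le: "\<bar>real_of_int n\<bar> * weight N (2 * n) * triple n \<le> ?g n" for n
  proof -
    have s: "(\<lambda>(k, l). 4 ^ N * ((c (k + l) * c (l + n) * d (n + k) + c (n + k) * c (k + l) * d (l + n) + c (n + k) * c (l + n) * d (k + l))
       + ((2 * (c (k + l) * (d (n + k))\<^sup>2 * recip (n - k)) + 2 * (c (k + l) * (d (l + n))\<^sup>2 * recip (n - l)))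
       + (c (l + n) * (d (n + k))\<^sup>2 * recip (n - k) + c (l + n) * (d (k + l))\<^sup>2 * recip (n - l))))) summable_on UNIV"
      using triple_part1(1)[of n] triple_part2(1)[of n] triple_part3(1)[of n] triple_part4(1)[of n] triple_part5(1)[of n] triple_part6(1)[of n] triple_part7(1)[of n]
      unfolding split_def by (intro summable_on_cmult_right summable_on_add)
    have "\<bar>real_of_int n\<bar> * weight N (2 * n) * triple n
       = (\<Sum>\<^sub>\<infinity>(k, l). \<bar>real_of_int n\<bar> * weight N (2 * n) * (c (n + k) * (recip (n - k) * (c (k + l) * (recip (n - l) * c (l + n))))))"
      unfolding triple_def split_def by (simp only: infsum_cmult_right')
    also have "\<dots> \<le> (\<Sum>\<^sub>\<infinity>(k, l). 4 ^ N * ((c (k + l) * c (l + n) * d (n + k) + c (n + k) * c (k + l) * d (l + n) + c (n + k) * c (l + n) * d (k + l))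
       + ((2 * (c (k + l) * (d (n + k))\<^sup>2 * recip (n - k)) + 2 * (c (k + l) * (d (l + n))\<^sup>2 * recip (n - l)))
       + (c (l + n) * (d (n + k))\<^sup>2 * recip (n - k) + c (l + n) * (d (k + l))\<^sup>2 * recip (n - l)))))"
    proof (rule infsum_mono[OF _ s])
      show "(\<lambda>(k, l). \<bar>real_of_int n\<bar> * weight N (2 * n) * (c (n + k) * (recip (n - k) * (c (k + l) * (recip (n - l) * c (l + n)))))) summable_on UNIV"
        using summable_on_cmult_right[OF triple_sum(3)[of n], of "\<bar>real_of_int n\<bar> * weight N (2 * n)"] by (simp add: split_def)
    next
      fix x :: "int \<times> int"
      obtain k l where x: "x = (k, l)" by (cases x)
      show "(case x of (k, l) \<Rightarrow> \<bar>real_of_int n\<bar> * weight N (2 * n) * (c (n + k) * (recip (n - k) * (c (k + l) * (recip (n - l) * c (l + n))))))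
        \<le> (case x of (k, l) \<Rightarrow> 4 ^ N * ((c (k + l) * c (l + n) * d (n + k) + c (n + k) * c (k + l) * d (l + n) + c (n + k) * c (l + n) * d (k + l))
       + ((2 * (c (k + l) * (d (n + k))\<^sup>2 * recip (n - k)) + 2 * (c (k + l) * (d (l + n))\<^sup>2 * recip (n - l)))
       + (c (l + n) * (d (n + k))\<^sup>2 * recip (n - k) + c (l + n) * (d (k + l))\<^sup>2 * recip (n - l)))))"
        unfolding x prod.case using triple_pointwise[of n k l] by (simp add: algebra_simps)
    qed
    also have "\<dots> = ?g n"
      using triple_part1(1)[of n] triple_part2(1)[of n] triple_part3(1)[of n] triple_part4(1)[of n] triple_part5(1)[of n] triple_part6(1)[of n] triple_part7(1)[of n]
      unfolding split_def by (simp only: infsum_add infsum_cmult_right' summable_on_add summable_on_cmult_right)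
    finally show ?thesis .
  qed
  have S: "sum_le (\<lambda>n. (?g n)\<^sup>2) ((4 ^ N)\<^sup>2 * (2 * (2 * (2 * K ^ 5 + 2 * K ^ 5) + 2 * K ^ 5)
     + 2 * (2 * (2 * (2\<^sup>2 * K ^ 5) + 2 * (2\<^sup>2 * K ^ 5)) + 2 * (2 * K ^ 5 + 2 * K ^ 5))))"
    by (intro sum_le_sq_cmult sum_le_sq_add triple_part1(2) triple_part2(2) triple_part3(2) triple_part4(2) triple_part5(2) triple_part6(2) triple_part7(2))
  have Mn0: "0 \<le> triple n" for n
    unfolding triple_def by (intro infsum_nonneg) (auto split: prod.splits)
  show ?thesis
  proof (rule sum_le_mono[OF S])
    fix n show "(\<bar>real_of_int n\<bar> * weight N (2 * n) * triple n)\<^sup>2 \<le> (?g n)\<^sup>2"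
      by (rule power_mono[OF le]) (auto intro!: mult_nonneg_nonneg Mn0)
  next
    have "(4 ^ N)\<^sup>2 = (16 ^ N :: real)" by (simp add: power2_eq_square power_mult_distrib[symmetric])
    then show "(4 ^ N)\<^sup>2 * (2 * (2 * (2 * K ^ 5 + 2 * K ^ 5) + 2 * K ^ 5)
     + 2 * (2 * (2 * (2\<^sup>2 * K ^ 5) + 2 * (2\<^sup>2 * K ^ 5)) + 2 * (2 * K ^ 5 + 2 * K ^ 5))) \<le> Cm"
      by (simp add: Cm_def)
  qed auto
qed

end

lemma summable_on_diff:
  fixes f g :: "'a \<Rightarrow> 'b::real_normed_vector"
  assumes "f summable_on A" "g summable_on A"
  shows "(\<lambda>x. f x - g x) summable_on A"
  using summable_on_add[OF assms(1), of "\<lambda>x. - g x"] assms(2) by (simp add: summable_on_uminus)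

section \<open>Symmetry of the operator and the diagonal of the reduced matrix\<close>

context hankel
begin

text \<open>The kernel depends on \<open>k + l\<close> only; the double sum converges absolutely, by Schur's test.\<close>

lemma Hankel_symmetric:
  assumes x: "sum_le (\<lambda>k. (cmod (x k))\<^sup>2) A" and y: "sum_le (\<lambda>k. (cmod (y k))\<^sup>2) B"
  shows "(\<lambda>k. (\<Sum>\<^sub>\<infinity>l. P t (k + l) * x l) * y k) summable_on UNIV"
    "(\<Sum>\<^sub>\<infinity>k. (\<Sum>\<^sub>\<infinity>l. P t (k + l) * x l) * y k) = (\<Sum>\<^sub>\<infinity>k. (\<Sum>\<^sub>\<infinity>l. P t (k + l) * y l) * x k)"
proof -
  have *: "sum_le (\<lambda>(k, l). c (k + l) * (cmod (y k))\<^sup>2) (K * B)"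
    if "sum_le (\<lambda>k. (cmod (y k))\<^sup>2) B" for y :: "int \<Rightarrow> complex" and B
  proof (rule sum_le_iterate)
    show "sum_le (\<lambda>l. c (k + l) * (cmod (y k))\<^sup>2) ((cmod (y k))\<^sup>2 * K)" for k
      using sum_le_cmult[OF sum_c_shift[of k], of "(cmod (y k))\<^sup>2"] by (simp add: mult.commute)
    show "sum_le (\<lambda>k. (cmod (y k))\<^sup>2 * K) (K * B)"
      using sum_le_cmult[OF that, of K] by (simp add: mult.commute)
  qed
  have 1: "sum_le (\<lambda>(k, l). c (k + l) * (cmod (x l))\<^sup>2) (K * A)"
    using sum_le_inj[OF *[OF x], of prod.swap] by (simp add: split_def add.commute)
  have S: "sum_le (\<lambda>z. (\<lambda>(k, l). c (k + l) * (cmod (x l))\<^sup>2) z + (\<lambda>(k, l). c (k + l) * (cmod (y k))\<^sup>2) z) (K * A + K * B)"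
    by (rule sum_le_add[OF 1 *[OF y]])
  have n: "norm (case z of (k, l) \<Rightarrow> P t (k + l) * x l * y k) \<le>
      (\<lambda>(k, l). c (k + l) * (cmod (x l))\<^sup>2) z + (\<lambda>(k, l). c (k + l) * (cmod (y k))\<^sup>2) z" for z
  proof -
    obtain k l where z: "z = (k, l)" by (cases z)
    have "2 * (cmod (x l) * cmod (y k)) \<le> (cmod (x l))\<^sup>2 + (cmod (y k))\<^sup>2" "0 \<le> cmod (x l) * cmod (y k)"
      using sum_squares_bound[of "cmod (x l)" "cmod (y k)"] by (simp_all add: mult.assoc)
    then have "cmod (x l) * cmod (y k) \<le> (cmod (x l))\<^sup>2 + (cmod (y k))\<^sup>2" by linarith
    then have "cmod (P t (k + l)) * (cmod (x l) * cmod (y k)) \<le> c (k + l) * ((cmod (x l))\<^sup>2 + (cmod (y k))\<^sup>2)"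
      by (intro mult_mono Pc) auto
    then show ?thesis by (simp add: z norm_mult algebra_simps)
  qed
  have sm: "(\<lambda>(k, l). P t (k + l) * x l * y k) summable_on UNIV \<times> UNIV"
    using sum_le_norm(2)[OF S n, of UNIV] by simp
  have i1: "(\<Sum>\<^sub>\<infinity>l. P t (k + l) * x l * y k) = (\<Sum>\<^sub>\<infinity>l. P t (k + l) * x l) * y k" for k
    by (rule infsum_cmult_left')
  have i2: "(\<Sum>\<^sub>\<infinity>k. P t (k + l) * x l * y k) = (\<Sum>\<^sub>\<infinity>k. P t (l + k) * y k) * x l" for l
    unfolding infsum_cmult_left'[symmetric] by (simp add: mult_ac add.commute)
  show "(\<lambda>k. (\<Sum>\<^sub>\<infinity>l. P t (k + l) * x l) * y k) summable_on UNIV"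
    using summable_on_Sigma_banach[OF sm] by (simp add: i1)
  show "(\<Sum>\<^sub>\<infinity>k. (\<Sum>\<^sub>\<infinity>l. P t (k + l) * x l) * y k) = (\<Sum>\<^sub>\<infinity>k. (\<Sum>\<^sub>\<infinity>l. P t (k + l) * y l) * x k)"
    using infsum_swap_banach[OF sm] by (simp add: i1 i2)
qed

definition C3 :: real where "C3 = 8 * R\<^sup>2 * \<kappa> * K"

context
  fixes n Y U
  assumes ric: "riccati n Y U" and large: "n_plane \<le> \<bar>real_of_int n\<bar>"
begin

lemmas diagonal_facts = nb[OF ric large] n0[OF ric large] n_pos[OF ric large] n1[OF ric large]
  Y_bound[OF ric large] U_bound[OF ric large] U_bound_v[OF ric large] Y_n[OF ric large] U_n[OF ric large]

lemma recip1_sqK: "sum_le (\<lambda>m. (recip1 m)\<^sup>2) K"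
  by (rule sum_le_mono[OF recip1_sq_le]) (use M_nonneg in \<open>simp_all add: K_def\<close>)

lemma recip1_shift_sq: "sum_le (\<lambda>k. (recip1 (n - k))\<^sup>2) K"
  by (rule sum_le_shift(3)[OF recip1_sqK])

lemma Y_sq: "sum_le (\<lambda>k. (cmod (Y s k))\<^sup>2) (R\<^sup>2 * K)"
proof (rule sum_le_mono[OF sum_le_cmult[OF sum_le_shift(1)[OF recip1_sqK, of n], of "R\<^sup>2"]])
  fix k
  have "cmod (Y s k) \<le> R * recip1 (n + k)"
    using order_trans[OF diagonal_facts(5) mult_left_mono[OF order_trans[OF wY_le_v v_le_recip1] R_nonneg]] .
  then show "(cmod (Y s k))\<^sup>2 \<le> R\<^sup>2 * (recip1 (n + k))\<^sup>2"
    unfolding power_mult_distrib[symmetric] by (intro power_mono) auto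
qed auto

lemma U_le_r: "cmod (U s k) \<le> R * \<kappa> / \<bar>real_of_int n\<bar> * recip1 (n - k)"
proof -
  have "wU n k \<le> \<kappa> / \<bar>real_of_int n\<bar> * recip1 (n - k)" unfolding wU_def by (intro mult_left_mono v_le_recip1) auto
  from order_trans[OF diagonal_facts(6) mult_left_mono[OF this R_nonneg], of s] show ?thesis by (simp add: mult.assoc)
qed

lemma U_sq: "sum_le (\<lambda>k. (cmod (U s k))\<^sup>2) ((R * \<kappa> / \<bar>real_of_int n\<bar>)\<^sup>2 * K)"
proof (rule sum_le_mono[OF sum_le_cmult[OF recip1_shift_sq, of "(R * \<kappa> / \<bar>real_of_int n\<bar>)\<^sup>2"]])
  fix k show "(cmod (U s k))\<^sup>2 \<le> (R * \<kappa> / \<bar>real_of_int n\<bar>)\<^sup>2 * (recip1 (n - k))\<^sup>2"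
    unfolding power_mult_distrib[symmetric] by (intro power_mono U_le_r) auto
qed auto

lemma col_l2: "\<exists>A. sum_le (\<lambda>k. (cmod (plane_col n Y U s t k))\<^sup>2) A"
proof (cases "t = s")
  case True then show ?thesis using Y_sq[of s] by (auto simp: plane_col_def)
next
  case False
  have d: "sum_le (\<lambda>k. (if k = n then 1 else 0 :: real)\<^sup>2) 1"
  proof -
    have "(if k = n then 1 else 0 :: real)\<^sup>2 = (if k = n then 1 else 0)" for k by simp
    then show ?thesis unfolding sum_le_def by (simp add: sum.delta)
  qed
  have "sum_le (\<lambda>k. (cmod ((if k = n then 1 else 0) + U s k))\<^sup>2) (2 * 1 + 2 * ((R * \<kappa> / \<bar>real_of_int n\<bar>)\<^sup>2 * K))"
    by (rule sum_le_sq_mono[OF sum_le_sq_add[OF d U_sq[of s]]])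
       (auto intro: order_trans[OF norm_triangle_ineq])
  then show ?thesis using False by (auto simp: plane_col_def)
qed

lemma YY_small: "sum_le (\<lambda>k. cmod (Y True k * Y False k)) (4 * R\<^sup>2 * K / \<bar>real_of_int n\<bar>)"
proof -
  let ?n = "\<bar>real_of_int n\<bar>"
  have hs: "sum_le (\<lambda>k. (recip (n - k))\<^sup>2) K" by (rule sum_le_shift(3)[OF recip_sqK])
  have "sum_le (\<lambda>k. (2 * R\<^sup>2 / ?n) * ((recip (n - k))\<^sup>2 + (recip1 (n + k))\<^sup>2)) ((2 * R\<^sup>2 / ?n) * (K + K))"
    by (intro sum_le_cmult sum_le_add hs sum_le_shift(1)[OF recip1_sqK]) auto
  then show ?thesis
  proof (rule sum_le_mono)
    fix k
    have b: "cmod (Y s k) \<le> R * wY n k" for s by (rule diagonal_facts(5))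
    have "cmod (Y True k * Y False k) \<le> (R * wY n k) * (R * wY n k)"
      unfolding norm_mult by (intro mult_mono b) auto
    also have "\<dots> = R\<^sup>2 * (wY n k * wY n k)" by (simp add: power2_eq_square)
    also have "wY n k * wY n k \<le> (1 / ?n) * (recip (n - k) * recip1 (n + k))"
      unfolding wY_def by (intro mult_mono recip_v_le diagonal_facts(2) mult_left_mono v_le_recip1) auto
    also have "recip (n - k) * recip1 (n + k) \<le> (recip (n - k))\<^sup>2 + (recip1 (n + k))\<^sup>2"
    proof -
      have "2 * (recip (n - k) * recip1 (n + k)) \<le> (recip (n - k))\<^sup>2 + (recip1 (n + k))\<^sup>2" "0 \<le> recip (n - k) * recip1 (n + k)"
        using sum_squares_bound[of "recip (n - k)" "recip1 (n + k)"] by (simp_all only: mult.assoc) auto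
      then show ?thesis by linarith
    qed
    finally have "cmod (Y True k * Y False k) \<le> R\<^sup>2 * ((1 / ?n) * ((recip (n - k))\<^sup>2 + (recip1 (n + k))\<^sup>2))"
      by (simp add: mult_left_mono divide_right_mono)
    also have "\<dots> \<le> 2 * (R\<^sup>2 * ((1 / ?n) * ((recip (n - k))\<^sup>2 + (recip1 (n + k))\<^sup>2)))"
    proof -
      have "0 \<le> R\<^sup>2 * ((1 / ?n) * ((recip (n - k))\<^sup>2 + (recip1 (n + k))\<^sup>2))" by (intro mult_nonneg_nonneg) auto
      then show ?thesis by linarith
    qed
    finally show "cmod (Y True k * Y False k) \<le> (2 * R\<^sup>2 / ?n) * ((recip (n - k))\<^sup>2 + (recip1 (n + k))\<^sup>2)" by simp
  qed (auto)
qed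

lemma UU_small: "sum_le (\<lambda>k. cmod (U True k * U False k)) (R\<^sup>2 * \<kappa>\<^sup>2 * K / \<bar>real_of_int n\<bar>)"
proof (rule sum_le_mono[OF sum_le_cmult[OF recip1_shift_sq, of "(R * \<kappa> / \<bar>real_of_int n\<bar>)\<^sup>2"]])
  fix k show "cmod (U True k * U False k) \<le> (R * \<kappa> / \<bar>real_of_int n\<bar>)\<^sup>2 * (recip1 (n - k))\<^sup>2"
    unfolding norm_mult power_mult_distrib[symmetric] power2_eq_square[of "_ * recip1 _"]
    by (intro mult_mono U_le_r) auto
next
  let ?n = "\<bar>real_of_int n\<bar>"
  have "(R * \<kappa> / ?n)\<^sup>2 * K = (R\<^sup>2 * \<kappa>\<^sup>2 * K / ?n) * (1 / ?n)" by (simp add: power2_eq_square)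
  also have "\<dots> \<le> (R\<^sup>2 * \<kappa>\<^sup>2 * K / ?n) * 1"
    using diagonal_facts(4) by (intro mult_left_mono) (auto simp: divide_le_eq)
  finally show "(R * \<kappa> / ?n)\<^sup>2 * K \<le> R\<^sup>2 * \<kappa>\<^sup>2 * K / ?n" by simp
qed auto

lemma UY_small: "sum_le (\<lambda>k. cmod (U s k * Y s k)) (2 * R\<^sup>2 * \<kappa> * K / \<bar>real_of_int n\<bar>)"
proof -
  let ?n = "\<bar>real_of_int n\<bar>"
  have "sum_le (\<lambda>k. (R\<^sup>2 * \<kappa> / ?n) * (recip1 (n - k) * recip1 (n + k))) ((R\<^sup>2 * \<kappa> / ?n) * (K + K))"
    by (intro sum_le_cmult sum_le_amgm recip1_shift_sq sum_le_shift(1)[OF recip1_sqK]) auto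
  then show ?thesis
  proof (rule sum_le_mono)
    fix k
    have "cmod (Y s k) \<le> R * recip1 (n + k)"
      using order_trans[OF diagonal_facts(5) mult_left_mono[OF order_trans[OF wY_le_v v_le_recip1] R_nonneg]] .
    then have "cmod (U s k * Y s k) \<le> (R * \<kappa> / ?n * recip1 (n - k)) * (R * recip1 (n + k))"
      unfolding norm_mult by (intro mult_mono U_le_r) auto
    then show "cmod (U s k * Y s k) \<le> (R\<^sup>2 * \<kappa> / ?n) * (recip1 (n - k) * recip1 (n + k))"
      by (simp add: power2_eq_square mult_ac)
  qed (auto simp: mult_ac)
qed

text \<open>Pair the image of each column with the other column, the components taken crosswise, and subtract. By the
symmetry of the operator the result is \<open>0\<close>. By the invariance of the plane it is
\<open>(p\<^sub>T - p\<^sub>F) (1 + o(1))\<close> plus the off-diagonal entries times the pairing of a column with itself, and that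
pairing is \<open>2 \<Sum> U Y = O(1 / \<bar>n\<bar>)\<close>.\<close>

lemma diag_entry_diff: "cmod (diag_entry n Y True - diag_entry n Y False) \<le> C3 / \<bar>real_of_int n\<bar> * (cmod (off_entry n U True) + cmod (off_entry n U False))"
proof -
  let ?n = "\<bar>real_of_int n\<bar>"
  let ?x = "plane_col n Y U True" and ?y = "plane_col n Y U False"
  define Ax where "Ax t k = (\<Sum>\<^sub>\<infinity>l. P t (k + l) * ?x (\<not> t) l)" for t k
  define Ay where "Ay t k = (\<Sum>\<^sub>\<infinity>l. P t (k + l) * ?y (\<not> t) l)" for t k
  define f where "f k = Ax True k * ?y False k + Ax False k * ?y True k - Ay False k * ?x True k - Ay True k * ?x False k" for k
  \<comment> \<open>the pairing of the two columns; its term at \<open>n\<close> is \<open>1\<close> and the sum of all others is small\<close>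
  define w12 where "w12 k = ?x True k * ?y False k + ?x False k * ?y True k" for k
  define p1 p2 q1 q2 where "p1 = diag_entry n Y True" and "p2 = diag_entry n Y False" and "q1 = off_entry n U True" and "q2 = off_entry n U False"
  \<comment> \<open>in the bilinear form pairing the two components crosswise, the diagonal part of the operator cancels\<close>
  have f_eq: "f k = (p1 - p2) * w12 k + q1 * (2 * (U False k * Y False k)) - q2 * (2 * (U True k * Y True k))" for k
  proof -
    have yy: "?y False k * ?y True k = U False k * Y False k" and xx: "?x True k * ?x False k = U True k * Y True k"
      by (cases "k = n"; simp add: plane_col_def diagonal_facts(8,9) mult.commute)+
    have A: "Ax t k = complex_of_real (pi * real_of_int n) * ?x t k + p1 * ?x t k + q1 * ?y t k - complex_of_real (pi * real_of_int k) * ?x t k" for t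
      using F_invariant[OF ric large, of True t k] by (simp add: seq_op_def Ax_def p1_def q1_def algebra_simps)
    have B: "Ay t k = complex_of_real (pi * real_of_int n) * ?y t k + p2 * ?y t k + q2 * ?x t k - complex_of_real (pi * real_of_int k) * ?y t k" for t
      using F_invariant[OF ric large, of False t k] by (simp add: seq_op_def Ay_def p2_def q2_def algebra_simps)
    have "f k = (p1 - p2) * w12 k + q1 * (2 * (?y False k * ?y True k)) - q2 * (2 * (?x True k * ?x False k))"
      unfolding f_def A B w12_def by (simp add: algebra_simps)
    then show ?thesis by (simp only: yy xx)
  qed
  obtain A1 where A1: "\<And>s t. sum_le (\<lambda>k. (cmod (plane_col n Y U s t k))\<^sup>2) (A1 s t)" using col_l2 by metis
  note hs = Hankel_symmetric[OF A1 A1]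
  have sums: "(\<lambda>k. Ax t k * ?y (\<not> t) k) summable_on UNIV" "(\<lambda>k. Ay t k * ?x (\<not> t) k) summable_on UNIV" for t
    unfolding Ax_def Ay_def by (rule hs(1))+
  have sym: "(\<Sum>\<^sub>\<infinity>k. Ax t k * ?y (\<not> t) k) = (\<Sum>\<^sub>\<infinity>k. Ay t k * ?x (\<not> t) k)" for t
    unfolding Ax_def Ay_def by (rule hs(2))
  have s1: "(\<lambda>k. Ax True k * ?y False k) summable_on UNIV" "(\<lambda>k. Ax False k * ?y True k) summable_on UNIV"
    "(\<lambda>k. Ay False k * ?x True k) summable_on UNIV" "(\<lambda>k. Ay True k * ?x False k) summable_on UNIV"
    using sums(1)[of True] sums(1)[of False] sums(2)[of True] sums(2)[of False] by simp_all
  have "infsum f UNIV = (\<Sum>\<^sub>\<infinity>k. Ax True k * ?y False k) + (\<Sum>\<^sub>\<infinity>k. Ax False k * ?y True k)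
      - (\<Sum>\<^sub>\<infinity>k. Ay False k * ?x True k) - (\<Sum>\<^sub>\<infinity>k. Ay True k * ?x False k)"
    unfolding f_def
    by (subst infsum_diff infsum_add; (intro s1 summable_on_add summable_on_diff)?)+ simp
  then have f0: "infsum f UNIV = 0" using sym[of True] sym[of False] by simp
  have w12_eq: "w12 k = (if k = n then 1 else 0) + (Y True k * Y False k + U True k * U False k)" for k
    by (cases "k = n") (simp_all add: w12_def plane_col_def diagonal_facts(8,9))
  note nY = sum_le_norm[OF YY_small order_refl] and nU = sum_le_norm[OF UU_small order_refl]
  define w' where "w' = (\<Sum>\<^sub>\<infinity>k. Y True k * Y False k + U True k * U False k)"
  have w'_small: "cmod w' \<le> 4 * R\<^sup>2 * K / ?n + R\<^sup>2 * \<kappa>\<^sup>2 * K / ?n"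
    unfolding w'_def using sum_le_norm(3)[OF sum_le_add[OF YY_small UU_small] norm_triangle_ineq] .
  have "4 * R\<^sup>2 * K / ?n + R\<^sup>2 * \<kappa>\<^sup>2 * K / ?n = (4 * R\<^sup>2 * K + R\<^sup>2 * \<kappa>\<^sup>2 * K) / ?n" by (simp add: add_divide_distrib)
  also have "\<dots> \<le> 1 / 2"
    using n_plane_D(2)[OF large] diagonal_facts(3) by (subst pos_divide_le_eq) auto
  finally have w'_half: "cmod w' \<le> 1 / 2" using w'_small by linarith
  have dlt: "((\<lambda>k. if k = n then 1 else 0 :: complex) has_sum 1) UNIV"
    using has_sum_finite_neutralI[of "{n}" UNIV "\<lambda>k. if k = n then 1 else 0 :: complex"] by simp
  have w12_sum: "w12 summable_on UNIV" "infsum w12 UNIV = 1 + w'"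
  proof -
    have e: "w12 = (\<lambda>k. (if k = n then 1 else 0) + (Y True k * Y False k + U True k * U False k))"
      using w12_eq by auto
    have d: "(\<lambda>k. if k = n then 1 else 0 :: complex) summable_on UNIV" "infsum (\<lambda>k. if k = n then 1 else 0 :: complex) UNIV = 1"
      using dlt by (auto simp: infsumI has_sum_imp_summable)
    have d2: "(\<lambda>k. Y True k * Y False k + U True k * U False k) summable_on UNIV"
      by (intro summable_on_add nY nU)
    show "w12 summable_on UNIV" unfolding e by (rule summable_on_add[OF d(1) d2])
    show "infsum w12 UNIV = 1 + w'" unfolding e w'_def using infsum_add[OF d(1) d2] d(2) by simp
  qed
  note nUY = sum_le_norm[OF UY_small order_refl]
  define z1 z2 where "z1 = (\<Sum>\<^sub>\<infinity>k. U True k * Y True k)" and "z2 = (\<Sum>\<^sub>\<infinity>k. U False k * Y False k)"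
  have z: "cmod z1 \<le> 2 * R\<^sup>2 * \<kappa> * K / ?n" "cmod z2 \<le> 2 * R\<^sup>2 * \<kappa> * K / ?n"
    unfolding z1_def z2_def by (rule nUY(3))+
  have "f = (\<lambda>k. (p1 - p2) * w12 k + (q1 * 2) * (U False k * Y False k) - (q2 * 2) * (U True k * Y True k))"
    using f_eq by (auto simp: mult_ac)
  then have "infsum f UNIV = (\<Sum>\<^sub>\<infinity>k. (p1 - p2) * w12 k + (q1 * 2) * (U False k * Y False k) - (q2 * 2) * (U True k * Y True k))"
    by simp
  also have "\<dots> = (p1 - p2) * (1 + w') + (q1 * 2) * z2 - (q2 * 2) * z1"
  proof -
    have sA: "(\<lambda>k. (p1 - p2) * w12 k) summable_on UNIV" by (rule summable_on_cmult_right[OF w12_sum(1)])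
    have sB: "(\<lambda>k. (q1 * 2) * (U False k * Y False k)) summable_on UNIV" by (rule summable_on_cmult_right[OF nUY(2)])
    have sC: "(\<lambda>k. (q2 * 2) * (U True k * Y True k)) summable_on UNIV" by (rule summable_on_cmult_right[OF nUY(2)])
    show ?thesis
      unfolding infsum_diff[OF summable_on_add[OF sA sB] sC] infsum_add[OF sA sB] infsum_cmult_right' w12_sum(2) z1_def z2_def ..
  qed
  finally have "(p1 - p2) * (1 + w') = (q2 * 2) * z1 - (q1 * 2) * z2" using f0 by (simp add: algebra_simps)
  then have "cmod (p1 - p2) * cmod (1 + w') = cmod ((q2 * 2) * z1 - (q1 * 2) * z2)" by (metis norm_mult)
  also have "\<dots> \<le> cmod q2 * 2 * cmod z1 + cmod q1 * 2 * cmod z2"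
    by (rule order_trans[OF norm_triangle_ineq4]) (simp add: norm_mult)
  also have "\<dots> \<le> cmod q2 * 2 * (2 * R\<^sup>2 * \<kappa> * K / ?n) + cmod q1 * 2 * (2 * R\<^sup>2 * \<kappa> * K / ?n)"
    by (intro add_mono mult_left_mono z) auto
  also have "\<dots> = (4 * R\<^sup>2 * \<kappa> * K / ?n) * (cmod q1 + cmod q2)" by (simp add: algebra_simps add_divide_distrib)
  finally have A: "cmod (p1 - p2) * cmod (1 + w') \<le> (4 * R\<^sup>2 * \<kappa> * K / ?n) * (cmod q1 + cmod q2)" .
  have "1 / 2 \<le> cmod (1 + w')"
    using norm_triangle_ineq2[of 1 "- w'"] w'_half by simp
  then have "cmod (p1 - p2) * (1 / 2) \<le> cmod (p1 - p2) * cmod (1 + w')" by (intro mult_left_mono) auto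
  with A have "cmod (p1 - p2) \<le> 2 * ((4 * R\<^sup>2 * \<kappa> * K / ?n) * (cmod q1 + cmod q2))" by linarith
  then show ?thesis by (simp add: C3_def p1_def p2_def q1_def q2_def mult_ac)
qed

end

end

section \<open>Fourier coefficients determine an integrable function\<close>

definition wave :: "real \<Rightarrow> int \<Rightarrow> real \<Rightarrow> complex" where
  "wave T m x = exp (\<i> * complex_of_real (2 * pi * real_of_int m * x / T))"

lemma norm_wave [simp]: "cmod (wave T m x) = 1"
  by (simp add: wave_def)

lemma wave_0 [simp]: "wave T 0 x = 1" "wave T m 0 = 1"
  by (simp_all add: wave_def)

lemma wave_add: "wave T (m + k) x = wave T m x * wave T k x"
  by (simp add: wave_def exp_add[symmetric] algebra_simps add_divide_distrib)

lemma wave_cnj: "cnj (wave T m x) = wave T (- m) x"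
  by (simp add: wave_def exp_cnj)

lemma continuous_on_wave [continuous_intros]: "continuous_on A (wave T m)"
  unfolding wave_def divide_inverse by (intro continuous_intros)

lemma wave_T: "T \<noteq> 0 \<Longrightarrow> wave T m T = 1"
proof -
  assume "T \<noteq> 0"
  then have "wave T m T = exp (\<i> * complex_of_real (2 * pi * real_of_int m))" by (simp add: wave_def)
  also have "\<dots> = 1" using exp_integer_2pi[of "of_int m"] by (simp add: mult_ac)
  finally show ?thesis .
qed

lemma wave_derivative:
  assumes "T \<noteq> 0"
  shows "(wave T m has_vector_derivative (\<i> * complex_of_real (2 * pi * real_of_int m / T)) * wave T m x) (at x within A)"
proof -
  have "((\<lambda>x. \<i> * complex_of_real (2 * pi * real_of_int m * x / T)) has_vector_derivative \<i> * complex_of_real (2 * pi * real_of_int m / T)) (at x within A)"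
    by (auto intro!: derivative_eq_intros simp: has_real_derivative_iff_has_vector_derivative[symmetric])
  from field_vector_diff_chain_within[OF this, of exp "exp (\<i> * complex_of_real (2 * pi * real_of_int m * x / T))"]
  show ?thesis unfolding wave_def o_def
    by (auto simp: mult.commute intro!: has_field_derivative_at_within DERIV_exp)
qed

text \<open>A function on \<open>[0, T]\<close> with equal values at the end points factors through the circle. Continuity at the
seam comes from the correspondence between homotopies of loops and homotopies of maps of the circle, applied to the
constant homotopy.\<close>

lemma continuous_circle_function:
  fixes H :: "real \<Rightarrow> complex"
  assumes T: "0 < T" and H: "continuous_on {0..T} H" "H 0 = H T"
  obtains f where "continuous_on (sphere 0 1) f" "\<And>x. x \<in> {0..T} \<Longrightarrow> f (wave T 1 x) = H x"
proof -
  define p where "p t = H (T * t)" for t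
  have "path p" unfolding path_def p_def
    by (rule continuous_on_compose2[OF H(1)]) (use T in \<open>auto intro!: continuous_intros simp: mult_left_le\<close>)
  moreover have "pathfinish p = pathstart p" using H(2) by (simp add: p_def pathfinish_def pathstart_def)
  ultimately have "homotopic_loops UNIV p p" by (simp add: homotopic_loops_refl)
  then have c: "continuous_on (sphere 0 1) (p \<circ> (\<lambda>z. Arg2pi z / (2 * pi)))"
    using homotopic_loops_imp_homotopic_circlemaps homotopic_with_imp_continuous by blast
  have "(p \<circ> (\<lambda>z. Arg2pi z / (2 * pi))) (wave T 1 x) = H x" if x: "x \<in> {0..T}" for x
  proof (cases "x = T")
    case True
    have "wave T 1 T = 1" using wave_T T by simp
    then show ?thesis using True H(2) by (simp add: p_def Arg2pi_of_real[of 1, simplified])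
  next
    case False
    have "Arg2pi (wave T 1 x) = 2 * pi * x / T"
      unfolding wave_def using x T False by (subst Arg2pi_exp) (auto simp: field_simps)
    then show ?thesis using T by (simp add: p_def)
  qed
  with c show thesis by (rule that)
qed

text \<open>The functions \<open>\<psi>\<close> for which \<open>H \<psi>\<close> has vanishing Fourier coefficients form a module over the
trigonometric polynomials, so they contain all real polynomials in \<open>wave T 1\<close>. By the Stone-Weierstrass theorem
on the circle \<open>H\<close> is a uniform limit of complex polynomials of this kind, and so \<open>\<integral> \<bar>H\<bar>\<^sup>2 = 0\<close>.\<close>

lemma continuous_uniqueness:
  fixes H :: "real \<Rightarrow> complex"
  assumes T: "0 < T" and H: "continuous_on {0..T} H" "H 0 = H T"
    and z: "\<And>m. integral {0..T} (\<lambda>x. H x * wave T m x) = 0"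
    and x: "x \<in> {0..T}"
  shows "H x = 0"
proof -
  \<comment> \<open>functions all of whose products with \<open>H\<close> have vanishing Fourier coefficients\<close>
  define Z where "Z \<psi> \<longleftrightarrow> continuous_on {0..T} \<psi> \<and> (\<forall>m. integral {0..T} (\<lambda>x. H x * \<psi> x * wave T m x) = 0)"
    for \<psi> :: "real \<Rightarrow> complex"
  let ?e = "wave T 1"
  have int: "continuous_on {0..T} \<psi> \<Longrightarrow> (\<lambda>x. H x * \<psi> x * wave T m x) integrable_on {0..T}" for \<psi> m
    by (intro integrable_continuous_interval continuous_intros H)
  have Zadd: "Z (\<lambda>x. \<psi> x + \<psi>' x)" if "Z \<psi>" "Z \<psi>'" for \<psi> \<psi>'
  proof -
    have "integral {0..T} (\<lambda>x. H x * (\<psi> x + \<psi>' x) * wave T m x) =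
       integral {0..T} (\<lambda>x. H x * \<psi> x * wave T m x + H x * \<psi>' x * wave T m x)" for m
      by (simp add: algebra_simps)
    also have "\<dots> m = 0" for m
      using that int by (subst Henstock_Kurzweil_Integration.integral_add) (auto simp: Z_def)
    finally show ?thesis using that by (auto simp: Z_def intro!: continuous_intros)
  qed
  have Zc: "Z (\<lambda>x. a * \<psi> x)" if "Z \<psi>" for \<psi> a
  proof -
    have "integral {0..T} (\<lambda>x. H x * (a * \<psi> x) * wave T m x) = a * integral {0..T} (\<lambda>x. H x * \<psi> x * wave T m x)" for m
      by (subst Henstock_Kurzweil_Integration.integral_mult_right[symmetric]) (simp add: mult_ac)
    then show ?thesis using that by (auto simp: Z_def intro!: continuous_intros)
  qed
  have Zw: "Z (\<lambda>x. wave T k x * \<psi> x)" if "Z \<psi>" for \<psi> k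
  proof -
    have "(\<lambda>x. H x * (wave T k x * \<psi> x) * wave T m x) = (\<lambda>x. H x * \<psi> x * wave T (k + m) x)" for m
      by (simp add: wave_add mult_ac)
    then show ?thesis using that by (auto simp: Z_def intro!: continuous_intros)
  qed
  have lin: "Z (\<lambda>x. complex_of_real (q (?e x)) * \<psi> x)" if "Z \<psi>" "bounded_linear q" for \<psi> and q :: "complex \<Rightarrow> real"
  proof -
    have q: "q z = Re z * q 1 + Im z * q \<i>" for z
    proof -
      have "z = Re z *\<^sub>R 1 + Im z *\<^sub>R \<i>" by (simp add: complex_eq_iff)
      then have "q z = q (Re z *\<^sub>R 1 + Im z *\<^sub>R \<i>)" by simp
      also have "\<dots> = Re z * q 1 + Im z * q \<i>"
        using that(2) by (simp only: linear_add[OF bounded_linear.linear] linear_scale[OF bounded_linear.linear] real_scaleR_def)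
      finally show ?thesis .
    qed
    define a b where "a = complex_of_real (q 1)" and "b = complex_of_real (q \<i>)"
    have e: "complex_of_real (q w) = (a - \<i> * b) / 2 * w + (a + \<i> * b) / 2 * cnj w" for w
      unfolding q[of w] a_def b_def by (simp add: complex_eq_iff field_simps)
    have "(\<lambda>x. complex_of_real (q (?e x)) * \<psi> x) = (\<lambda>x. (a - \<i> * b) / 2 * (wave T 1 x * \<psi> x) + (a + \<i> * b) / 2 * (wave T (- 1) x * \<psi> x))"
      unfolding e wave_cnj by (simp add: algebra_simps)
    then show ?thesis by (simp only:) (intro Zadd Zc Zw that(1))
  qed
  have poly: "Z \<psi> \<Longrightarrow> Z (\<lambda>x. complex_of_real (q (?e x)) * \<psi> x)" if "real_polynomial_function q" for q and \<psi>
    using that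
  proof (induction q arbitrary: \<psi>)
    case (linear f) then show ?case using lin by blast
  next
    case (const a) then show ?case using Zc[of \<psi> "complex_of_real a"] by simp
  next
    case (add f g)
    from Zadd[OF add.IH(1)[OF add.prems] add.IH(2)[OF add.prems]] show ?case by (simp add: algebra_simps)
  next
    case (mult f g)
    from mult.IH(1)[OF mult.IH(2)[OF mult.prems]] show ?case by (simp add: algebra_simps)
  qed
  have Z1: "Z (\<lambda>x. 1)" using z by (auto simp: Z_def)
  obtain f where f: "continuous_on (sphere 0 1) f" and fH: "\<And>x. x \<in> {0..T} \<Longrightarrow> f (?e x) = H x"
    using continuous_circle_function[OF T H] by metis
  define B where "B = integral {0..T} (\<lambda>x. cmod (H x))"
  have cn: "continuous_on {0..T} (\<lambda>x. cmod (H x))" by (intro continuous_intros H)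
  have B0: "0 \<le> B" unfolding B_def by (rule integral_nonneg[OF integrable_continuous_interval[OF cn]]) auto
  have HH: "continuous_on {0..T} (\<lambda>x. (cmod (H x))\<^sup>2)" by (intro continuous_intros H)
  have "integral {0..T} (\<lambda>x. (cmod (H x))\<^sup>2) \<le> e * B" if e: "e > 0" for e
  proof -
    obtain g where g: "polynomial_function g" and fg: "\<And>w. w \<in> sphere 0 1 \<Longrightarrow> norm (f w - g w) < e"
      using Stone_Weierstrass_polynomial_function[OF compact_sphere f e] by blast
    have gR: "real_polynomial_function (Re \<circ> g)" "real_polynomial_function (Im \<circ> g)"
      using g bounded_linear_Re bounded_linear_Im by (auto simp: polynomial_function_def)
    have "Z (\<lambda>x. complex_of_real ((Re \<circ> g) (?e x)) * 1 + (- \<i>) * (complex_of_real ((Im \<circ> g) (?e x)) * 1))"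
      by (intro Zadd Zc poly gR Z1)
    moreover have "complex_of_real ((Re \<circ> g) w) * 1 + (- \<i>) * (complex_of_real ((Im \<circ> g) w) * 1) = cnj (g w)" for w
      by (simp add: complex_eq_iff)
    ultimately have Zg: "Z (\<lambda>x. cnj (g (?e x)))" by simp
    then have g0: "integral {0..T} (\<lambda>x. H x * cnj (g (?e x))) = 0" and cg: "continuous_on {0..T} (\<lambda>x. cnj (g (?e x)))"
      using spec[of "\<lambda>m. integral {0..T} (\<lambda>x. H x * cnj (g (?e x)) * wave T m x) = 0" 0] by (auto simp: Z_def)
    have c1: "continuous_on {0..T} (\<lambda>x. H x * cnj (H x))" and c2: "continuous_on {0..T} (\<lambda>x. H x * cnj (g (?e x)))"
      by (intro continuous_intros H cg)+
    have "complex_of_real (integral {0..T} (\<lambda>x. (cmod (H x))\<^sup>2)) = integral {0..T} (\<lambda>x. H x * cnj (H x))"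
      using integral_linear[OF integrable_continuous_interval[OF HH] bounded_linear_of_real[where 'a = complex]]
      by (simp add: o_def complex_norm_square[symmetric])
    also have "\<dots> = integral {0..T} (\<lambda>x. H x * cnj (H x)) - integral {0..T} (\<lambda>x. H x * cnj (g (?e x)))" by (simp add: g0)
    also have "\<dots> = integral {0..T} (\<lambda>x. H x * cnj (H x) - H x * cnj (g (?e x)))"
      by (rule Henstock_Kurzweil_Integration.integral_diff[symmetric]; rule integrable_continuous_interval; rule c1 c2)
    finally have "complex_of_real (integral {0..T} (\<lambda>x. (cmod (H x))\<^sup>2)) = integral {0..T} (\<lambda>x. H x * cnj (H x) - H x * cnj (g (?e x)))" .
    then have "\<bar>integral {0..T} (\<lambda>x. (cmod (H x))\<^sup>2)\<bar> = norm (integral {0..T} (\<lambda>x. H x * cnj (H x) - H x * cnj (g (?e x))))"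
      by (metis norm_of_real real_norm_def)
    also have "\<dots> \<le> integral {0..T} (\<lambda>x. e * cmod (H x))"
    proof (rule integral_norm_bound_integral)
      show "(\<lambda>x. H x * cnj (H x) - H x * cnj (g (?e x))) integrable_on {0..T}"
        by (intro integrable_continuous_interval continuous_on_diff c1 c2)
      show "(\<lambda>x. e * cmod (H x)) integrable_on {0..T}"
        by (intro integrable_continuous_interval continuous_intros H)
      fix y assume y: "y \<in> {0..T}"
      have "H y * cnj (H y) - H y * cnj (g (?e y)) = H y * cnj (f (?e y) - g (?e y))"
        using fH[OF y] by (simp add: algebra_simps)
      then have "norm (H y * cnj (H y) - H y * cnj (g (?e y))) = cmod (H y) * cmod (f (?e y) - g (?e y))"
        by (simp only: norm_mult complex_mod_cnj)
      also have "\<dots> \<le> cmod (H y) * e"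
        using fg[of "?e y"] by (intro mult_left_mono) (auto simp: less_imp_le)
      finally show "norm (H y * cnj (H y) - H y * cnj (g (?e y))) \<le> e * cmod (H y)" by (simp add: mult.commute)
    qed
    also have "\<dots> = e * B" by (simp add: B_def)
    finally show ?thesis by linarith
  qed
  note le = this
  have "integral {0..T} (\<lambda>x. (cmod (H x))\<^sup>2) \<le> 0"
  proof (rule field_le_epsilon)
    fix e :: real assume "e > 0"
    then have "integral {0..T} (\<lambda>x. (cmod (H x))\<^sup>2) \<le> e / (B + 1) * B" using B0 by (intro le) auto
    also have "\<dots> \<le> e" using \<open>e > 0\<close> B0 by (simp add: field_simps)
    finally show "integral {0..T} (\<lambda>x. (cmod (H x))\<^sup>2) \<le> 0 + e" by simp
  qed
  moreover have "0 \<le> integral {0..T} (\<lambda>x. (cmod (H x))\<^sup>2)"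
    by (rule integral_nonneg[OF integrable_continuous_interval[OF HH]]) auto
  ultimately have "integral {0..T} (\<lambda>x. (cmod (H x))\<^sup>2) = 0" by linarith
  then have "(cmod (H x))\<^sup>2 = 0" using integral_eq_0_iff[OF HH T] x by auto
  then show ?thesis by simp
qed

lemma continuous_bounded_interval:
  fixes E :: "real \<Rightarrow> complex"
  assumes "continuous_on {a..b} E"
  obtains D where "0 \<le> D" "\<And>x. x \<in> {a..b} \<Longrightarrow> cmod (E x) \<le> D"
proof -
  obtain D where D: "\<forall>x\<in>E ` {a..b}. norm x \<le> D"
    using compact_imp_bounded[OF compact_continuous_image[OF assms compact_Icc]] unfolding bounded_iff by blast
  show thesis by (rule that[of "max D 0"]) (use D in \<open>auto simp: le_max_iff_disj\<close>)
qed

lemma integral_lebesgue_on_sub: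
  fixes f :: "real \<Rightarrow> complex"
  assumes "0 \<le> x" "x \<le> T"
  shows "(\<integral>t. f t \<partial>lebesgue_on {0..x}) = (\<integral>t. (if t \<le> x then f t else 0) \<partial>lebesgue_on {0..T})"
proof -
  have "(\<integral>t. f t \<partial>lebesgue_on {0..x}) = (\<integral>t. indicator {0..x} t *\<^sub>R f t \<partial>lebesgue)"
    by (rule integral_restrict_space) auto
  also have "\<dots> = (\<integral>t. indicator {0..T} t *\<^sub>R (if t \<le> x then f t else 0) \<partial>lebesgue)"
    using assms by (intro Bochner_Integration.integral_cong) (auto simp: indicator_def)
  also have "\<dots> = (\<integral>t. (if t \<le> x then f t else 0) \<partial>lebesgue_on {0..T})"
    by (rule integral_restrict_space[symmetric]) auto
  finally show ?thesis .
qed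

lemma integral_lebesgue_on_tail:
  fixes f :: "real \<Rightarrow> complex"
  assumes "0 \<le> x" "x \<le> T"
  shows "(\<integral>t. f t \<partial>lebesgue_on {x..T}) = (\<integral>t. (if x \<le> t then f t else 0) \<partial>lebesgue_on {0..T})"
proof -
  have "(\<integral>t. f t \<partial>lebesgue_on {x..T}) = (\<integral>t. indicator {x..T} t *\<^sub>R f t \<partial>lebesgue)"
    by (rule integral_restrict_space) auto
  also have "\<dots> = (\<integral>t. indicator {0..T} t *\<^sub>R (if x \<le> t then f t else 0) \<partial>lebesgue)"
    using assms by (intro Bochner_Integration.integral_cong) (auto simp: indicator_def)
  also have "\<dots> = (\<integral>t. (if x \<le> t then f t else 0) \<partial>lebesgue_on {0..T})"
    by (rule integral_restrict_space[symmetric]) auto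
  finally show ?thesis .
qed

lemma continuous_integrable_on_interval:
  fixes f :: "real \<Rightarrow> complex"
  shows "continuous_on {a..b} f \<Longrightarrow> integrable (lebesgue_on {a..b}) f"
  by (rule continuous_imp_integrable_real)

lemma FTC_lebesgue:
  fixes E :: "real \<Rightarrow> complex"
  assumes "x \<le> T" "\<And>y. y \<in> {x..T} \<Longrightarrow> (E has_vector_derivative e y) (at y within {x..T})" "continuous_on {x..T} e"
  shows "(\<integral>t. e t \<partial>lebesgue_on {x..T}) = E T - E x"
proof -
  have "(\<integral>t. e t \<partial>lebesgue_on {x..T}) = integral {x..T} e"
    by (rule lebesgue_integral_eq_integral[OF continuous_imp_integrable_real[OF assms(3)]]) simp
  also have "\<dots> = E T - E x"
    by (rule integral_unique[OF fundamental_theorem_of_calculus[OF assms(1,2)]])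
  finally show ?thesis .
qed

lemma integrable_times_continuous:
  fixes f E :: "real \<Rightarrow> complex"
  assumes f: "integrable (lebesgue_on {a..b}) f" and Ec: "continuous_on {a..b} E"
  shows "integrable (lebesgue_on {a..b}) (\<lambda>t. f t * E t)"
proof -
  let ?M = "lebesgue_on {a..b}"
  obtain D where D0: "0 \<le> D" and D: "\<And>x. x \<in> {a..b} \<Longrightarrow> cmod (E x) \<le> D"
    using continuous_bounded_interval[OF Ec] by metis
  have Em: "E \<in> borel_measurable ?M" using continuous_integrable_on_interval[OF Ec] by auto
  show ?thesis
  proof (rule Bochner_Integration.integrable_bound[OF integrable_mult_right[OF integrable_norm[OF f], of D]])
    show "(\<lambda>t. f t * E t) \<in> borel_measurable ?M" using f Em by measurable
    show "AE t in ?M. norm (f t * E t) \<le> norm (D * norm (f t))"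
      using D D0 by (intro AE_I2) (auto simp: norm_mult mult.commute intro!: mult_right_mono)
  qed
qed

text \<open>Integration by parts when one factor is the primitive of a merely integrable function: exchange the
order of integration over the triangle.\<close>

lemma integral_primitive_by_parts:
  fixes f :: "real \<Rightarrow> complex"
  assumes T: "0 \<le> T" and f: "integrable (lebesgue_on {0..T}) f"
    and E: "\<And>y A. (E has_vector_derivative e y) (at y within A)" and e: "continuous_on {0..T} e"
  shows "(\<integral>x. (\<integral>t. f t \<partial>lebesgue_on {0..x}) * e x \<partial>lebesgue_on {0..T})
       = (\<integral>t. f t \<partial>lebesgue_on {0..T}) * E T - (\<integral>t. f t * E t \<partial>lebesgue_on {0..T})"
proof -
  let ?M = "lebesgue_on {0..T}"
  interpret fin: finite_measure ?M by (rule finite_measure_lebesgue_on) simp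
  interpret pair_sigma_finite ?M ?M ..
  obtain C where C0: "0 \<le> C" and C: "\<And>x. x \<in> {0..T} \<Longrightarrow> cmod (e x) \<le> C"
    using continuous_bounded_interval[OF e] by metis
  have fm[measurable]: "f \<in> borel_measurable ?M" using f by auto
  have em[measurable]: "e \<in> borel_measurable ?M" using continuous_integrable_on_interval[OF e] by auto
  have idm[measurable]: "(\<lambda>x. x) \<in> borel_measurable ?M"
    using continuous_imp_integrable_real[OF continuous_on_id, of 0 T] by (rule borel_measurable_integrable)
  define k where "k x t = (if t \<le> x then f t * e x else 0)" for x t
  have f1: "(\<lambda>z. fst z) \<in> borel_measurable (?M \<Otimes>\<^sub>M ?M)" and f2: "(\<lambda>z. snd z) \<in> borel_measurable (?M \<Otimes>\<^sub>M ?M)"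
    using measurable_compose[OF measurable_fst idm] measurable_compose[OF measurable_snd idm] by simp_all
  have km[measurable]: "case_prod k \<in> borel_measurable (?M \<Otimes>\<^sub>M ?M)"
  proof -
    have "(\<lambda>z. if snd z \<le> fst z then f (snd z) * e (fst z) else 0) \<in> borel_measurable (?M \<Otimes>\<^sub>M ?M)"
      using f1 f2 by measurable
    then show ?thesis by (simp add: k_def split_def)
  qed
  have kx: "integrable ?M (k x)" if "x \<in> {0..T}" for x
  proof (rule Bochner_Integration.integrable_bound[OF integrable_norm[OF integrable_mult_left[OF f, of "e x"]]])
    show "k x \<in> borel_measurable ?M" unfolding k_def by measurable
    show "AE t in ?M. norm (k x t) \<le> norm (norm (f t * e x))" by (auto simp: k_def)
  qed
  have kn: "(\<integral>t. norm (k x t) \<partial>?M) \<le> C * (\<integral>t. norm (f t) \<partial>?M)" if x: "x \<in> {0..T}" for x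
  proof -
    have "(\<integral>t. norm (k x t) \<partial>?M) \<le> (\<integral>t. C * norm (f t) \<partial>?M)"
    proof (rule integral_mono[OF integrable_norm[OF kx[OF x]]])
      show "integrable ?M (\<lambda>t. C * norm (f t))" using f by (intro integrable_mult_right integrable_norm) auto
      show "norm (k x t) \<le> C * norm (f t)" for t
        using C[OF x] C0 mult_right_mono[OF C[OF x], of "norm (f t)"] by (auto simp: k_def norm_mult mult.commute)
    qed
    then show ?thesis by simp
  qed
  have int: "integrable (?M \<Otimes>\<^sub>M ?M) (case_prod k)"
  proof (rule Fubini_integrable[OF km])
    show "integrable ?M (\<lambda>x. \<integral>y. norm (case (x, y) of (x, y) \<Rightarrow> k x y) \<partial>?M)"
    proof (rule fin.integrable_const_bound[of _ "C * (\<integral>t. norm (f t) \<partial>?M)"])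
      show "AE x in ?M. norm (\<integral>y. norm (case (x, y) of (x, y) \<Rightarrow> k x y) \<partial>?M) \<le> C * (\<integral>t. norm (f t) \<partial>?M)"
        using kn by (intro AE_I2) (auto simp: integral_nonneg_AE)
      show "(\<lambda>x. \<integral>y. norm (case (x, y) of (x, y) \<Rightarrow> k x y) \<partial>?M) \<in> borel_measurable ?M"
        using km by measurable
    qed
    show "AE x in ?M. integrable ?M (\<lambda>y. case (x, y) of (x, y) \<Rightarrow> k x y)"
      using kx by (intro AE_I2) auto
  qed
  have "(\<integral>x. (\<integral>t. f t \<partial>lebesgue_on {0..x}) * e x \<partial>?M) = (\<integral>x. (\<integral>t. k x t \<partial>?M) \<partial>?M)"
  proof (rule Bochner_Integration.integral_cong[OF refl])
    fix x assume "x \<in> space ?M"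
    then have x: "0 \<le> x" "x \<le> T" by auto
    have "(\<integral>t. k x t \<partial>?M) = (\<integral>t. (if t \<le> x then f t else 0) * e x \<partial>?M)"
      by (intro Bochner_Integration.integral_cong) (auto simp: k_def)
    also have "\<dots> = (\<integral>t. (if t \<le> x then f t else 0) \<partial>?M) * e x" by simp
    finally show "(\<integral>t. f t \<partial>lebesgue_on {0..x}) * e x = (\<integral>t. k x t \<partial>?M)"
      using integral_lebesgue_on_sub[OF x, of f] by simp
  qed
  also have "\<dots> = (\<integral>t. (\<integral>x. k x t \<partial>?M) \<partial>?M)" by (rule Fubini_integral[OF int, symmetric])
  also have "\<dots> = (\<integral>t. f t * E T - f t * E t \<partial>?M)"
  proof (rule Bochner_Integration.integral_cong[OF refl])
    fix t assume "t \<in> space ?M"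
    then have t: "0 \<le> t" "t \<le> T" by auto
    have "(\<integral>x. k x t \<partial>?M) = (\<integral>x. f t * (if t \<le> x then e x else 0) \<partial>?M)"
      by (intro Bochner_Integration.integral_cong) (auto simp: k_def)
    also have "\<dots> = f t * (\<integral>x. e x \<partial>lebesgue_on {t..T})"
      using integral_lebesgue_on_tail[OF t, of e] by simp
    also have "(\<integral>x. e x \<partial>lebesgue_on {t..T}) = E T - E t"
      using t e by (intro FTC_lebesgue E) (auto intro: continuous_on_subset)
    finally show "(\<integral>x. k x t \<partial>?M) = f t * E T - f t * E t" by (simp add: algebra_simps)
  qed
  also have "\<dots> = (\<integral>t. f t * E T \<partial>?M) - (\<integral>t. f t * E t \<partial>?M)"
  proof (rule Bochner_Integration.integral_diff)
    show "integrable ?M (\<lambda>t. f t * E T)" using f by simp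
    have Ec: "continuous_on {0..T} E"
      using E by (meson continuous_on_vector_derivative)
    then show "integrable ?M (\<lambda>t. f t * E t)" by (rule integrable_times_continuous[OF f])
  qed
  finally show ?thesis by simp
qed

lemma wave_integral:
  assumes "0 < T"
  shows "(\<integral>x. wave T m x \<partial>lebesgue_on {0..T}) = (if m = 0 then of_real T else 0)"
proof (cases "m = 0")
  case True
  have "(\<integral>x. wave T m x \<partial>lebesgue_on {0..T}) = (\<integral>x. 1 \<partial>lebesgue_on {0..T})" by (simp add: True)
  also have "\<dots> = of_real T"
    using assms by (simp add: measure_restrict_space scaleR_conv_of_real)
  finally show ?thesis using True by simp
next
  case False
  let ?c = "\<i> * complex_of_real (2 * pi * real_of_int m / T)"
  have c: "?c \<noteq> 0" using False assms by simp
  have "(\<integral>x. wave T m x \<partial>lebesgue_on {0..T}) = wave T m T / ?c - wave T m 0 / ?c"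
  proof (rule FTC_lebesgue)
    show "((\<lambda>x. wave T m x / ?c) has_vector_derivative wave T m y) (at y within {0..T})" for y
      using has_vector_derivative_divide[OF wave_derivative[of T m y "{0..T}"], of ?c] assms c by simp
  qed (use assms in \<open>auto intro: continuous_on_wave\<close>)
  then show ?thesis using wave_T[of T m] assms False by simp
qed

text \<open>By parts, the primitive of \<open>g\<close> has vanishing Fourier coefficients except for the constant one. It is
continuous, hence constant, and it vanishes at \<open>0\<close>.\<close>

theorem Fourier_uniqueness:
  fixes g :: "real \<Rightarrow> complex"
  assumes T: "0 < T" and g: "integrable (lebesgue_on {0..T}) g"
    and z: "\<And>m. (\<integral>x. g x * wave T m x \<partial>lebesgue_on {0..T}) = 0"
  shows "AE x in lebesgue_on {0..T}. g x = 0"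
proof -
  let ?M = "lebesgue_on {0..T}"
  define G where "G x = (\<integral>t. g t \<partial>lebesgue_on {0..x})" for x
  have gi: "g integrable_on {0..T}" by (rule integrable_on_lebesgue_on[OF g]) simp
  have G_HK: "G x = integral {0..x} g" if "x \<in> {0..T}" for x
  proof -
    have "integrable (lebesgue_on {0..x}) g"
      using Equivalence_Lebesgue_Henstock_Integration.integrable_subinterval[OF g, of 0 x] that by auto
    then show ?thesis unfolding G_def by (intro lebesgue_integral_eq_integral) simp_all
  qed
  have Gc: "continuous_on {0..T} G"
    using indefinite_integral_continuous_1[OF gi] by (subst continuous_on_cong[OF refl G_HK]) auto
  have g0: "(\<integral>x. g x \<partial>?M) = 0" using z[of 0] by simp
  have G0: "G 0 = 0" using G_HK[of 0] T by simp
  have GT: "G T = 0" using g0 by (simp add: G_def)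
  have Gm: "(\<integral>x. G x * wave T m x \<partial>?M) = 0" if m: "m \<noteq> 0" for m
  proof -
    let ?c = "\<i> * complex_of_real (2 * pi * real_of_int m / T)"
    have c: "?c \<noteq> 0" using m T by simp
    have "((\<lambda>x. wave T m x / ?c) has_vector_derivative wave T m y) (at y within A)" for y A
      using has_vector_derivative_divide[OF wave_derivative[of T m y A], of ?c] T c by simp
    from integral_primitive_by_parts[OF _ g this continuous_on_wave] T
    have "(\<integral>x. G x * wave T m x \<partial>?M) = (\<integral>t. g t \<partial>?M) * (wave T m T / ?c) - (\<integral>t. g t * (wave T m t / ?c) \<partial>?M)"
      by (simp add: G_def)
    also have "(\<integral>t. g t * (wave T m t / ?c) \<partial>?M) = (\<integral>t. (g t * wave T m t) / ?c \<partial>?M)" by (simp only: times_divide_eq_right)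
    also have "\<dots> = (\<integral>t. g t * wave T m t \<partial>?M) / ?c" by (rule integral_divide_zero)
    finally show ?thesis using g0 z[of m] by simp
  qed
  define a where "a = (\<integral>x. G x \<partial>?M) / of_real T"
  have Gi: "integrable ?M (\<lambda>x. G x * wave T m x)" for m
    by (rule integrable_times_continuous[OF continuous_integrable_on_interval[OF Gc] continuous_on_wave])
  have wi: "integrable ?M (\<lambda>x. a * wave T m x)" for m
    by (intro integrable_mult_right continuous_integrable_on_interval continuous_on_wave)
  have "G x - a = 0" if "x \<in> {0..T}" for x
  proof (rule continuous_uniqueness[OF T _ _ _ that])
    show c: "continuous_on {0..T} (\<lambda>x. G x - a)" by (intro continuous_intros Gc)
    show "G 0 - a = G T - a" by (simp add: G0 GT)
    fix m
    have "integral {0..T} (\<lambda>x. (G x - a) * wave T m x) = (\<integral>x. (G x - a) * wave T m x \<partial>?M)"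
      by (rule lebesgue_integral_eq_integral[symmetric]) (auto intro!: continuous_imp_integrable_real continuous_intros Gc)
    also have "\<dots> = (\<integral>x. G x * wave T m x \<partial>?M) - (\<integral>x. a * wave T m x \<partial>?M)"
      unfolding left_diff_distrib by (rule Bochner_Integration.integral_diff[OF Gi wi])
    also have "\<dots> = 0"
    proof -
      have "(\<integral>x. a * wave T m x \<partial>?M) = a * (if m = 0 then of_real T else 0)"
        unfolding integral_mult_right_zero wave_integral[OF T] ..
      moreover have "(\<integral>x. G x * wave T 0 x \<partial>?M) = a * of_real T" using T by (simp add: a_def)
      ultimately show ?thesis using Gm[of m] by (cases "m = 0") simp_all
    qed
    finally show "integral {0..T} (\<lambda>x. (G x - a) * wave T m x) = 0" .
  qed
  then have Gz: "G x = 0" if "x \<in> {0..T}" for x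
    using that G0 T by (metis atLeastAtMost_iff eq_iff_diff_eq_0 less_eq_real_def)
  \<comment> \<open>an integrable function with vanishing primitive vanishes almost everywhere\<close>
  define f where "f x = (if x \<in> {0..T} then g x else 0)" for x
  have fint: "f integrable_on cbox a b \<and> integral (cbox a b) f = 0" for a b
  proof -
    let ?a = "max a 0" and ?b = "min b T"
    have "(f has_integral 0) (cbox a b)"
    proof (cases "?a \<le> ?b")
      case True
      have gab: "(g has_integral (integral {0..?b} g - integral {0..?a} g)) {?a..?b}"
      proof -
        have "g integrable_on {0..?b}" by (rule integrable_subinterval_real[OF gi]) auto
        moreover have "0 \<le> ?a" by simp
        ultimately have "integral {0..?a} g + integral {?a..?b} g = integral {0..?b} g"
          using True by (intro Henstock_Kurzweil_Integration.integral_combine) auto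
        moreover have "g integrable_on {?a..?b}" by (rule integrable_subinterval_real[OF gi]) auto
        ultimately show ?thesis by (metis add_diff_cancel_left' has_integral_integral)
      qed
      have "?a \<in> {0..T}" "?b \<in> {0..T}" using True T by auto
      then have "(g has_integral 0) {?a..?b}" using gab G_HK Gz by fastforce
      moreover have "{?a..?b} = {0..T} \<inter> {a..b}" by auto
      ultimately have "(g has_integral 0) ({0..T} \<inter> {a..b})" by (simp only:)
      then have "((\<lambda>x. if x \<in> {0..T} \<inter> {a..b} then g x else 0) has_integral 0) UNIV"
        by (rule has_integral_restrict_UNIV[THEN iffD2])
      then have "((\<lambda>x. if x \<in> {a..b} then f x else 0) has_integral 0) UNIV"
        by (rule has_integral_eq[rotated]) (auto simp: f_def)
      then show ?thesis by (simp only: has_integral_restrict_UNIV box_real)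
    next
      case False
      have "((\<lambda>x. 0) has_integral 0) (cbox a b)" by simp
      then show ?thesis
        by (rule has_integral_eq[rotated]) (use False in \<open>auto simp: f_def\<close>)
    qed
    then show ?thesis by (auto simp: integral_unique)
  qed
  obtain N where N: "negligible N" and Ne: "\<And>x e. x \<notin> N \<Longrightarrow> 0 < e \<Longrightarrow>
       \<exists>d>0. \<forall>h. 0 < h \<and> h < d \<longrightarrow> norm (integral (cbox x (x + h *\<^sub>R One)) f /\<^sub>R h ^ DIM(real) - f x) < e"
    using integrable_ccontinuous_explicit[of f] fint by metis
  have fz: "f x = 0" if x: "x \<notin> N" for x
  proof (rule ccontr)
    assume "f x \<noteq> 0"
    then obtain d where d: "d > 0" and dh: "\<And>h. 0 < h \<Longrightarrow> h < d \<Longrightarrow> norm (integral (cbox x (x + h *\<^sub>R One)) f /\<^sub>R h ^ DIM(real) - f x) < norm (f x)"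
      using Ne[OF x, of "norm (f x)"] by auto
    have "norm (integral (cbox x (x + (d/2) *\<^sub>R One)) f /\<^sub>R (d/2) ^ DIM(real) - f x) < norm (f x)"
      by (rule dh) (use d in auto)
    moreover have "integral (cbox x (x + (d/2) *\<^sub>R One)) f = 0" using fint by blast
    ultimately show False by simp
  qed
  have "AE x in lebesgue. x \<notin> N" using N by (simp add: negligible_iff_null_sets AE_not_in)
  then have "AE x in lebesgue. x \<in> {0..T} \<longrightarrow> g x = 0"
  proof eventually_elim
    case (elim x)
    show ?case using fz[OF elim] by (auto simp: f_def split: if_splits)
  qed
  then show ?thesis by (simp add: AE_restrict_space_iff)
qed

section \<open>Absolutely convergent trigonometric series\<close>

lemma infsum_int_sums:
  fixes f :: "int \<Rightarrow> complex"
  assumes "f summable_on UNIV"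
  shows "(\<lambda>j. f (int_decode j)) sums (infsum f UNIV)"
proof -
  have "(f has_sum infsum f UNIV) (range int_decode)" using assms by (simp add: surj_int_decode)
  then have "((f \<circ> int_decode) has_sum infsum f UNIV) UNIV"
    using has_sum_reindex[OF inj_int_decode[of UNIV], of f] by simp
  then show ?thesis using has_sum_imp_sums by (fastforce simp: o_def)
qed

text \<open>The interchange of a countable sum with an integral, after an enumeration of the integers.\<close>

lemma series_integral:
  fixes a :: "int \<Rightarrow> complex" and E :: "int \<Rightarrow> real \<Rightarrow> complex"
  assumes a: "sum_le (\<lambda>k. cmod (a k)) B" and E: "\<And>k x. cmod (E k x) \<le> 1" and Ec: "\<And>k. continuous_on {\<alpha>..\<beta>} (E k)"
    and g: "integrable (lebesgue_on {\<alpha>..\<beta>}) g"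
  shows "integrable (lebesgue_on {\<alpha>..\<beta>}) (\<lambda>x. (\<Sum>\<^sub>\<infinity>k. a k * E k x) * g x)" (is ?A)
    "(\<integral>x. (\<Sum>\<^sub>\<infinity>k. a k * E k x) * g x \<partial>lebesgue_on {\<alpha>..\<beta>}) = (\<Sum>\<^sub>\<infinity>k. a k * (\<integral>x. E k x * g x \<partial>lebesgue_on {\<alpha>..\<beta>}))" (is ?B)
    "(\<lambda>k. a k * (\<integral>x. E k x * g x \<partial>lebesgue_on {\<alpha>..\<beta>})) summable_on UNIV" (is ?C)
proof -
  let ?M = "lebesgue_on {\<alpha>..\<beta>}"
  define I where "I = (\<integral>x. norm (g x) \<partial>?M)"
  have I0: "0 \<le> I" unfolding I_def by (rule integral_nonneg_AE) auto
  have Eg: "integrable ?M (\<lambda>x. E k x * g x)" for k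
    using integrable_times_continuous[OF g Ec[of k]] by (simp add: mult.commute)
  have sa: "sum_le (\<lambda>k. I * cmod (a k)) (I * B)" by (rule sum_le_cmult[OF a I0])
  have In: "(\<integral>x. norm (a k * E k x * g x) \<partial>?M) \<le> I * cmod (a k)" for k
  proof -
    have "(\<integral>x. norm (a k * E k x * g x) \<partial>?M) \<le> (\<integral>x. cmod (a k) * norm (g x) \<partial>?M)"
    proof (rule integral_mono)
      show "integrable ?M (\<lambda>x. norm (a k * E k x * g x))"
        using integrable_norm[OF integrable_mult_right[OF Eg[of k], of "a k"]] by (simp add: mult.assoc)
      show "integrable ?M (\<lambda>x. cmod (a k) * norm (g x))" using g by (intro integrable_mult_right integrable_norm)
      show "norm (a k * E k x * g x) \<le> cmod (a k) * norm (g x)" for x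
        using mult_left_le[OF E[of k x], of "cmod (a k)"] by (auto simp: norm_mult intro: mult_right_mono)
    qed
    then show ?thesis by (simp add: I_def mult.commute)
  qed
  have nI: "norm (a k * (\<integral>x. E k x * g x \<partial>?M)) \<le> I * cmod (a k)" for k
  proof -
    have "norm (a k * (\<integral>x. E k x * g x \<partial>?M)) = norm (\<integral>x. a k * E k x * g x \<partial>?M)"
      by (simp add: mult.assoc)
    also have "\<dots> \<le> (\<integral>x. norm (a k * E k x * g x) \<partial>?M)" by (rule integral_norm_bound)
    finally show ?thesis using In[of k] by linarith
  qed
  show C: ?C by (rule sum_le_norm(2)[OF sa nI])
  have sx: "(\<lambda>k. a k * E k x) summable_on UNIV" for x
    by (rule sum_le_norm(2)[OF a]) (simp add: norm_mult mult_left_le E)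
  have sums1: "(\<lambda>j. a (int_decode j) * E (int_decode j) x * g x) sums ((\<Sum>\<^sub>\<infinity>k. a k * E k x) * g x)" for x
    by (intro sums_mult2 infsum_int_sums[OF sx])
  have na: "summable (\<lambda>j. cmod (a (int_decode j)))"
  proof -
    have "(\<lambda>j. cmod (a (int_decode j))) summable_on UNIV"
      using sum_le_inj[OF a, of int_decode] inj_int_decode sum_le_summable by blast
    then show ?thesis by (rule summable_on_imp_summable)
  qed
  let ?f = "\<lambda>j x. a (int_decode j) * E (int_decode j) x * g x"
  have i: "integrable ?M (?f j)" for j
    using integrable_mult_right[OF Eg[of "int_decode j"], of "a (int_decode j)"] by (simp add: mult.assoc)
  have ae: "AE x in ?M. summable (\<lambda>j. norm (?f j x))"
  proof (rule AE_I2)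
    fix x
    show "summable (\<lambda>j. norm (?f j x))"
    proof (rule summable_comparison_test'[OF summable_mult2[OF na, of "norm (g x)"], of 0])
      fix j show "norm (norm (?f j x)) \<le> cmod (a (int_decode j)) * norm (g x)"
        using mult_left_le[OF E[of "int_decode j" x], of "cmod (a (int_decode j))"] by (auto simp: norm_mult intro: mult_right_mono)
    qed
  qed
  have s: "summable (\<lambda>j. \<integral>x. norm (?f j x) \<partial>?M)"
    by (rule summable_comparison_test'[OF summable_mult[OF na, of I], of 0])
       (use In in \<open>auto simp: integral_nonneg_AE\<close>)
  have eq: "(\<lambda>x. \<Sum>j. ?f j x) = (\<lambda>x. (\<Sum>\<^sub>\<infinity>k. a k * E k x) * g x)"
    using sums1 by (auto simp: sums_iff)
  show ?A using integrable_suminf[OF i ae s] by (simp add: eq)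
  have "(\<integral>x. (\<Sum>\<^sub>\<infinity>k. a k * E k x) * g x \<partial>?M) = (\<Sum>j. \<integral>x. ?f j x \<partial>?M)"
    using integral_suminf[OF i ae s] by (simp add: eq)
  also have "\<dots> = (\<Sum>j. a (int_decode j) * (\<integral>x. E (int_decode j) x * g x \<partial>?M))"
    by (simp add: mult.assoc)
  also have "\<dots> = (\<Sum>\<^sub>\<infinity>k. a k * (\<integral>x. E k x * g x \<partial>?M))"
    using infsum_int_sums[OF C] by (simp add: sums_iff)
  finally show ?B .
qed

lemma series_continuous:
  fixes a :: "int \<Rightarrow> complex" and E :: "int \<Rightarrow> real \<Rightarrow> complex"
  assumes a: "sum_le (\<lambda>k. cmod (a k)) B" and E: "\<And>k x. cmod (E k x) \<le> 1" and Ec: "\<And>k. continuous_on A (E k)"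
  shows "continuous_on A (\<lambda>x. \<Sum>\<^sub>\<infinity>k. a k * E k x)"
proof -
  have sx: "(\<lambda>k. a k * E k x) summable_on UNIV" for x
    by (rule sum_le_norm(2)[OF a]) (simp add: norm_mult mult_left_le E)
  have na: "summable (\<lambda>j. cmod (a (int_decode j)))"
  proof -
    have "(\<lambda>j. cmod (a (int_decode j))) summable_on UNIV"
      using sum_le_inj[OF a, of int_decode] inj_int_decode sum_le_summable by blast
    then show ?thesis by (rule summable_on_imp_summable)
  qed
  have "uniform_limit A (\<lambda>m x. \<Sum>j<m. a (int_decode j) * E (int_decode j) x) (\<lambda>x. \<Sum>j. a (int_decode j) * E (int_decode j) x) sequentially"
    by (rule Weierstrass_m_test[OF _ na]) (simp add: norm_mult mult_left_le E)
  then have "continuous_on A (\<lambda>x. \<Sum>j. a (int_decode j) * E (int_decode j) x)"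
    by (rule uniform_limit_theorem[rotated]) (auto intro!: always_eventually continuous_intros Ec)
  moreover have "(\<Sum>j. a (int_decode j) * E (int_decode j) x) = (\<Sum>\<^sub>\<infinity>k. a k * E k x)" for x
    using infsum_int_sums[OF sx] by (simp add: sums_iff)
  ultimately show ?thesis by simp
qed

section \<open>From functions to sequences\<close>

text \<open>In the two components the modes \<open>k\<close> have opposite frequencies, so that the derivative term of the operator
is \<open>\<pi> k\<close> in both of them.\<close>

definition msign :: "bool \<Rightarrow> int" where "msign t = (if t then -1 else 1)"

definition part :: "bool \<Rightarrow> 'a \<times> 'a \<Rightarrow> 'a" where "part t p = (if t then snd p else fst p)"

lemma part_eqI: "(\<And>t. part t p = part t q) \<Longrightarrow> p = q"
  using prod_eqI[of p q] by (simp add: part_def) (metis)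

lemma part_simps [simp]: "part t (a, b) = (if t then b else a)"
  by (simp add: part_def)

lemma part_linear: "part t (p + q) = part t p + part t q" "part t (p - q) = part t p - part t q" "part t 0 = 0"
  for p q :: "complex \<times> complex"
  by (simp_all add: part_def)

lemma bounded_linear_part: "bounded_linear (part t :: complex \<times> complex \<Rightarrow> complex)"
proof -
  have "part True = (snd :: complex \<times> complex \<Rightarrow> complex)" "part False = (fst :: complex \<times> complex \<Rightarrow> complex)"
    by (auto simp: part_def)
  then show ?thesis by (cases t) (simp_all add: bounded_linear_fst bounded_linear_snd)
qed

lemma msign_not: "msign (\<not> t) = - msign t" and msign_sq [simp]: "msign t * msign t = 1" "msign t * (msign t * k) = k"
  by (auto simp: msign_def)

text \<open>The potential is \<open>1\<close>-periodic, and on \<open>[0, 2]\<close> it has frequencies \<open>m / 2\<close> with \<open>m\<close> even only.\<close>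

definition symbol :: "potential \<Rightarrow> bool \<Rightarrow> int \<Rightarrow> complex" where
  "symbol \<phi> t m = (if even m then fourier (part t \<phi>) (- msign t * (m div 2)) else 0)"

definition symbol_size :: "potential \<Rightarrow> int \<Rightarrow> real" where
  "symbol_size \<phi> m = cmod (symbol \<phi> False m) + cmod (symbol \<phi> True m)"

definition mode :: "bool \<Rightarrow> vecfun \<Rightarrow> int \<Rightarrow> complex" where
  "mode t F k = (1/2) * (\<integral>x. part t (F x) * wave 2 (msign t * k) x \<partial>lebesgue_on {0..2})"

lemma fourier_wave: "fourier u n = (\<integral>x. u x * wave 1 (- n) x \<partial>lebesgue_on {0..1})"
proof -
  have "- 2 * complex_of_real pi * \<i> * of_int n * complex_of_real x = \<i> * complex_of_real (2 * pi * real_of_int (- n) * x / 1)" for x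
    by (simp add: algebra_simps)
  then show ?thesis unfolding fourier_def wave_def by presburger
qed

lemma wave_2: "wave 2 (2 * m) x = wave 1 m x"
proof -
  have "2 * pi * real_of_int (2 * m) * x / 2 = 2 * pi * real_of_int m * x / 1" by simp
  then show ?thesis unfolding wave_def by (simp only:)
qed

lemma wave_periodic: "wave 1 m (x + 1) = wave 1 m x"
proof -
  have "wave 1 m (x + 1) = exp (\<i> * complex_of_real (2 * pi * real_of_int m * x) + of_int m * (2 * of_real pi * \<i>))"
    by (simp add: wave_def algebra_simps)
  also have "\<dots> = wave 1 m x * exp (of_int m * (2 * of_real pi * \<i>))"
    by (simp add: exp_add wave_def)
  also have "exp (of_int m * (2 * of_real pi * \<i>)) = 1"
    using exp_integer_2pi[of "of_int m"] by (simp add: mult_ac)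
  finally show ?thesis by simp
qed

lemma minus_double_div: "(- (2 * n)) div 2 = - n" for n :: int
  using nonzero_mult_div_cancel_left[of 2 "- n"] by simp

lemma L2_integrable:
  fixes f :: "real \<Rightarrow> 'a::euclidean_space"
  assumes "f \<in> L2_on {a..b}"
  shows "integrable (lebesgue_on {a..b}) f"
proof (rule Bochner_Integration.integrable_bound)
  interpret finite_measure "lebesgue_on {a..b}" by (rule finite_measure_lebesgue_on) simp
  show "integrable (lebesgue_on {a..b}) (\<lambda>x. 1 + (norm (f x))\<^sup>2)"
    using assms by (auto simp: L2_on_def)
  show "f \<in> borel_measurable (lebesgue_on {a..b})" using assms by (simp add: L2_on_def)
  have "norm (f x) \<le> 1 + (norm (f x))\<^sup>2" for x
  proof -
    have "2 * norm (f x) \<le> (norm (f x))\<^sup>2 + 1" using sum_squares_bound[of "norm (f x)" 1] by simp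
    then show ?thesis using norm_ge_zero[of "f x"] by linarith
  qed
  then show "AE x in lebesgue_on {a..b}. norm (f x) \<le> norm (1 + (norm (f x))\<^sup>2)"
    by (intro AE_I2) (simp only: real_norm_def abs_of_nonneg add_nonneg_nonneg zero_le_one zero_le_power2)
qed

text \<open>A potential with a bound for its norm. The factor \<open>5 ^ N\<close> in the instance of the sequence model compares
\<open>(1 + \<bar>2 n\<bar>)\<^sup>2\<close> with \<open>1 + n\<^sup>2\<close>.\<close>

locale zs_potential =
  fixes N :: nat and M0 :: real and \<phi> :: potential
  assumes N_pos: "N \<ge> 1" and \<phi>: "\<phi> \<in> Hc N" and \<phi>_norm: "Hc_norm N \<phi> \<le> M0"
begin

lemma part_sobolev: "part t \<phi> \<in> sobolev N"
  using \<phi> by (auto simp: Hc_def part_def)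

lemma sobolev_sum:
  "sum_le (\<lambda>n. (1 + (real_of_int n)\<^sup>2) ^ N * (cmod (fourier (part t \<phi>) n))\<^sup>2) ((sobolev_norm N (part t \<phi>))\<^sup>2)"
proof (rule sum_leI)
  show "(\<lambda>n. (1 + (real_of_int n)\<^sup>2) ^ N * (cmod (fourier (part t \<phi>) n))\<^sup>2) summable_on UNIV"
    using part_sobolev[of t] by (simp add: sobolev_def)
  have "0 \<le> (\<Sum>\<^sub>\<infinity>n. (1 + (real_of_int n)\<^sup>2) ^ N * (cmod (fourier (part t \<phi>) n))\<^sup>2)"
    by (rule infsum_nonneg) auto
  then show "(\<Sum>\<^sub>\<infinity>n. (1 + (real_of_int n)\<^sup>2) ^ N * (cmod (fourier (part t \<phi>) n))\<^sup>2) \<le> (sobolev_norm N (part t \<phi>))\<^sup>2"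
    by (simp add: sobolev_norm_def)
qed auto

lemma symbol_sum: "sum_le (\<lambda>m. (weight N m * cmod (symbol \<phi> t m))\<^sup>2) (5 ^ N * (sobolev_norm N (part t \<phi>))\<^sup>2)"
  unfolding sum_le_def
proof safe
  fix F :: "int set" assume F: "finite F"
  let ?g = "\<lambda>n. (1 + (real_of_int n)\<^sup>2) ^ N * (cmod (fourier (part t \<phi>) n))\<^sup>2"
  let ?\<sigma> = "\<lambda>m. - msign t * (m div 2)"
  have le: "(weight N m * cmod (symbol \<phi> t m))\<^sup>2 \<le> 5 ^ N * ?g (?\<sigma> m)" if ev: "even m" for m
  proof -
    obtain j where m: "m = 2 * j" using ev by (rule evenE)
    have "(1 + \<bar>real_of_int m\<bar>)\<^sup>2 \<le> 5 * (1 + (real_of_int j)\<^sup>2)"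
      using zero_le_power2[of "\<bar>real_of_int j\<bar> - 2"] by (simp add: m power2_eq_square algebra_simps)
    then have "((1 + \<bar>real_of_int m\<bar>)\<^sup>2) ^ N \<le> (5 * (1 + (real_of_int j)\<^sup>2)) ^ N" by (rule power_mono) simp
    also have "\<dots> = 5 ^ N * (1 + (real_of_int j)\<^sup>2) ^ N" by (rule power_mult_distrib)
    also have "(real_of_int j)\<^sup>2 = (real_of_int (?\<sigma> m))\<^sup>2" by (simp add: m msign_def)
    finally have "(weight N m)\<^sup>2 \<le> 5 ^ N * (1 + (real_of_int (?\<sigma> m))\<^sup>2) ^ N"
      by (simp add: weight_def power_mult[symmetric] mult.commute)
    from mult_right_mono[OF this, of "(cmod (symbol \<phi> t m))\<^sup>2"] show ?thesis
      using ev by (simp add: power_mult_distrib symbol_def mult.assoc)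
  qed
  have "(\<Sum>m\<in>F. (weight N m * cmod (symbol \<phi> t m))\<^sup>2) = (\<Sum>m\<in>{m\<in>F. even m}. (weight N m * cmod (symbol \<phi> t m))\<^sup>2)"
    using F by (intro sum.mono_neutral_right) (auto simp: symbol_def)
  also have "\<dots> \<le> (\<Sum>m\<in>{m\<in>F. even m}. 5 ^ N * ?g (?\<sigma> m))" by (rule sum_mono) (use le in auto)
  also have "\<dots> = 5 ^ N * (\<Sum>m\<in>{m\<in>F. even m}. ?g (?\<sigma> m))" by (simp only: sum_distrib_left)
  also have "(\<Sum>m\<in>{m\<in>F. even m}. ?g (?\<sigma> m)) = sum ?g (?\<sigma> ` {m\<in>F. even m})"
  proof (rule sum.reindex[symmetric, unfolded o_def])
    show "inj_on ?\<sigma> {m\<in>F. even m}"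
    proof (rule inj_onI)
      fix a b assume ab: "a \<in> {m\<in>F. even m}" "b \<in> {m\<in>F. even m}" and "?\<sigma> a = ?\<sigma> b"
      then have "a div 2 = b div 2" by (cases t) (simp_all add: msign_def)
      moreover have "2 * (a div 2) = a" "2 * (b div 2) = b" using ab by simp_all
      ultimately show "a = b" by metis
    qed
  qed
  also have "\<dots> \<le> (sobolev_norm N (part t \<phi>))\<^sup>2"
  proof -
    have "sum ?g G \<le> (sobolev_norm N (part t \<phi>))\<^sup>2" if "finite G" for G
      using sobolev_sum[of t] that by (simp add: sum_le_def)
    then show ?thesis using F by simp
  qed
  finally show "(\<Sum>m\<in>F. (weight N m * cmod (symbol \<phi> t m))\<^sup>2) \<le> 5 ^ N * (sobolev_norm N (part t \<phi>))\<^sup>2" by simp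
qed simp

lemma symbol_size_sum: "sum_le (\<lambda>m. (weight N m * symbol_size \<phi> m)\<^sup>2) (2 * 5 ^ N * M0\<^sup>2)"
proof -
  have "sum_le (\<lambda>m. (weight N m * symbol_size \<phi> m)\<^sup>2) (2 * (5 ^ N * (sobolev_norm N (part False \<phi>))\<^sup>2) + 2 * (5 ^ N * (sobolev_norm N (part True \<phi>))\<^sup>2))"
    using sum_le_sq_add[OF symbol_sum[of False] symbol_sum[of True]] by (simp add: symbol_size_def distrib_left)
  then show ?thesis
  proof (rule sum_le_mono)
    have "0 \<le> Hc_norm N \<phi>" by (simp add: Hc_norm_def)
    then have "(Hc_norm N \<phi>)\<^sup>2 \<le> M0\<^sup>2" using \<phi>_norm by (intro power_mono)
    moreover have "(Hc_norm N \<phi>)\<^sup>2 = (sobolev_norm N (part False \<phi>))\<^sup>2 + (sobolev_norm N (part True \<phi>))\<^sup>2"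
      by (simp add: Hc_norm_def part_def)
    ultimately have "(2 * 5 ^ N) * ((sobolev_norm N (part False \<phi>))\<^sup>2 + (sobolev_norm N (part True \<phi>))\<^sup>2) \<le> (2 * 5 ^ N) * M0\<^sup>2"
      by (intro mult_left_mono) auto
    then show "2 * (5 ^ N * (sobolev_norm N (part False \<phi>))\<^sup>2) + 2 * (5 ^ N * (sobolev_norm N (part True \<phi>))\<^sup>2) \<le> 2 * 5 ^ N * M0\<^sup>2"
      by (simp add: algebra_simps)
  qed auto
qed

end

sublocale zs_potential \<subseteq> hankel N "2 * 5 ^ N * M0\<^sup>2" "symbol \<phi>" "symbol_size \<phi>"
proof
  show "1 \<le> N" by (rule N_pos)
  show "cmod (symbol \<phi> s m) \<le> symbol_size \<phi> m" for s m by (cases s) (simp_all add: symbol_size_def)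
qed (rule symbol_size_sum)

context zs_potential
begin

text \<open>The continuous representative of a component of the potential.\<close>

definition pot :: "bool \<Rightarrow> real \<Rightarrow> complex" where
  "pot t x = (\<Sum>\<^sub>\<infinity>m. symbol \<phi> t m * wave 2 (- msign t * m) x)"

lemma symbol_l1: "sum_le (\<lambda>m. cmod (symbol \<phi> t m)) K"
  by (rule sum_le_mono[OF sum_c]) (auto intro: Pc)

lemma pot_continuous: "continuous_on A (pot t)"
  unfolding pot_def by (rule series_continuous[OF symbol_l1]) (auto intro: continuous_on_wave)

lemma pot_1_periodic: "pot t x = (\<Sum>\<^sub>\<infinity>n. fourier (part t \<phi>) n * wave 1 n x)"
proof -
  let ?f = "\<lambda>m. symbol \<phi> t m * wave 2 (- msign t * m) x" and ?\<sigma> = "\<lambda>n. - msign t * (2 * n)"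
  have "infsum ?f UNIV = infsum ?f (range ?\<sigma>)"
  proof (rule infsum_cong_neutral)
    fix m assume "m \<in> UNIV - range ?\<sigma>"
    then have "odd m"
    proof (rule contrapos_pp)
      assume "\<not> odd m"
      then have "even m" by simp
      then obtain j where "m = 2 * j" by (rule evenE)
      then have "m = ?\<sigma> (- msign t * j)" by (simp add: msign_def)
      then show "\<not> m \<in> UNIV - range ?\<sigma>" by blast
    qed
    then show "?f m = 0" by (simp add: symbol_def)
  qed auto
  also have "\<dots> = infsum (?f \<circ> ?\<sigma>) UNIV"
    by (rule infsum_reindex) (auto simp: inj_def msign_def)
  also have "?f \<circ> ?\<sigma> = (\<lambda>n. fourier (part t \<phi>) n * wave 1 n x)"
  proof
    fix n
    show "(?f \<circ> ?\<sigma>) n = fourier (part t \<phi>) n * wave 1 n x"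
      unfolding wave_2[symmetric] by (cases t) (simp_all add: symbol_def msign_def minus_double_div)
  qed
  finally show ?thesis by (simp add: pot_def)
qed

lemma fourier_l1: "\<exists>B. sum_le (\<lambda>n. cmod (fourier (part t \<phi>) n)) B"
proof -
  have "sum_le (\<lambda>n. cmod (symbol \<phi> t (- msign t * (2 * n)))) K"
    by (rule sum_le_inj[OF symbol_l1]) (auto simp: inj_def msign_def)
  moreover have "symbol \<phi> t (- msign t * (2 * n)) = fourier (part t \<phi>) n" for n
    by (simp add: symbol_def msign_def minus_double_div)
  ultimately show ?thesis by auto
qed

text \<open>Both sides have the same Fourier coefficients on \<open>[0, 1]\<close> and are \<open>1\<close>-periodic.\<close>

lemma part_eq_pot: "AE x in lebesgue_on {0..2}. part t \<phi> x = pot t x"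
proof -
  let ?u = "part t \<phi>" and ?M = "lebesgue_on {0..1}"
  obtain B where B: "sum_le (\<lambda>n. cmod (fourier ?u n)) B" using fourier_l1 by blast
  have u: "?u \<in> L2_periodic" using part_sobolev[of t] by (simp add: sobolev_def)
  then have ui: "integrable ?M ?u" and per: "?u (x + 1) = ?u x" for x
    by (auto simp: L2_periodic_def intro: L2_integrable)
  have pp: "pot t (x + 1) = pot t x" for x by (simp add: pot_1_periodic wave_periodic)
  have pi: "integrable ?M (pot t)" by (rule continuous_integrable_on_interval[OF pot_continuous])
  have "AE x in ?M. ?u x - pot t x = 0"
  proof (rule Fourier_uniqueness)
    show "integrable ?M (\<lambda>x. ?u x - pot t x)" by (intro Bochner_Integration.integrable_diff ui pi)
    fix m
    have "(\<integral>x. (?u x - pot t x) * wave 1 m x \<partial>?M) = (\<integral>x. ?u x * wave 1 m x \<partial>?M) - (\<integral>x. pot t x * wave 1 m x \<partial>?M)"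
      unfolding left_diff_distrib
      by (rule Bochner_Integration.integral_diff; rule integrable_times_continuous) (use ui pi in \<open>auto intro: continuous_on_wave\<close>)
    also have "(\<integral>x. pot t x * wave 1 m x \<partial>?M) = (\<Sum>\<^sub>\<infinity>n. fourier ?u n * (\<integral>x. wave 1 n x * wave 1 m x \<partial>?M))"
      unfolding pot_1_periodic by (rule series_integral(2)[OF B]) (auto intro: continuous_on_wave continuous_integrable_on_interval)
    also have "\<dots> = (\<Sum>\<^sub>\<infinity>n. fourier ?u n * (if n = - m then 1 else 0))"
      by (rule infsum_cong) (auto simp: wave_add[symmetric] wave_integral)
    also have "\<dots> = fourier ?u (- m)" by (rule delta_sum)
    finally show "(\<integral>x. (?u x - pot t x) * wave 1 m x \<partial>?M) = 0" by (simp add: fourier_wave)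
  qed simp
  then have "AE x in lebesgue. x \<in> {0..1} \<longrightarrow> ?u x = pot t x" by (simp add: AE_restrict_space_iff)
  then obtain Z where Z: "{x. \<not> (x \<in> {0..1} \<longrightarrow> ?u x = pot t x)} \<subseteq> Z" "negligible Z"
    by (auto elim!: AE_E simp: negligible_iff_null_sets null_sets_def)
  have "negligible (Z \<union> (+) 1 ` Z)" by (intro negligible_Un Z(2) negligible_translation)
  then have "AE x in lebesgue. x \<notin> Z \<union> (+) 1 ` Z" unfolding negligible_iff_null_sets by (rule AE_not_in)
  then have "AE x in lebesgue. x \<in> {0..2} \<longrightarrow> ?u x = pot t x"
  proof eventually_elim
    case (elim x)
    show ?case
    proof
      assume x: "x \<in> {0..2}"
      show "?u x = pot t x"
      proof (cases "x \<le> 1")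
        case True
        then show ?thesis using elim x Z(1) by auto
      next
        case False
        have "x - 1 \<notin> Z"
        proof
          assume "x - 1 \<in> Z" then have "1 + (x - 1) \<in> (+) 1 ` Z" by blast
          then show False using elim by simp
        qed
        moreover have "x - 1 \<in> {0..1}" using x False by auto
        ultimately have "?u (x - 1) = pot t (x - 1)" using Z(1) by blast
        then show ?thesis using per[of "x - 1"] pp[of "x - 1"] by simp
      qed
    qed
  qed
  then show ?thesis by (simp add: AE_restrict_space_iff)
qed

end

section \<open>The domain of the operator\<close>

lemma H1_part:
  assumes H: "H1_periodic_deriv F f"
  shows "integrable (lebesgue_on {0..2}) (\<lambda>x. part t (f x))" "continuous_on {0..2} (\<lambda>x. part t (F x))"
    "part t (F 0) = part t (F 2)" "(\<integral>x. part t (f x) \<partial>lebesgue_on {0..2}) = 0"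
    "\<And>x. x \<in> {0..2} \<Longrightarrow> part t (F x) = part t (F 0) + (\<integral>y. part t (f y) \<partial>lebesgue_on {0..x})"
proof -
  have fi: "integrable (lebesgue_on {0..2}) f" using H by (auto simp: H1_periodic_deriv_def intro: L2_integrable)
  show ci: "integrable (lebesgue_on {0..2}) (\<lambda>x. part t (f x))"
    by (rule integrable_bounded_linear[OF bounded_linear_part fi])
  show Fx: "part t (F x) = part t (F 0) + (\<integral>y. part t (f y) \<partial>lebesgue_on {0..x})" if "x \<in> {0..2}" for x
  proof -
    have "integrable (lebesgue_on {0..x}) f"
      using Equivalence_Lebesgue_Henstock_Integration.integrable_subinterval[OF fi, of 0 x] that by auto
    then have "(\<integral>y. part t (f y) \<partial>lebesgue_on {0..x}) = part t (\<integral>y. f y \<partial>lebesgue_on {0..x})"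
      by (rule integral_bounded_linear[OF bounded_linear_part])
    moreover have "F x = F 0 + (\<integral>y. f y \<partial>lebesgue_on {0..x})" using H that unfolding H1_periodic_deriv_def by blast
    ultimately show ?thesis by (metis part_linear(1))
  qed
  have "F 0 = F 2" using H unfolding H1_periodic_deriv_def by blast
  then show per: "part t (F 0) = part t (F 2)" by simp
  show "(\<integral>x. part t (f x) \<partial>lebesgue_on {0..2}) = 0" using Fx[of 2] per by simp
  have HK: "(\<lambda>x. part t (f x)) integrable_on {0..2}" by (rule integrable_on_lebesgue_on[OF ci]) simp
  have "part t (F x) = part t (F 0) + integral {0..x} (\<lambda>x. part t (f x))" if "x \<in> {0..2}" for x
  proof -
    have "integrable (lebesgue_on {0..x}) (\<lambda>x. part t (f x))"
      using Equivalence_Lebesgue_Henstock_Integration.integrable_subinterval[OF ci, of 0 x] that by auto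
    then show ?thesis using Fx[OF that] by (simp add: lebesgue_integral_eq_integral)
  qed
  note e = this
  have "continuous_on {0..2} (\<lambda>x. part t (F 0) + integral {0..x} (\<lambda>x. part t (f x)))"
    by (intro continuous_intros indefinite_integral_continuous_1 HK)
  then show "continuous_on {0..2} (\<lambda>x. part t (F x))"
    by (rule continuous_on_eq) (rule e[symmetric])
qed

lemma H1_derivative_coeff:
  assumes H: "H1_periodic_deriv F f"
  shows "(\<integral>x. part t (f x) * wave 2 j x \<partial>lebesgue_on {0..2})
     = - (\<i> * complex_of_real (pi * real_of_int j)) * (\<integral>x. part t (F x) * wave 2 j x \<partial>lebesgue_on {0..2})"
proof -
  let ?M = "lebesgue_on {0..2 :: real}" and ?c = "\<i> * complex_of_real (pi * real_of_int j)"
  note h = H1_part[where t = t, OF H]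
  have "((\<lambda>x. wave 2 j x) has_vector_derivative ?c * wave 2 j y) (at y within A)" for y A
    using wave_derivative[of 2 j y A] by (simp add: mult_ac)
  moreover have "continuous_on {0..2} (\<lambda>y. ?c * wave 2 j y)" by (intro continuous_intros continuous_on_wave)
  ultimately have "(\<integral>x. (\<integral>y. part t (f y) \<partial>lebesgue_on {0..x}) * (?c * wave 2 j x) \<partial>?M)
      = (\<integral>x. part t (f x) \<partial>?M) * wave 2 j 2 - (\<integral>x. part t (f x) * wave 2 j x \<partial>?M)"
    by (intro integral_primitive_by_parts h) auto
  also have "\<dots> = - (\<integral>x. part t (f x) * wave 2 j x \<partial>?M)" by (simp add: h(4))
  also have "(\<integral>x. (\<integral>y. part t (f y) \<partial>lebesgue_on {0..x}) * (?c * wave 2 j x) \<partial>?M)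
      = (\<integral>x. ?c * (part t (F x) * wave 2 j x) - (?c * part t (F 0)) * wave 2 j x \<partial>?M)"
  proof (rule Bochner_Integration.integral_cong[OF refl])
    fix x assume "x \<in> space ?M"
    then have "x \<in> {0..2}" by simp
    then have "(\<integral>y. part t (f y) \<partial>lebesgue_on {0..x}) = part t (F x) - part t (F 0)" using h(5)[of x] by (simp only: add_diff_cancel_left')
    then show "(\<integral>y. part t (f y) \<partial>lebesgue_on {0..x}) * (?c * wave 2 j x) = ?c * (part t (F x) * wave 2 j x) - (?c * part t (F 0)) * wave 2 j x"
      by (simp only:) (simp add: algebra_simps)
  qed
  also have "\<dots> = (\<integral>x. ?c * (part t (F x) * wave 2 j x) \<partial>?M) - (\<integral>x. (?c * part t (F 0)) * wave 2 j x \<partial>?M)"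
    by (rule Bochner_Integration.integral_diff; intro integrable_mult_right continuous_integrable_on_interval continuous_intros continuous_on_wave h(2))
  also have "\<dots> = ?c * (\<integral>x. part t (F x) * wave 2 j x \<partial>?M) - (?c * part t (F 0)) * (if j = 0 then of_real 2 else 0)"
    unfolding integral_mult_right_zero by (subst wave_integral) auto
  also have "\<dots> = ?c * (\<integral>x. part t (F x) * wave 2 j x \<partial>?M)" by simp
  finally show ?thesis by (simp add: algebra_simps)
qed

lemma mode_bounded:
  assumes H: "H1_periodic_deriv F f"
  shows "\<exists>S. \<forall>t k. cmod (mode t F k) \<le> S"
proof -
  have "\<exists>S. \<forall>k. cmod (mode t F k) \<le> S" for t
  proof -
    have "cmod (mode t F k) \<le> (\<integral>x. cmod (part t (F x)) \<partial>lebesgue_on {0..2})" for k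
    proof -
      have "cmod (\<integral>x. part t (F x) * wave 2 (msign t * k) x \<partial>lebesgue_on {0..2}) \<le> (\<integral>x. cmod (part t (F x)) \<partial>lebesgue_on {0..2})"
        using integral_norm_bound[of "lebesgue_on {0..2}" "\<lambda>x. part t (F x) * wave 2 (msign t * k) x"] by (simp add: norm_mult)
      moreover have "cmod (mode t F k) = 1 / 2 * cmod (\<integral>x. part t (F x) * wave 2 (msign t * k) x \<partial>lebesgue_on {0..2})"
        by (simp add: mode_def norm_mult)
      ultimately show ?thesis using norm_ge_zero[of "\<integral>x. part t (F x) * wave 2 (msign t * k) x \<partial>lebesgue_on {0..2}"] by linarith
    qed
    then show ?thesis by blast
  qed
  then obtain S where S: "\<And>t k. cmod (mode t F k) \<le> S t" by metis
  have "cmod (mode t F k) \<le> max (S True) (S False)" for t k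
    using S[of t k] by (cases t) (simp_all add: le_max_iff_disj)
  then show ?thesis by blast
qed

text \<open>Elements of the domain are continuous on \<open>[0, 2]\<close> and \<open>0\<close> elsewhere, so equality of all modes gives equality
at every point.\<close>

lemma mode_inject:
  assumes H: "H1_periodic_deriv F f" and H': "H1_periodic_deriv F' f'"
    and eq: "\<And>t k. mode t F k = mode t F' k"
  shows "F = F'"
proof
  fix x
  show "F x = F' x"
  proof (cases "x \<in> {0..2}")
    case True
    show ?thesis
    proof (rule part_eqI)
      fix t
      note h = H1_part[where t = t, OF H] and h' = H1_part[where t = t, OF H']
      have "part t (F x) - part t (F' x) = 0"
      proof (rule continuous_uniqueness[of 2 _ x])
        show "continuous_on {0..2} (\<lambda>x. part t (F x) - part t (F' x))" by (intro continuous_intros h h')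
        show "part t (F 0) - part t (F' 0) = part t (F 2) - part t (F' 2)" using h(3) h'(3) by simp
        fix m
        have i: "integrable (lebesgue_on {0..2}) (\<lambda>x. part t (F x) * wave 2 m x)"
          "integrable (lebesgue_on {0..2}) (\<lambda>x. part t (F' x) * wave 2 m x)"
          by (intro continuous_integrable_on_interval continuous_intros continuous_on_wave h(2) h'(2))+
        have "integral {0..2} (\<lambda>x. (part t (F x) - part t (F' x)) * wave 2 m x)
          = (\<integral>x. (part t (F x) - part t (F' x)) * wave 2 m x \<partial>lebesgue_on {0..2})"
          by (rule lebesgue_integral_eq_integral[symmetric])
             (intro continuous_imp_integrable_real continuous_intros continuous_on_wave h(2) h'(2), simp)
        also have "\<dots> = (\<integral>x. part t (F x) * wave 2 m x \<partial>lebesgue_on {0..2}) - (\<integral>x. part t (F' x) * wave 2 m x \<partial>lebesgue_on {0..2})"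
          unfolding left_diff_distrib by (rule Bochner_Integration.integral_diff[OF i])
        also have "\<dots> = 0" using eq[of t "msign t * m"] by (simp add: mode_def)
        finally show "integral {0..2} (\<lambda>x. (part t (F x) - part t (F' x)) * wave 2 m x) = 0" .
      qed (use True in auto)
      then show "part t (F x) = part t (F' x)" by simp
    qed
  next
    case False
    then have "F x = 0" "F' x = 0" using H H' unfolding H1_periodic_deriv_def by blast+
    then show ?thesis by simp
  qed
qed

context zs_potential
begin

text \<open>The component \<open>t\<close> of \<open>(L(\<phi>) - \<mu>) F\<close>, with the potential replaced by its continuous representative.\<close>

definition ZSc :: "complex \<Rightarrow> vecfun \<Rightarrow> vecfun \<Rightarrow> bool \<Rightarrow> real \<Rightarrow> complex" where
  "ZSc \<mu> F f t x = \<i> * of_int (msign t) * part t (f x) + pot t x * part (\<not> t) (F x) - \<mu> * part t (F x)"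

lemma ZSc_AE: "AE x in lebesgue_on {0..2}. \<forall>t. part t (ZS_op \<phi> F f x - vecfun_scale \<mu> F x) = ZSc \<mu> F f t x"
proof -
  have "AE x in lebesgue_on {0..2}. part True \<phi> x = pot True x \<and> part False \<phi> x = pot False x"
    using part_eq_pot[of True] part_eq_pot[of False] by eventually_elim auto
  then show ?thesis
  proof eventually_elim
    case (elim x)
    show ?case
    proof
      fix t show "part t (ZS_op \<phi> F f x - vecfun_scale \<mu> F x) = ZSc \<mu> F f t x"
        using elim by (cases t) (simp_all add: ZS_op_def vecfun_scale_def ZSc_def msign_def part_def)
    qed
  qed
qed

lemma ZSc_coeff:
  assumes H: "H1_periodic_deriv F f"
  shows "integrable (lebesgue_on {0..2}) (ZSc \<mu> F f t)"
    "(1/2) * (\<integral>x. ZSc \<mu> F f t x * wave 2 (msign t * k) x \<partial>lebesgue_on {0..2}) = seq_op (\<lambda>t. mode t F) t k - \<mu> * mode t F k"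
proof -
  let ?M = "lebesgue_on {0..2 :: real}"
  note h = H1_part[OF H]
  let ?w = "wave 2 (msign t * k)"
  have i1: "integrable ?M (\<lambda>x. \<i> * of_int (msign t) * part t (f x))" by (intro integrable_mult_right h)
  have i2: "integrable ?M (\<lambda>x. pot t x * part (\<not> t) (F x))"
    by (intro continuous_integrable_on_interval continuous_intros pot_continuous h)
  have i3: "integrable ?M (\<lambda>x. \<mu> * part t (F x))"
    by (intro continuous_integrable_on_interval continuous_intros h)
  show "integrable ?M (ZSc \<mu> F f t)"
    unfolding ZSc_def by (intro Bochner_Integration.integrable_diff Bochner_Integration.integrable_add i1 i2 i3)
  have j: "integrable ?M g \<Longrightarrow> integrable ?M (\<lambda>x. g x * ?w x)" for g
    by (rule integrable_times_continuous[OF _ continuous_on_wave])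
  have "(\<integral>x. ZSc \<mu> F f t x * ?w x \<partial>?M) = (\<integral>x. \<i> * of_int (msign t) * part t (f x) * ?w x + pot t x * part (\<not> t) (F x) * ?w x - \<mu> * part t (F x) * ?w x \<partial>?M)"
    by (simp add: ZSc_def algebra_simps)
  also have "\<dots> = (\<integral>x. \<i> * of_int (msign t) * part t (f x) * ?w x \<partial>?M) + (\<integral>x. pot t x * part (\<not> t) (F x) * ?w x \<partial>?M) - (\<integral>x. \<mu> * part t (F x) * ?w x \<partial>?M)"
    by (simp only: Bochner_Integration.integral_diff[OF Bochner_Integration.integrable_add[OF j[OF i1] j[OF i2]] j[OF i3]]
        Bochner_Integration.integral_add[OF j[OF i1] j[OF i2]])
  also have "(\<integral>x. \<i> * of_int (msign t) * part t (f x) * ?w x \<partial>?M) = \<i> * of_int (msign t) * (\<integral>x. part t (f x) * ?w x \<partial>?M)"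
    by (simp only: mult.assoc integral_mult_right_zero)
  also have "\<dots> = complex_of_real (pi * real_of_int k) * (2 * mode t F k)"
    unfolding H1_derivative_coeff[OF H] mode_def by (cases t) (simp_all add: msign_def algebra_simps)
  also have "(\<integral>x. \<mu> * part t (F x) * ?w x \<partial>?M) = \<mu> * (2 * mode t F k)"
    unfolding mode_def by (simp add: mult.assoc)
  also have "(\<integral>x. pot t x * part (\<not> t) (F x) * ?w x \<partial>?M) = 2 * (\<Sum>\<^sub>\<infinity>l. symbol \<phi> t (k + l) * mode (\<not> t) F l)"
  proof -
    have "(\<integral>x. pot t x * part (\<not> t) (F x) * ?w x \<partial>?M) = (\<integral>x. (\<Sum>\<^sub>\<infinity>m. symbol \<phi> t m * wave 2 (- msign t * m) x) * (part (\<not> t) (F x) * ?w x) \<partial>?M)"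
      by (simp add: pot_def mult.assoc)
    also have "\<dots> = (\<Sum>\<^sub>\<infinity>m. symbol \<phi> t m * (\<integral>x. wave 2 (- msign t * m) x * (part (\<not> t) (F x) * ?w x) \<partial>?M))"
      by (rule series_integral(2)[OF symbol_l1])
         (auto intro!: continuous_on_wave continuous_integrable_on_interval continuous_on_mult h)
    also have "\<dots> = (\<Sum>\<^sub>\<infinity>m. 2 * (symbol \<phi> t m * mode (\<not> t) F (m - k)))"
    proof (rule infsum_cong)
      fix m
      have "msign (\<not> t) * (m - k) = - msign t * m + msign t * k" by (simp add: msign_not algebra_simps)
      then have w: "wave 2 (msign (\<not> t) * (m - k)) x = wave 2 (- msign t * m) x * ?w x" for x
        by (simp only: wave_add)
      have "(\<integral>x. wave 2 (- msign t * m) x * (part (\<not> t) (F x) * ?w x) \<partial>?M) = 2 * mode (\<not> t) F (m - k)"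
        unfolding mode_def w by (simp only: mult.left_commute[of "wave 2 (- msign t * m) _"]) simp
      then show "symbol \<phi> t m * (\<integral>x. wave 2 (- msign t * m) x * (part (\<not> t) (F x) * ?w x) \<partial>?M) = 2 * (symbol \<phi> t m * mode (\<not> t) F (m - k))"
        by simp
    qed
    also have "\<dots> = 2 * (\<Sum>\<^sub>\<infinity>m. symbol \<phi> t m * mode (\<not> t) F (m - k))" by (rule infsum_cmult_right')
    also have "(\<Sum>\<^sub>\<infinity>m. symbol \<phi> t m * mode (\<not> t) F (m - k)) = (\<Sum>\<^sub>\<infinity>l. symbol \<phi> t (k + l) * mode (\<not> t) F (k + l - k))"
      by (rule infsum_reindex_bij_betw[symmetric, of "\<lambda>l. k + l"]) (rule bij_betw_byWitness[where f' = "\<lambda>l. l - k"], auto)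
    finally show ?thesis by simp
  qed
  finally have e: "(\<integral>x. ZSc \<mu> F f t x * ?w x \<partial>?M) = complex_of_real (pi * real_of_int k) * (2 * mode t F k)
      + 2 * (\<Sum>\<^sub>\<infinity>l. symbol \<phi> t (k + l) * mode (\<not> t) F l) - \<mu> * (2 * mode t F k)" .
  show "(1/2) * (\<integral>x. ZSc \<mu> F f t x * ?w x \<partial>?M) = seq_op (\<lambda>t. mode t F) t k - \<mu> * mode t F k"
    unfolding e seq_op_def by (simp add: algebra_simps)
qed

text \<open>The operator equation in terms of modes; the converse is \<open>kernel_eq_of_modes\<close>, by uniqueness of Fourier
coefficients.\<close>

lemma modes_of_kernel_eq:
  assumes H: "H1_periodic_deriv F f" and G: "H1_periodic_deriv G g"
    and eq: "AE x in lebesgue_on {0..2}. ZS_op \<phi> F f x - vecfun_scale \<mu> F x = G x"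
  shows "seq_op (\<lambda>t. mode t F) t k - \<mu> * mode t F k = mode t G k"
proof -
  let ?M = "lebesgue_on {0..2 :: real}" and ?w = "wave 2 (msign t * k)"
  have i1: "integrable ?M (\<lambda>x. ZSc \<mu> F f t x * ?w x)"
    by (rule integrable_times_continuous[OF ZSc_coeff(1)[OF H] continuous_on_wave])
  have i2: "integrable ?M (\<lambda>x. part t (G x) * ?w x)"
    by (intro continuous_integrable_on_interval continuous_intros continuous_on_wave H1_part[OF G])
  have "(\<integral>x. ZSc \<mu> F f t x * ?w x \<partial>?M) = (\<integral>x. part t (G x) * ?w x \<partial>?M)"
  proof (rule integral_cong_AE)
    show "AE x in ?M. ZSc \<mu> F f t x * ?w x = part t (G x) * ?w x"
      using ZSc_AE[of F f \<mu>] eq by eventually_elim metis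
  qed (use i1 i2 in auto)
  then show ?thesis using ZSc_coeff(2)[OF H, of \<mu> t k] by (simp add: mode_def)
qed

lemma kernel_eq_of_modes:
  assumes H: "H1_periodic_deriv F f" and G: "H1_periodic_deriv G g"
    and eq: "\<And>t k. seq_op (\<lambda>t. mode t F) t k - \<mu> * mode t F k = mode t G k"
  shows "AE x in lebesgue_on {0..2}. ZS_op \<phi> F f x - vecfun_scale \<mu> F x = G x"
proof -
  let ?M = "lebesgue_on {0..2 :: real}"
  have "AE x in ?M. ZSc \<mu> F f t x - part t (G x) = 0" for t
  proof (rule Fourier_uniqueness)
    have i2: "integrable ?M (\<lambda>x. part t (G x))"
      by (intro continuous_integrable_on_interval H1_part[OF G])
    show "integrable ?M (\<lambda>x. ZSc \<mu> F f t x - part t (G x))"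
      by (intro Bochner_Integration.integrable_diff ZSc_coeff(1)[OF H] i2)
    fix m
    have "(\<integral>x. (ZSc \<mu> F f t x - part t (G x)) * wave 2 m x \<partial>?M) = (\<integral>x. ZSc \<mu> F f t x * wave 2 m x \<partial>?M) - (\<integral>x. part t (G x) * wave 2 m x \<partial>?M)"
      unfolding left_diff_distrib
      by (rule Bochner_Integration.integral_diff; rule integrable_times_continuous)
         (auto intro: ZSc_coeff(1)[OF H] i2 continuous_on_wave)
    also have "\<dots> = 0" using ZSc_coeff(2)[OF H, of \<mu> t "msign t * m"] eq[of t "msign t * m"] by (simp add: mode_def)
    finally show "(\<integral>x. (ZSc \<mu> F f t x - part t (G x)) * wave 2 m x \<partial>?M) = 0" .
  qed simp
  from this[of True] this[of False] ZSc_AE[of F f \<mu>] show ?thesis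
  proof eventually_elim
    case (elim x)
    show ?case
    proof (rule part_eqI)
      fix t show "part t (ZS_op \<phi> F f x - vecfun_scale \<mu> F x) = part t (G x)"
        using elim by (cases t) auto
    qed
  qed
qed

end

section \<open>From sequences to functions\<close>

definition synth :: "(bool \<Rightarrow> int \<Rightarrow> complex) \<Rightarrow> vecfun" where
  "synth x y = (if y \<in> {0..2} then (\<Sum>\<^sub>\<infinity>k. x False k * wave 2 (- msign False * k) y, \<Sum>\<^sub>\<infinity>k. x True k * wave 2 (- msign True * k) y) else 0)"

lemma part_synth: "y \<in> {0..2} \<Longrightarrow> part t (synth x y) = (\<Sum>\<^sub>\<infinity>k. x t k * wave 2 (- msign t * k) y)"
  by (simp add: synth_def part_def)

lemma part_integral:
  fixes f :: "real \<Rightarrow> complex \<times> complex"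
  assumes "integrable M f"
  shows "part t (\<integral>y. f y \<partial>M) = (\<integral>y. part t (f y) \<partial>M)"
  by (rule integral_bounded_linear[OF bounded_linear_part assms, symmetric])

text \<open>A sequence \<open>x\<close> with \<open>k x\<close> summable is the sequence of modes of an element of the domain, whose derivative is
the series differentiated term by term.\<close>

lemma synth_H1:
  assumes x: "\<And>t. sum_le (\<lambda>k. cmod (x t k)) B" and x': "\<And>t. sum_le (\<lambda>k. cmod (complex_of_real (pi * real_of_int k) * x t k)) B'"
  shows "\<exists>f. H1_periodic_deriv (synth x) f" and "mode t (synth x) k = x t k"
proof -
  define b where "b t k = - (\<i> * complex_of_real (pi * real_of_int (msign t * k))) * x t k" for t k
  have b: "sum_le (\<lambda>k. cmod (b t k)) B'" for t
  proof -
    have "cmod (b t k) = cmod (complex_of_real (pi * real_of_int k) * x t k)" for k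
      by (simp add: b_def norm_mult abs_mult msign_def)
    then show ?thesis using x'[of t] by simp
  qed
  define D where "D t y = (\<Sum>\<^sub>\<infinity>k. b t k * wave 2 (- msign t * k) y)" for t y
  define f where "f y = (D False y, D True y)" for y
  have Dc: "continuous_on A (D t)" for t A
    unfolding D_def by (rule series_continuous[OF b]) (auto intro: continuous_on_wave)
  have fc: "continuous_on A f" for A unfolding f_def by (intro continuous_intros Dc)
  have cf_f: "part t (f y) = D t y" for t y by (cases t) (simp_all add: f_def)
  have fL2: "f \<in> L2_on {0..2}"
    unfolding L2_on_def
  proof safe
    show "f \<in> borel_measurable (lebesgue_on {0..2})"
      using continuous_imp_integrable_real[OF fc] by auto
    show "integrable (lebesgue_on {0..2}) (\<lambda>y. (norm (f y))\<^sup>2)"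
      by (intro continuous_imp_integrable_real continuous_intros fc)
  qed
  have per: "synth x 0 = synth x 2"
  proof (rule part_eqI)
    fix t show "part t (synth x 0) = part t (synth x 2)"
      by (simp add: part_synth wave_T)
  qed
  have xw: "(\<lambda>k. x t k * wave 2 (- msign t * k) y) summable_on UNIV" for t y
    by (rule sum_le_norm(2)[OF x[of t]]) (simp add: norm_mult)
  have prim: "synth x y = synth x 0 + (\<integral>s. f s \<partial>lebesgue_on {0..y})" if y: "y \<in> {0..2}" for y
  proof (rule part_eqI)
    fix t
    have "part t (\<integral>s. f s \<partial>lebesgue_on {0..y}) = (\<integral>s. D t s \<partial>lebesgue_on {0..y})"
      using part_integral[OF continuous_imp_integrable_real[OF fc], of t] by (simp add: cf_f)
    also have "\<dots> = (\<integral>s. (\<Sum>\<^sub>\<infinity>k. b t k * wave 2 (- msign t * k) s) * 1 \<partial>lebesgue_on {0..y})" by (simp add: D_def)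
    also have "\<dots> = (\<Sum>\<^sub>\<infinity>k. b t k * (\<integral>s. wave 2 (- msign t * k) s * 1 \<partial>lebesgue_on {0..y}))"
      by (rule series_integral(2)[OF b]) (auto intro: continuous_on_wave continuous_integrable_on_interval)
    also have "\<dots> = (\<Sum>\<^sub>\<infinity>k. x t k * wave 2 (- msign t * k) y - x t k * wave 2 (- msign t * k) 0)"
    proof (rule infsum_cong)
      fix k
      let ?j = "- msign t * k"
      show "b t k * (\<integral>s. wave 2 ?j s * 1 \<partial>lebesgue_on {0..y}) = x t k * wave 2 ?j y - x t k * wave 2 ?j 0"
      proof (cases "k = 0")
        case True then show ?thesis by (simp add: b_def)
      next
        case False
        let ?c = "\<i> * complex_of_real (pi * real_of_int ?j)"
        have c: "?c \<noteq> 0" using False by (simp add: msign_def)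
        have bc: "b t k = ?c * x t k" by (simp add: b_def)
        have der: "(wave 2 ?j has_vector_derivative ?c * wave 2 ?j s) (at s within A)" for s A
          using wave_derivative[of 2 ?j s A] by (simp add: mult_ac)
        have "(\<integral>s. ?c * wave 2 ?j s \<partial>lebesgue_on {0..y}) = wave 2 ?j y - wave 2 ?j 0"
          using y by (intro FTC_lebesgue der continuous_intros continuous_on_wave) auto
        then have "?c * (\<integral>s. wave 2 ?j s \<partial>lebesgue_on {0..y}) = wave 2 ?j y - wave 2 ?j 0"
          by (simp only: integral_mult_right_zero)
        then have "x t k * (?c * (\<integral>s. wave 2 ?j s \<partial>lebesgue_on {0..y})) = x t k * (wave 2 ?j y - wave 2 ?j 0)"
          by (simp only:)
        then show ?thesis unfolding bc mult_1_right by (simp only: mult.assoc mult.left_commute right_diff_distrib)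
      qed
    qed
    also have "\<dots> = part t (synth x y) - part t (synth x 0)"
    proof -
      have z: "part t (synth x 0) = (\<Sum>\<^sub>\<infinity>k. x t k * wave 2 (- msign t * k) 0)" by (rule part_synth) simp
      show ?thesis unfolding z part_synth[OF y] infsum_diff[OF xw xw] ..
    qed
    finally show "part t (synth x y) = part t (synth x 0 + (\<integral>s. f s \<partial>lebesgue_on {0..y}))"
      by (simp only: part_linear(1)) simp
  qed
  have "H1_periodic_deriv (synth x) f"
    unfolding H1_periodic_deriv_def
  proof (intro conjI allI impI ballI)
    show "synth x y = 0" if "y \<notin> {0..2}" for y using that unfolding synth_def by (rule if_not_P)
  qed (rule per fL2 prim | assumption)+
  then show "\<exists>f. H1_periodic_deriv (synth x) f" by blast
  have "(\<integral>y. part t (synth x y) * wave 2 (msign t * k) y \<partial>lebesgue_on {0..2})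
     = (\<integral>y. (\<Sum>\<^sub>\<infinity>l. x t l * wave 2 (- msign t * l) y) * wave 2 (msign t * k) y \<partial>lebesgue_on {0..2})"
    by (rule Bochner_Integration.integral_cong[OF refl]) (simp add: part_synth)
  also have "\<dots> = (\<Sum>\<^sub>\<infinity>l. x t l * (\<integral>y. wave 2 (- msign t * l) y * wave 2 (msign t * k) y \<partial>lebesgue_on {0..2}))"
    by (rule series_integral(2)[OF x]) (auto intro: continuous_on_wave continuous_integrable_on_interval)
  also have "\<dots> = (\<Sum>\<^sub>\<infinity>l. (2 * x t l) * (if l = k then 1 else 0))"
  proof (rule infsum_cong)
    fix l
    have "- msign t * l + msign t * k = 0 \<longleftrightarrow> l = k" by (auto simp: msign_def)
    then show "x t l * (\<integral>y. wave 2 (- msign t * l) y * wave 2 (msign t * k) y \<partial>lebesgue_on {0..2}) = (2 * x t l) * (if l = k then 1 else 0)"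
      by (simp only: wave_add[symmetric]) (subst wave_integral, auto)
  qed
  also have "\<dots> = 2 * x t k" by (rule delta_sum)
  finally show "mode t (synth x) k = x t k" by (simp add: mode_def)
qed

lemma synth_lin:
  assumes x: "\<And>t. sum_le (\<lambda>k. cmod (x t k)) B" and y: "\<And>t. sum_le (\<lambda>k. cmod (y t k)) B'"
  shows "synth (\<lambda>t k. a * x t k + b * y t k) = vecfun_scale a (synth x) + vecfun_scale b (synth y)"
proof
  fix w
  show "synth (\<lambda>t k. a * x t k + b * y t k) w = (vecfun_scale a (synth x) + vecfun_scale b (synth y)) w"
  proof (cases "w \<in> {0..2}")
    case True
    have sx: "(\<lambda>k. x t k * wave 2 (- msign t * k) w) summable_on UNIV" for t
      by (rule sum_le_norm(2)[OF x[of t]]) (simp add: norm_mult)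
    have sy: "(\<lambda>k. y t k * wave 2 (- msign t * k) w) summable_on UNIV" for t
      by (rule sum_le_norm(2)[OF y[of t]]) (simp add: norm_mult)
    show ?thesis
    proof (rule part_eqI)
      fix t
      have "part t (synth (\<lambda>t k. a * x t k + b * y t k) w)
        = (\<Sum>\<^sub>\<infinity>k. a * (x t k * wave 2 (- msign t * k) w) + b * (y t k * wave 2 (- msign t * k) w))"
        unfolding part_synth[OF True] by (simp add: algebra_simps)
      also have "\<dots> = a * part t (synth x w) + b * part t (synth y w)"
        unfolding part_synth[OF True] infsum_add[OF summable_on_cmult_right[OF sx] summable_on_cmult_right[OF sy]] infsum_cmult_right' ..
      finally show "part t (synth (\<lambda>t k. a * x t k + b * y t k) w) = part t ((vecfun_scale a (synth x) + vecfun_scale b (synth y)) w)"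
        by (cases t) (simp_all add: part_def vecfun_scale_def)
    qed
  next
    case False
    then have z: "synth x w = (0, 0)" for x by (simp only: synth_def if_False zero_prod_def)
    show ?thesis unfolding plus_fun_apply vecfun_scale_def z by simp
  qed
qed

lemma infsum_finite_sum:
  fixes f :: "'a \<Rightarrow> 'b \<Rightarrow> 'c::real_normed_vector"
  assumes "finite F" "\<And>k. k \<in> F \<Longrightarrow> f k summable_on A"
  shows "(\<lambda>l. \<Sum>k\<in>F. f k l) summable_on A \<and> (\<Sum>\<^sub>\<infinity>l\<in>A. \<Sum>k\<in>F. f k l) = (\<Sum>k\<in>F. infsum (f k) A)"
  using assms
proof (induction F rule: finite_induct)
  case (insert a F)
  then show ?case by (simp add: infsum_add summable_on_add)
qed simp

context hankel
begin

lemma Hankel_l1: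
  assumes x: "sum_le (\<lambda>k. cmod (x k)) B"
  shows "sum_le (\<lambda>k. cmod (\<Sum>\<^sub>\<infinity>l. P t (k + l) * x l)) (K * B)"
  unfolding sum_le_def
proof safe
  fix F :: "int set" assume F: "finite F"
  have b: "cmod (P t (k + l) * x l) \<le> K * cmod (x l)" for k l
    using mult_right_mono[OF order_trans[OF Pc[of t "k + l"] sum_le_point[OF sum_c]], of "cmod (x l)"] by (simp add: norm_mult)
  note s = sum_le_norm[OF sum_le_cmult[OF x K0(1)] b]
  have "(\<Sum>k\<in>F. cmod (\<Sum>\<^sub>\<infinity>l. P t (k + l) * x l)) \<le> (\<Sum>k\<in>F. \<Sum>\<^sub>\<infinity>l. cmod (P t (k + l) * x l))"
    by (intro sum_mono norm_infsum_bound s(1))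
  also have "\<dots> = (\<Sum>\<^sub>\<infinity>l. \<Sum>k\<in>F. cmod (P t (k + l) * x l))"
    using infsum_finite_sum[OF F, of "\<lambda>k l. cmod (P t (k + l) * x l)" UNIV] s(1) by simp
  also have "\<dots> \<le> K * B"
  proof (rule sum_le_infsum[OF sum_le_mono[OF sum_le_cmult[OF x K0(1)]]])
    fix l
    have "(\<Sum>k\<in>F. cmod (P t (k + l) * x l)) \<le> (\<Sum>k\<in>F. c (l + k)) * cmod (x l)"
      unfolding sum_distrib_right norm_mult
      by (intro sum_mono mult_right_mono) (use Pc in \<open>auto simp: add.commute\<close>)
    also have "\<dots> \<le> K * cmod (x l)"
      using sum_c_shift[of l] F by (intro mult_right_mono) (auto simp: sum_le_def)
    finally show "(\<Sum>k\<in>F. cmod (P t (k + l) * x l)) \<le> K * cmod (x l)" .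
  qed (auto intro: sum_nonneg)
  finally show "(\<Sum>k\<in>F. cmod (\<Sum>\<^sub>\<infinity>l. P t (k + l) * x l)) \<le> K * B" .
qed simp

context
  fixes n Y U
  assumes ric: "riccati n Y U" and large: "n_plane \<le> \<bar>real_of_int n\<bar>"
begin

lemmas decay_facts = nb[OF ric large] n0[OF ric large] n_pos[OF ric large] n1[OF ric large]
  Y_bound[OF ric large] U_bound[OF ric large] U_bound_v[OF ric large] Y_n[OF ric large] U_n[OF ric large]

lemma Y_l1: "sum_le (\<lambda>l. cmod (Y s l)) (R * (recip_const + recip_const))"
proof (rule sum_le_mono[OF sum_le_cmult[OF sum_le_amgm[OF sum_le_shift(3)[OF recip_sq_le, of n] sum_le_shift(1)[OF recip1_sq_le, of n]] R_nonneg]])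
  fix l
  have "wY n l \<le> recip (n - l) * recip1 (n + l)" unfolding wY_def by (intro mult_left_mono v_le_recip1) auto
  from order_trans[OF decay_facts(5) mult_left_mono[OF this R_nonneg]]
  show "cmod (Y s l) \<le> R * (recip (n - l) * recip1 (n + l))" .
qed auto

lemma U_l1: "\<exists>B. sum_le (\<lambda>k. cmod (U s k)) B"
proof -
  have S: "sum_le (\<lambda>k. cmod (\<Sum>\<^sub>\<infinity>l. P (\<not> s) (k + l) * Y s l) + cmod (diag_entry n Y s) * (recip (n - k) * recip1 (n - k)) + cmod (off_entry n U s) * cmod (Y (\<not> s) k))
    (K * (R * (recip_const + recip_const)) + cmod (diag_entry n Y s) * (recip_const + recip_const) + cmod (off_entry n U s) * (R * (recip_const + recip_const)))"
    by (intro sum_le_add Hankel_l1 Y_l1 sum_le_cmult sum_le_amgm sum_le_shift(3)[OF recip_sq_le] sum_le_shift(3)[OF recip1_sq_le]) auto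
  have "cmod (U s k) \<le> cmod (\<Sum>\<^sub>\<infinity>l. P (\<not> s) (k + l) * Y s l) + cmod (diag_entry n Y s) * (recip (n - k) * recip1 (n - k)) + cmod (off_entry n U s) * cmod (Y (\<not> s) k)" for k
  proof -
    let ?S = "\<Sum>\<^sub>\<infinity>l. P (\<not> s) (k + l) * Y s l"
    have "cmod (U s k) = cmod (FU n Y U s k)" using ric unfolding riccati_def by metis
    also have "\<dots> = cmod (1 / complex_of_real (pi * real_of_int (n - k))) * cmod (?S - diag_entry n Y s * U s k - off_entry n U s * Y (\<not> s) k)"
      by (simp only: FU_def norm_mult)
    also have "\<dots> \<le> recip (n - k) * (cmod ?S + cmod (diag_entry n Y s) * cmod (U s k) + cmod (off_entry n U s) * cmod (Y (\<not> s) k))"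
      by (intro mult_mono resolvent_le_recip) (auto simp: norm_mult[symmetric] intro!: order_trans[OF norm_triangle_ineq4] add_mono)
    also have "\<dots> = recip (n - k) * cmod ?S + cmod (diag_entry n Y s) * (recip (n - k) * cmod (U s k)) + recip (n - k) * (cmod (off_entry n U s) * cmod (Y (\<not> s) k))"
      by (simp add: algebra_simps)
    also have "\<dots> \<le> 1 * cmod ?S + cmod (diag_entry n Y s) * (recip (n - k) * recip1 (n - k)) + 1 * (cmod (off_entry n U s) * cmod (Y (\<not> s) k))"
      by (intro add_mono mult_right_mono mult_left_mono recip_le1 order_trans[OF decay_facts(7) v_le_recip1]) auto
    finally show ?thesis by simp
  qed
  from sum_le_mono[OF S _ this order_refl] show ?thesis by auto
qed

lemma col_l1: "\<exists>B. \<forall>t. sum_le (\<lambda>k. cmod (plane_col n Y U s t k)) B"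
proof -
  obtain B where B: "sum_le (\<lambda>k. cmod (U s k)) B" using U_l1 by blast
  have B0: "0 \<le> B" by (rule sum_le_bound_nonneg[OF B])
  have d: "sum_le (\<lambda>k. if k = n then 1 else 0 :: real) 1"
    unfolding sum_le_def by (auto simp: sum.delta)
  have "sum_le (\<lambda>k. (if k = n then 1 else 0) + cmod (U s k) + cmod (Y s k)) (1 + B + R * (recip_const + recip_const))"
    by (intro sum_le_add d B Y_l1)
  moreover have "cmod (plane_col n Y U s t k) \<le> (if k = n then 1 else 0) + cmod (U s k) + cmod (Y s k)" for t k
    by (auto simp: plane_col_def intro: order_trans[OF norm_triangle_ineq])
  ultimately have "sum_le (\<lambda>k. cmod (plane_col n Y U s t k)) (1 + B + R * (recip_const + recip_const))" for t
    using sum_le_mono[of "\<lambda>k. (if k = n then 1 else 0) + cmod (U s k) + cmod (Y s k)" "1 + B + R * (recip_const + recip_const)"] by simp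
  then show ?thesis by blast
qed

text \<open>By the invariance of the plane, \<open>\<pi> k\<close> times a column is a combination of the columns and of the Hankel matrix
applied to a column, both of which are absolutely summable.\<close>

lemma col_l1': "\<exists>B. \<forall>t. sum_le (\<lambda>k. cmod (complex_of_real (pi * real_of_int k) * plane_col n Y U s t k)) B"
proof -
  obtain B where B: "\<And>s t. sum_le (\<lambda>k. cmod (plane_col n Y U s t k)) (B s)" using col_l1 by metis
  let ?a = "complex_of_real (pi * real_of_int n) + diag_entry n Y s"
  have S: "sum_le (\<lambda>k. cmod ?a * cmod (plane_col n Y U s t k) + cmod (off_entry n U s) * cmod (plane_col n Y U (\<not> s) t k)
       + cmod (\<Sum>\<^sub>\<infinity>l. P t (k + l) * plane_col n Y U s (\<not> t) l)) (cmod ?a * B s + cmod (off_entry n U s) * B (\<not> s) + K * B s)" for t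
    by (intro sum_le_add sum_le_cmult Hankel_l1 B) auto
  have "cmod (complex_of_real (pi * real_of_int k) * plane_col n Y U s t k) \<le> cmod ?a * cmod (plane_col n Y U s t k)
      + cmod (off_entry n U s) * cmod (plane_col n Y U (\<not> s) t k) + cmod (\<Sum>\<^sub>\<infinity>l. P t (k + l) * plane_col n Y U s (\<not> t) l)" for t k
  proof -
    have "complex_of_real (pi * real_of_int k) * plane_col n Y U s t k = ?a * plane_col n Y U s t k + off_entry n U s * plane_col n Y U (\<not> s) t k
        - (\<Sum>\<^sub>\<infinity>l. P t (k + l) * plane_col n Y U s (\<not> t) l)"
      using F_invariant[OF ric large, of s t k] by (simp add: seq_op_def algebra_simps)
    then have "cmod (complex_of_real (pi * real_of_int k) * plane_col n Y U s t k) = cmod (?a * plane_col n Y U s t k + off_entry n U s * plane_col n Y U (\<not> s) t k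
        - (\<Sum>\<^sub>\<infinity>l. P t (k + l) * plane_col n Y U s (\<not> t) l))" by (simp only:)
    also have "\<dots> \<le> cmod (?a * plane_col n Y U s t k) + cmod (off_entry n U s * plane_col n Y U (\<not> s) t k) + cmod (\<Sum>\<^sub>\<infinity>l. P t (k + l) * plane_col n Y U s (\<not> t) l)"
      by (intro order_trans[OF norm_triangle_ineq4] add_mono norm_triangle_ineq order_refl)
    finally show ?thesis by (simp add: norm_mult)
  qed
  from sum_le_mono[OF S _ this order_refl] show ?thesis by auto
qed

end

end

section \<open>Root spaces of a two by two matrix\<close>

definition mat2 :: "(bool \<Rightarrow> complex) \<Rightarrow> (bool \<Rightarrow> complex) \<Rightarrow> complex \<Rightarrow> (bool \<Rightarrow> complex) \<Rightarrow> bool \<Rightarrow> complex" where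
  "mat2 p q z v s = (p s - z) * v s + q (\<not> s) * v (\<not> s)"

text \<open>A two by two matrix, given by trace and determinant through the roots of its characteristic polynomial.\<close>

locale two_roots =
  fixes p q :: "bool \<Rightarrow> complex" and z1 z2 :: complex
  assumes trace: "z1 + z2 = p True + p False" and det: "z1 * z2 = p True * p False - q True * q False"
begin

abbreviation "A \<equiv> mat2 p q"

lemma flip: "two_roots p q z2 z1"
  using trace det by unfold_locales (simp_all add: add.commute mult.commute)

lemma A_shift: "A z v s = A z' v s + (z' - z) * v s"
  by (simp add: mat2_def algebra_simps)

lemma A_0 [simp]: "A z (\<lambda>_. 0) = (\<lambda>_. 0)"
  by (auto simp: mat2_def)

lemma A_scale: "A z (\<lambda>s. a * v s) = (\<lambda>s. a * A z v s)"
  by (auto simp: mat2_def algebra_simps)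

lemma cayley_hamilton: "A z1 (A z2 v) = (\<lambda>_. 0)"
proof
  fix s
  have t: "p s + p (\<not> s) = z1 + z2" using trace by (cases s) auto
  have d: "z1 * z2 = p s * p (\<not> s) - q s * q (\<not> s)" using det by (cases s) auto
  have e: "z2 = p s + p (\<not> s) - z1" using t by simp
  have d': "z1 * (p s + p (\<not> s) - z1) = p s * p (\<not> s) - q s * q (\<not> s)" using d unfolding e .
  have "A z1 (A z2 v) s = v s * ((p s - z1) * (p s - z2) + q s * q (\<not> s)) + q (\<not> s) * v (\<not> s) * (p s + p (\<not> s) - z1 - z2)"
    by (simp add: mat2_def algebra_simps)
  also have "(p s - z1) * (p s - z2) + q s * q (\<not> s) = z1 * (p s + p (\<not> s) - z1) - (p s * p (\<not> s) - q s * q (\<not> s))"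
    unfolding e by (simp add: algebra_simps)
  finally show "A z1 (A z2 v) s = 0" using d' t by simp
qed

definition root :: "complex \<Rightarrow> (bool \<Rightarrow> complex) set" where
  "root z = {v. \<exists>k. (A z ^^ k) v = (\<lambda>_. 0)}"

text \<open>The Cayley-Hamilton identity makes every eigenvalue a root of the characteristic polynomial.\<close>

lemma root_other:
  assumes "z \<noteq> z1" "z \<noteq> z2"
  shows "root z = {\<lambda>_. 0}"
proof -
  have inj: "v = (\<lambda>_. 0)" if "A z v = (\<lambda>_. 0)" for v
  proof
    fix s
    have 2: "A z2 v = (\<lambda>s. (z - z2) * v s)"
    proof
      fix s show "A z2 v s = (z - z2) * v s" using A_shift[of z2 v s z] that by simp
    qed
    have "0 = A z1 (A z2 v) s" by (simp add: cayley_hamilton)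
    also have "\<dots> = (z - z2) * A z1 v s" unfolding 2 A_scale ..
    also have "A z1 v s = (z - z1) * v s" using A_shift[of z1 v s z] that by simp
    finally show "v s = 0" using assms by simp
  qed
  have "v = (\<lambda>_. 0)" if "(A z ^^ k) v = (\<lambda>_. 0)" for k v
    using that by (induction k) (auto dest: inj)
  moreover have "(A z ^^ 0) (\<lambda>_. 0) = (\<lambda>_. 0)" by simp
  ultimately show ?thesis unfolding root_def by blast
qed

lemma root_double:
  assumes "z1 = z2" shows "root z1 = UNIV"
proof -
  have "(A z1 ^^ 2) v = (\<lambda>_. 0)" for v using cayley_hamilton[of v] assms by (simp add: numeral_2_eq_2)
  then show ?thesis unfolding root_def by blast
qed

text \<open>For different roots \<open>A z2\<close> is not zero, any vector \<open>e \<noteq> 0\<close> in its image lies in the kernel of \<open>A z1\<close>, and this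
kernel is the line through \<open>e\<close>. On the image of \<open>A z1\<close> the map \<open>A z1\<close> is multiplication by \<open>z2 - z1\<close>, so its powers have no larger
kernel.\<close>

lemma root_simple:
  assumes "z1 \<noteq> z2" shows "\<exists>e. e \<noteq> (\<lambda>_. 0) \<and> root z1 = {v. \<exists>a. v = (\<lambda>s. a * e s)}"
proof -
  interpret fl: two_roots p q z2 z1 by (rule flip)
  have ker: "A z1 v = (\<lambda>_. 0)" if "(A z1 ^^ k) v = (\<lambda>_. 0)" for k v
  proof -
    define w where "w = A z1 v"
    have w: "A z1 w = (\<lambda>s. (z2 - z1) * w s)"
    proof
      fix s show "A z1 w s = (z2 - z1) * w s"
        using A_shift[of z1 w s z2] fl.cayley_hamilton[of v] by (simp add: w_def)
    qed
    have "(A z1 ^^ j) w = (\<lambda>s. (z2 - z1) ^ j * w s)" for j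
    proof (induction j)
      case (Suc j)
      have "(A z1 ^^ Suc j) w = (\<lambda>s. (z2 - z1) ^ j * A z1 w s)" by (simp add: Suc A_scale)
      then show ?case unfolding w by (auto simp: mult_ac)
    qed simp
    moreover have "(A z1 ^^ k) w = (\<lambda>_. 0)"
    proof -
      have "(A z1 ^^ k) w = A z1 ((A z1 ^^ k) v)" unfolding w_def by (rule funpow_swap1[symmetric])
      then show ?thesis using that by simp
    qed
    ultimately have "(\<lambda>s. (z2 - z1) ^ k * w s) = (\<lambda>_. 0)" by simp
    then have "(z2 - z1) ^ k * w s = 0" for s by meson
    then show ?thesis using assms by (auto simp: w_def[symmetric])
  qed
  then have root: "root z1 = {v. A z1 v = (\<lambda>_. 0)}"
    unfolding root_def by (auto dest: ker intro: exI[of _ "Suc 0"])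
  obtain u where u: "A z2 u \<noteq> (\<lambda>_. 0)"
  proof (rule ccontr)
    assume "\<not> thesis"
    then have z: "A z2 u = (\<lambda>_. 0)" for u using that by blast
    have "p s = z2" for s using fun_cong[OF z[of "\<lambda>t. if t = s then 1 else 0"], of s] by (cases s) (simp_all add: mat2_def)
    then show False using trace assms by simp
  qed
  define e where "e = A z2 u"
  have e: "e \<noteq> (\<lambda>_. 0)" "A z1 e = (\<lambda>_. 0)" using u cayley_hamilton by (auto simp: e_def)
  have nz: "\<exists>s. p s - z1 \<noteq> 0 \<or> q (\<not> s) \<noteq> 0"
  proof (rule ccontr)
    assume "\<not> ?thesis"
    then have "p True = z1" "p False = z1" by auto
    then show False using trace assms by simp
  qed
  then obtain s where s: "p s - z1 \<noteq> 0 \<or> q (\<not> s) \<noteq> 0" by blast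
  have cross: "v s * e (\<not> s) = v (\<not> s) * e s" if v: "A z1 v = (\<lambda>_. 0)" for v
  proof -
    have 1: "(p s - z1) * v s + q (\<not> s) * v (\<not> s) = 0" using fun_cong[OF v, of s] by (simp add: mat2_def)
    have 2: "(p s - z1) * e s + q (\<not> s) * e (\<not> s) = 0" using fun_cong[OF e(2), of s] by (simp add: mat2_def)
    have "(p s - z1) * (v s * e (\<not> s) - v (\<not> s) * e s) = ((p s - z1) * v s + q (\<not> s) * v (\<not> s)) * e (\<not> s) - v (\<not> s) * ((p s - z1) * e s + q (\<not> s) * e (\<not> s))"
      by (simp add: algebra_simps)
    moreover have "q (\<not> s) * (v s * e (\<not> s) - v (\<not> s) * e s) = v s * ((p s - z1) * e s + q (\<not> s) * e (\<not> s)) - ((p s - z1) * v s + q (\<not> s) * v (\<not> s)) * e s"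
      by (simp add: algebra_simps)
    ultimately show ?thesis using s 1 2 by auto
  qed
  have "\<exists>a. v = (\<lambda>t. a * e t)" if v: "A z1 v = (\<lambda>_. 0)" for v
  proof -
    have all: "P t" if "P s" "P (\<not> s)" for P :: "bool \<Rightarrow> bool" and t using that by (cases s; cases t) auto
    obtain t where "e t \<noteq> 0" using e(1) by auto
    then have "e s \<noteq> 0 \<or> e (\<not> s) \<noteq> 0" using all[of "\<lambda>t. e t = 0" t] by blast
    then show ?thesis
    proof
      assume a: "e s \<noteq> 0"
      have "v t = (v s / e s) * e t" for t
        by (rule all[of "\<lambda>t. v t = (v s / e s) * e t"]) (use a cross[OF v] in \<open>simp_all add: field_simps\<close>)
      then show ?thesis by blast
    next
      assume a: "e (\<not> s) \<noteq> 0"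
      have "v t = (v (\<not> s) / e (\<not> s)) * e t" for t
        by (rule all[of "\<lambda>t. v t = (v (\<not> s) / e (\<not> s)) * e t"]) (use a cross[OF v] in \<open>simp_all add: field_simps\<close>)
      then show ?thesis by blast
    qed
  qed
  moreover have "A z1 (\<lambda>s. a * e s) = (\<lambda>_. 0)" for a by (simp add: A_scale e(2))
  ultimately have "root z1 = {v. \<exists>a. v = (\<lambda>s. a * e s)}" unfolding root by auto
  then show ?thesis using e(1) by blast
qed

end

section \<open>Root spaces of the operator\<close>

interpretation vf: vector_space vecfun_scale
  by (rule vector_space_vecfun_scale)

context zs_potential
begin

context
  fixes n Y U
  assumes ric: "riccati n Y U" and large: "n_plane \<le> \<bar>real_of_int n\<bar>"
begin

text \<open>The invariant plane of the operator, parametrised by the coordinates with respect to its two columns.\<close>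

definition plane_seq :: "(bool \<Rightarrow> complex) \<Rightarrow> bool \<Rightarrow> int \<Rightarrow> complex" where
  "plane_seq u t k = u True * plane_col n Y U True t k + u False * plane_col n Y U False t k"

definition plane_fun :: "(bool \<Rightarrow> complex) \<Rightarrow> vecfun" where
  "plane_fun u = synth (plane_seq u)"

lemma plane_seq_l1: "\<exists>B. \<forall>t. sum_le (\<lambda>k. cmod (plane_seq u t k)) B"
  "\<exists>B. \<forall>t. sum_le (\<lambda>k. cmod (complex_of_real (pi * real_of_int k) * plane_seq u t k)) B"
proof -
  obtain B B' where B: "\<And>s t. sum_le (\<lambda>k. cmod (plane_col n Y U s t k)) (B s)"
    and B': "\<And>s t. sum_le (\<lambda>k. cmod (complex_of_real (pi * real_of_int k) * plane_col n Y U s t k)) (B' s)"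
    using col_l1[OF ric large] col_l1'[OF ric large] by metis
  have "sum_le (\<lambda>k. cmod (plane_seq u t k)) (cmod (u True) * B True + cmod (u False) * B False)" for t
  proof -
    have S: "sum_le (\<lambda>k. cmod (u True) * cmod (plane_col n Y U True t k) + cmod (u False) * cmod (plane_col n Y U False t k))
        (cmod (u True) * B True + cmod (u False) * B False)"
      by (intro sum_le_add sum_le_cmult B) auto
    show ?thesis
      by (rule sum_le_mono[OF S]) (auto simp: plane_seq_def norm_mult[symmetric] intro: norm_triangle_ineq)
  qed
  then show "\<exists>B. \<forall>t. sum_le (\<lambda>k. cmod (plane_seq u t k)) B" by blast
  have "sum_le (\<lambda>k. cmod (complex_of_real (pi * real_of_int k) * plane_seq u t k)) (cmod (u True) * B' True + cmod (u False) * B' False)" for t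
  proof (rule sum_le_mono[OF sum_le_add[OF sum_le_cmult[OF B'] sum_le_cmult[OF B']]])
    fix k
    have "complex_of_real (pi * real_of_int k) * plane_seq u t k = u True * (complex_of_real (pi * real_of_int k) * plane_col n Y U True t k)
       + u False * (complex_of_real (pi * real_of_int k) * plane_col n Y U False t k)" by (simp add: plane_seq_def algebra_simps)
    then show "cmod (complex_of_real (pi * real_of_int k) * plane_seq u t k) \<le> cmod (u True) * cmod (complex_of_real (pi * real_of_int k) * plane_col n Y U True t k)
       + cmod (u False) * cmod (complex_of_real (pi * real_of_int k) * plane_col n Y U False t k)"
      unfolding norm_mult[symmetric] using norm_triangle_ineq by metis
  qed auto
  then show "\<exists>B. \<forall>t. sum_le (\<lambda>k. cmod (complex_of_real (pi * real_of_int k) * plane_seq u t k)) B" by blast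
qed

lemma plane_fun_H1: "\<exists>f. H1_periodic_deriv (plane_fun u) f" and mode_plane_fun: "mode t (plane_fun u) k = plane_seq u t k"
proof -
  obtain B B' where "\<And>t. sum_le (\<lambda>k. cmod (plane_seq u t k)) B"
    "\<And>t. sum_le (\<lambda>k. cmod (complex_of_real (pi * real_of_int k) * plane_seq u t k)) B'"
    using plane_seq_l1[of u] by blast
  note s = synth_H1[OF this]
  show "\<exists>f. H1_periodic_deriv (plane_fun u) f" "mode t (plane_fun u) k = plane_seq u t k"
    unfolding plane_fun_def by (rule s)+
qed

lemma plane_seq_n: "plane_seq u t n = u (\<not> t)"
  by (cases t) (simp_all add: plane_seq_def F_n[OF ric large])

lemma plane_fun_lin: "plane_fun (\<lambda>s. a * u s + b * w s) = vecfun_scale a (plane_fun u) + vecfun_scale b (plane_fun w)"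
proof -
  obtain B B' where "\<And>t. sum_le (\<lambda>k. cmod (plane_seq u t k)) B" "\<And>t. sum_le (\<lambda>k. cmod (plane_seq w t k)) B'"
    using plane_seq_l1(1)[of u] plane_seq_l1(1)[of w] by blast
  from synth_lin[OF this, where a = a and b = b] have "synth (\<lambda>t k. a * plane_seq u t k + b * plane_seq w t k) = vecfun_scale a (plane_fun u) + vecfun_scale b (plane_fun w)"
    by (simp add: plane_fun_def)
  moreover have "(\<lambda>t k. a * plane_seq u t k + b * plane_seq w t k) = plane_seq (\<lambda>s. a * u s + b * w s)"
    by (intro ext) (simp add: plane_seq_def algebra_simps)
  ultimately show ?thesis by (simp add: plane_fun_def)
qed

lemma plane_fun_scale: "plane_fun (\<lambda>s. a * u s) = vecfun_scale a (plane_fun u)"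
  using plane_fun_lin[of a u 0 u] by simp

lemma plane_fun_0: "plane_fun (\<lambda>_. 0) = 0"
  using plane_fun_scale[of 0 "\<lambda>_. 0"] by simp

lemma plane_fun_inj: "plane_fun u = plane_fun w \<Longrightarrow> u = w"
proof
  fix s assume "plane_fun u = plane_fun w"
  then have "plane_seq u (\<not> s) n = plane_seq w (\<not> s) n" using mode_plane_fun by metis
  then show "u s = w s" by (simp add: plane_seq_n)
qed

abbreviation "An \<equiv> mat2 (diag_entry n Y) (off_entry n U)"

lemma seq_op_plane: "seq_op (plane_seq u) t k - (complex_of_real (pi * real_of_int n) + z) * plane_seq u t k = plane_seq (An z u) t k"
proof -
  have "seq_op (plane_seq u) t k = u True * seq_op (plane_col n Y U True) t k + u False * seq_op (plane_col n Y U False) t k"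
    using seq_op_comb[OF ric large, of "u True" "u False" t k] by (simp add: plane_seq_def[abs_def])
  then show ?thesis
    unfolding F_invariant[OF ric large] by (simp add: plane_seq_def mat2_def algebra_simps)
qed

text \<open>By induction on \<open>k\<close>: if \<open>(L - \<mu>) F\<close> is in the plane, then so is \<open>F\<close>, by \<open>in_plane\<close>; on the plane the operator
is the two by two matrix.\<close>

lemma ZS_kernel_eq:
  assumes z: "\<bar>Re z\<bar> \<le> pi / 2"
  shows "ZS_kernel \<phi> (complex_of_real (pi * real_of_int n) + z) k = plane_fun ` {u. (An z ^^ k) u = (\<lambda>_. 0)}"
proof (induction k)
  case 0
  have "plane_fun (\<lambda>_. 0) = (\<lambda>x. 0)" using plane_fun_0 by (simp add: zero_fun_def)
  then show ?case by auto
next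
  case (Suc k)
  let ?\<mu> = "complex_of_real (pi * real_of_int n) + z"
  have \<mu>: "\<bar>Re ?\<mu> - pi * real_of_int n\<bar> \<le> pi / 2" using z by simp
  have swap: "(An z ^^ Suc k) u = (An z ^^ k) (An z u)" for u by (simp only: funpow_Suc_right o_apply)
  show ?case
  proof (intro equalityI subsetI)
    fix F assume "F \<in> ZS_kernel \<phi> ?\<mu> (Suc k)"
    then obtain f G where f: "H1_periodic_deriv F f" and G: "G \<in> ZS_kernel \<phi> ?\<mu> k"
      and eq: "AE x in lebesgue_on {0..2}. ZS_op \<phi> F f x - vecfun_scale ?\<mu> F x = G x" by auto
    obtain w where w: "G = plane_fun w" "(An z ^^ k) w = (\<lambda>_. 0)" using G unfolding Suc.IH by blast
    obtain g where g: "H1_periodic_deriv G g" using plane_fun_H1[of w] w(1) by blast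
    have e: "seq_op (\<lambda>t. mode t F) t k - ?\<mu> * mode t F k = w True * plane_col n Y U True t k + w False * plane_col n Y U False t k" for t k
      using modes_of_kernel_eq[OF f g eq, of t k] unfolding w(1) mode_plane_fun plane_seq_def .
    obtain S where S: "\<And>t k. cmod (mode t F k) \<le> S" using mode_bounded[OF f] by blast
    define u where "u s = mode (\<not> s) F n" for s
    have cF: "mode t F k = plane_seq u t k" for t k
      using in_plane[where x = "\<lambda>t. mode t F", OF ric large \<mu> S e, of t k] by (simp add: u_def plane_seq_def)
    obtain g' where g': "H1_periodic_deriv (plane_fun u) g'" using plane_fun_H1 by blast
    have F: "F = plane_fun u" by (rule mode_inject[OF f g']) (simp add: cF mode_plane_fun)
    have "plane_seq (An z u) t n = plane_seq w t n" for t
    proof -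
      have "(\<lambda>t. mode t F) = plane_seq u" using cF by (intro ext)
      then have "seq_op (plane_seq u) t n - ?\<mu> * plane_seq u t n = plane_seq w t n" using e[of t n] unfolding plane_seq_def[of w, symmetric] cF by simp
      then show ?thesis using seq_op_plane[of u t n z] by (simp only:)
    qed
    then have zw: "plane_seq (An z u) t n = plane_seq w t n" for t .
    have "An z u = w"
    proof
      fix s show "An z u s = w s" using zw[of "\<not> s"] unfolding plane_seq_n by simp
    qed
    then have "(An z ^^ Suc k) u = (\<lambda>_. 0)" unfolding swap using w(2) by simp
    then show "F \<in> plane_fun ` {u. (An z ^^ Suc k) u = (\<lambda>_. 0)}" using F by blast
  next
    fix F assume "F \<in> plane_fun ` {u. (An z ^^ Suc k) u = (\<lambda>_. 0)}"
    then obtain u where F: "F = plane_fun u" and u: "(An z ^^ k) (An z u) = (\<lambda>_. 0)" unfolding swap by blast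
    obtain f g where f: "H1_periodic_deriv (plane_fun u) f" and g: "H1_periodic_deriv (plane_fun (An z u)) g"
      using plane_fun_H1 by blast
    have "AE x in lebesgue_on {0..2}. ZS_op \<phi> (plane_fun u) f x - vecfun_scale ?\<mu> (plane_fun u) x = plane_fun (An z u) x"
    proof (rule kernel_eq_of_modes[OF f g])
      fix t k show "seq_op (\<lambda>t. mode t (plane_fun u)) t k - ?\<mu> * mode t (plane_fun u) k = mode t (plane_fun (An z u)) k"
        unfolding mode_plane_fun using seq_op_plane[of u t k z] by (simp add: mode_plane_fun[abs_def] eta_contract_eq)
    qed
    moreover have "plane_fun (An z u) \<in> ZS_kernel \<phi> ?\<mu> k" unfolding Suc.IH using u by blast
    ultimately show "F \<in> ZS_kernel \<phi> ?\<mu> (Suc k)" using f F by auto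
  qed
qed

lemma dim_plane_line:
  assumes "V = plane_fun ` {u. \<exists>a. u = (\<lambda>s. a * e s)}" "e \<noteq> (\<lambda>_. 0)"
  shows "vf.dim V = 1"
proof -
  have ne: "plane_fun e \<noteq> 0" using plane_fun_inj[of e "\<lambda>_. 0"] assms(2) plane_fun_0 by auto
  have "V = vf.span {plane_fun e}"
    unfolding assms(1) vf.span_singleton by (auto simp: plane_fun_scale[symmetric])
  then have "vf.span {plane_fun e} = vf.span V" by (simp add: vf.span_span)
  from vf.dim_eq_card[OF this] show ?thesis using ne by (simp add: vf.dependent_single)
qed

lemma dim_plane: "vf.dim (plane_fun ` UNIV) = 2"
proof -
  let ?e1 = "\<lambda>s. if s then 1 else 0 :: complex" and ?e2 = "\<lambda>s. if s then 0 else 1 :: complex"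
  have dec: "plane_fun u = vecfun_scale (u True) (plane_fun ?e1) + vecfun_scale (u False) (plane_fun ?e2)" for u
  proof -
    have "(\<lambda>s. u True * ?e1 s + u False * ?e2 s) = u" by (auto simp: fun_eq_iff)
    then show ?thesis using plane_fun_lin[of "u True" ?e1 "u False" ?e2] by simp
  qed
  have ne: "plane_fun ?e2 \<noteq> 0"
  proof
    assume "plane_fun ?e2 = 0"
    then have "?e2 = (\<lambda>_. 0)" using plane_fun_inj[of ?e2 "\<lambda>_. 0"] plane_fun_0 by simp
    from fun_cong[OF this, of False] show False by simp
  qed
  have nin: "plane_fun ?e1 \<notin> vf.span {plane_fun ?e2}"
  proof
    assume "plane_fun ?e1 \<in> vf.span {plane_fun ?e2}"
    then obtain a where "plane_fun ?e1 = plane_fun (\<lambda>s. a * ?e2 s)" unfolding vf.span_singleton plane_fun_scale by blast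
    then have "?e1 = (\<lambda>s. a * ?e2 s)" by (rule plane_fun_inj)
    from fun_cong[OF this, of True] show False by simp
  qed
  have neq: "plane_fun ?e1 \<noteq> plane_fun ?e2" using nin vf.span_base[of "plane_fun ?e2" "{plane_fun ?e2}"] by auto
  have ind: "vf.independent {plane_fun ?e1, plane_fun ?e2}"
    using nin ne by (intro vf.independent_insertI) (auto simp: vf.dependent_single vf.independent_empty)
  have "range plane_fun \<subseteq> vf.span {plane_fun ?e1, plane_fun ?e2}"
  proof
    fix x assume "x \<in> range plane_fun"
    then obtain u where "x = plane_fun u" by blast
    then have "x = vecfun_scale (u True) (plane_fun ?e1) + vecfun_scale (u False) (plane_fun ?e2)" using dec by metis
    then show "x \<in> vf.span {plane_fun ?e1, plane_fun ?e2}" by (simp add: vf.span_add vf.span_scale vf.span_base)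
  qed
  moreover have "{plane_fun ?e1, plane_fun ?e2} \<subseteq> vf.span (range plane_fun)" by (auto intro: vf.span_base)
  ultimately have "vf.span {plane_fun ?e1, plane_fun ?e2} = vf.span (range plane_fun)"
    unfolding vf.span_eq by blast
  from vf.dim_eq_card[OF this ind] show ?thesis using neq by simp
qed

lemma alg_mult_strip:
  assumes roots: "two_roots (diag_entry n Y) (off_entry n U) z1 z2" and z: "\<bar>Re z\<bar> \<le> pi / 2"
  shows "ZS_alg_mult \<phi> (complex_of_real (pi * real_of_int n) + z) = (if z = z1 then 1 else 0) + (if z = z2 then 1 else 0)"
proof -
  interpret a: two_roots "diag_entry n Y" "off_entry n U" z1 z2 by (rule roots)
  interpret b: two_roots "diag_entry n Y" "off_entry n U" z2 z1 by (rule a.flip)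
  have U: "(\<Union>k. ZS_kernel \<phi> (complex_of_real (pi * real_of_int n) + z) k) = plane_fun ` a.root z"
    unfolding ZS_kernel_eq[OF z] a.root_def by blast
  show ?thesis
  proof (cases "z = z1 \<or> z = z2")
    case False
    then have "a.root z = {\<lambda>_. 0}" by (intro a.root_other) auto
    then have "ZS_alg_mult \<phi> (complex_of_real (pi * real_of_int n) + z) = vf.dim {0}"
      unfolding ZS_alg_mult_def U by (simp add: plane_fun_0)
    also have "\<dots> = 0" using vf.dim_eq_card[of "{}" "{0}"] by (simp add: vf.independent_empty)
    finally show ?thesis using False by simp
  next
    case True
    show ?thesis
    proof (cases "z1 = z2")
      case eq: True
      then have "a.root z = UNIV" using True a.root_double by auto
      then show ?thesis using True eq unfolding ZS_alg_mult_def U by (simp add: dim_plane)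
    next
      case False
      have "\<exists>e. e \<noteq> (\<lambda>_. 0) \<and> a.root z = {u. \<exists>a. u = (\<lambda>s. a * e s)}"
        using True a.root_simple[OF False] b.root_simple False by auto
      then obtain e where e: "e \<noteq> (\<lambda>_. 0)" "a.root z = {u. \<exists>a. u = (\<lambda>s. a * e s)}" by blast
      have "ZS_alg_mult \<phi> (complex_of_real (pi * real_of_int n) + z) = 1"
        unfolding ZS_alg_mult_def U using dim_plane_line[OF _ e(1)] e(2) by simp
      then show ?thesis using True False by auto
    qed
  qed
qed

end

end

section \<open>Numbering the eigenvalues\<close>

text \<open>Descending induction from the region where \<open>s j = j div 2\<close>: if the indices with \<open>s j > m\<close> are exactly those
from \<open>2 (m + 1)\<close> on, then the two indices with \<open>s j = m\<close> are the two just below, by monotonicity.\<close>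

lemma monotone_blocks_upper:
  fixes s :: "int \<Rightarrow> int"
  assumes mono: "mono s" and J: "\<And>j. J \<le> \<bar>j\<bar> \<Longrightarrow> s j = j div 2"
    and two: "\<And>m. n \<le> m \<Longrightarrow> card {j. s j = m} = 2"
  shows "{j. s j = n} = {2 * n, 2 * n + 1}"
proof -
  have step: "{j. s j = m} = {2 * m, 2 * m + 1}" if m: "n \<le> m" and up: "{j. m + 1 \<le> s j} = {2 * (m + 1)..}" for m
  proof -
    let ?S = "{j. s j = m}"
    have c: "card ?S = 2" by (rule two[OF m])
    then have fin: "finite ?S" by (metis card.infinite zero_neq_numeral)
    have lt: "j < 2 * (m + 1)" if "s j = m" for j
    proof (rule ccontr)
      assume "\<not> ?thesis"
      then have "j \<in> {j. m + 1 \<le> s j}" unfolding up by simp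
      then show False using that by simp
    qed
    have inS: "j' \<in> ?S" if "s j = m" "j \<le> j'" "j' < 2 * (m + 1)" for j j'
    proof -
      have "m \<le> s j'" using monoD[OF mono that(2)] that(1) by simp
      moreover have "j' \<notin> {j. m + 1 \<le> s j}" unfolding up using that(3) by simp
      ultimately show ?thesis by simp
    qed
    have "?S \<noteq> {}" using c by (metis card.empty zero_neq_numeral)
    then obtain j where j: "s j = m" by auto
    have 1: "2 * m + 1 \<in> ?S" using inS[OF j, of "2 * m + 1"] lt[OF j] by simp
    have "?S \<noteq> {2 * m + 1}" using c by auto
    then obtain j' where j': "s j' = m" "j' \<noteq> 2 * m + 1" using 1 by auto
    then have 2: "2 * m \<in> ?S" using inS[OF j'(1), of "2 * m"] lt[OF j'(1)] by simp
    have "{2 * m, 2 * m + 1} \<subseteq> ?S" using 1 2 by blast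
    moreover have "card {2 * m, 2 * m + 1} = card ?S" using c by simp
    ultimately show ?thesis using card_subset_eq[OF fin] by metis
  qed
  have claim: "{j. m \<le> s j} = {2 * m..}" if "n \<le> m" for m
  proof -
    \<comment> \<open>an index from which on \<open>s\<close> is explicit; the claim descends from there\<close>
  define B where "B = max (max m (\<bar>J\<bar> + 1)) 1"
    have top: "{j. B \<le> s j} = {2 * B..}"
    proof (intro equalityI subsetI)
      fix j assume j: "j \<in> {2 * B..}"
      moreover have "\<bar>J\<bar> + 1 \<le> B" by (simp add: B_def)
      ultimately have "J \<le> \<bar>j\<bar>" by simp
      then have "s j = j div 2" by (rule J)
      then show "j \<in> {j. B \<le> s j}" using j by simp
    next
      fix j assume j: "j \<in> {j. B \<le> s j}"
      show "j \<in> {2 * B..}"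
      proof (rule ccontr)
        assume "j \<notin> {2 * B..}"
        then have "j \<le> 2 * B - 1" by simp
        then have "s j \<le> s (2 * B - 1)" by (rule monoD[OF mono])
        also have "s (2 * B - 1) = (2 * B - 1) div 2" 
        proof (rule J)
          have "\<bar>J\<bar> + 1 \<le> B" by (simp add: B_def)
          then show "J \<le> \<bar>2 * B - 1\<bar>" by linarith
        qed
        also have "\<dots> < B" by simp
        finally show False using j by simp
      qed
    qed
    have "m \<le> B" by (auto simp: B_def)
    then show ?thesis using that
    proof (induction m rule: int_le_induct)
      case base show ?case by (rule top)
    next
      case (step i)
      have up: "{j. (i - 1) + 1 \<le> s j} = {2 * ((i - 1) + 1)..}" using step.IH step.prems by simp
      have "{j. i - 1 \<le> s j} = {j. s j = i - 1} \<union> {j. (i - 1) + 1 \<le> s j}" by auto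
      also have "\<dots> = {2 * (i - 1), 2 * (i - 1) + 1} \<union> {2 * ((i - 1) + 1)..}"
        using \<open>\<And>m. n \<le> m \<Longrightarrow> {j. m + 1 \<le> s j} = {2 * (m + 1)..} \<Longrightarrow> {j. s j = m} = {2 * m, 2 * m + 1}\<close>[OF step.prems up] up by simp
      also have "\<dots> = {2 * (i - 1)..}" by auto
      finally show ?case .
    qed
  qed
  show ?thesis by (rule step[OF order_refl claim]) simp
qed

lemma monotone_blocks:
  fixes s :: "int \<Rightarrow> int"
  assumes mono: "mono s" and J: "\<And>j. J \<le> \<bar>j\<bar> \<Longrightarrow> s j = j div 2"
    and n0: "0 < n0" and two: "\<And>m. n0 \<le> \<bar>m\<bar> \<Longrightarrow> card {j. s j = m} = 2" and n: "n0 \<le> \<bar>n\<bar>"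
  shows "{j. s j = n} = {2 * n, 2 * n + 1}"
proof (cases "0 \<le> n")
  case True
  then show ?thesis using n by (intro monotone_blocks_upper[OF mono J] two) auto
next
  case False
  \<comment> \<open>the reflection \<open>j \<mapsto> 1 - j\<close> exchanges the blocks of \<open>n\<close> and \<open>- n\<close>\<close>
  define s' where "s' j = - s (1 - j)" for j
  have set: "{j. s' j = m} = (\<lambda>j. 1 - j) ` {j. s j = - m}" for m
  proof (intro equalityI subsetI)
    fix j assume "j \<in> {j. s' j = m}"
    then have "1 - j \<in> {j. s j = - m}" by (auto simp: s'_def)
    then show "j \<in> (\<lambda>j. 1 - j) ` {j. s j = - m}" by (rule rev_image_eqI) simp
  qed (auto simp: s'_def)
  have "{j. s' j = - n} = {2 * (- n), 2 * (- n) + 1}"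
  proof (rule monotone_blocks_upper)
    show "mono s'" using mono by (auto simp: s'_def mono_def)
    show "s' j = j div 2" if "\<bar>J\<bar> + 1 \<le> \<bar>j\<bar>" for j
    proof -
      have "s (1 - j) = (1 - j) div 2" using that by (intro J) linarith
      then show ?thesis unfolding s'_def by presburger
    qed
    show "card {j. s' j = m} = 2" if "- n \<le> m" for m
    proof -
      have "card {j. s j = - m} = 2" using that n False by (intro two) linarith
      then show ?thesis unfolding set by (subst card_image) (auto simp: inj_on_def)
    qed
  qed
  then have e: "(\<lambda>j. 1 - j) ` {j. s j = n} = {- (2 * n), 1 - 2 * n}" unfolding set by simp
  have "{j. s j = n} = (\<lambda>j. 1 - j) ` ((\<lambda>j. 1 - j) ` {j. s j = n})" by (simp add: image_image)
  also have "\<dots> = {2 * n, 2 * n + 1}" unfolding e by auto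
  finally show ?thesis .
qed

text \<open>The index \<open>n\<close> of the strip \<open>\<bar>Re \<mu> - \<pi> n\<bar> \<le> \<pi> / 2\<close>, with the right boundary line assigned to the next strip.\<close>

definition strip :: "complex \<Rightarrow> int" where
  "strip \<mu> = \<lfloor>Re \<mu> / pi + 1 / 2\<rfloor>"

lemma strip_D: "strip \<mu> = n \<Longrightarrow> \<bar>Re \<mu> - pi * real_of_int n\<bar> \<le> pi / 2"
proof -
  assume "strip \<mu> = n"
  then have "real_of_int n \<le> Re \<mu> / pi + 1 / 2" "Re \<mu> / pi + 1 / 2 < real_of_int n + 1"
    unfolding strip_def by linarith+
  then have "pi * real_of_int n \<le> pi * (Re \<mu> / pi + 1 / 2)" "pi * (Re \<mu> / pi + 1 / 2) \<le> pi * (real_of_int n + 1)"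
    by (intro mult_left_mono; simp)+
  then have "pi * real_of_int n \<le> Re \<mu> + pi / 2" "Re \<mu> + pi / 2 \<le> pi * real_of_int n + pi"
    by (simp_all add: algebra_simps)
  then show ?thesis by linarith
qed

lemma strip_I: "\<bar>Re \<mu> - pi * real_of_int n\<bar> < pi / 2 \<Longrightarrow> strip \<mu> = n"
proof -
  assume a: "\<bar>Re \<mu> - pi * real_of_int n\<bar> < pi / 2"
  then have "pi * real_of_int n \<le> Re \<mu> + pi / 2" "Re \<mu> + pi / 2 < pi * real_of_int n + pi" by linarith+
  then have "real_of_int n \<le> (Re \<mu> + pi / 2) / pi" "(Re \<mu> + pi / 2) / pi < real_of_int n + 1"
    by (simp_all add: le_divide_eq divide_less_eq algebra_simps)
  moreover have "(Re \<mu> + pi / 2) / pi = Re \<mu> / pi + 1 / 2" by (simp add: add_divide_distrib)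
  ultimately show ?thesis unfolding strip_def by (intro floor_unique) auto
qed

lemma strip_mono: "lex_le a b \<Longrightarrow> strip a \<le> strip b"
  unfolding strip_def lex_le_def by (intro floor_mono add_right_mono divide_right_mono) auto

lemma summable_finite_large:
  fixes f :: "int \<Rightarrow> real"
  assumes f: "f summable_on UNIV" "\<And>x. 0 \<le> f x"
  shows "finite {x. 1 \<le> f x}"
proof (rule ccontr)
  assume inf: "infinite {x. 1 \<le> f x}"
  obtain m :: nat where m: "infsum f UNIV < real m" using reals_Archimedean2 by blast
  obtain T where T: "T \<subseteq> {x. 1 \<le> f x}" "finite T" "card T = m" using infinite_arbitrarily_large[OF inf] by blast
  have "real m = (\<Sum>x\<in>T. 1)" using T by simp
  also have "\<dots> \<le> sum f T" using T by (intro sum_mono) auto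
  also have "\<dots> \<le> infsum f UNIV" using f T by (intro finite_sum_le_infsum) auto
  finally show False using m by simp
qed

text \<open>Square summability of \<open>l n - n \<pi>\<close> makes all but finitely many of these differences smaller than \<open>1 < \<pi> / 2\<close>.\<close>

lemma near_multiples:
  fixes l :: "int \<Rightarrow> complex"
  assumes "(\<lambda>n. (cmod (l n - of_int n * of_real pi))\<^sup>2) summable_on UNIV"
  shows "\<exists>J. \<forall>n. J \<le> \<bar>n\<bar> \<longrightarrow> strip (l n) = n" and "finite {n. l n = \<mu>}"
proof -
  let ?E = "{n. 1 \<le> (cmod (l n - of_int n * of_real pi))\<^sup>2}"
  have fin: "finite ?E" by (rule summable_finite_large[OF assms]) simp
  have near: "\<bar>Re (l n) - pi * real_of_int n\<bar> < 1" if "n \<notin> ?E" for n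
  proof -
    have "(cmod (l n - of_int n * of_real pi))\<^sup>2 < 1\<^sup>2" using that by simp
    then have "cmod (l n - of_int n * of_real pi) < 1" by (rule power2_less_imp_less) simp
    moreover have "\<bar>Re (l n - of_int n * of_real pi)\<bar> \<le> cmod (l n - of_int n * of_real pi)" by (rule abs_Re_le_cmod)
    ultimately show ?thesis by (simp add: mult.commute)
  qed
  obtain J where J: "\<And>n. n \<in> ?E \<Longrightarrow> \<bar>n\<bar> < J"
  proof -
    have "\<bar>n\<bar> < Max (insert 0 (abs ` ?E)) + 1" if "n \<in> ?E" for n
      using fin that Max_ge[of "insert 0 (abs ` ?E)" "\<bar>n\<bar>"] by auto
    then show thesis by (rule that)
  qed
  have "strip (l n) = n" if "J \<le> \<bar>n\<bar>" for n
  proof -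
    have "n \<notin> ?E" using J[of n] that by linarith
    then show ?thesis using near[of n] pi_gt3 by (intro strip_I) linarith
  qed
  then show "\<exists>J. \<forall>n. J \<le> \<bar>n\<bar> \<longrightarrow> strip (l n) = n" by blast
  have "{n. l n = \<mu>} \<subseteq> ?E \<union> {strip \<mu>}"
  proof
    fix n assume n: "n \<in> {n. l n = \<mu>}"
    show "n \<in> ?E \<union> {strip \<mu>}"
    proof (cases "n \<in> ?E")
      case False
      then have "strip (l n) = n" using near[OF False] pi_gt3 by (intro strip_I) linarith
      then show ?thesis using n by simp
    qed simp
  qed
  then show "finite {n. l n = \<mu>}" by (rule finite_subset) (use fin in simp)
qed

lemma even_odd_cases: "\<exists>m. j = 2 * m \<or> j = 2 * m + 1" for j :: int
  by presburger

context zs_potential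
begin

text \<open>The entries of the matrix are at most \<open>1 / 4\<close> in modulus, so its eigenvalues are far from the boundary of the
strip.\<close>

lemma reduced_roots:
  assumes large: "n_plane \<le> \<bar>real_of_int n\<bar>" and ric: "riccati n Y U"
  obtains z1 z2 where "two_roots (diag_entry n Y) (off_entry n U) z1 z2" "\<bar>Re z1\<bar> < pi / 2" "\<bar>Re z2\<bar> < pi / 2"
    "(z1 - z2)\<^sup>2 = (diag_entry n Y True - diag_entry n Y False)\<^sup>2 + 4 * (off_entry n U True * off_entry n U False)"
proof -
  define a b e f where "a = diag_entry n Y True" and "b = diag_entry n Y False" and "e = off_entry n U True" and "f = off_entry n U False"
  define \<delta> where "\<delta> = csqrt ((a - b)\<^sup>2 / 4 + e * f)"
  have \<delta>: "\<delta>\<^sup>2 = (a - b)\<^sup>2 / 4 + e * f" by (simp add: \<delta>_def)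
  define z1 z2 where "z1 = (a + b) / 2 + \<delta>" and "z2 = (a + b) / 2 - \<delta>"
  have prod: "z1 * z2 = a * b - e * f"
  proof -
    have "z1 * z2 = ((a + b) / 2)\<^sup>2 - \<delta>\<^sup>2" by (simp add: z1_def z2_def power2_eq_square algebra_simps)
    also have "\<dots> = (((a + b) / 2)\<^sup>2 - (a - b)\<^sup>2 / 4) - e * f" unfolding \<delta> by simp
    also have "((a + b) / 2)\<^sup>2 - (a - b)\<^sup>2 / 4 = a * b" by (simp add: power2_eq_square field_simps)
    finally show ?thesis .
  qed
  have sum: "z1 + z2 = a + b" by (simp add: z1_def z2_def)
  have "two_roots (diag_entry n Y) (off_entry n U) z1 z2"
    by unfold_locales (use prod sum in \<open>simp_all add: a_def b_def e_def f_def\<close>)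
  moreover have small: "\<bar>Re z\<bar> < pi / 2" if z: "z = z1 \<or> z = z2" for z
  proof (rule ccontr)
    assume "\<not> ?thesis"
    then have "1 \<le> cmod z" using abs_Re_le_cmod[of z] pi_gt3 by linarith
    moreover have "cmod a \<le> 1 / 4" "cmod b \<le> 1 / 4" "cmod e \<le> 1 / 4" "cmod f \<le> 1 / 4"
      using p_le_quarter[OF ric large] q_le_quarter[OF ric large] by (auto simp: a_def b_def e_def f_def)
    ultimately have "3 / 4 \<le> cmod (z - a)" "3 / 4 \<le> cmod (z - b)"
      using norm_triangle_ineq2[of z a] norm_triangle_ineq2[of z b] by linarith+
    then have "(3 / 4) * (3 / 4) \<le> cmod (z - a) * cmod (z - b)" by (intro mult_mono) auto
    also have "\<dots> = cmod (e * f)"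
    proof -
      have "(z - a) * (z - b) = z * z - (a + b) * z + a * b" by (simp add: algebra_simps)
      also have "\<dots> = z * z - (z1 + z2) * z + (z1 * z2 + e * f)" using prod sum by simp
      also have "\<dots> = e * f" using z by (auto simp: algebra_simps)
      finally show ?thesis by (simp add: norm_mult[symmetric])
    qed
    also have "\<dots> \<le> (1 / 4) * (1 / 4)"
      unfolding norm_mult using \<open>cmod e \<le> 1 / 4\<close> \<open>cmod f \<le> 1 / 4\<close> by (intro mult_mono) auto
    finally show False by simp
  qed
  moreover have "(z1 - z2)\<^sup>2 = (a - b)\<^sup>2 + 4 * (e * f)"
  proof -
    have "(z1 - z2)\<^sup>2 = 4 * \<delta>\<^sup>2" by (simp add: z1_def z2_def power2_eq_square algebra_simps)
    then show ?thesis unfolding \<delta> by simp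
  qed
  ultimately show thesis using that[of z1 z2] by (simp add: a_def b_def e_def f_def)
qed

text \<open>Interleave the two sequences of eigenvalues to one sequence \<open>L\<close>, ordered lexicographically, and let \<open>s\<close> be the index
of the strip. Then \<open>s\<close> is monotone, far out \<open>s j = j div 2\<close>, and every strip with large index contains two terms
by \<open>alg_mult_strip\<close>; this determines \<open>s\<close> on all large blocks by \<open>monotone_blocks\<close>. So \<open>lm n\<close>
and \<open>lp n\<close> are the two eigenvalues in the strip of \<open>n\<close>, although finitely many others are not controlled.\<close>

theorem gap_squared:
  assumes lst: "periodic_eigenvalue_listing \<phi> lm lp" and large: "n_plane \<le> \<bar>real_of_int n\<bar>"
    and ric: "riccati n Y U"
  shows "(lp n - lm n)\<^sup>2 = (diag_entry n Y True - diag_entry n Y False)\<^sup>2 + 4 * (off_entry n U True * off_entry n U False)"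
proof -
  have mult: "card {n. lm n = \<mu>} + card {n. lp n = \<mu>} = ZS_alg_mult \<phi> \<mu>"
    and ord: "lex_le (lm n) (lp n)" "lex_le (lp n) (lm (n + 1))"
    and sm: "(\<lambda>n. (cmod (lm n - of_int n * of_real pi))\<^sup>2) summable_on UNIV"
    and sp: "(\<lambda>n. (cmod (lp n - of_int n * of_real pi))\<^sup>2) summable_on UNIV" for \<mu> n
    using lst unfolding periodic_eigenvalue_listing_def by blast+
  \<comment> \<open>both sequences in one, in lexicographic order\<close>
  define L where "L j = (if even j then lm (j div 2) else lp (j div 2))" for j
  have L2: "L (2 * m) = lm m" "L (2 * m + 1) = lp m" for m by (auto simp: L_def)
  define s where "s j = strip (L j)" for j
  have mono: "mono s"
  proof -
    have "s j \<le> s (j + 1)" for j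
    proof -
      obtain m where "j = 2 * m \<or> j = 2 * m + 1" using even_odd_cases by blast
      then show ?thesis
      proof
        assume j: "j = 2 * m" show ?thesis unfolding s_def j L2 by (rule strip_mono[OF ord(1)])
      next
        assume j: "j = 2 * m + 1"
        have "L (j + 1) = lm (m + 1)" using L2(1)[of "m + 1"] j by (simp add: algebra_simps)
        then show ?thesis unfolding s_def using strip_mono[OF ord(2), of m] by (simp add: j L2)
      qed
    qed
    then have step: "s j \<le> s (j + 1)" for j .
    have "s a \<le> s (a + int k)" for a k
    proof (induction k)
      case (Suc k)
      have "a + int (Suc k) = a + int k + 1" by simp
      then show ?case using Suc step[of "a + int k"] by (metis order_trans)
    qed simp
    then show ?thesis unfolding mono_def by (metis zle_iff_zadd)
  qed
  obtain J1 J2 where J1: "\<And>n. J1 \<le> \<bar>n\<bar> \<Longrightarrow> strip (lm n) = n" and J2: "\<And>n. J2 \<le> \<bar>n\<bar> \<Longrightarrow> strip (lp n) = n"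
    using near_multiples(1)[OF sm] near_multiples(1)[OF sp] by blast
  have far: "s j = j div 2" if "2 * (\<bar>J1\<bar> + \<bar>J2\<bar> + 1) \<le> \<bar>j\<bar>" for j
  proof -
    define q where "q = \<bar>j div 2\<bar>"
    have half: "\<bar>j\<bar> \<le> 2 * \<bar>j div 2\<bar> + 1" for j :: int by presburger
    have "2 * (\<bar>J1\<bar> + \<bar>J2\<bar> + 1) \<le> 2 * q + 1" unfolding q_def by (rule order_trans[OF that half])
    then have "\<bar>J1\<bar> \<le> q" "\<bar>J2\<bar> \<le> q" using abs_ge_zero[of J1] abs_ge_zero[of J2] by presburger+
    then have "J1 \<le> q" "J2 \<le> q" using order_trans[OF abs_ge_self] by blast+
    then have "J1 \<le> \<bar>j div 2\<bar>" "J2 \<le> \<bar>j div 2\<bar>" by (simp_all add: q_def)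
    then show ?thesis by (simp add: s_def L_def J1 J2)
  qed
  have fin: "finite {n. lm n = \<mu>}" "finite {n. lp n = \<mu>}" for \<mu>
    using near_multiples(2)[OF sm] near_multiples(2)[OF sp] by auto
  have in_strip: "\<exists>z1 z2. (z1 - z2)\<^sup>2 = (diag_entry m Y True - diag_entry m Y False)\<^sup>2 + 4 * (off_entry m U True * off_entry m U False) \<and>
      card {j. s j = m} = 2 \<and>
      (\<forall>j. s j = m \<longrightarrow> L j = of_real (pi * real_of_int m) + z1 \<or> L j = of_real (pi * real_of_int m) + z2) \<and>
      (z1 \<noteq> z2 \<longrightarrow> (\<forall>j j'. s j = m \<longrightarrow> s j' = m \<longrightarrow> j \<noteq> j' \<longrightarrow> L j \<noteq> L j'))"
    if nbm: "n_plane \<le> \<bar>real_of_int m\<bar>" and rm: "riccati m Y U" for m Y U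
  proof -
    obtain z1 z2 where roots: "two_roots (diag_entry m Y) (off_entry m U) z1 z2" and small: "\<bar>Re z1\<bar> < pi / 2" "\<bar>Re z2\<bar> < pi / 2"
      and disc: "(z1 - z2)\<^sup>2 = (diag_entry m Y True - diag_entry m Y False)\<^sup>2 + 4 * (off_entry m U True * off_entry m U False)"
      using reduced_roots[OF nbm rm] by metis
    let ?c = "complex_of_real (pi * real_of_int m)"
    have strip: "strip (?c + z1) = m" "strip (?c + z2) = m" using small by (auto intro!: strip_I)
    have am: "ZS_alg_mult \<phi> (?c + z) = (if z = z1 then 1 else 0) + (if z = z2 then 1 else 0)" if "\<bar>Re z\<bar> \<le> pi / 2" for z
      by (rule alg_mult_strip[OF rm nbm roots that])
    have finL: "finite {j. L j = \<mu>}" and cardL: "card {j. L j = \<mu>} = ZS_alg_mult \<phi> \<mu>" for \<mu>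
    proof -
      have "{j. L j = \<mu>} = (\<lambda>m. 2 * m) ` {n. lm n = \<mu>} \<union> (\<lambda>m. 2 * m + 1) ` {n. lp n = \<mu>}"
      proof (intro equalityI subsetI)
        fix j assume j: "j \<in> {j. L j = \<mu>}"
        obtain m where "j = 2 * m \<or> j = 2 * m + 1" using even_odd_cases by blast
        then show "j \<in> (\<lambda>m. 2 * m) ` {n. lm n = \<mu>} \<union> (\<lambda>m. 2 * m + 1) ` {n. lp n = \<mu>}"
          using j L2[of m] by auto
      qed (auto simp: L2)
      moreover have "(\<lambda>m. 2 * m) ` {n. lm n = \<mu>} \<inter> (\<lambda>m. 2 * m + 1) ` {n. lp n = \<mu>} = {}" by (auto, presburger)
      ultimately show "finite {j. L j = \<mu>}" "card {j. L j = \<mu>} = ZS_alg_mult \<phi> \<mu>"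
        using fin mult[of \<mu>] by (simp_all add: card_Un_disjoint card_image inj_on_def)
    qed
    have vals: "L j = ?c + z1 \<or> L j = ?c + z2" if "s j = m" for j
    proof -
      define z where "z = L j - ?c"
      have z: "L j = ?c + z" by (simp add: z_def)
      have "\<bar>Re z\<bar> \<le> pi / 2" using strip_D[of "L j" m] that by (simp add: s_def z)
      then have am: "ZS_alg_mult \<phi> (L j) = (if z = z1 then 1 else 0) + (if z = z2 then 1 else 0)" unfolding z by (rule am)
      have "j \<in> {i. L i = L j}" by simp
      then have "card {i. L i = L j} \<noteq> 0" using finL[of "L j"] by (metis card_0_eq empty_iff)
      then show ?thesis using am cardL[of "L j"] z by (auto split: if_splits)
    qed
    have set: "{j. s j = m} = {j. L j = ?c + z1} \<union> {j. L j = ?c + z2}"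
      using vals strip by (auto simp: s_def)
    have c1: "card {j. L j = ?c + z1} = (if z1 = z2 then 2 else 1)" "card {j. L j = ?c + z2} = (if z1 = z2 then 2 else 1)"
      unfolding cardL using am[of z1] am[of z2] small by auto
    have "card {j. s j = m} = 2"
    proof (cases "z1 = z2")
      case True then show ?thesis unfolding set using c1 by simp
    next
      case False
      then have "{j. L j = ?c + z1} \<inter> {j. L j = ?c + z2} = {}" by auto
      then show ?thesis unfolding set using c1 False finL by (simp add: card_Un_disjoint)
    qed
    moreover have "L j \<noteq> L j'" if "z1 \<noteq> z2" "s j = m" "s j' = m" "j \<noteq> j'" for j j'
    proof
      assume e: "L j = L j'"
      have "card {i. L i = L j} = 1" using vals[OF that(2)] c1 that(1) by auto
      moreover have "{j, j'} \<subseteq> {i. L i = L j}" using e by auto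
      then have "card {j, j'} \<le> card {i. L i = L j}" by (rule card_mono[OF finL])
      ultimately show False using that(4) by simp
    qed
    ultimately show ?thesis using disc vals by blast
  qed
  define n0 where "n0 = max 1 \<lceil>n_plane\<rceil>"
  have NB0: "n_plane \<le> \<bar>real_of_int m\<bar>" if "n0 \<le> \<bar>m\<bar>" for m
  proof -
    have "\<lceil>n_plane\<rceil> \<le> \<bar>m\<bar>" using that by (simp add: n0_def)
    then show ?thesis by linarith
  qed
  have n1: "1 \<le> \<bar>n\<bar>" using n1[OF ric large] by linarith
  have "\<lceil>n_plane\<rceil> \<le> \<bar>n\<bar>" using large by (simp add: ceiling_le_iff)
  then have nn0: "n0 \<le> \<bar>n\<bar>" using n1 by (simp add: n0_def)
  have "{j. s j = n} = {2 * n, 2 * n + 1}"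
  proof (rule monotone_blocks[OF mono far _ _ nn0])
    show "0 < n0" by (simp add: n0_def)
    fix m assume "n0 \<le> \<bar>m\<bar>"
    then have nbm: "n_plane \<le> \<bar>real_of_int m\<bar>" by (rule NB0)
    obtain Y' U' where "riccati m Y' U'" using riccati_exists[of m] n_plane_D(1)[OF nbm] by blast
    then show "card {j. s j = m} = 2" using in_strip[OF nbm] by blast
  qed auto
  then have sn: "s (2 * n) = n" "s (2 * n + 1) = n" by auto
  from in_strip[OF large ric] show ?thesis
  proof (elim exE conjE)
    fix z1 z2
    assume disc: "(z1 - z2)\<^sup>2 = (diag_entry n Y True - diag_entry n Y False)\<^sup>2 + 4 * (off_entry n U True * off_entry n U False)"
      and vals: "\<forall>j. s j = n \<longrightarrow> L j = of_real (pi * real_of_int n) + z1 \<or> L j = of_real (pi * real_of_int n) + z2"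
      and dist: "z1 \<noteq> z2 \<longrightarrow> (\<forall>j j'. s j = n \<longrightarrow> s j' = n \<longrightarrow> j \<noteq> j' \<longrightarrow> L j \<noteq> L j')"
    have v: "lm n = of_real (pi * real_of_int n) + z1 \<or> lm n = of_real (pi * real_of_int n) + z2"
      "lp n = of_real (pi * real_of_int n) + z1 \<or> lp n = of_real (pi * real_of_int n) + z2"
      using vals[rule_format, OF sn(1)] vals[rule_format, OF sn(2)] unfolding L2 by auto
    have "z1 \<noteq> z2 \<Longrightarrow> lm n \<noteq> lp n" using dist[rule_format, OF _ sn(1) sn(2)] unfolding L2 by simp
    then have "lp n - lm n = z1 - z2 \<or> lp n - lm n = - (z1 - z2)"
      using v by (cases "z1 = z2") (elim disjE; simp)+
    then have "(lp n - lm n)\<^sup>2 = (z1 - z2)\<^sup>2" by (elim disjE) (simp_all only: power2_minus)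
    then show ?thesis using disc by simp
  qed
qed

end

section \<open>Square roots\<close>

lemma nearer_root_close:
  assumes "cmod (g - \<sigma>) \<le> cmod (g + \<sigma>)"
  shows "(cmod (g - \<sigma>))\<^sup>2 \<le> cmod (g\<^sup>2 - \<sigma>\<^sup>2)"
proof -
  have "(cmod (g - \<sigma>))\<^sup>2 \<le> cmod (g - \<sigma>) * cmod (g + \<sigma>)"
    unfolding power2_eq_square using assms by (intro mult_left_mono) auto
  also have "\<dots> = cmod (g\<^sup>2 - \<sigma>\<^sup>2)"
    unfolding norm_mult[symmetric] by (simp add: power2_eq_square algebra_simps)
  finally show ?thesis .
qed

text \<open>With nonnegative roots the error \<open>\<tau>\<close> enters linearly even when \<open>w\<close> is small compared with \<open>\<tau>\<close>.\<close>

lemma nonneg_root_close: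
  fixes g w \<tau> :: real
  assumes "0 \<le> g" "0 \<le> w" "0 \<le> \<tau>" "\<bar>g\<^sup>2 - w\<^sup>2\<bar> \<le> 2 * w * \<tau> + 2 * \<tau>\<^sup>2"
  shows "\<bar>g - w\<bar> \<le> 4 * \<tau>"
proof (cases "w \<le> g")
  case True
  have "g\<^sup>2 \<le> w\<^sup>2 + 2 * w * \<tau> + 2 * \<tau>\<^sup>2" using assms(4) by linarith
  also have "\<dots> \<le> w\<^sup>2 + 2 * w * \<tau> + 2 * \<tau>\<^sup>2 + (2 * (w * \<tau>) + 2 * \<tau>\<^sup>2)" using assms by simp
  also have "\<dots> = (w + 2 * \<tau>)\<^sup>2" by (simp add: power2_eq_square algebra_simps)
  finally have "g \<le> w + 2 * \<tau>" using assms by (intro power2_le_imp_le[of g "w + 2 * \<tau>"]) auto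
  then show ?thesis using True assms by linarith
next
  case False
  show ?thesis
  proof (rule ccontr)
    assume "\<not> ?thesis"
    then have gap: "4 * \<tau> < w - g" using False by linarith
    then have w: "0 < w" "4 * \<tau> < w" using assms by linarith+
    have "4 * \<tau> * w < (w - g) * w" using gap w by (intro mult_strict_right_mono) auto
    also have "\<dots> \<le> (w - g) * (w + g)" using False assms by (intro mult_left_mono) auto
    also have "\<dots> = w\<^sup>2 - g\<^sup>2" by (simp add: power2_eq_square algebra_simps)
    also have "\<dots> \<le> 2 * w * \<tau> + 2 * \<tau>\<^sup>2" using assms(4) by linarith
    also have "2 * \<tau>\<^sup>2 \<le> 2 * (w * \<tau>)" unfolding power2_eq_square
      using w assms by (intro mult_left_mono mult_right_mono) auto
    finally show False by (simp add: algebra_simps)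
  qed
qed

lemma sum_le_power4: "sum_le (\<lambda>x. (f x)\<^sup>2) S \<Longrightarrow> sum_le (\<lambda>x. (f x) ^ 4) (S\<^sup>2)" for f :: "'a \<Rightarrow> real"
proof -
  assume S: "sum_le (\<lambda>x. (f x)\<^sup>2) S"
  have "sum_le (\<lambda>x. S * (f x)\<^sup>2) (S * S)" by (rule sum_le_cmult[OF S sum_le_bound_nonneg[OF S]])
  then show ?thesis
  proof (rule sum_le_mono)
    fix x
    have "(f x) ^ 4 = (f x)\<^sup>2 * (f x)\<^sup>2" by (simp flip: power_add)
    also have "\<dots> \<le> S * (f x)\<^sup>2" by (intro mult_right_mono sum_le_point[OF S]) auto
    finally show "(f x) ^ 4 \<le> S * (f x)\<^sup>2" .
  qed (auto simp: power2_eq_square)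
qed

section \<open>Asymptotics of the reduced matrix\<close>

context hankel
begin

text \<open>The error of the off-diagonal entries, rescaled by \<open>\<bar>n\<bar> weight N (2 * n)\<close>; it is square summable over \<open>n\<close>.\<close>

definition rem_q :: "int \<Rightarrow> real" where
  "rem_q n = \<bar>real_of_int n\<bar> * weight N (2 * n) * triple n + Ce * recip n"

definition rem_const :: real where "rem_const = 2 * M + 2 * (2 * Cm + 2 * (Ce\<^sup>2 * recip_const))"

lemma triple_nonneg: "0 \<le> triple n"
  by (rule sum_le_bound_nonneg[OF triple_sum(2)])

lemma rem_q_nonneg: "0 \<le> rem_q n"
  unfolding rem_q_def by (intro add_nonneg_nonneg mult_nonneg_nonneg) (auto simp: triple_nonneg)

lemma rem_q_sum: "sum_le (\<lambda>n. (d (2 * n) + rem_q n)\<^sup>2) rem_const"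
proof -
  have "sum_le (\<lambda>n. (d (2 * n))\<^sup>2) M" by (rule sum_le_inj[OF d_sq]) (simp add: inj_def)
  moreover have "sum_le (\<lambda>n. (rem_q n)\<^sup>2) (2 * Cm + 2 * (Ce\<^sup>2 * recip_const))"
    unfolding rem_q_def by (rule sum_le_sq_add[OF triple_l2 sum_le_sq_cmult[OF recip_sq_le]])
  ultimately show ?thesis unfolding rem_const_def by (rule sum_le_sq_add)
qed

lemma v_power: "\<bar>real_of_int n\<bar> ^ N * v (2 * n) \<le> 1"
proof -
  have "\<bar>real_of_int n\<bar> ^ N \<le> weight N (2 * n)" unfolding weight_def by (intro power_mono) auto
  then have "\<bar>real_of_int n\<bar> ^ N * v (2 * n) \<le> weight N (2 * n) * v (2 * n)" by (intro mult_right_mono) auto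
  then show ?thesis by simp
qed

context
  fixes n Y U
  assumes ric: "riccati n Y U" and large: "n_plane \<le> \<bar>real_of_int n\<bar>"
begin

lemma npos: "0 < \<bar>real_of_int n\<bar>" "1 \<le> \<bar>real_of_int n\<bar>"
  using n_pos[OF ric large] n1[OF ric large] by auto

lemma off_entry_approx: "cmod (off_entry n U s - P s (2 * n)) \<le> rem_q n * v (2 * n) / \<bar>real_of_int n\<bar>"
proof -
  have "rem_q n * v (2 * n) / \<bar>real_of_int n\<bar> = (weight N (2 * n) * v (2 * n)) * triple n + Ce / \<bar>real_of_int n\<bar>\<^sup>2 * v (2 * n)"
    using npos(1) by (simp del: weight_v add: rem_q_def recip_def power2_eq_square field_simps)
  then show ?thesis using off_entry_error[OF ric large, of s] by simp
qed

lemma symbol_bound: "cmod (P s (2 * n)) \<le> d (2 * n) * v (2 * n)"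
  using Pc[of s "2 * n"] by (simp add: c_eq)

lemma rem_q_div_le: "rem_q n * v (2 * n) / \<bar>real_of_int n\<bar> \<le> rem_q n * v (2 * n)"
proof -
  have "0 \<le> rem_q n * v (2 * n)" using rem_q_nonneg[of n] by (intro mult_nonneg_nonneg) auto
  from mult_left_mono[OF npos(2) this] show ?thesis using npos by (simp add: divide_le_eq)
qed

lemma off_entry_bound: "cmod (off_entry n U s) \<le> v (2 * n) * (d (2 * n) + rem_q n)"
proof -
  have "cmod (off_entry n U s) \<le> cmod (off_entry n U s - P s (2 * n)) + cmod (P s (2 * n))"
    using norm_triangle_ineq[of "off_entry n U s - P s (2 * n)" "P s (2 * n)"] by simp
  then show ?thesis using off_entry_approx[of s] symbol_bound[of s] rem_q_div_le by (simp add: algebra_simps)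
qed

lemma C3_nonneg: "0 \<le> C3"
  unfolding C3_def by (intro mult_nonneg_nonneg) auto

lemma diagonal_bound:
  "cmod (diag_entry n Y True - diag_entry n Y False) \<le> 2 * C3 * (v (2 * n) * (d (2 * n) + rem_q n) / \<bar>real_of_int n\<bar>)"
proof -
  have "cmod (diag_entry n Y True - diag_entry n Y False) \<le> C3 / \<bar>real_of_int n\<bar> * (cmod (off_entry n U True) + cmod (off_entry n U False))"
    by (rule diag_entry_diff[OF ric large])
  also have "\<dots> \<le> C3 / \<bar>real_of_int n\<bar> * (v (2 * n) * (d (2 * n) + rem_q n) + v (2 * n) * (d (2 * n) + rem_q n))"
    using C3_nonneg by (intro mult_left_mono add_mono off_entry_bound) auto
  also have "\<dots> = 2 * C3 * (v (2 * n) * (d (2 * n) + rem_q n) / \<bar>real_of_int n\<bar>)" by simp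
  finally show ?thesis .
qed

lemma product_diff:
  "cmod (off_entry n U True * off_entry n U False - P True (2 * n) * P False (2 * n))
     \<le> 2 * ((v (2 * n))\<^sup>2 * (d (2 * n) + rem_q n)\<^sup>2 / \<bar>real_of_int n\<bar>)"
proof -
  let ?V = "v (2 * n)" and ?x = "d (2 * n)" and ?y = "rem_q n" and ?n = "\<bar>real_of_int n\<bar>"
  have "off_entry n U True * off_entry n U False - P True (2 * n) * P False (2 * n)
      = (off_entry n U True - P True (2 * n)) * off_entry n U False + P True (2 * n) * (off_entry n U False - P False (2 * n))"
    by (simp add: algebra_simps)
  then have "cmod (off_entry n U True * off_entry n U False - P True (2 * n) * P False (2 * n))
      \<le> cmod (off_entry n U True - P True (2 * n)) * cmod (off_entry n U False) + cmod (P True (2 * n)) * cmod (off_entry n U False - P False (2 * n))"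
    by (metis norm_mult norm_triangle_ineq)
  also have "\<dots> \<le> (?y * ?V / ?n) * (?V * (?x + ?y)) + (?x * ?V) * (?y * ?V / ?n)"
    using rem_q_nonneg[of n] by (intro add_mono mult_mono off_entry_approx off_entry_bound symbol_bound) (auto intro: mult_nonneg_nonneg)
  also have "\<dots> = ?V\<^sup>2 * (?y * (2 * ?x + ?y)) / ?n"
    unfolding times_divide_eq_left times_divide_eq_right add_divide_distrib[symmetric]
    by (simp add: power2_eq_square algebra_simps)
  also have "\<dots> \<le> ?V\<^sup>2 * (2 * (?x + ?y)\<^sup>2) / ?n"
  proof (intro divide_right_mono mult_left_mono)
    have "0 \<le> ?x * ?x" "0 \<le> ?y * ?y" "0 \<le> ?x * ?y" using rem_q_nonneg[of n] by (auto intro: mult_nonneg_nonneg)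
    then show "?y * (2 * ?x + ?y) \<le> 2 * (?x + ?y)\<^sup>2" unfolding power2_eq_square by (simp add: algebra_simps)
  qed auto
  also have "\<dots> = 2 * (?V\<^sup>2 * (?x + ?y)\<^sup>2 / ?n)" by (simp only: mult.left_commute times_divide_eq_right)
  finally show ?thesis .
qed

lemma discriminant_diff:
  "cmod ((diag_entry n Y True - diag_entry n Y False)\<^sup>2 + 4 * (off_entry n U True * off_entry n U False) - 4 * (P True (2 * n) * P False (2 * n)))
     \<le> (4 * C3\<^sup>2 + 8) * ((v (2 * n))\<^sup>2 * (d (2 * n) + rem_q n)\<^sup>2 / \<bar>real_of_int n\<bar>)"
proof -
  let ?V = "v (2 * n)" and ?x = "d (2 * n) + rem_q n" and ?n = "\<bar>real_of_int n\<bar>"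
  have "(diag_entry n Y True - diag_entry n Y False)\<^sup>2 + 4 * (off_entry n U True * off_entry n U False) - 4 * (P True (2 * n) * P False (2 * n))
      = (diag_entry n Y True - diag_entry n Y False)\<^sup>2 + 4 * (off_entry n U True * off_entry n U False - P True (2 * n) * P False (2 * n))"
    by (simp add: algebra_simps)
  then have "cmod ((diag_entry n Y True - diag_entry n Y False)\<^sup>2 + 4 * (off_entry n U True * off_entry n U False) - 4 * (P True (2 * n) * P False (2 * n)))
      \<le> cmod ((diag_entry n Y True - diag_entry n Y False)\<^sup>2) + cmod (4 * (off_entry n U True * off_entry n U False - P True (2 * n) * P False (2 * n)))"
    by (metis norm_triangle_ineq)
  also have "\<dots> = (cmod (diag_entry n Y True - diag_entry n Y False))\<^sup>2 + 4 * cmod (off_entry n U True * off_entry n U False - P True (2 * n) * P False (2 * n))"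
    by (simp only: norm_mult norm_power norm_numeral)
  also have "\<dots> \<le> (2 * C3 * (?V * ?x / ?n))\<^sup>2 + 4 * (2 * (?V\<^sup>2 * ?x\<^sup>2 / ?n))"
    by (intro add_mono power_mono mult_left_mono diagonal_bound product_diff) auto
  also have "(2 * C3 * (?V * ?x / ?n))\<^sup>2 = 4 * C3\<^sup>2 * ((?V\<^sup>2 * ?x\<^sup>2 / ?n) / ?n)"
    by (simp add: power2_eq_square)
  also have "\<dots> \<le> 4 * C3\<^sup>2 * (?V\<^sup>2 * ?x\<^sup>2 / ?n)"
  proof (rule mult_left_mono)
    have "0 \<le> ?V\<^sup>2 * ?x\<^sup>2 / ?n" by simp
    from mult_left_mono[OF npos(2) this] npos(1) show "?V\<^sup>2 * ?x\<^sup>2 / ?n / ?n \<le> ?V\<^sup>2 * ?x\<^sup>2 / ?n"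
      by (subst pos_divide_le_eq) (simp_all only: mult_1_right)
  qed auto
  finally show ?thesis unfolding distrib_right by (simp only: add_ac) simp
qed

text \<open>The error of the discriminant is \<open>O(v (2 * n)\<^sup>2 / \<bar>n\<bar>)\<close> times a summable sequence, and \<open>v (2 * n) \<le> \<bar>n\<bar>\<^sup>-\<^sup>N\<close>.\<close>

lemma complex_gap_error:
  assumes g: "g\<^sup>2 = (diag_entry n Y True - diag_entry n Y False)\<^sup>2 + 4 * (off_entry n U True * off_entry n U False)"
    and \<sigma>: "\<sigma>\<^sup>2 = P True (2 * n) * P False (2 * n)" and near: "cmod (g - 2 * \<sigma>) \<le> cmod (g + 2 * \<sigma>)"
  shows "(cmod (g - 2 * \<sigma>) * \<bar>real_of_int n\<bar> powr (real N + 1 / 2))\<^sup>2 \<le> (4 * C3\<^sup>2 + 8) * (d (2 * n) + rem_q n)\<^sup>2"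
proof -
  let ?V = "v (2 * n)" and ?x = "d (2 * n) + rem_q n" and ?n = "\<bar>real_of_int n\<bar>"
  have pw: "(?n powr (real N + 1 / 2))\<^sup>2 = (?n ^ N)\<^sup>2 * ?n"
  proof -
    have "?n powr (real N + 1 / 2) = ?n ^ N * ?n powr (1 / 2)" using npos by (simp only: powr_add powr_realpow)
    then show ?thesis using npos by (simp add: power_mult_distrib powr_half_sqrt)
  qed
  have "(cmod (g - 2 * \<sigma>))\<^sup>2 \<le> cmod (g\<^sup>2 - (2 * \<sigma>)\<^sup>2)" by (rule nearer_root_close[OF near])
  also have "\<dots> \<le> (4 * C3\<^sup>2 + 8) * (?V\<^sup>2 * ?x\<^sup>2 / ?n)"
    using discriminant_diff by (simp add: power_mult_distrib \<sigma> g)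
  finally have "(cmod (g - 2 * \<sigma>) * ?n powr (real N + 1 / 2))\<^sup>2 \<le> (4 * C3\<^sup>2 + 8) * (?V\<^sup>2 * ?x\<^sup>2 / ?n) * ((?n ^ N)\<^sup>2 * ?n)"
    unfolding power_mult_distrib pw by (intro mult_right_mono) auto
  also have "\<dots> = (4 * C3\<^sup>2 + 8) * ((?n ^ N * ?V)\<^sup>2 * ?x\<^sup>2)"
    using npos by (simp add: power_mult_distrib)
  also have "\<dots> \<le> (4 * C3\<^sup>2 + 8) * (1\<^sup>2 * ?x\<^sup>2)"
    by (intro mult_left_mono mult_right_mono power_mono v_power) auto
  finally show ?thesis by simp
qed

text \<open>Both off-diagonal symbols have modulus \<open>w\<close>, so the error of \<open>4 q\<^sub>T q\<^sub>F\<close> is \<open>8 w \<eta> + 4 \<eta>\<^sup>2\<close> with \<open>\<eta>\<close> the error of a single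
entry, which is of the form required by \<open>nonneg_root_close\<close>.\<close>

lemma real_gap_error:
  fixes g w :: real
  assumes g: "(complex_of_real g)\<^sup>2 = (diag_entry n Y True - diag_entry n Y False)\<^sup>2 + 4 * (off_entry n U True * off_entry n U False)"
    and w: "P True (2 * n) * P False (2 * n) = complex_of_real (w\<^sup>2)" "cmod (P True (2 * n)) = w"
    and g0: "0 \<le> g" and sym: "cmod (P False (2 * n)) = w"
  shows "(\<bar>g - 2 * w\<bar> * \<bar>real_of_int n\<bar> powr (real N + 1))\<^sup>2 \<le> (8 * (C3 + 1))\<^sup>2 * (d (2 * n) + rem_q n)\<^sup>2"
proof -
  let ?V = "v (2 * n)" and ?x = "d (2 * n) + rem_q n" and ?n = "\<bar>real_of_int n\<bar>"
  define \<eta> where "\<eta> = rem_q n * ?V / ?n"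
  define \<delta> where "\<delta> = cmod (diag_entry n Y True - diag_entry n Y False)"
  have \<eta>0: "0 \<le> \<eta>" unfolding \<eta>_def using rem_q_nonneg[of n] by (auto intro: mult_nonneg_nonneg)
  have \<delta>0: "0 \<le> \<delta>" by (simp add: \<delta>_def)
  have w0: "0 \<le> w" using w(2) by auto
  have q: "cmod (off_entry n U s - P s (2 * n)) \<le> \<eta>" for s using off_entry_approx[of s] by (simp add: \<eta>_def)
  have qF: "cmod (off_entry n U False) \<le> w + \<eta>"
    using norm_triangle_ineq[of "off_entry n U False - P False (2 * n)" "P False (2 * n)"] q[of False] sym by simp
  have prod: "cmod (off_entry n U True * off_entry n U False - of_real (w\<^sup>2)) \<le> 2 * (w * \<eta>) + \<eta>\<^sup>2"
  proof -
    have "off_entry n U True * off_entry n U False - of_real (w\<^sup>2)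
      = (off_entry n U True - P True (2 * n)) * off_entry n U False + P True (2 * n) * (off_entry n U False - P False (2 * n))"
      unfolding w(1)[symmetric] by (simp add: algebra_simps)
    then have "cmod (off_entry n U True * off_entry n U False - of_real (w\<^sup>2))
      \<le> cmod (off_entry n U True - P True (2 * n)) * cmod (off_entry n U False) + cmod (P True (2 * n)) * cmod (off_entry n U False - P False (2 * n))"
      by (metis norm_mult norm_triangle_ineq)
    also have "\<dots> \<le> \<eta> * (w + \<eta>) + w * \<eta>"
      unfolding w(2) using \<eta>0 w0 by (intro add_mono mult_mono q qF) auto
    finally show ?thesis by (simp add: power2_eq_square algebra_simps)
  qed
  have "\<bar>g\<^sup>2 - (2 * w)\<^sup>2\<bar> = cmod (complex_of_real (g\<^sup>2 - (2 * w)\<^sup>2))" by (simp only: norm_of_real)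
  also have "complex_of_real (g\<^sup>2 - (2 * w)\<^sup>2)
     = (diag_entry n Y True - diag_entry n Y False)\<^sup>2 + 4 * (off_entry n U True * off_entry n U False - of_real (w\<^sup>2))"
    using g by (simp add: algebra_simps)
  also have "cmod \<dots> \<le> cmod ((diag_entry n Y True - diag_entry n Y False)\<^sup>2) + cmod (4 * (off_entry n U True * off_entry n U False - of_real (w\<^sup>2)))"
    by (rule norm_triangle_ineq)
  also have "\<dots> = \<delta>\<^sup>2 + 4 * cmod (off_entry n U True * off_entry n U False - of_real (w\<^sup>2))"
    by (simp only: norm_mult norm_power norm_numeral \<delta>_def)
  also have "\<dots> \<le> \<delta>\<^sup>2 + 4 * (2 * (w * \<eta>) + \<eta>\<^sup>2)" using prod by simp
  also have "\<dots> \<le> 2 * (2 * w) * (\<delta> + 2 * \<eta>) + 2 * (\<delta> + 2 * \<eta>)\<^sup>2"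
  proof -
    have "0 \<le> \<delta> * \<delta>" "0 \<le> \<eta> * \<eta>" "0 \<le> \<delta> * \<eta>" "0 \<le> w * \<delta>" "0 \<le> w * \<eta>"
      using \<eta>0 \<delta>0 w0 by (auto intro: mult_nonneg_nonneg)
    then show ?thesis unfolding power2_eq_square by (simp add: algebra_simps)
  qed
  finally have "\<bar>g - 2 * w\<bar> \<le> 4 * (\<delta> + 2 * \<eta>)"
    using g0 w0 \<delta>0 \<eta>0 by (intro nonneg_root_close) auto
  also have "\<dots> \<le> 4 * (2 * C3 * (?V * ?x / ?n) + 2 * (?V * ?x / ?n))"
  proof (intro mult_left_mono add_mono)
    show "\<delta> \<le> 2 * C3 * (?V * ?x / ?n)" unfolding \<delta>_def by (rule diagonal_bound)
    show "\<eta> \<le> ?V * ?x / ?n" unfolding \<eta>_def by (intro divide_right_mono) (auto simp: algebra_simps mult_nonneg_nonneg)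
  qed auto
  also have "\<dots> = 8 * (C3 + 1) * (?V * ?x / ?n)" unfolding distrib_left distrib_right by (simp only: mult_ac) simp
  finally have "\<bar>g - 2 * w\<bar> * (?n ^ N * ?n) \<le> 8 * (C3 + 1) * (?V * ?x / ?n) * (?n ^ N * ?n)"
    by (intro mult_right_mono) auto
  also have "\<dots> = 8 * (C3 + 1) * ((?n ^ N * ?V) * ?x)"
    using npos by simp
  also have "\<dots> \<le> 8 * (C3 + 1) * (1 * ?x)"
    using C3_nonneg rem_q_nonneg[of n] by (intro mult_left_mono mult_right_mono v_power) auto
  finally have "\<bar>g - 2 * w\<bar> * ?n powr (real N + 1) \<le> 8 * (C3 + 1) * ?x"
    using npos by (simp add: powr_add powr_realpow)
  then have "(\<bar>g - 2 * w\<bar> * ?n powr (real N + 1))\<^sup>2 \<le> (8 * (C3 + 1) * ?x)\<^sup>2"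
    by (intro power_mono) auto
  then show ?thesis by (simp only: power_mult_distrib)
qed

end

end

section \<open>Self-adjointness for potentials of real type\<close>

lemma fourier_cnj: "fourier (\<lambda>x. cnj (u x)) n = cnj (fourier u (- n))"
proof -
  have "cnj (exp (- 2 * complex_of_real pi * \<i> * of_int (- n) * complex_of_real x))
      = exp (- 2 * complex_of_real pi * \<i> * of_int n * complex_of_real x)" for x
    by (simp add: exp_cnj)
  then show ?thesis unfolding fourier_def Bochner_Integration.integral_cnj[symmetric] complex_cnj_mult by presburger
qed

lemma sobolev_cnj:
  assumes u: "u \<in> sobolev N" shows "(\<lambda>x. cnj (u x)) \<in> sobolev N"
proof -
  have per: "u (x + 1) = u x" and u2: "u \<in> L2_on {0..1}" for x
    using u by (auto simp: sobolev_def L2_periodic_def)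
  have "(\<lambda>x. cnj (u x)) \<in> borel_measurable (lebesgue_on {0..1})"
    using u2 by (intro borel_measurable_continuous_on[where f = cnj] continuous_intros) (auto simp: L2_on_def)
  then have "(\<lambda>x. cnj (u x)) \<in> L2_periodic" using u2 per by (simp add: L2_periodic_def L2_on_def)
  moreover have "(\<lambda>n::int. (1 + (real_of_int n)\<^sup>2) ^ N * (cmod (fourier (\<lambda>x. cnj (u x)) n))\<^sup>2) summable_on UNIV"
  proof -
    have "bij (uminus :: int \<Rightarrow> int)" by (rule bij_uminus)
    then have "(\<lambda>n::int. (1 + (real_of_int (- n))\<^sup>2) ^ N * (cmod (fourier u (- n)))\<^sup>2) summable_on UNIV"
      using summable_on_reindex_bij_betw[of uminus UNIV UNIV "\<lambda>n::int. (1 + (real_of_int n)\<^sup>2) ^ N * (cmod (fourier u n))\<^sup>2"] u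
      by (simp add: sobolev_def)
    then show ?thesis by (simp add: fourier_cnj)
  qed
  ultimately show ?thesis by (simp add: sobolev_def)
qed

lemma Hr_subset_Hc: "Hr N \<subseteq> Hc N"
  by (auto simp: Hr_def Hc_def intro: sobolev_cnj)

text \<open>The condition \<open>\<phi>\<^sub>2 = cnj \<phi>\<^sub>1\<close> makes the two Hankel matrices adjoint to each other.\<close>

lemma symbol_real:
  assumes "\<phi> \<in> Hr N" shows "symbol \<phi> t m = cnj (symbol \<phi> (\<not> t) m)"
proof -
  obtain u where "\<phi> = (u, \<lambda>x. cnj (u x))" using assms by (auto simp: Hr_def)
  then show ?thesis by (simp add: symbol_def msign_def fourier_cnj)
qed

lemma H1_periodic_deriv_0: "H1_periodic_deriv (\<lambda>x. 0) (\<lambda>x. 0)"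
  by (simp add: H1_periodic_deriv_def L2_on_def)

lemma mode_0: "mode t (\<lambda>x. 0) k = 0"
  by (simp add: mode_def part_def)

context zs_potential
begin

text \<open>The modes of \<open>F\<close> are bounded, so the equation bounds \<open>k\<close> times them, and they are \<open>O(1 / \<bar>k\<bar>)\<close>.\<close>

lemma eigenfunction_l2:
  assumes H: "H1_periodic_deriv F f" and eq: "\<And>t k. seq_op (\<lambda>t. mode t F) t k = \<mu> * mode t F k"
  shows "\<exists>C. \<forall>t. sum_le (\<lambda>k. (cmod (mode t F k))\<^sup>2) C"
proof -
  obtain S where S: "\<And>t k. cmod (mode t F k) \<le> S" using mode_bounded[OF H] by blast
  have S0: "0 \<le> S" using order_trans[OF norm_ge_zero S] .
  let ?B = "S + (cmod \<mu> * S + S * K)"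
  have B0: "0 \<le> ?B" using S0 by simp
  have bd: "cmod (mode t F k) \<le> ?B * recip1 k" for t k
  proof -
    have "of_real (pi * real_of_int k) * mode t F k = \<mu> * mode t F k - (\<Sum>\<^sub>\<infinity>l. symbol \<phi> t (k + l) * mode (\<not> t) F l)"
      using eq[of t k] unfolding seq_op_def by (simp add: algebra_simps)
    then have "cmod (of_real (pi * real_of_int k) * mode t F k) \<le> cmod (\<mu> * mode t F k) + cmod (\<Sum>\<^sub>\<infinity>l. symbol \<phi> t (k + l) * mode (\<not> t) F l)"
      by (metis norm_triangle_ineq4)
    also have "\<dots> \<le> cmod \<mu> * S + S * K"
      unfolding norm_mult by (intro add_mono mult_left_mono S conv_bounded(1) S0) auto
    finally have 1: "pi * (\<bar>real_of_int k\<bar> * cmod (mode t F k)) \<le> cmod \<mu> * S + S * K"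
      by (simp add: norm_mult abs_mult mult.assoc)
    have "0 \<le> \<bar>real_of_int k\<bar> * cmod (mode t F k)" by simp
    from mult_right_mono[OF _ this, of 1 pi] have "\<bar>real_of_int k\<bar> * cmod (mode t F k) \<le> cmod \<mu> * S + S * K"
      using 1 pi_gt3 by linarith
    then have "(1 + \<bar>real_of_int k\<bar>) * cmod (mode t F k) \<le> ?B" using S[of t k] unfolding distrib_right by linarith
    moreover have "0 < 1 + \<bar>real_of_int k\<bar>" by simp
    ultimately show ?thesis unfolding recip1_def by (simp add: pos_le_divide_eq mult.commute)
  qed
  have "sum_le (\<lambda>k. (cmod (mode t F k))\<^sup>2) (?B\<^sup>2 * recip_const)" for t
    by (rule sum_le_sq_mono[OF sum_le_sq_cmult[OF recip1_sq_le] _ bd]) simp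
  then show ?thesis by blast
qed

text \<open>The usual argument for symmetric operators, in the sequence model: pair the equation with the eigenvector. The
diagonal part contributes real numbers only, and the contributions \<open>q True\<close>, \<open>q False\<close> of the Hankel parts are
complex conjugates of each other.\<close>

lemma real_eigenvalue:
  assumes \<phi>r: "\<phi> \<in> Hr N" and F: "F \<in> ZS_kernel \<phi> \<mu> (Suc 0)" "F \<noteq> (\<lambda>x. 0)"
  shows "Im \<mu> = 0"
proof (rule ccontr)
  assume nz: "Im \<mu> \<noteq> 0"
  obtain f where f: "H1_periodic_deriv F f"
    and e: "AE x in lebesgue_on {0..2}. ZS_op \<phi> F f x - vecfun_scale \<mu> F x = (\<lambda>x. 0) x"
    using F(1) by auto
  have eq: "seq_op (\<lambda>t. mode t F) t k = \<mu> * mode t F k" for t k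
    using modes_of_kernel_eq[OF f H1_periodic_deriv_0 e, of t k] by (simp add: mode_0)
  obtain C where C: "\<And>t. sum_le (\<lambda>k. (cmod (mode t F k))\<^sup>2) C" using eigenfunction_l2[OF f eq] by blast
  define a where "a t k = (\<Sum>\<^sub>\<infinity>l. symbol \<phi> t (k + l) * mode (\<not> t) F l)" for t k
  define q where "q t = (\<Sum>\<^sub>\<infinity>k. a t k * cnj (mode t F k))" for t
  have C': "sum_le (\<lambda>k. (cmod (cnj (mode t F k)))\<^sup>2) C" for t using C[of t] by simp
  have sm: "(\<lambda>k. a t k * cnj (mode t F k)) summable_on UNIV" for t
    unfolding a_def by (rule Hankel_symmetric(1)[OF C C'])
  have Imq: "Im (q t) = Im \<mu> * (\<Sum>\<^sub>\<infinity>k. (cmod (mode t F k))\<^sup>2)" for t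
  proof -
    have pt: "Im (a t k * cnj (mode t F k)) = Im \<mu> * (cmod (mode t F k))\<^sup>2" for k
    proof -
      have "a t k = (\<mu> - of_real (pi * real_of_int k)) * mode t F k"
        using eq[of t k] unfolding seq_op_def a_def by (simp add: algebra_simps)
      then have "a t k * cnj (mode t F k) = (\<mu> - of_real (pi * real_of_int k)) * of_real ((cmod (mode t F k))\<^sup>2)"
        by (simp only: mult.assoc complex_norm_square)
      then show ?thesis by simp
    qed
    show ?thesis unfolding q_def infsum_Im[OF sm, symmetric] pt
      by (rule infsum_cmult_right) (use sum_le_summable[OF C] in simp)
  qed
  have "q True = cnj (q False)"
  proof -
    have "q True = (\<Sum>\<^sub>\<infinity>k. (\<Sum>\<^sub>\<infinity>l. symbol \<phi> True (k + l) * cnj (mode True F l)) * mode False F k)"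
      using Hankel_symmetric(2)[OF C[of False] C'[of True], of True] by (simp add: q_def a_def)
    also have "\<dots> = (\<Sum>\<^sub>\<infinity>k. cnj (a False k * cnj (mode False F k)))"
    proof (rule infsum_cong)
      fix k
      have "(\<Sum>\<^sub>\<infinity>l. symbol \<phi> True (k + l) * cnj (mode True F l)) = (\<Sum>\<^sub>\<infinity>l. cnj (symbol \<phi> False (k + l) * mode True F l))"
        using symbol_real[OF \<phi>r, of True] by simp
      also have "\<dots> = cnj (a False k)" unfolding infsum_cnj a_def by simp
      finally show "(\<Sum>\<^sub>\<infinity>l. symbol \<phi> True (k + l) * cnj (mode True F l)) * mode False F k = cnj (a False k * cnj (mode False F k))"
        by simp
    qed
    finally show ?thesis unfolding infsum_cnj q_def .
  qed
  then have "Im (q True) + Im (q False) = 0" by simp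
  then have "Im \<mu> * ((\<Sum>\<^sub>\<infinity>k. (cmod (mode True F k))\<^sup>2) + (\<Sum>\<^sub>\<infinity>k. (cmod (mode False F k))\<^sup>2)) = 0"
    unfolding Imq by (simp add: distrib_left)
  then have sum: "(\<Sum>\<^sub>\<infinity>k. (cmod (mode True F k))\<^sup>2) + (\<Sum>\<^sub>\<infinity>k. (cmod (mode False F k))\<^sup>2) = 0" using nz by simp
  have nn: "0 \<le> (\<Sum>\<^sub>\<infinity>k. (cmod (mode t F k))\<^sup>2)" for t by (rule infsum_nonneg) simp
  have z: "(\<Sum>\<^sub>\<infinity>k. (cmod (mode t F k))\<^sup>2) = 0" for t using nn[of True] nn[of False] sum by (cases t; simp; linarith)
  have "mode t F k = 0" for t k
  proof -
    have "(\<Sum>j\<in>{k}. (cmod (mode t F j))\<^sup>2) \<le> (\<Sum>\<^sub>\<infinity>k. (cmod (mode t F k))\<^sup>2)"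
      by (rule finite_sum_le_infsum[OF sum_le_summable[OF C]]) auto
    then show ?thesis using z[of t] by simp
  qed
  then have "F = (\<lambda>x. 0)" by (intro mode_inject[OF f H1_periodic_deriv_0]) (simp add: mode_0)
  then show False using F(2) by simp
qed

text \<open>Without eigenfunctions there are no root vectors of higher order.\<close>

lemma real_multiplicity:
  assumes \<phi>r: "\<phi> \<in> Hr N" and m: "ZS_alg_mult \<phi> \<mu> \<noteq> 0"
  shows "Im \<mu> = 0"
proof (rule ccontr)
  assume nr: "Im \<mu> \<noteq> 0"
  have k1: "F = (\<lambda>x. 0)" if "F \<in> ZS_kernel \<phi> \<mu> (Suc 0)" for F
    using real_eigenvalue[OF \<phi>r that] nr by blast
  have sub: "ZS_kernel \<phi> \<mu> k \<subseteq> {\<lambda>x. 0}" for k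
  proof (induction k)
    case (Suc k)
    have "F \<in> ZS_kernel \<phi> \<mu> (Suc 0)" if F: "F \<in> ZS_kernel \<phi> \<mu> (Suc k)" for F
    proof -
      obtain f G where f: "H1_periodic_deriv F f" and G: "G \<in> ZS_kernel \<phi> \<mu> k"
        and e: "AE x in lebesgue_on {0..2}. ZS_op \<phi> F f x - vecfun_scale \<mu> F x = G x" using F by auto
      have "G = (\<lambda>x. 0)" using Suc.IH G by blast
      then show ?thesis using f e by auto
    qed
    then show ?case using k1 by blast
  qed simp
  have "(\<Union>k. ZS_kernel \<phi> \<mu> k) = {\<lambda>x. 0}"
  proof
    show "{\<lambda>x. 0} \<subseteq> (\<Union>k. ZS_kernel \<phi> \<mu> k)" using UN_upper[of 0 UNIV "ZS_kernel \<phi> \<mu>"] by simp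
  qed (use sub in blast)
  then have "ZS_alg_mult \<phi> \<mu> = vf.dim {0}" by (simp add: ZS_alg_mult_def zero_fun_def)
  also have "\<dots> = 0" using vf.dim_eq_card[of "{}" "{0}"] by (simp add: vf.independent_empty)
  finally show False using m by simp
qed

text \<open>Each listed number occurs in the list, finitely often, and thus has positive algebraic multiplicity.\<close>

lemma real_gap:
  assumes \<phi>r: "\<phi> \<in> Hr N" and lst: "periodic_eigenvalue_listing \<phi> lm lp"
  shows "Im (lp n - lm n) = 0" "0 \<le> Re (lp n - lm n)"
proof -
  have mult: "card {n. lm n = \<mu>} + card {n. lp n = \<mu>} = ZS_alg_mult \<phi> \<mu>"
    and ord: "lex_le (lm n) (lp n)"
    and sm: "(\<lambda>n. (cmod (lm n - of_int n * of_real pi))\<^sup>2) summable_on UNIV"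
    and sp: "(\<lambda>n. (cmod (lp n - of_int n * of_real pi))\<^sup>2) summable_on UNIV" for \<mu> n
    using lst unfolding periodic_eigenvalue_listing_def by blast+
  have "card {j. lm j = lm n} \<noteq> 0" using near_multiples(2)[OF sm, of "lm n"] by auto
  then have 1: "Im (lm n) = 0" using mult[of "lm n"] by (intro real_multiplicity[OF \<phi>r]) simp
  have "card {j. lp j = lp n} \<noteq> 0" using near_multiples(2)[OF sp, of "lp n"] by auto
  then have 2: "Im (lp n) = 0" using mult[of "lp n"] by (intro real_multiplicity[OF \<phi>r]) simp
  show "Im (lp n - lm n) = 0" "0 \<le> Re (lp n - lm n)" using 1 2 ord[of n] by (auto simp: lex_le_def)
qed

section \<open>Gap asymptotics for one potential\<close>

lemma symbol_2n: "symbol \<phi> True (2 * n) = fourier (snd \<phi>) n" "symbol \<phi> False (2 * n) = fourier (fst \<phi>) (- n)"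
  by (simp_all add: symbol_def msign_def part_def)

lemma complex_gap:
  assumes lst: "periodic_eigenvalue_listing \<phi> lm lp" and large: "n_plane \<le> \<bar>real_of_int n\<bar>"
    and \<sigma>: "\<sigma>\<^sup>2 = fourier (fst \<phi>) (- n) * fourier (snd \<phi>) n"
    and near: "cmod (lp n - lm n - 2 * \<sigma>) \<le> cmod (lp n - lm n + 2 * \<sigma>)"
  shows "(cmod (lp n - lm n - 2 * \<sigma>) * \<bar>real_of_int n\<bar> powr (real N + 1 / 2))\<^sup>2
     \<le> (4 * C3\<^sup>2 + 8) * (d (2 * n) + rem_q n)\<^sup>2"
proof -
  obtain Y U where ric: "riccati n Y U" using riccati_exists[of n] n_plane_D(1)[OF large] by blast
  show ?thesis
    by (rule complex_gap_error[OF ric large gap_squared[OF lst large ric] _ near]) (unfold \<sigma> symbol_2n, rule mult.commute)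
qed

lemma real_type_gap:
  assumes \<phi>r: "\<phi> \<in> Hr N" and lst: "periodic_eigenvalue_listing \<phi> lm lp" and large: "n_plane \<le> \<bar>real_of_int n\<bar>"
  shows "(cmod (lp n - lm n - of_real (2 * cmod (fourier (fst \<phi>) (- n)))) * \<bar>real_of_int n\<bar> powr (real N + 1))\<^sup>2
     \<le> (8 * (C3 + 1))\<^sup>2 * (d (2 * n) + rem_q n)\<^sup>2"
proof -
  obtain Y U where ric: "riccati n Y U" using riccati_exists[of n] n_plane_D(1)[OF large] by blast
  define g where "g = Re (lp n - lm n)"
  let ?w = "cmod (fourier (fst \<phi>) (- n))"
  have g: "lp n - lm n = of_real g" using real_gap(1)[OF \<phi>r lst, of n] by (simp add: g_def complex_eq_iff)
  have g0: "0 \<le> g" using real_gap(2)[OF \<phi>r lst, of n] by (simp add: g_def)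
  have P: "symbol \<phi> True (2 * n) = cnj (symbol \<phi> False (2 * n))" using symbol_real[OF \<phi>r, of True "2 * n"] by simp
  have "(\<bar>g - 2 * ?w\<bar> * \<bar>real_of_int n\<bar> powr (real N + 1))\<^sup>2 \<le> (8 * (C3 + 1))\<^sup>2 * (d (2 * n) + rem_q n)\<^sup>2"
  proof (rule real_gap_error[OF ric large _ _ _ g0])
    show "(complex_of_real g)\<^sup>2 = (diag_entry n Y True - diag_entry n Y False)\<^sup>2 + 4 * (off_entry n U True * off_entry n U False)"
      using gap_squared[OF lst large ric] by (simp only: g)
    show "symbol \<phi> True (2 * n) * symbol \<phi> False (2 * n) = complex_of_real (?w\<^sup>2)"
      unfolding P symbol_2n(2) complex_norm_square by (simp only: mult.commute)
  qed (unfold P symbol_2n(2), simp_all)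
  moreover have "cmod (lp n - lm n - of_real (2 * ?w)) = \<bar>g - 2 * ?w\<bar>"
    unfolding g of_real_diff[symmetric] norm_of_real ..
  ultimately show ?thesis by (simp only:)
qed

end

section \<open>Uniform asymptotics\<close>

lemma remainder_from_sum_le:
  fixes x y :: "int \<Rightarrow> complex"
  assumes n0: "1 \<le> n0" and S: "sum_le b S"
    and le: "\<And>n. n0 \<le> \<bar>n\<bar> \<Longrightarrow> (cmod (x n - y n) * \<bar>real_of_int n\<bar> powr s) ^ p \<le> b n"
  shows "\<exists>e. lp_remainder p s n0 x y e \<and> (\<Sum>\<^sub>\<infinity>n\<in>{n. n0 \<le> \<bar>n\<bar>}. cmod (e n) ^ p) \<le> S"
proof -
  define e where "e n = (x n - y n) * of_real (real_of_int \<bar>n\<bar> powr s)" for n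
  have e: "cmod (e n) = cmod (x n - y n) * \<bar>real_of_int n\<bar> powr s" for n
    by (simp add: e_def norm_mult)
  have 1: "x n = y n + e n / of_real (real_of_int \<bar>n\<bar> powr s)" if "n0 \<le> \<bar>n\<bar>" for n
  proof -
    have "real_of_int \<bar>n\<bar> powr s \<noteq> 0" using that n0 by simp
    then show ?thesis by (simp add: e_def)
  qed
  have 2: "(\<lambda>n. cmod (e n) ^ p) summable_on {n. n0 \<le> \<bar>n\<bar>}"
    by (rule summable_on_comparison_test[OF sum_le_summable[OF S]]) (use le in \<open>auto simp: e\<close>)
  have "(\<Sum>\<^sub>\<infinity>n\<in>{n. n0 \<le> \<bar>n\<bar>}. cmod (e n) ^ p) \<le> infsum b {n. n0 \<le> \<bar>n\<bar>}"
    by (rule infsum_mono[OF 2 sum_le_summable[OF S]]) (use le in \<open>auto simp: e\<close>)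
  also have "\<dots> \<le> S" by (rule sum_le_infsum[OF S])
  finally show ?thesis using 1 2 by (auto simp: lp_remainder_def)
qed

lemma uniform_imp_single:
  assumes "lp_asymp_uniform p s B x y" "\<phi> \<in> B" shows "lp_asymp p s (x \<phi>) (y \<phi>)"
  using assms unfolding lp_asymp_uniform_def lp_asymp_def by blast

lemma Hc_bounded_single: "Hc_bounded N {\<phi>}"
  by (auto simp: Hc_bounded_def)

text \<open>\<open>2 * 5 ^ N * M0\<^sup>2\<close> is the parameter of the sequence model for potentials of norm at most \<open>M0\<close>; the value depends on
nothing else.\<close>

definition first_index :: "nat \<Rightarrow> real \<Rightarrow> int" where
  "first_index N M0 = max 1 \<lceil>hankel.n_plane N (2 * 5 ^ N * M0\<^sup>2)\<rceil>"

lemma first_index_n_plane: "first_index N M0 \<le> \<bar>n\<bar> \<Longrightarrow> hankel.n_plane N (2 * 5 ^ N * M0\<^sup>2) \<le> \<bar>real_of_int n\<bar>"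
proof -
  assume "first_index N M0 \<le> \<bar>n\<bar>"
  then have "\<lceil>hankel.n_plane N (2 * 5 ^ N * M0\<^sup>2)\<rceil> \<le> \<bar>n\<bar>" by (simp add: first_index_def)
  then show ?thesis by linarith
qed

lemma uniform_complex:
  fixes lm lp \<gamma> \<sigma> :: "potential \<Rightarrow> int \<Rightarrow> complex"
  assumes N: "N \<ge> 1" and lst: "\<And>\<phi>. \<phi> \<in> Hc N \<Longrightarrow> periodic_eigenvalue_listing \<phi> (lm \<phi>) (lp \<phi>)"
    and \<gamma>: "\<And>\<phi> n. \<gamma> \<phi> n = lp \<phi> n - lm \<phi> n"
    and \<sigma>: "\<And>\<phi> n. (\<sigma> \<phi> n)\<^sup>2 = fourier (fst \<phi>) (- n) * fourier (snd \<phi>) n"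
    and near: "\<And>\<phi> n. cmod (\<gamma> \<phi> n - 2 * \<sigma> \<phi> n) \<le> cmod (\<gamma> \<phi> n + 2 * \<sigma> \<phi> n)"
    and B: "B \<subseteq> Hc N" "Hc_bounded N B"
  shows "lp_asymp_uniform 2 (real N + 1 / 2) B \<gamma> (\<lambda>\<phi> n. 2 * \<sigma> \<phi> n)"
proof -
  obtain M0 where M0: "\<And>\<phi>. \<phi> \<in> B \<Longrightarrow> Hc_norm N \<phi> \<le> M0" using B(2) by (auto simp: Hc_bounded_def)
  let ?M = "2 * 5 ^ N * M0\<^sup>2"
  let ?C = "(4 * (hankel.C3 N ?M)\<^sup>2 + 8) * hankel.rem_const N ?M"
  have "\<exists>e. lp_remainder 2 (real N + 1 / 2) (first_index N M0) (\<gamma> \<phi>) (\<lambda>n. 2 * \<sigma> \<phi> n) e \<and>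
      (\<Sum>\<^sub>\<infinity>n\<in>{n. first_index N M0 \<le> \<bar>n\<bar>}. cmod (e n) ^ 2) \<le> max 1 ?C" if \<phi>B: "\<phi> \<in> B" for \<phi>
  proof -
    interpret zs_potential N M0 \<phi> using N B(1) \<phi>B M0 by unfold_locales auto
    have S: "sum_le (\<lambda>n. (4 * C3\<^sup>2 + 8) * (d (2 * n) + rem_q n)\<^sup>2) (max 1 ?C)"
      by (rule sum_le_mono[OF sum_le_cmult[OF rem_q_sum, of "4 * C3\<^sup>2 + 8"]]) auto
    show ?thesis
    proof (rule remainder_from_sum_le[OF _ S])
      show "(cmod (\<gamma> \<phi> n - 2 * \<sigma> \<phi> n) * \<bar>real_of_int n\<bar> powr (real N + 1 / 2))\<^sup>2 \<le> (4 * C3\<^sup>2 + 8) * (d (2 * n) + rem_q n)\<^sup>2"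
        if "first_index N M0 \<le> \<bar>n\<bar>" for n
        unfolding \<gamma> by (rule complex_gap[OF lst[OF \<phi>] first_index_n_plane[OF that] \<sigma> near[unfolded \<gamma>]])
    qed (simp add: first_index_def)
  qed
  moreover have "1 \<le> first_index N M0" "0 < max 1 ?C" by (auto simp: first_index_def)
  ultimately show ?thesis unfolding lp_asymp_uniform_def by blast
qed

lemma uniform_real:
  fixes lm lp \<gamma> :: "potential \<Rightarrow> int \<Rightarrow> complex"
  assumes N: "N \<ge> 1" and lst: "\<And>\<phi>. \<phi> \<in> Hc N \<Longrightarrow> periodic_eigenvalue_listing \<phi> (lm \<phi>) (lp \<phi>)"
    and \<gamma>: "\<And>\<phi> n. \<gamma> \<phi> n = lp \<phi> n - lm \<phi> n"
    and B: "B \<subseteq> Hr N" "Hc_bounded N B"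
  shows "lp_asymp_uniform 4 (real N + 1) B \<gamma> (\<lambda>\<phi> n. complex_of_real (2 * cmod (fourier (fst \<phi>) (- n))))"
proof -
  obtain M0 where M0: "\<And>\<phi>. \<phi> \<in> B \<Longrightarrow> Hc_norm N \<phi> \<le> M0" using B(2) by (auto simp: Hc_bounded_def)
  let ?M = "2 * 5 ^ N * M0\<^sup>2"
  let ?C = "((8 * (hankel.C3 N ?M + 1))\<^sup>2 * hankel.rem_const N ?M)\<^sup>2"
  have "\<exists>e. lp_remainder 4 (real N + 1) (first_index N M0) (\<gamma> \<phi>) (\<lambda>n. complex_of_real (2 * cmod (fourier (fst \<phi>) (- n)))) e \<and>
      (\<Sum>\<^sub>\<infinity>n\<in>{n. first_index N M0 \<le> \<bar>n\<bar>}. cmod (e n) ^ 4) \<le> max 1 ?C" if \<phi>B: "\<phi> \<in> B" for \<phi>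
  proof -
    have \<phi>r: "\<phi> \<in> Hr N" using B(1) \<phi>B by blast
    interpret zs_potential N M0 \<phi> using N \<phi>r Hr_subset_Hc \<phi>B M0 by unfold_locales auto
    have S: "sum_le (\<lambda>n. (8 * (C3 + 1) * (d (2 * n) + rem_q n)) ^ 4) (max 1 ?C)"
      by (rule sum_le_mono[OF sum_le_power4[OF sum_le_sq_cmult[OF rem_q_sum, of "8 * (C3 + 1)"]]]) auto
    show ?thesis
    proof (rule remainder_from_sum_le[OF _ S])
      fix n assume "first_index N M0 \<le> \<bar>n\<bar>"
      from real_type_gap[OF \<phi>r lst[OF \<phi>] first_index_n_plane[OF this]]
      have "((cmod (\<gamma> \<phi> n - complex_of_real (2 * cmod (fourier (fst \<phi>) (- n)))) * \<bar>real_of_int n\<bar> powr (real N + 1))\<^sup>2)\<^sup>2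
          \<le> ((8 * (C3 + 1))\<^sup>2 * (d (2 * n) + rem_q n)\<^sup>2)\<^sup>2"
        unfolding \<gamma> by (intro power_mono) auto
      then show "(cmod (\<gamma> \<phi> n - complex_of_real (2 * cmod (fourier (fst \<phi>) (- n)))) * \<bar>real_of_int n\<bar> powr (real N + 1)) ^ 4
          \<le> (8 * (C3 + 1) * (d (2 * n) + rem_q n)) ^ 4"
        by (simp only: power_mult_distrib[symmetric] power_mult[symmetric]) simp
    qed (simp add: first_index_def)
  qed
  moreover have "1 \<le> first_index N M0" "0 < max 1 ?C" by (auto simp: first_index_def)
  ultimately show ?thesis unfolding lp_asymp_uniform_def by blast
qed

theorem corollary1p1:
  fixes N :: nat
    and lm lp \<gamma> :: "potential \<Rightarrow> int \<Rightarrow> complex"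
  assumes "N \<ge> 1"
    and "\<And>\<phi>. \<phi> \<in> Hc N \<Longrightarrow> periodic_eigenvalue_listing \<phi> (lm \<phi>) (lp \<phi>)"
    and "\<And>\<phi> n. \<gamma> \<phi> n = lp \<phi> n - lm \<phi> n"
  shows "(\<exists>\<sigma> :: potential \<Rightarrow> int \<Rightarrow> complex.
           (\<forall>\<phi>\<in>Hc N. \<forall>n. (\<sigma> \<phi> n)\<^sup>2 = fourier (fst \<phi>) (- n) * fourier (snd \<phi>) n) \<and>
           (\<forall>\<phi>\<in>Hc N. lp_asymp 2 (real N + 1 / 2) (\<gamma> \<phi>) (\<lambda>n. 2 * \<sigma> \<phi> n)) \<and>
           (\<forall>B. B \<subseteq> Hc N \<and> Hc_bounded N B \<longrightarrow>
              lp_asymp_uniform 2 (real N + 1 / 2) B \<gamma> (\<lambda>\<phi> n. 2 * \<sigma> \<phi> n)))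
       \<and> (\<forall>\<phi>\<in>Hr N. (\<forall>n. \<gamma> \<phi> n \<in> \<real> \<and> 0 \<le> Re (\<gamma> \<phi> n)) \<and>
            lp_asymp 4 (real N + 1) (\<gamma> \<phi>) (\<lambda>n. complex_of_real (2 * cmod (fourier (fst \<phi>) (- n)))))
       \<and> (\<forall>B. B \<subseteq> Hr N \<and> Hc_bounded N B \<longrightarrow>
            lp_asymp_uniform 4 (real N + 1) B \<gamma>
              (\<lambda>\<phi> n. complex_of_real (2 * cmod (fourier (fst \<phi>) (- n)))))"
proof -
  define \<rho> where "\<rho> \<phi> n = csqrt (fourier (fst \<phi>) (- n) * fourier (snd \<phi>) n)" for \<phi> :: potential and n
  \<comment> \<open>of the two square roots the one that is nearer to half of the gap\<close>
  define \<sigma> where "\<sigma> \<phi> n = (if cmod (\<gamma> \<phi> n - 2 * \<rho> \<phi> n) \<le> cmod (\<gamma> \<phi> n + 2 * \<rho> \<phi> n) then \<rho> \<phi> n else - \<rho> \<phi> n)" for \<phi> n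
  have \<sigma>: "(\<sigma> \<phi> n)\<^sup>2 = fourier (fst \<phi>) (- n) * fourier (snd \<phi>) n" for \<phi> n
    by (simp add: \<sigma>_def \<rho>_def)
  have near: "cmod (\<gamma> \<phi> n - 2 * \<sigma> \<phi> n) \<le> cmod (\<gamma> \<phi> n + 2 * \<sigma> \<phi> n)" for \<phi> n
    by (auto simp: \<sigma>_def)
  note c = uniform_complex[OF assms \<sigma> near] and unif = uniform_real[OF assms]
  have c1: "lp_asymp 2 (real N + 1 / 2) (\<gamma> \<phi>) (\<lambda>n. 2 * \<sigma> \<phi> n)" if "\<phi> \<in> Hc N" for \<phi>
    by (rule uniform_imp_single[OF c, of "{\<phi>}"]) (use that Hc_bounded_single in auto)
  have r1: "lp_asymp 4 (real N + 1) (\<gamma> \<phi>) (\<lambda>n. complex_of_real (2 * cmod (fourier (fst \<phi>) (- n))))" if "\<phi> \<in> Hr N" for \<phi>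
    by (rule uniform_imp_single[OF unif, of "{\<phi>}"]) (use that Hc_bounded_single in auto)
  have re: "\<gamma> \<phi> n \<in> \<real> \<and> 0 \<le> Re (\<gamma> \<phi> n)" if \<phi>r: "\<phi> \<in> Hr N" for \<phi> n
  proof -
    have \<phi>c: "\<phi> \<in> Hc N" using \<phi>r Hr_subset_Hc by blast
    interpret zs_potential N "Hc_norm N \<phi>" \<phi> using assms(1) \<phi>c by unfold_locales auto
    show ?thesis using real_gap[OF \<phi>r assms(2)[OF \<phi>c], of n] unfolding assms(3) by (simp add: complex_is_Real_iff)
  qed
  show ?thesis using \<sigma> c1 c r1 unif re by blast
qed

end
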